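(* Let $\Gamma$ be a finitely generated and recursively presented self-simulable group. Every finitely presented algebraic action of $\Gamma$ is the topological factor of a $\Gamma$-subshift of finite type.
   Context: r.e. means recursively enumerable. A finitely generated group is recursively presented if for some (equivalently, any) finite symmetric generating set $S$ the set of words in $S^*$ representing the identity is r.e. An algebraic action is an action $\Gamma\curvearrowright X$ of a countable group by continuous automorphisms of a compact metrizable abelian group $X$. The Pontryagin dual $\widehat X$ (continuous homomorphisms $X\to\mathbb{R}/\mathbb{Z}$) is a countable left module over the integral group ring $\mathbb{Z}[\Gamma]$ via $(g\cdot\chi)(x)=\chi(g^{-1}x)$. The algebraic action is finitely presented if $\widehat X$ is a finitely presented left $\mathbb{Z}[\Gamma]$-module, i.e. isomorphic to $\mathbb{Z}[\Gamma]^n/\mathbb{Z}[\Gamma]^kP$ for some $n,k$ and some $k\times n$ matrix $P$ over $\mathbb{Z}[\Gamma]$. Cantor space. For $w\in\{0,1\}^*$, $[w]$ is the set of sequences in $\{0,1\}^{\mathbb N}$ with prefix $w$. A set is effectively open if it equals $\bigcup_{w\in L}[w]$ for some r.e. $L\subset\{0,1\}^*$; effectively closed sets are complements of effectively open sets. A map $f\colon X\to\{0,1\}^{\mathbb{N}}$, $X\subset\{0,1\}^{\mathbb N}$, is computable if, uniformly in $w$, there is an effectively open $U_w$ with $f^{-1}([w])=U_w\cap X$. An action of a finitely generated group on $X\subset\{0,1\}^{\mathbb N}$ is computable if for some (equivalently any) finite generating set each generator acts by a computable map. A finitely generated group $\Gamma$ is self-simulable if for every effectively closed $X\subset\{0,1\}^{\mathbb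 N}$ and every computable action $\Gamma\curvearrowright X$ there is a $\Gamma$-SFT $Y$ such that $\Gamma\curvearrowright X$ is a topological factor of $\Gamma\curvearrowright Y$. For a finite alphabet $A$, $\Gamma$ acts on $A^\Gamma$ by $(gx)(h)=x(g^{-1}h)$. For a pattern $p\in A^F$, $F\subset\Gamma$ finite, $[p]=\{x\in A^\Gamma:x|_F=p\}$. A $\Gamma$-SFT (subshift of finite type) is a set $\{x\in A^\Gamma: gx\notin[p]\ \forall g\in\Gamma, p\in\mathcal F\}$ with $\mathcal F$ a finite set of patterns. $\Gamma\curvearrowright Y$ is a topological factor of $\Gamma\curvearrowright X$ if there is a continuous surjective $\Gamma$-equivariant map $X\to Y$. *)

theory Defs
  imports
    "HOL-Analysis.Analysis"
    "HOL-Algebra.Generated_Groups"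
    "HOL-Algebra.Group_Action"
    "HOL-Algebra.AbelCoset"
    "HOL-Algebra.Module"
    "HOL-Library.Nat_Bijection"
    "HOL-Library.Poly_Mapping"
begin

section \<open>Recursively enumerable sets\<close>

text \<open>
  \<open>recursive n f\<close>: the total function \<open>f\<close> of \<open>n\<close> arguments, given as a list, is (general) recursive.
  Only the values of \<open>f\<close> on lists of length \<open>n\<close> matter (rule \<open>ext\<close>). Minimisation is restricted to
  regular functions, so that all functions in the class are total.
\<close>

inductive recursive :: "nat \<Rightarrow> (nat list \<Rightarrow> nat) \<Rightarrow> bool" where
  zero: "recursive n (\<lambda>_. 0)"
| succ: "recursive 1 (\<lambda>xs. Suc (xs ! 0))"
| proj: "i < n \<Longrightarrow> recursive n (\<lambda>xs. xs ! i)"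
| comp: "recursive (length gs) f \<Longrightarrow> (\<And>g. g \<in> set gs \<Longrightarrow> recursive n g) \<Longrightarrow>
    recursive n (\<lambda>xs. f (map (\<lambda>g. g xs) gs))"
| prec: "recursive n f \<Longrightarrow> recursive (Suc (Suc n)) g \<Longrightarrow>
    recursive (Suc n) (\<lambda>xs. rec_nat (f (tl xs)) (\<lambda>k r. g (k # r # tl xs)) (hd xs))"
| mini: "recursive (Suc n) f \<Longrightarrow> (\<And>xs. length xs = n \<Longrightarrow> \<exists>k. f (k # xs) = 0) \<Longrightarrow>
    recursive n (\<lambda>xs. LEAST k. f (k # xs) = 0)"
| ext: "recursive n f \<Longrightarrow> (\<And>xs. length xs = n \<Longrightarrow> f xs = g xs) \<Longrightarrow> recursive n g"

definition rec_enum :: "nat set \<Rightarrow> bool" where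
  "rec_enum A \<longleftrightarrow> A = {} \<or> (\<exists>f. recursive 1 f \<and> A = range (\<lambda>k. f [k]))"

definition word_code :: "('s \<Rightarrow> nat) \<Rightarrow> 's list \<Rightarrow> nat" where
  "word_code e w = list_encode (map e w)"

text \<open>
  For finite \<open>S\<close> the choice of the numbering \<open>e\<close> is immaterial.
\<close>

definition re_language :: "'s set \<Rightarrow> 's list set \<Rightarrow> bool" where
  "re_language S L \<longleftrightarrow>
     L \<subseteq> lists S \<and> (\<exists>e. inj_on e S \<and> rec_enum (word_code e ` L))"

definition re_word_relation :: "(bool list \<times> bool list) set \<Rightarrow> bool" where
  "re_word_relation R \<longleftrightarrow>
     rec_enum ((\<lambda>(v, w). prod_encode (word_code of_bool v, word_code of_bool w)) ` R)"


section \<open>Finitely generated groups\<close>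

definition finite_generating_set :: "('g, 'b) monoid_scheme \<Rightarrow> 'g set \<Rightarrow> bool" where
  "finite_generating_set G S \<longleftrightarrow> finite S \<and> S \<subseteq> carrier G \<and> generate G S = carrier G"

definition finitely_generated :: "('g, 'b) monoid_scheme \<Rightarrow> bool" where
  "finitely_generated G \<longleftrightarrow> (\<exists>S. finite_generating_set G S)"

definition word_value :: "('g, 'b) monoid_scheme \<Rightarrow> 'g list \<Rightarrow> 'g" where
  "word_value G w = foldr (\<lambda>s g. s \<otimes>\<^bsub>G\<^esub> g) w \<one>\<^bsub>G\<^esub>"

definition recursively_presented :: "('g, 'b) monoid_scheme \<Rightarrow> bool" where
  "recursively_presented G \<longleftrightarrow>
     (\<exists>S. finite_generating_set G S \<and> (\<forall>s\<in>S. inv\<^bsub>G\<^esub> s \<in> S) \<and>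
          re_language S {w \<in> lists S. word_value G w = \<one>\<^bsub>G\<^esub>})"


section \<open>Topological factors and subshifts of finite type\<close>

text \<open>
  The action \<open>a\<close> of \<open>G\<close> on the space \<open>X\<close> is a topological factor of the action \<open>b\<close> on the space \<open>Y\<close>.
\<close>

definition topological_factor ::
    "('g, 'b) monoid_scheme \<Rightarrow> 'x topology \<Rightarrow> ('g \<Rightarrow> 'x \<Rightarrow> 'x) \<Rightarrow>
     'y topology \<Rightarrow> ('g \<Rightarrow> 'y \<Rightarrow> 'y) \<Rightarrow> bool" where
  "topological_factor G X a Y b \<longleftrightarrow>
     (\<exists>\<pi>. continuous_map Y X \<pi> \<and> \<pi> ` topspace Y = topspace X \<and>
          (\<forall>g\<in>carrier G. \<forall>y\<in>topspace Y. \<pi> (b g y) = a g (\<pi> y)))"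

definition config_topology :: "('g, 'b) monoid_scheme \<Rightarrow> 'a set \<Rightarrow> ('g \<Rightarrow> 'a) topology" where
  "config_topology G A = product_topology (\<lambda>_. discrete_topology A) (carrier G)"

definition shift :: "('g, 'b) monoid_scheme \<Rightarrow> 'g \<Rightarrow> ('g \<Rightarrow> 'a) \<Rightarrow> ('g \<Rightarrow> 'a)" where
  "shift G g x = (\<lambda>h\<in>carrier G. x (inv\<^bsub>G\<^esub> g \<otimes>\<^bsub>G\<^esub> h))"

text \<open>
  A pattern with support \<open>F\<close> is a partial function with domain \<open>F\<close>.
\<close>

definition is_pattern :: "('g, 'b) monoid_scheme \<Rightarrow> 'a set \<Rightarrow> ('g \<rightharpoonup> 'a) \<Rightarrow> bool" where
  "is_pattern G A p \<longleftrightarrow> finite (dom p) \<and> dom p \<subseteq> carrier G \<and> ran p \<subseteq> A"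

definition pattern_cylinder ::
    "('g, 'b) monoid_scheme \<Rightarrow> 'a set \<Rightarrow> ('g \<rightharpoonup> 'a) \<Rightarrow> ('g \<Rightarrow> 'a) set" where
  "pattern_cylinder G A p = {x \<in> carrier G \<rightarrow>\<^sub>E A. \<forall>h\<in>dom p. p h = Some (x h)}"

definition is_SFT :: "('g, 'b) monoid_scheme \<Rightarrow> 'a set \<Rightarrow> ('g \<Rightarrow> 'a) set \<Rightarrow> bool" where
  "is_SFT G A Y \<longleftrightarrow> finite A \<and>
     (\<exists>\<F>. finite \<F> \<and> (\<forall>p\<in>\<F>. is_pattern G A p) \<and>
          Y = {x \<in> carrier G \<rightarrow>\<^sub>E A. \<forall>g\<in>carrier G. \<forall>p\<in>\<F>. shift G g x \<notin> pattern_cylinder G A p})"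

text \<open>
  Up to renaming symbols, every finite alphabet is a finite set of natural numbers.
\<close>

definition factor_of_SFT ::
    "('g, 'b) monoid_scheme \<Rightarrow> 'x topology \<Rightarrow> ('g \<Rightarrow> 'x \<Rightarrow> 'x) \<Rightarrow> bool" where
  "factor_of_SFT G X a \<longleftrightarrow>
     (\<exists>(A :: nat set) Y. is_SFT G A Y \<and>
        topological_factor G X a (subtopology (config_topology G A) Y) (shift G))"


section \<open>Computable actions and self-simulability\<close>

definition cantor_topology :: "(nat \<Rightarrow> bool) topology" where
  "cantor_topology = product_topology (\<lambda>_. discrete_topology UNIV) UNIV"

definition word_cylinder :: "bool list \<Rightarrow> (nat \<Rightarrow> bool) set" where
  "word_cylinder w = {x. \<forall>i<length w. x i = w ! i}"

definition effectively_open :: "(nat \<Rightarrow> bool) set \<Rightarrow> bool" where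
  "effectively_open U \<longleftrightarrow>
     (\<exists>L. rec_enum (word_code of_bool ` L) \<and> U = (\<Union>w\<in>L. word_cylinder w))"

definition effectively_closed :: "(nat \<Rightarrow> bool) set \<Rightarrow> bool" where
  "effectively_closed X \<longleftrightarrow> effectively_open (- X)"

text \<open>
  Uniformity in \<open>w\<close>: the words defining the effectively open sets \<open>U w\<close> are given by a single
  r.e. relation.
\<close>

definition computable_map ::
    "(nat \<Rightarrow> bool) set \<Rightarrow> ((nat \<Rightarrow> bool) \<Rightarrow> (nat \<Rightarrow> bool)) \<Rightarrow> bool" where
  "computable_map X f \<longleftrightarrow>
     (\<exists>R. re_word_relation R \<and>
          (\<forall>w. {x \<in> X. f x \<in> word_cylinder w} = (\<Union>v\<in>{v. (w, v) \<in> R}. word_cylinder v) \<inter> X))"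

definition computable_action ::
    "('g, 'b) monoid_scheme \<Rightarrow> (nat \<Rightarrow> bool) set \<Rightarrow>
     ('g \<Rightarrow> (nat \<Rightarrow> bool) \<Rightarrow> (nat \<Rightarrow> bool)) \<Rightarrow> bool" where
  "computable_action G X a \<longleftrightarrow> group_action G X a \<and>
     (\<exists>S. finite_generating_set G S \<and> (\<forall>s\<in>S. computable_map X (a s)))"

definition self_simulable :: "('g, 'b) monoid_scheme \<Rightarrow> bool" where
  "self_simulable G \<longleftrightarrow>
     (\<forall>X a. effectively_closed X \<longrightarrow> computable_action G X a \<longrightarrow>
        factor_of_SFT G (subtopology cantor_topology X) a)"


section \<open>Group rings and finitely presented left modules\<close>

text \<open>
  The integral group ring: \<open>frag_extend\<close> is \<open>\<int>\<close>-linear extension, so the product is the bilinear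
  extension of the product of \<open>G\<close>.
\<close>

definition group_ring :: "('g, 'b) monoid_scheme \<Rightarrow> ('g \<Rightarrow>\<^sub>0 int) ring" where
  "group_ring G = \<lparr>carrier = {a. Poly_Mapping.keys a \<subseteq> carrier G},
     monoid.mult = (\<lambda>a b. frag_extend (\<lambda>g. frag_extend (\<lambda>h. frag_of (g \<otimes>\<^bsub>G\<^esub> h)) b) a),
     one = frag_of \<one>\<^bsub>G\<^esub>,
     zero = 0,
     add = (+)\<rparr>"

text \<open>
  Modules use the library record, whose ring multiplication and unit (\<open>mult\<close> and \<open>one\<close>) are
  irrelevant. The library locale \<open>module\<close> itself requires a commutative ring of scalars.
\<close>

definition free_left_module :: "('r, 'c) ring_scheme \<Rightarrow> nat \<Rightarrow> ('r, nat \<Rightarrow> 'r) module" where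
  "free_left_module R n = \<lparr>carrier = {..<n} \<rightarrow>\<^sub>E carrier R,
     monoid.mult = undefined,
     one = undefined,
     zero = (\<lambda>i\<in>{..<n}. \<zero>\<^bsub>R\<^esub>),
     add = (\<lambda>v w. \<lambda>i\<in>{..<n}. v i \<oplus>\<^bsub>R\<^esub> w i),
     smult = (\<lambda>r v. \<lambda>i\<in>{..<n}. r \<otimes>\<^bsub>R\<^esub> v i)\<rparr>"

definition quotient_left_module :: "('r, 'm) module \<Rightarrow> 'm set \<Rightarrow> ('r, 'm set) module" where
  "quotient_left_module M N = \<lparr>carrier = a_rcosets\<^bsub>M\<^esub> N,
     monoid.mult = undefined,
     one = undefined,
     zero = N,
     add = (\<lambda>C D. C <+>\<^bsub>M\<^esub> D),
     smult = (\<lambda>r C. \<Union>m\<in>C. N +>\<^bsub>M\<^esub> (r \<odot>\<^bsub>M\<^esub> m))\<rparr>"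

definition row_times_matrix ::
    "('r, 'c) ring_scheme \<Rightarrow> nat \<Rightarrow> nat \<Rightarrow> (nat \<Rightarrow> 'r) \<Rightarrow> (nat \<Rightarrow> nat \<Rightarrow> 'r) \<Rightarrow> (nat \<Rightarrow> 'r)" where
  "row_times_matrix R k n v P = (\<lambda>j\<in>{..<n}. \<Oplus>\<^bsub>R\<^esub>i\<in>{..<k}. v i \<otimes>\<^bsub>R\<^esub> P i j)"

definition isomorphic_left_modules ::
    "('r, 'c) ring_scheme \<Rightarrow> ('r, 'm) module \<Rightarrow> ('r, 'n) module \<Rightarrow> bool" where
  "isomorphic_left_modules R M N \<longleftrightarrow>
     (\<exists>\<phi>. \<phi> \<in> iso (add_monoid M) (add_monoid N) \<and>
          (\<forall>r\<in>carrier R. \<forall>m\<in>carrier M. \<phi> (r \<odot>\<^bsub>M\<^esub> m) = r \<odot>\<^bsub>N\<^esub> \<phi> m))"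

definition finitely_presented_left_module ::
    "('r, 'c) ring_scheme \<Rightarrow> ('r, 'm) module \<Rightarrow> bool" where
  "finitely_presented_left_module R M \<longleftrightarrow>
     (\<exists>n k P. (\<forall>i<k. \<forall>j<n. P i j \<in> carrier R) \<and>
        isomorphic_left_modules R M
          (quotient_left_module (free_left_module R n)
             ((\<lambda>v. row_times_matrix R k n v P) ` carrier (free_left_module R k))))"


section \<open>Algebraic actions and Pontryagin duals\<close>

definition real_group :: "real monoid" where
  "real_group = \<lparr>carrier = UNIV, monoid.mult = (+), one = 0\<rparr>"

text \<open>
  The circle group \<open>\<real>/\<int>\<close>, in the multiplicative notation of the library, with the quotient topology:
  \<open>\<Union>U\<close> is the preimage of \<open>U\<close> under the projection.
\<close>

definition circle_group :: "real set monoid" where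
  "circle_group = real_group Mod \<int>"

definition circle_topology :: "real set topology" where
  "circle_topology = topology (\<lambda>U. U \<subseteq> carrier circle_group \<and> open (\<Union>U))"

lemma openin_circle_topology:
  "openin circle_topology U \<longleftrightarrow> U \<subseteq> carrier circle_group \<and> open (\<Union>U)"
proof -
  have disj: "C = D \<or> C \<inter> D = {}"
    if CD: "C \<in> carrier circle_group" "D \<in> carrier circle_group" for C D
  proof -
    have "\<exists>x. E = (\<lambda>h. h + x) ` \<int>" if "E \<in> carrier circle_group" for E
      using that unfolding circle_group_def FactGroup_def RCOSETS_def r_coset_def real_group_def
      by (auto simp: UNION_singleton_eq_range)
    then obtain x y where xy: "C = (\<lambda>h. h + x) ` \<int>" "D = (\<lambda>h. h + y) ` \<int>"
      using CD by meson
    show ?thesis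
    proof (cases "C \<inter> D = {}")
      case False
      then obtain k l where kl: "k \<in> \<int>" "l \<in> \<int>" "k + x = l + y"
        unfolding xy by blast
      have d: "x - y \<in> \<int>"
        using kl Ints_diff[of l k] by (metis add.commute add_diff_cancel_left' add_diff_eq diff_add_eq)
      have "C \<subseteq> D"
      proof
        fix t assume "t \<in> C"
        then obtain m where "m \<in> \<int>" "t = m + x" using xy by auto
        then have "m + (x - y) \<in> \<int>" "t = (m + (x - y)) + y" using d by auto
        then show "t \<in> D" using xy by blast
      qed
      moreover have "D \<subseteq> C"
      proof
        fix t assume "t \<in> D"
        then obtain m where "m \<in> \<int>" "t = m + y" using xy by auto
        then have "m - (x - y) \<in> \<int>" "t = (m - (x - y)) + x" using d by auto
        then show "t \<in> C" using xy by blast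
      qed
      ultimately show ?thesis by blast
    qed blast
  qed
  have "istopology (\<lambda>U. U \<subseteq> carrier circle_group \<and> open (\<Union>U))"
    unfolding istopology_def
  proof (intro conjI allI impI)
    fix U V
    assume U: "U \<subseteq> carrier circle_group \<and> open (\<Union>U)"
      and V: "V \<subseteq> carrier circle_group \<and> open (\<Union>V)"
    have "\<Union>(U \<inter> V) = \<Union>U \<inter> \<Union>V"
      using U V disj by blast
    then show "open (\<Union>(U \<inter> V))" using U V by auto
    show "U \<inter> V \<subseteq> carrier circle_group" using U by auto
  next
    fix K :: "real set set set"
    assume K: "\<forall>U\<in>K. U \<subseteq> carrier circle_group \<and> open (\<Union>U)"
    then show "\<Union>K \<subseteq> carrier circle_group" by auto
    have "\<Union>(\<Union>K) = (\<Union>U\<in>K. \<Union>U)" by auto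
    then show "open (\<Union>(\<Union>K))" using K by (metis (no_types, lifting) open_UN)
  qed
  then show ?thesis
    unfolding circle_topology_def by (simp add: topology_inverse')
qed

locale compact_metrizable_abelian_group = comm_group X
  for X :: "('x, 'c) monoid_scheme" (structure) +
  fixes T :: "'x topology"
  assumes topspace_eq: "topspace T = carrier X"
    and continuous_mult: "continuous_map (prod_topology T T) T (\<lambda>(x, y). x \<otimes> y)"
    and continuous_inv: "continuous_map T T (\<lambda>x. inv x)"
    and compact_T: "compact_space T"
    and metrizable_T: "metrizable_space T"

locale algebraic_action =
  compact_metrizable_abelian_group X T + group_action G "carrier X" a
  for G :: "('g, 'b) monoid_scheme" and X :: "('x, 'c) monoid_scheme" and T :: "'x topology"
    and a :: "'g \<Rightarrow> 'x \<Rightarrow> 'x" +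
  assumes acts_by_homomorphisms: "g \<in> carrier G \<Longrightarrow> a g \<in> hom X X"
    and acts_continuously: "g \<in> carrier G \<Longrightarrow> continuous_map T T (a g)"

definition characters :: "('x, 'c) monoid_scheme \<Rightarrow> 'x topology \<Rightarrow> ('x \<Rightarrow> real set) set" where
  "characters X T =
     {\<xi> \<in> hom X circle_group. continuous_map T circle_topology \<xi> \<and> \<xi> \<in> extensional (carrier X)}"

text \<open>
  Scalar multiplication is the \<open>\<int>\<close>-linear extension of \<open>(g \<cdot> \<xi>)(x) = \<xi>(g\<inverse> x)\<close>.
\<close>

definition dual_module ::
    "('g, 'b) monoid_scheme \<Rightarrow> ('x, 'c) monoid_scheme \<Rightarrow> 'x topology \<Rightarrow> ('g \<Rightarrow> 'x \<Rightarrow> 'x) \<Rightarrow>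
     ('g \<Rightarrow>\<^sub>0 int, 'x \<Rightarrow> real set) module" where
  "dual_module G X T a = \<lparr>carrier = characters X T,
     monoid.mult = undefined,
     one = undefined,
     zero = (\<lambda>x\<in>carrier X. \<one>\<^bsub>circle_group\<^esub>),
     add = (\<lambda>\<xi> \<psi>. \<lambda>x\<in>carrier X. \<xi> x \<otimes>\<^bsub>circle_group\<^esub> \<psi> x),
     smult = (\<lambda>r \<xi>. \<lambda>x\<in>carrier X.
       finprod circle_group
         (\<lambda>g. \<xi> (a (inv\<^bsub>G\<^esub> g) x) [^]\<^bsub>circle_group\<^esub> Poly_Mapping.lookup r g)
         (Poly_Mapping.keys r))\<rparr>"

definition finitely_presented_action ::
    "('g, 'b) monoid_scheme \<Rightarrow> ('x, 'c) monoid_scheme \<Rightarrow> 'x topology \<Rightarrow> ('g \<Rightarrow> 'x \<Rightarrow> 'x) \<Rightarrow> bool" where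
  "finitely_presented_action G X T a \<longleftrightarrow>
     finitely_presented_left_module (group_ring G) (dual_module G X T a)"

end

theory Submission imports Defs begin

text \<open>
  Since the dual of \<open>X\<close> is \<open>\<int>[\<Gamma>]\<^sup>n / \<int>[\<Gamma>]\<^sup>k P\<close>, Pontryagin duality identifies \<open>X\<close> with the set of
  \<open>(\<real>/\<int>)\<^sup>n\<close>-valued functions on \<open>\<Gamma>\<close> satisfying finitely many translation-invariant integral linear
  equations. Writing the coordinates in binary and keeping a bounded carry at every digit turns each
  equation into a rule that involves finitely many bits of \<open>\<Gamma> \<times> \<nat>\<close> at a time, uniformly in the digit. When
  \<open>\<Gamma>\<close> is numbered by words in its generators, equality of numbers is r.e., so the configurations obeying
  the rules form an effectively closed set on which \<open>\<Gamma>\<close> acts computably by translation. This action has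
  \<open>X\<close> as a factor, and self-simulability applies to it.

  The part of duality that is needed is that characters separate points and that every homomorphism
  from the dual to the circle is evaluation at a point. Both rest on the Haar mean, obtained by averaging
  a continuous function over finitely many translates. To separate \<open>x\<close> from the identity, let \<open>b\<close> be the
  difference of a function and its translate by \<open>x\<close>. Convolution with \<open>b * b\<^sup>*\<close> is a compact self-adjoint
  operator, and power iteration yields an idempotent for its top eigenvalue. Squared norms of idempotents
  are at least 1 and add up under splitting, so there is a minimal idempotent below this one; it is a
  multiple of a character, which is nontrivial at \<open>x\<close>. A homomorphism \<open>h\<close> from the dual to the circle is
  interpolated on finitely many characters as in Bohr's proof of Kronecker's theorem, by comparing means
  of powers of \<open>1 + \<Sum>\<chi>\<close> and of its twist by \<open>h\<close>; compactness then gives a single point.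
\<close>

section \<open>Recursive functions and predicates\<close>

text \<open>Two obstacles shape the construction. The word problem of \<Gamma> is only r.e., so in
  general no computable numbering of \<Gamma> without repetitions and no test for distinct elements
  is at hand. Repetitions are therefore allowed and consistency is made part of the closed set: a
  sequence is rejected once two numbers proved equal carry different bits, which needs only the
  positive half of the word problem. The circle, being connected, is not a subset of Cantor space,
  and a sum of binary expansions is not determined digit by digit: a carry may come from arbitrarily
  far away. Guessing the carry at every digit as extra data makes the check local, and carries up to
  the sum of the absolute coefficients suffice. Binary expansions are not unique, which does no harm
  because only a surjection onto X is required. The analysis uses continuous functions alone.
  Equicontinuity is measured by neighbourhoods of the identity, and L2 estimates become uniform
  after one more convolution, so neither measures nor spectral theory have to be set up.\<close>

lemma recursive_cong:
  "recursive n f \<Longrightarrow> (\<And>xs. length xs = n \<Longrightarrow> g xs = f xs) \<Longrightarrow> recursive n g"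
  by (rule recursive.ext) auto

lemma recursive_comp1:
  assumes "recursive 1 f" "recursive n g"
  shows "recursive n (\<lambda>xs. f [g xs])"
  using recursive.comp[of "[g]" f n] assms by simp

lemma recursive_comp2:
  assumes "recursive 2 f" "recursive n g" "recursive n h"
  shows "recursive n (\<lambda>xs. f [g xs, h xs])"
  using recursive.comp[of "[g, h]" f n] assms by (auto simp: numeral_2_eq_2)

lemma map_nth_length: "length xs = n \<Longrightarrow> map (\<lambda>i. xs ! i) [0..<n] = xs"
  by (metis map_nth)

lemma recursive_comp_Cons:
  assumes "recursive (Suc n) f" "recursive n g"
  shows "recursive n (\<lambda>xs. f (g xs # xs))"
proof -
  have "recursive n (\<lambda>xs. f (map (\<lambda>g. g xs) (g # map (\<lambda>i xs. xs ! i) [0..<n])))"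
    by (rule recursive.comp) (use assms in \<open>auto intro: recursive.proj\<close>)
  then show ?thesis
    by (rule recursive_cong) (simp add: o_def map_nth_length)
qed

lemma recursive_Suc: "recursive n f \<Longrightarrow> recursive n (\<lambda>xs. Suc (f xs))"
  using recursive_comp1[OF recursive.succ, of n f] by simp

lemma recursive_const: "recursive n (\<lambda>xs. c)"
  by (induction c) (auto intro: recursive.zero recursive_Suc)

lemma recursive_nth: "i < n \<Longrightarrow> recursive n (\<lambda>xs. xs ! i)"
  by (rule recursive.proj)

lemma recursive_hd: "0 < n \<Longrightarrow> recursive n hd"
  by (rule recursive_cong[OF recursive.proj[of 0]]) (auto simp: hd_conv_nth)

lemma recursive_tl:
  assumes "recursive n f"
  shows "recursive (Suc n) (\<lambda>xs. f (tl xs))"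
proof -
  have "recursive (Suc n) (\<lambda>xs. f (map (\<lambda>g. g xs) (map (\<lambda>i xs. xs ! Suc i) [0..<n])))"
    by (rule recursive.comp) (use assms in \<open>auto intro: recursive.proj\<close>)
  then show ?thesis
  proof (rule recursive_cong)
    fix xs :: "nat list" assume "length xs = Suc n"
    then have "map (\<lambda>i. xs ! Suc i) [0..<n] = tl xs"
      by (intro nth_equalityI) (auto simp: nth_tl)
    then show "f (tl xs) = f (map (\<lambda>g. g xs) (map (\<lambda>i xs. xs ! Suc i) [0..<n]))"
      by (simp add: o_def)
  qed
qed

text \<open>\<open>prec\<close> recurses on the head of the argument list;
  \<open>recursive_comp_Cons\<close> then substitutes an arbitrary recursive function
  \<open>h\<close> for that head.\<close>

lemma recursive_rec_nat:
  assumes "recursive n f" "recursive (Suc (Suc n)) (\<lambda>ys. g (hd ys) (hd (tl ys)) (tl (tl ys)))"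
    and "recursive n h"
  shows "recursive n (\<lambda>xs. rec_nat (f xs) (\<lambda>k r. g k r xs) (h xs))"
proof -
  from recursive_comp_Cons[OF recursive.prec[OF assms(1,2)] assms(3)]
  show ?thesis by simp
qed

lemma recursive_Least:
  assumes "recursive (Suc n) (\<lambda>ys. f (hd ys) (tl ys))"
    and "\<And>xs. length xs = n \<Longrightarrow> \<exists>k. f k xs = 0"
  shows "recursive n (\<lambda>xs. LEAST k. f k xs = 0)"
  using recursive.mini[OF assms(1)] assms(2) by simp

lemma recursive_comp1':
  assumes "recursive 1 (\<lambda>xs. f (xs ! 0))" "recursive n g"
  shows "recursive n (\<lambda>xs. f (g xs))"
  using recursive_comp1[OF assms] by simp

lemmas recursive_intros = recursive_tl recursive_const recursive_Suc recursive_nth recursive_hd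

section \<open>Arithmetic and decidable predicates\<close>

lemma recursive_add:
  assumes "recursive n f" "recursive n g"
  shows "recursive n (\<lambda>xs. f xs + g xs)"
proof -
  have "rec_nat a (\<lambda>k r. Suc r) b = a + b" for a b :: nat
    by (induction b) auto
  moreover have "recursive (Suc (Suc n)) (\<lambda>ys. Suc (hd (tl ys)))"
    by (intro recursive_intros) simp_all
  ultimately show ?thesis
    using recursive_rec_nat[OF assms(1) _ assms(2), of "\<lambda>k r xs. Suc r"] by simp
qed

lemma recursive_mult:
  assumes "recursive n f" "recursive n g"
  shows "recursive n (\<lambda>xs. f xs * g xs)"
proof -
  have "rec_nat 0 (\<lambda>k r. r + a) b = a * b" for a b :: nat
    by (induction b) auto
  moreover have "recursive (Suc (Suc n)) (\<lambda>ys. hd (tl ys) + f (tl (tl ys)))"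
    by (intro recursive_intros recursive_add assms) simp_all
  ultimately show ?thesis
    using recursive_rec_nat[OF recursive_const _ assms(2), of "\<lambda>k r xs. r + f xs" 0] by simp
qed

lemma recursive_pred:
  assumes "recursive n f"
  shows "recursive n (\<lambda>xs. f xs - 1)"
proof -
  have "rec_nat 0 (\<lambda>k r. k) a = a - 1" for a :: nat
    by (cases a) auto
  moreover have "recursive (Suc (Suc n)) hd"
    by (intro recursive_intros) simp_all
  ultimately show ?thesis
    using recursive_rec_nat[OF recursive_const _ assms, of "\<lambda>k r xs. k" 0] by simp
qed

lemma recursive_diff:
  assumes "recursive n f" "recursive n g"
  shows "recursive n (\<lambda>xs. f xs - g xs)"
proof -
  have "rec_nat a (\<lambda>k r. r - 1) b = a - b" for a b :: nat
    by (induction b) auto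
  moreover have "recursive (Suc (Suc n)) (\<lambda>ys. hd (tl ys) - 1)"
    by (intro recursive_intros recursive_pred) simp_all
  ultimately show ?thesis
    using recursive_rec_nat[OF assms(1) _ assms(2), of "\<lambda>k r xs. r - 1"] by simp
qed

lemmas recursive_arith = recursive_intros recursive_add recursive_mult recursive_diff

text \<open>True is coded by 0 because minimisation in \<open>recursive\<close> searches for a
  zero.\<close>

definition dec_pred :: "nat \<Rightarrow> (nat list \<Rightarrow> bool) \<Rightarrow> bool" where
  "dec_pred n P \<longleftrightarrow> recursive n (\<lambda>xs. if P xs then 0 else 1)"

lemma recursive_if:
  assumes "dec_pred n P" "recursive n f" "recursive n g"
  shows "recursive n (\<lambda>xs. if P xs then f xs else g xs)"
proof -
  have "recursive n (\<lambda>xs. (1 - (if P xs then 0 else 1)) * f xs + (if P xs then 0 else 1) * g xs)"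
    using assms unfolding dec_pred_def by (intro recursive_arith assms(2,3)) simp_all
  then show ?thesis by (rule recursive_cong) auto
qed

lemma dec_pred_not: "dec_pred n P \<Longrightarrow> dec_pred n (\<lambda>xs. \<not> P xs)"
  using recursive_cong[OF recursive_if[OF _ recursive_const[of n 1] recursive_const[of n 0], of P]] unfolding dec_pred_def
  by auto

lemma dec_pred_eq_0: "recursive n f \<Longrightarrow> dec_pred n (\<lambda>xs. f xs = 0)"
  unfolding dec_pred_def
  by (rule recursive_cong[of n "\<lambda>xs. 1 - (1 - f xs)"], intro recursive_arith) auto

lemma dec_pred_le: "recursive n f \<Longrightarrow> recursive n g \<Longrightarrow> dec_pred n (\<lambda>xs. f xs \<le> g xs)"
  using dec_pred_eq_0[OF recursive_diff[of n f g]] by simp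

lemma dec_pred_less: "recursive n f \<Longrightarrow> recursive n g \<Longrightarrow> dec_pred n (\<lambda>xs. f xs < g xs)"
  using dec_pred_le[OF recursive_Suc[of n f], of g] by (simp add: Suc_le_eq)

lemma dec_pred_conj:
  "dec_pred n P \<Longrightarrow> dec_pred n Q \<Longrightarrow> dec_pred n (\<lambda>xs. P xs \<and> Q xs)"
  using recursive_cong[OF recursive_if[OF _ _ recursive_const[of n 1], of P "\<lambda>xs. if Q xs then 0 else 1"]] unfolding dec_pred_def
  by auto

lemma dec_pred_const: "dec_pred n (\<lambda>xs. b)"
  unfolding dec_pred_def by (rule recursive_const)

lemma dec_pred_disj:
  "dec_pred n P \<Longrightarrow> dec_pred n Q \<Longrightarrow> dec_pred n (\<lambda>xs. P xs \<or> Q xs)"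
  using dec_pred_not[OF dec_pred_conj[OF dec_pred_not[of n P] dec_pred_not[of n Q]]] by simp

lemma dec_pred_eq: "recursive n f \<Longrightarrow> recursive n g \<Longrightarrow> dec_pred n (\<lambda>xs. f xs = g xs)"
  using dec_pred_conj[OF dec_pred_le[of n f g] dec_pred_le[of n g f]] by (simp add: eq_iff)

lemma dec_pred_in_finite:
  assumes "finite D" "recursive n f" shows "dec_pred n (\<lambda>xs. f xs \<in> D)"
  using assms(1)
  by induction (auto intro!: dec_pred_const dec_pred_disj dec_pred_eq assms(2) recursive_const)

lemma recursive_sum_lessThan:
  assumes "recursive (Suc n) (\<lambda>ys. f (hd ys) (tl ys))" "recursive n h"
  shows "recursive n (\<lambda>xs. \<Sum>k<h xs. f k xs)"
proof -
  have *: "rec_nat 0 (\<lambda>k r. r + f k xs) m = (\<Sum>k<m. f k xs)" for xs m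
    by (induction m) auto
  \<comment> \<open>The summand ignores the accumulator, which is the second argument of the
    recursion step, so that entry is projected away.\<close>
  have "recursive (Suc (Suc n)) (\<lambda>ys. (\<lambda>zs. f (hd zs) (tl zs)) (map (\<lambda>g. g ys) (hd # map (\<lambda>i xs. xs ! Suc (Suc i)) [0..<n])))"
    by (rule recursive.comp) (use assms in \<open>auto intro: recursive.proj recursive_hd\<close>)
  then have "recursive (Suc (Suc n)) (\<lambda>ys. f (hd ys) (tl (tl ys)))"
  proof (rule recursive_cong)
    fix xs :: "nat list" assume "length xs = Suc (Suc n)"
    then have "map (\<lambda>i. xs ! Suc (Suc i)) [0..<n] = tl (tl xs)"
      by (intro nth_equalityI) (auto simp: nth_tl)
    then show "f (hd xs) (tl (tl xs)) = (\<lambda>zs. f (hd zs) (tl zs)) (map (\<lambda>g. g xs) (hd # map (\<lambda>i xs. xs ! Suc (Suc i)) [0..<n]))"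
      by (simp add: o_def)
  qed
  then have "recursive (Suc (Suc n)) (\<lambda>ys. hd (tl ys) + f (hd ys) (tl (tl ys)))"
    by (intro recursive_add recursive_tl recursive_hd) simp_all
  from recursive_rec_nat[OF recursive_const this assms(2), of 0] show ?thesis
    by (simp add: *)
qed

text \<open>The number of failures below the bound is a recursive sum, and the quantifier asks
  whether it is 0.\<close>

lemma dec_pred_all_less:
  assumes "dec_pred (Suc n) (\<lambda>ys. P (hd ys) (tl ys))" "recursive n h"
  shows "dec_pred n (\<lambda>xs. \<forall>k<h xs. P k xs)"
proof -
  have "recursive n (\<lambda>xs. \<Sum>k<h xs. if P k xs then 0 else 1)"
    by (rule recursive_sum_lessThan) (use assms in \<open>auto simp: dec_pred_def\<close>)
  from dec_pred_eq_0[OF this] show ?thesis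
    by (auto simp: dec_pred_def elim!: recursive_cong)
qed

section \<open>Pairing and codes of lists\<close>

lemma recursive_triangle: "recursive n f \<Longrightarrow> recursive n (\<lambda>xs. triangle (f xs))"
proof -
  assume f: "recursive n f"
  have *: "triangle m = (\<Sum>k<m. Suc k)" for m
    by (induction m) auto
  show ?thesis unfolding *
    by (rule recursive_sum_lessThan, intro recursive_intros) (use f in simp_all)
qed

lemma recursive_prod_encode:
  "recursive n f \<Longrightarrow> recursive n g \<Longrightarrow> recursive n (\<lambda>xs. prod_encode (f xs, g xs))"
  unfolding prod_encode_def by (auto intro!: recursive_triangle recursive_add)

text \<open>\<open>prod_encode\<close> counts along antidiagonals:
  \<open>n = triangle (a + b) + a\<close>, so \<open>k = a + b\<close> is the first index with
  \<open>n < triangle (Suc k)\<close>. Truncated subtraction turns this inequality into the zero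
  test that minimisation requires.\<close>

lemma prod_decode_conv_Least:
  fixes n :: nat
  defines "k \<equiv> LEAST k. Suc n - triangle (Suc k) = 0"
  shows "prod_decode n = (n - triangle k, k - (n - triangle k))"
proof -
  obtain a b where ab: "prod_decode n = (a, b)" by force
  then have n: "n = triangle (a + b) + a"
    using prod_decode_inverse[of n] by (simp add: prod_encode_def)
  have mono: "triangle i \<le> triangle j" if "i \<le> j" for i j
    using that by (induction rule: dec_induct) auto
  have "k = a + b"
    unfolding k_def
  proof (rule Least_equality)
    show "Suc n - triangle (Suc (a + b)) = 0" by (simp add: n)
  next
    fix y assume y: "Suc n - triangle (Suc y) = 0"
    show "a + b \<le> y"
      using mono[of "Suc y" "a + b"] y n by (cases "a + b \<le> y") (auto simp: not_le)
  qed
  then show ?thesis using n ab by auto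
qed

lemma recursive_prod_decode:
  assumes "recursive n f"
  shows "recursive n (\<lambda>xs. fst (prod_decode (f xs)))" "recursive n (\<lambda>xs. snd (prod_decode (f xs)))"
proof -
  have k: "recursive n (\<lambda>xs. LEAST k. Suc (f xs) - triangle (Suc k) = 0)"
  proof (rule recursive_Least)
    show "recursive (Suc n) (\<lambda>ys. Suc (f (tl ys)) - triangle (Suc (hd ys)))"
      by (intro recursive_arith assms recursive_triangle) simp_all
    have "m < triangle (Suc m)" for m by (induction m) auto
    then show "\<exists>k. Suc (f xs) - triangle (Suc k) = 0" for xs
      by (metis Suc_leI diff_is_0_eq)
  qed
  show "recursive n (\<lambda>xs. fst (prod_decode (f xs)))" "recursive n (\<lambda>xs. snd (prod_decode (f xs)))"
    unfolding prod_decode_conv_Least fst_conv snd_conv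
    by (intro recursive_diff recursive_triangle k assms)+
qed

lemmas recursive_fst = recursive_prod_decode(1)
lemmas recursive_snd = recursive_prod_decode(2)

definition list_tl :: "nat \<Rightarrow> nat" where "list_tl c = list_encode (tl (list_decode c))"
definition list_nth :: "nat \<Rightarrow> nat \<Rightarrow> nat" where
  "list_nth c i = (if i < length (list_decode c) then list_decode c ! i else 0)"
definition list_cons :: "nat \<Rightarrow> nat \<Rightarrow> nat" where "list_cons x c = list_encode (x # list_decode c)"
definition list_len :: "nat \<Rightarrow> nat" where "list_len c = length (list_decode c)"

lemma recursive_list_cons:
  "recursive n f \<Longrightarrow> recursive n g \<Longrightarrow> recursive n (\<lambda>xs. list_cons (f xs) (g xs))"
  unfolding list_cons_def by (simp add: recursive_Suc recursive_prod_encode)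

lemma recursive_list_tl: "recursive n f \<Longrightarrow> recursive n (\<lambda>xs. list_tl (f xs))"
proof -
  assume f: "recursive n f"
  have "list_tl c = (if c = 0 then 0 else snd (prod_decode (c - 1)))" for c
    by (cases c) (auto simp: list_tl_def split: prod.splits)
  then show ?thesis
    using recursive_if[OF dec_pred_eq_0[OF f] recursive_const recursive_snd[OF recursive_pred[OF f]]] by simp
qed

lemma list_decode_funpow_list_tl: "list_decode ((list_tl ^^ i) c) = drop i (list_decode c)"
  by (induction i) (auto simp: list_tl_def drop_Suc tl_drop)

lemma recursive_funpow_list_tl:
  assumes "recursive n f" "recursive n g"
  shows "recursive n (\<lambda>xs. (list_tl ^^ (f xs)) (g xs))"
proof -
  have "rec_nat a (\<lambda>k r. list_tl r) b = (list_tl ^^ b) a" for a b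
    by (induction b) auto
  moreover have "recursive (Suc (Suc n)) (\<lambda>ys. list_tl (hd (tl ys)))"
    by (intro recursive_intros recursive_list_tl) simp_all
  ultimately show ?thesis
    using recursive_rec_nat[OF assms(2) _ assms(1), of "\<lambda>k r xs. list_tl r"] by simp
qed

text \<open>Entry \<open>i\<close> is the head after \<open>i\<close> tails, and a nonempty list has
  a code \<open>Suc m\<close> whose head is the first component of \<open>m\<close>. Past the end
  the tail has code 0, and \<open>0 - 1 = 0\<close> decodes to first component 0, which is the
  default value of \<open>list_nth\<close>.\<close>

lemma recursive_list_nth:
  assumes "recursive n f" "recursive n g"
  shows "recursive n (\<lambda>xs. list_nth (f xs) (g xs))"
proof -
  have "list_nth c i = fst (prod_decode ((list_tl ^^ i) c - 1))" for c i
  proof (cases "(list_tl ^^ i) c")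
    case 0
    have "drop i (list_decode c) = []"
      using list_decode_funpow_list_tl[of i c] 0 by simp
    then have "\<not> i < length (list_decode c)" by simp
    then show ?thesis using 0 by (simp add: list_nth_def prod_decode_def prod_decode_aux.simps)
  next
    case (Suc m)
    then have d: "drop i (list_decode c) = list_decode (Suc m)"
      by (metis list_decode_funpow_list_tl)
    then have "drop i (list_decode c) = fst (prod_decode m) # list_decode (snd (prod_decode m))"
      by (simp split: prod.splits)
    then have "i < length (list_decode c) \<and> list_decode c ! i = fst (prod_decode m)"
      by (metis Cons_nth_drop_Suc drop_all list.distinct(1) list.inject not_le)
    then show ?thesis using Suc by (simp add: list_nth_def)
  qed
  then show ?thesis using recursive_fst[OF recursive_pred[OF recursive_funpow_list_tl[OF assms(2,1)]]] by simp
qed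

text \<open>The length is the least number of tails that reaches 0, the code of the empty
  list.\<close>

lemma recursive_list_len:
  assumes "recursive n f"
  shows "recursive n (\<lambda>xs. list_len (f xs))"
proof -
  have z: "(list_tl ^^ i) c = 0 \<longleftrightarrow> length (list_decode c) \<le> i" for c i
    by (metis drop_eq_Nil list_decode.simps(1) list_decode_funpow_list_tl list_decode_inverse list_encode.simps(1))
  have "list_len c = (LEAST k. (list_tl ^^ k) c = 0)" for c
    unfolding z list_len_def by (rule Least_equality[symmetric]) auto
  moreover have "recursive n (\<lambda>xs. LEAST k. (list_tl ^^ k) (f xs) = 0)"
    by (rule recursive_Least, intro recursive_funpow_list_tl recursive_hd recursive_tl assms, simp, auto simp: z)
  ultimately show ?thesis by simp
qed

text \<open>A right fold consumes the interval from its last element, so recursion step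
  \<open>j\<close> treats the index \<open>n - Suc j\<close>.\<close>

lemma foldr_upt_rec_nat:
  "foldr g [0..<n] a = rec_nat a (\<lambda>j r. g (n - Suc j) r) n"
proof -
  have "k \<le> n \<Longrightarrow> foldr g [n - k..<n] a = rec_nat a (\<lambda>j r. g (n - Suc j) r) k" for k
  proof (induction k)
    case (Suc k)
    then have "[n - Suc k..<n] = (n - Suc k) # [n - k..<n]"
      by (metis Suc_diff_Suc Suc_le_lessD diff_less le_zero_eq less_numeral_extra(3) not_less_eq upt_conv_Cons zero_less_Suc le0 le_neq_implies_less)
    then show ?case using Suc by simp
  qed auto
  from this[of n] show ?thesis by simp
qed

lemma recursive_foldr_upt:
  assumes "recursive (Suc (Suc n)) (\<lambda>ys. g (hd ys) (hd (tl ys)) (tl (tl ys)))"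
    and "recursive n a" "recursive n h"
  shows "recursive n (\<lambda>xs. foldr (\<lambda>i r. g i r xs) [0..<h xs] (a xs))"
proof -
  have "recursive (Suc (Suc n)) (\<lambda>ys. (\<lambda>zs. g (hd zs) (hd (tl zs)) (tl (tl zs)))
     (map (\<lambda>g. g ys) ((\<lambda>ys. h (tl (tl ys)) - Suc (hd ys)) # map (\<lambda>i xs. xs ! Suc i) [0..<Suc n])))"
    by (rule recursive.comp)
      (use assms in \<open>auto intro!: recursive_diff recursive_tl recursive_Suc recursive_hd intro: recursive.proj\<close>)
  then have "recursive (Suc (Suc n)) (\<lambda>ys. g (h (tl (tl ys)) - Suc (hd ys)) (hd (tl ys)) (tl (tl ys)))"
  proof (rule recursive_cong)
    fix xs :: "nat list" assume "length xs = Suc (Suc n)"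
    then have "map (\<lambda>i. xs ! Suc i) [0..<Suc n] = tl xs"
      by (intro nth_equalityI) (auto simp: nth_tl simp del: upt_Suc)
    then show "g (h (tl (tl xs)) - Suc (hd xs)) (hd (tl xs)) (tl (tl xs)) = (\<lambda>zs. g (hd zs) (hd (tl zs)) (tl (tl zs)))
     (map (\<lambda>g. g xs) ((\<lambda>ys. h (tl (tl ys)) - Suc (hd ys)) # map (\<lambda>i xs. xs ! Suc i) [0..<Suc n]))"
      by (simp add: o_def del: upt_Suc)
  qed
  from recursive_rec_nat[OF assms(2) this assms(3)] show ?thesis
    by (simp add: foldr_upt_rec_nat)
qed

lemma foldr_nth_upt: "foldr g xs a = foldr (\<lambda>i r. g (xs ! i) r) [0..<length xs] a"
proof -
  have "foldr g xs a = foldr g (map ((!) xs) [0..<length xs]) a" by (simp add: map_nth)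
  then show ?thesis by (simp add: foldr_map o_def)
qed

definition list_append :: "nat \<Rightarrow> nat \<Rightarrow> nat" where
  "list_append c d = list_encode (list_decode c @ list_decode d)"

lemma foldr_list_decode:
  "foldr g (list_decode c) a = foldr (\<lambda>i r. g (list_nth c i) r) [0..<list_len c] a"
  unfolding list_len_def foldr_nth_upt[of g "list_decode c"]
  by (intro foldr_cong) (auto simp: list_nth_def)

lemma recursive_list_append:
  assumes "recursive n f" "recursive n g"
  shows "recursive n (\<lambda>xs. list_append (f xs) (g xs))"
proof -
  have "foldr list_cons ys d = list_encode (ys @ list_decode d)" for ys d
    by (induction ys) (auto simp: list_cons_def)
  then have "list_append c d = foldr (\<lambda>i r. list_cons (list_nth c i) r) [0..<list_len c] d" for c d
    by (simp add: list_append_def foldr_list_decode[symmetric])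
  moreover have "recursive n (\<lambda>xs. foldr (\<lambda>i r. list_cons (list_nth (f xs) i) r) [0..<list_len (f xs)] (g xs))"
    by (rule recursive_foldr_upt; intro recursive_intros recursive_list_cons recursive_list_nth recursive_list_len assms) simp_all
  ultimately show ?thesis by simp
qed

text \<open>Makes every number readable as a word: entries that are not codes of generators will be
  dropped.\<close>

definition list_filter :: "nat set \<Rightarrow> nat \<Rightarrow> nat" where
  "list_filter D c = list_encode (filter (\<lambda>x. x \<in> D) (list_decode c))"

lemma list_filter_conv_foldr:
  "list_filter D c = foldr (\<lambda>i r. if list_nth c i \<in> D then list_cons (list_nth c i) r else r) [0..<list_len c] 0"
proof -
  have "foldr (\<lambda>x r. if x \<in> D then list_cons x r else r) ys 0 = list_encode (filter (\<lambda>x. x \<in> D) ys)" for ys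
    by (induction ys) (auto simp: list_cons_def)
  then show ?thesis
    unfolding list_filter_def foldr_list_decode[symmetric, where g = "\<lambda>x r. if x \<in> D then list_cons x r else r"] by simp
qed

lemma recursive_list_filter:
  assumes D: "finite D" and f: "recursive n f"
  shows "recursive n (\<lambda>xs. list_filter D (f xs))"
  unfolding list_filter_conv_foldr
  by (rule recursive_foldr_upt; intro recursive_if dec_pred_in_finite D recursive_intros recursive_list_cons recursive_list_nth recursive_list_len f; simp)

text \<open>R.e. predicates as projections of decidable ones. Unlike \<open>rec_enum\<close>, this
  form takes several arguments and treats the empty set like any other, so closure properties can be
  applied as rules.\<close>

definition re_pred :: "nat \<Rightarrow> (nat list \<Rightarrow> bool) \<Rightarrow> bool" where
  "re_pred n P \<longleftrightarrow> (\<exists>f. recursive (Suc n) f \<and> (\<forall>xs. length xs = n \<longrightarrow> P xs \<longleftrightarrow> (\<exists>k. f (k # xs) = 0)))"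

lemma re_predI:
  "recursive (Suc n) f \<Longrightarrow> (\<And>xs. length xs = n \<Longrightarrow> P xs \<longleftrightarrow> (\<exists>k. f (k # xs) = 0)) \<Longrightarrow> re_pred n P"
  unfolding re_pred_def by auto

lemma re_pred_cong:
  "re_pred n P \<Longrightarrow> (\<And>xs. length xs = n \<Longrightarrow> Q xs \<longleftrightarrow> P xs) \<Longrightarrow> re_pred n Q"
  unfolding re_pred_def by simp

lemma re_pred_dec: "dec_pred n P \<Longrightarrow> re_pred n P"
  unfolding re_pred_def dec_pred_def
  by (rule exI[of _ "\<lambda>ys. if P (tl ys) then 0 else 1"]) (auto dest: recursive_tl)

lemma re_pred_ex_dec:
  assumes "dec_pred (Suc n) (\<lambda>ys. P (hd ys) (tl ys))"
  shows "re_pred n (\<lambda>xs. \<exists>k. P k xs)"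
  unfolding re_pred_def
  by (rule exI[of _ "\<lambda>ys. if P (hd ys) (tl ys) then 0 else 1"]) (use assms in \<open>auto simp: dec_pred_def\<close>)

text \<open>Two existential witnesses are merged into one by pairing.\<close>

lemma re_pred_witness2:
  assumes f: "recursive (Suc n) f" and g: "recursive (Suc n) g"
    and P: "\<And>xs. length xs = n \<Longrightarrow> P xs \<longleftrightarrow> (\<exists>k l. f (k # xs) = 0 \<and> g (l # xs) = 0)"
  shows "re_pred n P"
proof -
  have *: "recursive (Suc n) (\<lambda>ys. h (p (hd ys) # tl ys))"
    if "recursive (Suc n) h" "\<And>m u. recursive m u \<Longrightarrow> recursive m (\<lambda>xs. p (u xs))" for h p
  proof -
    have "recursive (Suc n) (\<lambda>ys. h (map (\<lambda>g. g ys) ((\<lambda>ys. p (hd ys)) # map (\<lambda>i xs. xs ! Suc i) [0..<n])))"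
      by (rule recursive.comp) (use that in \<open>auto intro: recursive.proj recursive_hd\<close>)
    then show ?thesis
    proof (rule recursive_cong)
      fix xs :: "nat list" assume "length xs = Suc n"
      then have "map (\<lambda>i. xs ! Suc i) [0..<n] = tl xs"
        by (intro nth_equalityI) (auto simp: nth_tl)
      then show "h (p (hd xs) # tl xs) = h (map (\<lambda>g. g xs) ((\<lambda>ys. p (hd ys)) # map (\<lambda>i xs. xs ! Suc i) [0..<n]))"
        by (simp add: o_def)
    qed
  qed
  have "recursive (Suc n) (\<lambda>ys. f (fst (prod_decode (hd ys)) # tl ys) + g (snd (prod_decode (hd ys)) # tl ys))"
    using *[OF f, of "\<lambda>u. fst (prod_decode u)"] *[OF g, of "\<lambda>u. snd (prod_decode u)"]
    by (intro recursive_add) (auto intro: recursive_fst recursive_snd)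
  then show ?thesis
  proof (rule re_predI)
    fix xs :: "nat list" assume "length xs = n"
    then show "P xs \<longleftrightarrow> (\<exists>k. f (fst (prod_decode (hd (k # xs))) # tl (k # xs)) + g (snd (prod_decode (hd (k # xs))) # tl (k # xs)) = 0)"
      using P by (auto simp: add_eq_0_iff_both_eq_0) (metis fst_conv snd_conv prod_encode_inverse)
  qed
qed

lemma re_pred_conj:
  assumes "re_pred n P" "re_pred n Q" shows "re_pred n (\<lambda>xs. P xs \<and> Q xs)"
proof -
  obtain f g where f: "recursive (Suc n) f" "\<forall>xs. length xs = n \<longrightarrow> P xs \<longleftrightarrow> (\<exists>k. f (k # xs) = 0)"
    and g: "recursive (Suc n) g" "\<forall>xs. length xs = n \<longrightarrow> Q xs \<longleftrightarrow> (\<exists>k. g (k # xs) = 0)"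
    using assms unfolding re_pred_def by auto
  show ?thesis by (rule re_pred_witness2[OF f(1) g(1)]) (use f(2) g(2) in auto)
qed

lemma re_pred_disj:
  assumes "re_pred n P" "re_pred n Q" shows "re_pred n (\<lambda>xs. P xs \<or> Q xs)"
proof -
  obtain f g where f: "recursive (Suc n) f" "\<forall>xs. length xs = n \<longrightarrow> P xs \<longleftrightarrow> (\<exists>k. f (k # xs) = 0)"
    and g: "recursive (Suc n) g" "\<forall>xs. length xs = n \<longrightarrow> Q xs \<longleftrightarrow> (\<exists>k. g (k # xs) = 0)"
    using assms unfolding re_pred_def by auto
  have "recursive (Suc n) (\<lambda>ys. f ys * g ys)" by (intro recursive_mult f g)
  then show ?thesis 
    by (rule re_predI) (use f(2) g(2) in auto)
qed

lemma re_pred_ex: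
  assumes "re_pred (Suc n) (\<lambda>ys. P (hd ys) (tl ys))"
  shows "re_pred n (\<lambda>xs. \<exists>k. P k xs)"
proof -
  obtain f where f: "recursive (Suc (Suc n)) f"
    "\<forall>ys. length ys = Suc n \<longrightarrow> P (hd ys) (tl ys) \<longleftrightarrow> (\<exists>k. f (k # ys) = 0)"
    using assms unfolding re_pred_def by auto
  have "recursive (Suc n) (\<lambda>ys. f (map (\<lambda>g. g ys) ((\<lambda>ys. fst (prod_decode (hd ys))) # (\<lambda>ys. snd (prod_decode (hd ys))) # map (\<lambda>i xs. xs ! Suc i) [0..<n])))"
    by (rule recursive.comp) (use f in \<open>auto intro: recursive.proj recursive_hd recursive_fst recursive_snd\<close>)
  then show ?thesis proof (rule re_predI)
    fix xs :: "nat list" assume l: "length xs = n"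
    then have *: "map (\<lambda>i. xs ! i) [0..<n] = xs"
      by (metis map_nth)
    have "(\<exists>k. P k xs) \<longleftrightarrow> (\<exists>k j. f (j # k # xs) = 0)"
      using f(2) l by (metis length_Cons list.sel(1,3))
    also have "\<dots> \<longleftrightarrow> (\<exists>k. f (fst (prod_decode k) # snd (prod_decode k) # xs) = 0)"
      by (metis fst_conv snd_conv prod_encode_inverse)
    finally show "(\<exists>k. P k xs) \<longleftrightarrow> (\<exists>k. f (map (\<lambda>g. g (k # xs)) ((\<lambda>ys. fst (prod_decode (hd ys))) # (\<lambda>ys. snd (prod_decode (hd ys))) # map (\<lambda>i xs. xs ! Suc i) [0..<n])) = 0)"
      using * by (simp add: o_def)
  qed
qed

lemma re_pred_comp:
  assumes "re_pred (length gs) P" "\<And>g. g \<in> set gs \<Longrightarrow> recursive n g"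
  shows "re_pred n (\<lambda>xs. P (map (\<lambda>g. g xs) gs))"
proof -
  obtain f where f: "recursive (Suc (length gs)) f"
    "\<forall>ys. length ys = length gs \<longrightarrow> P ys \<longleftrightarrow> (\<exists>k. f (k # ys) = 0)"
    using assms(1) unfolding re_pred_def by auto
  have "recursive (Suc n) (\<lambda>ys. f (map (\<lambda>g. g ys) (hd # map (\<lambda>g ys. g (tl ys)) gs)))"
    by (rule recursive.comp) (use f assms(2) in \<open>auto intro: recursive_hd recursive_tl\<close>)
  then show ?thesis 
    by (rule re_predI) (use f(2) in \<open>auto simp: o_def\<close>)
qed

lemma re_pred_comp1:
  "re_pred 1 (\<lambda>xs. P (xs ! 0)) \<Longrightarrow> recursive n g \<Longrightarrow> re_pred n (\<lambda>xs. P (g xs))"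
  using re_pred_comp[of "[g]" "\<lambda>xs. P (xs ! 0)" n] by auto

lemma re_pred_comp2:
  "re_pred 2 (\<lambda>xs. P (xs ! 0) (xs ! 1)) \<Longrightarrow> recursive n g \<Longrightarrow> recursive n h \<Longrightarrow> re_pred n (\<lambda>xs. P (g xs) (h xs))"
  using re_pred_comp[of "[g, h]" "\<lambda>xs. P (xs ! 0) (xs ! 1)" n] by (auto simp: numeral_2_eq_2)

lemma re_pred_False: "re_pred n (\<lambda>xs. False)"
  by (intro re_pred_dec dec_pred_const)

lemma re_pred_True: "re_pred n (\<lambda>xs. True)"
  by (intro re_pred_dec dec_pred_const)

lemma re_pred_finite_ex:
  assumes "finite I" "\<And>i. i \<in> I \<Longrightarrow> re_pred n (\<lambda>xs. P i xs)"
  shows "re_pred n (\<lambda>xs. \<exists>i\<in>I. P i xs)"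
  using assms by induction (auto intro: re_pred_False re_pred_disj)

lemma re_pred_finite_all:
  assumes "finite I" "\<And>i. i \<in> I \<Longrightarrow> re_pred n (\<lambda>xs. P i xs)"
  shows "re_pred n (\<lambda>xs. \<forall>i\<in>I. P i xs)"
  using assms by induction (auto intro: re_pred_True re_pred_conj)

lemma re_pred_rec_enum:
  assumes "rec_enum A" shows "re_pred 1 (\<lambda>xs. xs ! 0 \<in> A)"
proof (cases "A = {}")
  case False
  then obtain f where f: "recursive 1 f" "A = range (\<lambda>k. f [k])"
    using assms unfolding rec_enum_def by auto
  have "dec_pred (Suc 1) (\<lambda>ys. tl ys ! 0 = f [hd ys])"
    by (intro dec_pred_eq recursive_comp1[OF f(1)] recursive_intros) simp_all
  from re_pred_ex_dec[OF this] show ?thesis by (rule re_pred_cong) (use f(2) in auto)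
qed (simp add: re_pred_False)

text \<open>Every number is decoded as a pair of a candidate witness and a candidate element. The
  element is output when the witness is correct, and the fixed member \<open>c\<close> otherwise, so
  that the enumeration is total.\<close>

lemma rec_enum_re_pred:
  assumes "re_pred 1 (\<lambda>xs. xs ! 0 \<in> A)" shows "rec_enum A"
proof (cases "A = {}")
  case False
  then obtain c where c: "c \<in> A" by auto
  obtain f where f: "recursive 2 f" "\<forall>xs. length xs = 1 \<longrightarrow> xs ! 0 \<in> A \<longleftrightarrow> (\<exists>k. f (k # xs) = 0)"
    using assms unfolding re_pred_def by (auto simp: numeral_2_eq_2)
  have f2: "x \<in> A \<longleftrightarrow> (\<exists>k. f [k, x] = 0)" for x
    using f(2)[rule_format, of "[x]"] by simp
  have "recursive 1 (\<lambda>xs. if f [fst (prod_decode (xs ! 0)), snd (prod_decode (xs ! 0))] = 0 then snd (prod_decode (xs ! 0)) else c)"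
    by (intro recursive_if dec_pred_eq_0 recursive_comp2[OF f(1)] recursive_fst recursive_snd recursive_intros) simp_all
  moreover have "A = range (\<lambda>k. if f [fst (prod_decode k), snd (prod_decode k)] = 0 then snd (prod_decode k) else c)"
  proof (intro equalityI subsetI)
    fix x assume "x \<in> A"
    then obtain k where "f [k, x] = 0" using f2 by auto
    then show "x \<in> range (\<lambda>k. if f [fst (prod_decode k), snd (prod_decode k)] = 0 then snd (prod_decode k) else c)"
      by (intro range_eqI[of _ _ "prod_encode (k, x)"]) simp
  qed (auto simp: f2 c split: if_splits, use c f2 in auto)
  ultimately show ?thesis unfolding rec_enum_def
    by (intro disjI2 exI[where x = "\<lambda>xs. if f [fst (prod_decode (xs ! 0)), snd (prod_decode (xs ! 0))] = 0 then snd (prod_decode (xs ! 0)) else c"] conjI) simp_all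
qed (simp add: rec_enum_def)

section \<open>Numbered groups and local rules\<close>

lemma word_value_closed:
  assumes "group G" "set w \<subseteq> carrier G" shows "word_value G w \<in> carrier G"
proof -
  interpret group G by fact
  show ?thesis using assms(2) by (induction w) (auto simp: word_value_def)
qed

lemma word_value_append:
  assumes "group G" "set v \<subseteq> carrier G" "set w \<subseteq> carrier G"
  shows "word_value G (v @ w) = word_value G v \<otimes>\<^bsub>G\<^esub> word_value G w"
proof -
  interpret group G by fact
  have "set v \<subseteq> carrier G \<Longrightarrow> word_value G (v @ w) = word_value G v \<otimes>\<^bsub>G\<^esub> word_value G w"
  proof (induction v)
    case Nil
    then show ?case using word_value_closed[OF assms(1,3)] by (simp add: word_value_def)
  next
    case (Cons a v)
    then have "word_value G (v @ w) = word_value G v \<otimes>\<^bsub>G\<^esub> word_value G w" by simp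
    moreover have "word_value G (a # u) = a \<otimes>\<^bsub>G\<^esub> word_value G u" for u by (simp add: word_value_def)
    ultimately show ?case
      using Cons.prems word_value_closed[OF assms(1,3)] word_value_closed[OF assms(1), of v] by (simp add: m_assoc)
  qed
  then show ?thesis using assms(2) by simp
qed

lemma generate_word_value:
  assumes "group G" "S \<subseteq> carrier G" "\<forall>s\<in>S. inv\<^bsub>G\<^esub> s \<in> S" "g \<in> generate G S"
  shows "\<exists>w\<in>lists S. word_value G w = g"
proof -
  interpret group G by fact
  show ?thesis using assms(4)
  proof induction
    case one
    then show ?case by (intro bexI[of _ "[]"]) (auto simp: word_value_def)
  next
    case (incl h)
    then show ?case using assms(2) by (intro bexI[of _ "[h]"]) (auto simp: word_value_def)
  next
    case (inv h)
    then show ?case using assms(2,3) by (intro bexI[of _ "[inv\<^bsub>G\<^esub> h]"]) (auto simp: word_value_def)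
  next
    case (eng h1 h2)
    then obtain v w where vw: "v \<in> lists S" "w \<in> lists S" "word_value G v = h1" "word_value G w = h2" by auto
    then show ?case using assms(2)
      by (intro bexI[of _ "v @ w"]) (auto simp: word_value_append[OF assms(1)] in_lists_conv_set subset_iff)
  qed
qed

text \<open>All that computability asks of the group: multiplication is the recursive function
  \<open>list_append\<close>, and equality can be confirmed. Inverses are never computed from
  numbers, and inequality need not be recognisable.\<close>

locale numbered_group = group G for G :: "('g, 'b) monoid_scheme" (structure) +
  fixes \<nu> :: "nat \<Rightarrow> 'g"
  assumes range_number: "range \<nu> = carrier G"
    and number_append: "\<nu> (list_append c d) = \<nu> c \<otimes> \<nu> d"
    and number_eq_re: "re_pred 2 (\<lambda>xs. \<nu> (xs ! 0) = \<nu> (xs ! 1))"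

lemma recursively_presented_numbering:
  fixes G :: "('g, 'b) monoid_scheme"
  assumes "group G" "recursively_presented G"
  shows "\<exists>\<nu>. numbered_group G \<nu>"
proof -
  interpret group G by fact
  obtain S e where S: "finite S" "S \<subseteq> carrier G" "generate G S = carrier G" "\<forall>s\<in>S. inv\<^bsub>G\<^esub> s \<in> S"
    and e: "inj_on e S" "rec_enum (word_code e ` {w \<in> lists S. word_value G w = \<one>\<^bsub>G\<^esub>})"
    using assms(2) unfolding recursively_presented_def re_language_def finite_generating_set_def by auto
  define D where "D = e ` S"
  define dec where "dec c = map (inv_into S e) (filter (\<lambda>x. x \<in> D) (list_decode c))" for c
  define \<nu> where "\<nu> c = word_value G (dec c)" for c
  have dec_S: "dec c \<in> lists S" for c
    unfolding dec_def D_def by (auto simp: inv_into_into)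
  have dec_code: "word_code e (dec c) = list_filter D c" for c
    unfolding dec_def word_code_def list_filter_def
    by (auto simp: D_def f_inv_into_f intro!: arg_cong[of _ _ list_encode] map_idI)
  have dec_word_code: "dec (word_code e w) = w" if "w \<in> lists S" for w
    using that e(1) unfolding dec_def word_code_def D_def
    by (induction w) auto
  have \<nu>_closed: "\<nu> c \<in> carrier G" for c
    unfolding \<nu>_def by (rule word_value_closed[OF assms(1)]) (use dec_S[of c] S(2) in auto)
  have append: "\<nu> (list_append c d) = \<nu> c \<otimes>\<^bsub>G\<^esub> \<nu> d" for c d
  proof -
    have "dec (list_append c d) = dec c @ dec d" by (simp add: dec_def list_append_def)
    then show ?thesis unfolding \<nu>_def
      using dec_S[of c] dec_S[of d] S(2) by (simp add: word_value_append[OF assms(1)] in_lists_conv_set subset_iff)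
  qed
  have surj: "range \<nu> = carrier G"
  proof (intro equalityI subsetI)
    fix g assume "g \<in> carrier G"
    then obtain w where "w \<in> lists S" "word_value G w = g"
      using generate_word_value[OF assms(1) S(2,4)] S(3) by auto
    then have "\<nu> (word_code e w) = g" by (simp add: \<nu>_def dec_word_code)
    then show "g \<in> range \<nu>" by blast
  qed (use \<nu>_closed in auto)
  \<comment> \<open>\<open>list_filter D c\<close> is the code of the word \<open>dec c\<close> by
    \<open>dec_code\<close>, so triviality of \<open>\<nu> c\<close> becomes membership of a
    recursive function of \<open>c\<close> in the given r.e. set.\<close>
  have one: "\<nu> c = \<one>\<^bsub>G\<^esub> \<longleftrightarrow> list_filter D c \<in> word_code e ` {w \<in> lists S. word_value G w = \<one>\<^bsub>G\<^esub>}" for c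
  proof
    assume "list_filter D c \<in> word_code e ` {w \<in> lists S. word_value G w = \<one>\<^bsub>G\<^esub>}"
    then obtain w where w: "list_filter D c = word_code e w" "w \<in> lists S" "word_value G w = \<one>\<^bsub>G\<^esub>"
      by blast
    have "dec c = dec (word_code e (dec c))" by (rule dec_word_code[OF dec_S, symmetric])
    also have "\<dots> = w" unfolding dec_code w(1) by (rule dec_word_code[OF w(2)])
    finally show "\<nu> c = \<one>\<^bsub>G\<^esub>" using w(3) by (simp add: \<nu>_def)
  next
    assume "\<nu> c = \<one>\<^bsub>G\<^esub>"
    then have "dec c \<in> {w \<in> lists S. word_value G w = \<one>\<^bsub>G\<^esub>}" using dec_S by (simp add: \<nu>_def)
    then show "list_filter D c \<in> word_code e ` {w \<in> lists S. word_value G w = \<one>\<^bsub>G\<^esub>}"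
      unfolding dec_code[symmetric] by (rule imageI)
  qed
  have "re_pred 1 (\<lambda>xs. \<nu> (xs ! 0) = \<one>\<^bsub>G\<^esub>)"
    unfolding one using S(1)
    by (intro re_pred_comp1[OF re_pred_rec_enum[OF e(2)]] recursive_list_filter recursive_intros) (auto simp: D_def)
  note one_re = re_pred_comp1[where P = "\<lambda>c. \<nu> c = \<one>\<^bsub>G\<^esub>", OF this]
  \<comment> \<open>Searching for a common right inverse \<open>u\<close> reduces equality to two
    instances of triviality without computing an inverse.\<close>
  have eq: "\<nu> c = \<nu> d \<longleftrightarrow> (\<exists>u. \<nu> (list_append c u) = \<one>\<^bsub>G\<^esub> \<and> \<nu> (list_append d u) = \<one>\<^bsub>G\<^esub>)" for c d
  proof
    assume "\<nu> c = \<nu> d"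
    moreover obtain u where "\<nu> u = inv\<^bsub>G\<^esub> \<nu> c"
      using surj \<nu>_closed by (metis inv_closed imageE)
    ultimately show "\<exists>u. \<nu> (list_append c u) = \<one>\<^bsub>G\<^esub> \<and> \<nu> (list_append d u) = \<one>\<^bsub>G\<^esub>"
      using \<nu>_closed by (auto simp: append intro!: exI[of _ u] r_inv) 
  next
    assume "\<exists>u. \<nu> (list_append c u) = \<one>\<^bsub>G\<^esub> \<and> \<nu> (list_append d u) = \<one>\<^bsub>G\<^esub>"
    then show "\<nu> c = \<nu> d"
      using \<nu>_closed by (metis append right_cancel)
  qed
  have "re_pred 2 (\<lambda>xs. \<nu> (xs ! 0) = \<nu> (xs ! 1))"
    unfolding eq
    by (intro re_pred_ex re_pred_conj one_re recursive_list_append recursive_intros; simp)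
  with append surj show ?thesis
    by (intro exI[of _ \<nu>]) (unfold_locales, auto)
qed

section \<open>Codes of Boolean words\<close>

definition bool_code :: "nat \<Rightarrow> bool" where
  "bool_code c \<longleftrightarrow> (\<forall>i<list_len c. list_nth c i \<le> 1)"

text \<open>Outside the length of the word neither value is seen: a finite word can only confirm
  bits.\<close>

definition sees :: "nat \<Rightarrow> nat \<Rightarrow> bool \<Rightarrow> bool" where
  "sees c i b \<longleftrightarrow> i < list_len c \<and> list_nth c i = of_bool b"

lemma bool_code_iff: "bool_code c \<longleftrightarrow> c \<in> range (word_code of_bool)"
proof
  assume c: "bool_code c"
  have "map (\<lambda>x. of_bool (x = 1)) (list_decode c) = list_decode c"
    using c unfolding bool_code_def list_len_def list_nth_def
    by (intro map_idI) (auto simp: in_set_conv_nth le_Suc_eq)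
  then have "word_code of_bool (map (\<lambda>x. x = 1) (list_decode c)) = c"
    unfolding word_code_def by (simp add: o_def)
  then show "c \<in> range (word_code of_bool)" by (metis rangeI)
qed (auto simp: bool_code_def word_code_def list_len_def list_nth_def)

lemma sees_word_code: "sees (word_code of_bool w) i b \<longleftrightarrow> i < length w \<and> w ! i = b"
  by (auto simp: sees_def word_code_def list_len_def list_nth_def)

lemma dec_pred_imp:
  "dec_pred n P \<Longrightarrow> dec_pred n Q \<Longrightarrow> dec_pred n (\<lambda>xs. P xs \<longrightarrow> Q xs)"
  unfolding imp_conv_disj by (intro dec_pred_disj dec_pred_not)

lemma dec_pred_bool_code: "recursive n f \<Longrightarrow> dec_pred n (\<lambda>xs. bool_code (f xs))"
  unfolding bool_code_def
  by (intro dec_pred_all_less dec_pred_le recursive_list_nth recursive_list_len recursive_intros; simp)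

lemma dec_pred_sees: "recursive n f \<Longrightarrow> recursive n g \<Longrightarrow> dec_pred n (\<lambda>xs. sees (f xs) (g xs) b)"
  unfolding sees_def
  by (intro dec_pred_conj dec_pred_less dec_pred_eq recursive_list_nth recursive_list_len recursive_intros; simp)

lemma rec_enum_words:
  assumes "re_pred 1 (\<lambda>xs. V (xs ! 0))"
  shows "rec_enum (word_code of_bool ` {w. V (word_code of_bool w)})"
proof (rule rec_enum_re_pred)
  have "re_pred 1 (\<lambda>xs. bool_code (xs ! 0) \<and> V (xs ! 0))"
    by (intro re_pred_conj re_pred_dec dec_pred_bool_code assms recursive_intros) simp
  then show "re_pred 1 (\<lambda>xs. xs ! 0 \<in> word_code of_bool ` {w. V (word_code of_bool w)})"
    by (rule re_pred_cong) (auto simp: bool_code_iff)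
qed

section \<open>Configurations on the group as an effectively closed set\<close>

context numbered_group
begin

text \<open>The choice is not effective; in computability claims \<open>code\<close> is applied to
  fixed group elements only, where it is a constant.\<close>

definition code :: "'g \<Rightarrow> nat" where "code g = (SOME c. \<nu> c = g)"

lemma number_code: "g \<in> carrier G \<Longrightarrow> \<nu> (code g) = g"
  unfolding code_def by (rule someI_ex) (use range_number in \<open>metis imageE\<close>)

lemma number_closed: "\<nu> c \<in> carrier G"
  using range_number by auto

text \<open>
  A rule \<open>(ts, \<beta>)\<close> is the linear equation \<open>\<Sum>\<alpha> * x (h g) (\<phi> m) = \<beta>\<close>, the sum being over the terms
  \<open>(g, \<phi>, \<alpha>)\<close> of \<open>ts\<close>, imposed at all \<open>h\<close> and \<open>m\<close>. A configuration \<open>x\<close> on \<open>G \<times> \<nat>\<close> is stored as the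
  sequence \<open>z\<close> with \<open>z (prod_encode (c, m)) = x (\<nu> c) m\<close>.
\<close>

definition obeys :: "(('g \<times> (nat \<Rightarrow> nat) \<times> int) list \<times> int) set \<Rightarrow> ('g \<Rightarrow> nat \<Rightarrow> bool) \<Rightarrow> bool" where
  "obeys \<R> x \<longleftrightarrow> (\<forall>(ts, \<beta>)\<in>\<R>. \<forall>h\<in>carrier G. \<forall>m. (\<Sum>(g, \<phi>, \<alpha>)\<leftarrow>ts. \<alpha> * of_bool (x (h \<otimes> g) (\<phi> m))) = \<beta>)"

definition encode_config :: "('g \<Rightarrow> nat \<Rightarrow> bool) \<Rightarrow> nat \<Rightarrow> bool" where
  "encode_config x i = x (\<nu> (fst (prod_decode i))) (snd (prod_decode i))"

definition decode_config :: "(nat \<Rightarrow> bool) \<Rightarrow> 'g \<Rightarrow> nat \<Rightarrow> bool" where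
  "decode_config z g m = z (prod_encode (code g, m))"

definition configs :: "(('g \<times> (nat \<Rightarrow> nat) \<times> int) list \<times> int) set \<Rightarrow> (nat \<Rightarrow> bool) set" where
  "configs \<R> = encode_config ` {x. obeys \<R> x}"

definition recursive_rules :: "(('g \<times> (nat \<Rightarrow> nat) \<times> int) list \<times> int) set \<Rightarrow> bool" where
  "recursive_rules \<R> \<longleftrightarrow> finite \<R> \<and> (\<forall>(ts, \<beta>)\<in>\<R>. \<forall>(g, \<phi>, \<alpha>)\<in>set ts. g \<in> carrier G \<and> recursive 1 (\<lambda>xs. \<phi> (xs ! 0)))"

lemma recursive_rulesD:
  assumes "recursive_rules \<R>" "(ts, \<beta>) \<in> \<R>" "(g, \<phi>, \<alpha>) \<in> set ts"
  shows "g \<in> carrier G" "recursive 1 (\<lambda>xs. \<phi> (xs ! 0))"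
  using assms unfolding recursive_rules_def by fastforce+

text \<open>Defined on all sequences by way of \<open>decode_config\<close>; on encoded
  configurations it is translation in the convention of \<open>shift\<close>.\<close>

definition translate :: "'g \<Rightarrow> (nat \<Rightarrow> bool) \<Rightarrow> nat \<Rightarrow> bool" where
  "translate g z = encode_config (\<lambda>h. decode_config z (inv g \<otimes> h))"

lemma decode_encode: "g \<in> carrier G \<Longrightarrow> decode_config (encode_config x) g m = x g m"
  by (simp add: decode_config_def encode_config_def number_code)

text \<open>A family of conditions on finitely many bits each, quantified over numbers instead of
  group elements. The two conjuncts are the two ways of failing that \<open>violation\<close>
  recognises.\<close>

lemma configs_iff:
  assumes R: "recursive_rules \<R>"
  shows "z \<in> configs \<R> \<longleftrightarrow>
    (\<forall>c d m. \<nu> c = \<nu> d \<longrightarrow> z (prod_encode (c, m)) = z (prod_encode (d, m))) \<and>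
    (\<forall>(ts, \<beta>)\<in>\<R>. \<forall>c m. (\<Sum>(g, \<phi>, \<alpha>)\<leftarrow>ts. \<alpha> * of_bool (z (prod_encode (list_append c (code g), \<phi> m)))) = \<beta>)"
    (is "_ \<longleftrightarrow> ?A \<and> ?B")
proof
  have ts: "(\<Sum>(g, \<phi>, \<alpha>)\<leftarrow>ts. \<alpha> * of_bool (encode_config x (prod_encode (list_append c (code g), \<phi> m)))) =
    (\<Sum>(g, \<phi>, \<alpha>)\<leftarrow>ts. \<alpha> * of_bool (x (\<nu> c \<otimes> g) (\<phi> m)))"
    if "(ts, \<beta>) \<in> \<R>" for ts \<beta> x c m
    by (rule arg_cong[of _ _ sum_list], rule map_cong)
      (auto simp: encode_config_def number_append number_code recursive_rulesD(1)[OF R that])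
  {
    assume "z \<in> configs \<R>"
    then obtain x where x: "z = encode_config x" "obeys \<R> x" unfolding configs_def by auto
    have ?A by (simp add: x encode_config_def)
    moreover have ?B using x(2) ts[of _ _ x] number_closed unfolding x(1) obeys_def by fastforce
    ultimately show "?A \<and> ?B" ..
  }
  assume AB: "?A \<and> ?B"
  have z: "z = encode_config (decode_config z)"
  proof
    fix i
    obtain c m where "prod_decode i = (c, m)" by fastforce
    then have i: "i = prod_encode (c, m)" by (metis prod_decode_inverse)
    have "\<nu> (code (\<nu> c)) = \<nu> c" by (simp add: number_code number_closed)
    with conjunct1[OF AB] have "z (prod_encode (code (\<nu> c), m)) = z (prod_encode (c, m))"
      by (elim allE[of _ "code (\<nu> c)"] allE[of _ c] allE[of _ m] impE) auto
    then show "z i = encode_config (decode_config z) i"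
      by (simp add: i encode_config_def decode_config_def)
  qed
  have "obeys \<R> (decode_config z)"
    unfolding obeys_def
  proof (intro ballI allI, clarify)
    fix ts \<beta> h m assume r: "(ts, \<beta>) \<in> \<R>" and h: "h \<in> carrier G"
    have "(\<Sum>(g, \<phi>, \<alpha>)\<leftarrow>ts. \<alpha> * of_bool (z (prod_encode (list_append (code h) (code g), \<phi> m)))) = \<beta>"
      using bspec[OF conjunct2[OF AB] r] by simp
    then show "(\<Sum>(g, \<phi>, \<alpha>)\<leftarrow>ts. \<alpha> * of_bool (decode_config z (h \<otimes> g) (\<phi> m))) = \<beta>"
      using ts[OF r, of "decode_config z" "code h"] h by (simp add: number_code z[symmetric])
  qed
  then show "z \<in> configs \<R>" unfolding configs_def using z by blast
qed

text \<open>The list \<open>vs\<close> holds the bits that the terms of the rule would have to read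
  for the equation to fail. There are finitely many such lists, so the second disjunct is a finite
  disjunction of r.e. conditions.\<close>

definition violation :: "(('g \<times> (nat \<Rightarrow> nat) \<times> int) list \<times> int) set \<Rightarrow> nat \<Rightarrow> bool" where
  "violation \<R> w \<longleftrightarrow>
    (\<exists>c d m. \<nu> c = \<nu> d \<and> sees w (prod_encode (c, m)) True \<and> sees w (prod_encode (d, m)) False) \<or>
    (\<exists>r\<in>\<R>. \<exists>vs\<in>{vs. length vs = length (fst r) \<and> (\<Sum>((g, \<phi>, \<alpha>), v)\<leftarrow>zip (fst r) vs. \<alpha> * of_bool v) \<noteq> snd r}.
       \<exists>c m. \<forall>t\<in>{..<length (fst r)}. sees w (prod_encode (list_append c (code (fst (fst r ! t))), fst (snd (fst r ! t)) m)) (vs ! t))"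

lemma re_pred_violation:
  assumes R: "recursive_rules \<R>"
  shows "re_pred 1 (\<lambda>xs. violation \<R> (xs ! 0))"
  unfolding violation_def
proof (intro re_pred_disj re_pred_finite_ex)
  show "re_pred 1 (\<lambda>xs. \<exists>c d m. \<nu> c = \<nu> d \<and> sees (xs ! 0) (prod_encode (c, m)) True \<and> sees (xs ! 0) (prod_encode (d, m)) False)"
    by (intro re_pred_ex re_pred_conj re_pred_comp2[OF number_eq_re] re_pred_dec dec_pred_sees recursive_prod_encode recursive_intros; simp)
  show "finite \<R>" using R by (simp add: recursive_rules_def)
  fix r assume r: "r \<in> \<R>"
  have "finite {vs::bool list. length vs = length (fst r)}"
    using finite_lists_length_eq[of "UNIV::bool set"] by simp
  then show "finite {vs. length vs = length (fst r) \<and> (\<Sum>((g, \<phi>, \<alpha>), v)\<leftarrow>zip (fst r) vs. \<alpha> * of_bool v) \<noteq> snd r}"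
    by (rule rev_finite_subset) auto
  fix vs :: "bool list"
  have rec: "recursive n (\<lambda>xs. fst (snd (fst r ! t)) (f xs))"
    if "t \<in> {..<length (fst r)}" "recursive n f" for t n f
  proof -
    have "fst r ! t \<in> set (fst r)" using that by auto
    then have "recursive 1 (\<lambda>xs. fst (snd (fst r ! t)) (xs ! 0))"
      using R r unfolding recursive_rules_def by (auto simp: split_def)
    from recursive_comp1'[OF this that(2)] show ?thesis .
  qed
  show "re_pred 1 (\<lambda>xs. \<exists>c m. \<forall>t\<in>{..<length (fst r)}. sees (xs ! 0) (prod_encode (list_append c (code (fst (fst r ! t))), fst (snd (fst r ! t)) m)) (vs ! t))"
    by (intro re_pred_ex re_pred_finite_all re_pred_dec dec_pred_sees recursive_prod_encode recursive_list_append rec recursive_intros; simp)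
qed

lemma effectively_closed_configs:
  assumes R: "recursive_rules \<R>"
  shows "effectively_closed (configs \<R>)"
  unfolding effectively_closed_def effectively_open_def
proof (intro exI conjI)
  show "rec_enum (word_code of_bool ` {w. violation \<R> (word_code of_bool w)})"
    by (intro rec_enum_words re_pred_violation R)
  show "- configs \<R> = \<Union> (word_cylinder ` {w. violation \<R> (word_code of_bool w)})"
  proof (intro equalityI subsetI)
    fix z assume "z \<in> - configs \<R>"
    then consider (1) c d m where "\<nu> c = \<nu> d" "z (prod_encode (c, m)) \<noteq> z (prod_encode (d, m))"
      | (2) ts \<beta> c m where "(ts, \<beta>) \<in> \<R>" "(\<Sum>(g, \<phi>, \<alpha>)\<leftarrow>ts. \<alpha> * of_bool (z (prod_encode (list_append c (code g), \<phi> m)))) \<noteq> \<beta>"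
      unfolding Compl_iff configs_iff[OF R] by blast
    then show "z \<in> \<Union> (word_cylinder ` {w. violation \<R> (word_code of_bool w)})"
    proof cases
      case 1
      then obtain c d where cd: "\<nu> c = \<nu> d" "z (prod_encode (c, m))" "\<not> z (prod_encode (d, m))" by metis
      \<comment> \<open>The sum of the two positions bounds both, so this prefix of \<open>z\<close>
        is long enough to exhibit the conflict.\<close>
      define w where "w = map z [0..<Suc (prod_encode (c, m) + prod_encode (d, m))]"
      have "z \<in> word_cylinder w" unfolding w_def word_cylinder_def by (simp del: upt_Suc)
      moreover have "violation \<R> (word_code of_bool w)"
        unfolding violation_def sees_word_code
        by (rule disjI1, rule exI[of _ c], rule exI[of _ d], rule exI[of _ m]) (use cd in \<open>simp add: w_def del: upt_Suc\<close>)
      ultimately show ?thesis by auto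
    next
      case 2
      define p where "p t = prod_encode (list_append c (code (fst (ts ! t))), fst (snd (ts ! t)) m)" for t
      define w where "w = map z [0..<Suc (\<Sum>t<length ts. p t)]"
      have lt: "p t < Suc (\<Sum>t<length ts. p t)" if "t < length ts" for t
        using member_le_sum[of t "{..<length ts}" p] that by simp
      define vs where "vs = map (\<lambda>t. z (p t)) [0..<length ts]"
      have "z \<in> word_cylinder w" unfolding w_def word_cylinder_def by (simp del: upt_Suc)
      moreover have "violation \<R> (word_code of_bool w)"
        unfolding violation_def sees_word_code
      proof (rule disjI2, rule bexI[OF _ 2(1)], rule bexI[of _ vs], rule exI[of _ c], rule exI[of _ m], rule ballI)
        fix t assume "t \<in> {..<length (fst (ts, \<beta>))}"
        then show "prod_encode (list_append c (code (fst (fst (ts, \<beta>) ! t))), fst (snd (fst (ts, \<beta>) ! t)) m) < length w \<and>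
          w ! prod_encode (list_append c (code (fst (fst (ts, \<beta>) ! t))), fst (snd (fst (ts, \<beta>) ! t)) m) = vs ! t"
          using lt[of t] unfolding p_def[symmetric] fst_conv by (simp add: w_def vs_def del: upt_Suc)
      next
        have "map (\<lambda>((g, \<phi>, \<alpha>), v). \<alpha> * of_bool v) (zip ts vs) =
          map (\<lambda>(g, \<phi>, \<alpha>). \<alpha> * of_bool (z (prod_encode (list_append c (code g), \<phi> m)))) ts"
          by (rule nth_equalityI) (auto simp: vs_def p_def split_def)
        then show "vs \<in> {vs. length vs = length (fst (ts, \<beta>)) \<and>
          (\<Sum>((g, \<phi>, \<alpha>), v)\<leftarrow>zip (fst (ts, \<beta>)) vs. \<alpha> * of_bool v) \<noteq> snd (ts, \<beta>)}"
          using 2(2) by (simp add: vs_def)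
      qed
      ultimately show ?thesis by auto
    qed
  next
    fix z assume "z \<in> \<Union> (word_cylinder ` {w. violation \<R> (word_code of_bool w)})"
    then obtain w where w: "violation \<R> (word_code of_bool w)" "\<And>i. i < length w \<Longrightarrow> z i = w ! i"
      by (auto simp: word_cylinder_def)
    from w(1) show "z \<in> - configs \<R>"
      unfolding violation_def sees_word_code
    proof (elim disjE exE bexE)
      fix c d m assume "\<nu> c = \<nu> d \<and> (prod_encode (c, m) < length w \<and> w ! prod_encode (c, m) = True) \<and>
        prod_encode (d, m) < length w \<and> w ! prod_encode (d, m) = False"
      then have "\<nu> c = \<nu> d" "z (prod_encode (c, m)) \<noteq> z (prod_encode (d, m))" using w(2) by auto
      then show ?thesis unfolding Compl_iff configs_iff[OF R] by blast
    next
      fix r vs c m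
      assume r: "r \<in> \<R>" and vs: "vs \<in> {vs. length vs = length (fst r) \<and> (\<Sum>((g, \<phi>, \<alpha>), v)\<leftarrow>zip (fst r) vs. \<alpha> * of_bool v) \<noteq> snd r}"
        and t: "\<forall>t\<in>{..<length (fst r)}. prod_encode (list_append c (code (fst (fst r ! t))), fst (snd (fst r ! t)) m) < length w \<and>
          w ! prod_encode (list_append c (code (fst (fst r ! t))), fst (snd (fst r ! t)) m) = vs ! t"
      obtain ts \<beta> where r_eq: "r = (ts, \<beta>)" by force
      have "map (\<lambda>((g, \<phi>, \<alpha>), v). \<alpha> * of_bool v) (zip ts vs) =
          map (\<lambda>(g, \<phi>, \<alpha>). \<alpha> * of_bool (z (prod_encode (list_append c (code g), \<phi> m)))) ts"
        by (rule nth_equalityI) (use vs t w(2) in \<open>auto simp: r_eq split_def\<close>)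
      then have "(\<Sum>(g, \<phi>, \<alpha>)\<leftarrow>ts. \<alpha> * of_bool (z (prod_encode (list_append c (code g), \<phi> m)))) \<noteq> \<beta>"
        using vs by (simp add: r_eq)
      then show ?thesis unfolding Compl_iff configs_iff[OF R] using r r_eq by blast
    qed
  qed
qed

section \<open>The translation action and its computability\<close>

lemma translate_obeys:
  assumes R: "recursive_rules \<R>" and x: "obeys \<R> x" and g: "g \<in> carrier G"
  shows "obeys \<R> (\<lambda>h. x (inv g \<otimes> h))"
  unfolding obeys_def
proof (intro ballI allI, clarify)
  fix ts \<beta> h m assume r: "(ts, \<beta>) \<in> \<R>" and h: "h \<in> carrier G"
  have "(\<Sum>(k, \<phi>, \<alpha>)\<leftarrow>ts. \<alpha> * of_bool (x ((inv g \<otimes> h) \<otimes> k) (\<phi> m))) = \<beta>"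
    using x r g h unfolding obeys_def by auto
  moreover have "(\<Sum>(k, \<phi>, \<alpha>)\<leftarrow>ts. \<alpha> * of_bool (x ((inv g \<otimes> h) \<otimes> k) (\<phi> m))) =
    (\<Sum>(k, \<phi>, \<alpha>)\<leftarrow>ts. \<alpha> * of_bool (x (inv g \<otimes> (h \<otimes> k)) (\<phi> m)))"
    by (rule arg_cong[of _ _ sum_list], rule map_cong)
      (use g h in \<open>auto simp: m_assoc recursive_rulesD(1)[OF R r]\<close>)
  ultimately show "(\<Sum>(k, \<phi>, \<alpha>)\<leftarrow>ts. \<alpha> * of_bool (x (inv g \<otimes> (h \<otimes> k)) (\<phi> m))) = \<beta>" by simp
qed

lemma translate_encode:
  assumes "g \<in> carrier G"
  shows "translate g (encode_config x) = encode_config (\<lambda>h. x (inv g \<otimes> h))"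
  unfolding translate_def encode_config_def[of "\<lambda>h. x (inv g \<otimes> h)"] encode_config_def[of "\<lambda>h. decode_config (encode_config x) (inv g \<otimes> h)"]
  using assms by (simp add: decode_encode number_closed)

lemma decode_translate:
  assumes "g \<in> carrier G" "h \<in> carrier G"
  shows "decode_config (translate g z) h m = decode_config z (inv g \<otimes> h) m"
  using assms by (simp add: translate_def decode_encode)

lemma translate_closed:
  "recursive_rules \<R> \<Longrightarrow> g \<in> carrier G \<Longrightarrow> z \<in> configs \<R> \<Longrightarrow> translate g z \<in> configs \<R>"
  unfolding configs_def using translate_encode translate_obeys by fastforce

lemma translate_mult:
  assumes "g \<in> carrier G" "h \<in> carrier G" "z \<in> configs \<R>"
  shows "translate (g \<otimes> h) z = translate g (translate h z)"
proof -
  obtain x where z: "z = encode_config x" using assms(3) by (auto simp: configs_def)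
  have "encode_config (\<lambda>k. x (inv (g \<otimes> h) \<otimes> k)) = encode_config (\<lambda>k. x (inv h \<otimes> (inv g \<otimes> k)))"
    using assms by (simp add: fun_eq_iff encode_config_def inv_mult_group m_assoc number_closed)
  then show ?thesis using assms by (simp add: z translate_encode)
qed

lemma translate_one: "z \<in> configs \<R> \<Longrightarrow> translate \<one> z = z"
  by (auto simp: configs_def translate_encode) (auto simp: encode_config_def number_closed)

lemma group_action_translate:
  assumes R: "recursive_rules \<R>"
  shows "group_action G (configs \<R>) (\<lambda>g. restrict (translate g) (configs \<R>))"
proof -
  have bij: "bij_betw (restrict (translate g) (configs \<R>)) (configs \<R>) (configs \<R>)" if g: "g \<in> carrier G" for g
  proof (rule bij_betw_byWitness[where f' = "translate (inv g)"])
    show "\<forall>z\<in>configs \<R>. translate (inv g) (restrict (translate g) (configs \<R>) z) = z"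
      using g translate_mult[of "inv g" g] translate_one by auto
    show "\<forall>z\<in>configs \<R>. restrict (translate g) (configs \<R>) (translate (inv g) z) = z"
      using g translate_mult[of g "inv g"] translate_one translate_closed[OF R] by auto
  qed (use g translate_closed[OF R] in auto)
  show ?thesis
    unfolding group_action_def group_hom_def group_hom_axioms_def
  proof (intro conjI)
    show "(\<lambda>g. restrict (translate g) (configs \<R>)) \<in> hom G (BijGroup (configs \<R>))"
    proof (rule homI)
      fix g h assume gh: "g \<in> carrier G" "h \<in> carrier G"
      show "restrict (translate (g \<otimes> h)) (configs \<R>) =
        restrict (translate g) (configs \<R>) \<otimes>\<^bsub>BijGroup (configs \<R>)\<^esub> restrict (translate h) (configs \<R>)"
        using gh translate_closed[OF R] bij
        by (auto simp: BijGroup_def Bij_def compose_def translate_mult intro!: restrict_ext)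
    qed (use bij in \<open>auto simp: BijGroup_def Bij_def\<close>)
  qed (auto simp: group_BijGroup is_group)
qed

lemma computable_translate:
  assumes R: "recursive_rules \<R>" and g: "g \<in> carrier G"
  shows "computable_map (configs \<R>) (restrict (translate g) (configs \<R>))"
proof -
  \<comment> \<open>Bit \<open>i\<close> of the translate is bit \<open>p i\<close> of the original:
    the group element is multiplied on the left by the constant number
    \<open>code (inv g)\<close>.\<close>
  define p where "p i = prod_encode (list_append (code (inv g)) (fst (prod_decode i)), snd (prod_decode i))" for i
  have p: "translate g z i = z (p i)" if "z \<in> configs \<R>" for z i
    using that g
    by (auto simp: configs_def translate_encode encode_config_def p_def number_append number_code)
  \<comment> \<open>\<open>Q u v\<close>: the bits seen in \<open>v\<close> force the translate to
    begin with \<open>u\<close>.\<close>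
  define Q where "Q u v \<longleftrightarrow> (\<forall>i<list_len u. (sees u i True \<longrightarrow> sees v (p i) True) \<and> (sees u i False \<longrightarrow> sees v (p i) False))" for u v
  define V where "V c \<longleftrightarrow> bool_code (fst (prod_decode c)) \<and> bool_code (snd (prod_decode c)) \<and> Q (fst (prod_decode c)) (snd (prod_decode c))" for c
  define Rel where "Rel = {(w, v). Q (word_code of_bool w) (word_code of_bool v)}"
  have Q_iff: "Q (word_code of_bool w) (word_code of_bool v) \<longleftrightarrow> (\<forall>i<length w. p i < length v \<and> v ! p i = w ! i)" for w v :: "bool list"
    unfolding Q_def sees_word_code by (auto simp: word_code_def list_len_def)
  have "dec_pred 1 (\<lambda>xs. V (xs ! 0))"
    unfolding V_def Q_def p_def
    by (intro dec_pred_conj dec_pred_bool_code dec_pred_all_less dec_pred_imp dec_pred_sees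
        recursive_fst recursive_snd recursive_list_len recursive_prod_encode recursive_list_append recursive_intros; simp)
  then have "re_pred 1 (\<lambda>xs. xs ! 0 \<in> (\<lambda>(v, w). prod_encode (word_code of_bool v, word_code of_bool w)) ` Rel)"
  proof (rule re_pred_cong[OF re_pred_dec])
    fix xs :: "nat list"
    show "xs ! 0 \<in> (\<lambda>(v, w). prod_encode (word_code of_bool v, word_code of_bool w)) ` Rel \<longleftrightarrow> V (xs ! 0)"
    proof
      assume "V (xs ! 0)"
      then obtain v w :: "bool list" where vw: "fst (prod_decode (xs ! 0)) = word_code of_bool v"
         "snd (prod_decode (xs ! 0)) = word_code of_bool w" "(v, w) \<in> Rel"
        unfolding V_def bool_code_iff Rel_def by auto
      then have "xs ! 0 = prod_encode (word_code of_bool v, word_code of_bool w)"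
        by (metis prod.collapse prod_decode_inverse)
      then show "xs ! 0 \<in> (\<lambda>(v, w). prod_encode (word_code of_bool v, word_code of_bool w)) ` Rel"
        using vw(3) by auto
    qed (auto simp: V_def Rel_def bool_code_iff)
  qed
  from rec_enum_re_pred[OF this] have re: "re_word_relation Rel" unfolding re_word_relation_def .
  have "{x \<in> configs \<R>. restrict (translate g) (configs \<R>) x \<in> word_cylinder w} = \<Union> (word_cylinder ` {v. (w, v) \<in> Rel}) \<inter> configs \<R>" for w
  proof (intro equalityI subsetI)
    fix z assume "z \<in> {x \<in> configs \<R>. restrict (translate g) (configs \<R>) x \<in> word_cylinder w}"
    then have z: "z \<in> configs \<R>" "\<And>i. i < length w \<Longrightarrow> z (p i) = w ! i"
      using p by (auto simp: word_cylinder_def)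
    define v where "v = map z [0..<Suc (\<Sum>i<length w. p i)]"
    have "p i < Suc (\<Sum>i<length w. p i)" if "i < length w" for i
      using member_le_sum[of i "{..<length w}" p] that by simp
    then have "(w, v) \<in> Rel" unfolding Rel_def using z(2) by (auto simp: Q_iff v_def simp del: upt_Suc)
    moreover have "z \<in> word_cylinder v" unfolding v_def word_cylinder_def by (simp del: upt_Suc)
    ultimately show "z \<in> \<Union> (word_cylinder ` {v. (w, v) \<in> Rel}) \<inter> configs \<R>" using z(1) by auto
  qed (auto simp: word_cylinder_def Rel_def Q_iff p)
  then show ?thesis unfolding computable_map_def using re by blast
qed

text \<open>Factor maps compose, so computability ends here: what remains is to choose rules and a
  continuous equivariant surjection from their configurations onto X.\<close>

theorem factor_of_SFT_configs:
  assumes R: "recursive_rules \<R>" and fg: "finitely_generated G" and ss: "self_simulable G"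
    and cont: "continuous_map (subtopology cantor_topology (configs \<R>)) T \<pi>"
    and surj: "\<pi> ` configs \<R> = topspace T"
    and equiv: "\<And>g z. g \<in> carrier G \<Longrightarrow> z \<in> configs \<R> \<Longrightarrow> \<pi> (translate g z) = a g (\<pi> z)"
  shows "factor_of_SFT G T a"
proof -
  let ?b = "\<lambda>g. restrict (translate g) (configs \<R>)"
  have top: "topspace (subtopology cantor_topology (configs \<R>)) = configs \<R>"
    by (simp add: cantor_topology_def)
  have "computable_action G (configs \<R>) ?b"
    unfolding computable_action_def
    using group_action_translate[OF R] computable_translate[OF R] fg
    unfolding finitely_generated_def finite_generating_set_def by blast
  then have "factor_of_SFT G (subtopology cantor_topology (configs \<R>)) ?b"
    using ss effectively_closed_configs[OF R] unfolding self_simulable_def by blast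
  then obtain A :: "nat set" and Y \<rho> where Y: "is_SFT G A Y"
    and \<rho>: "continuous_map (subtopology (config_topology G A) Y) (subtopology cantor_topology (configs \<R>)) \<rho>"
      "\<rho> ` topspace (subtopology (config_topology G A) Y) = configs \<R>"
      "\<forall>g\<in>carrier G. \<forall>y\<in>topspace (subtopology (config_topology G A) Y). \<rho> (shift G g y) = ?b g (\<rho> y)"
    unfolding factor_of_SFT_def topological_factor_def top by (elim exE conjE) (rule that)
  have "topological_factor G T a (subtopology (config_topology G A) Y) (shift G)"
    unfolding topological_factor_def
  proof (intro exI conjI ballI)
    show "continuous_map (subtopology (config_topology G A) Y) T (\<pi> \<circ> \<rho>)"
      by (rule continuous_map_compose[OF \<rho>(1) cont])
    show "(\<pi> \<circ> \<rho>) ` topspace (subtopology (config_topology G A) Y) = topspace T"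
      using \<rho>(2) surj by (metis image_comp)
    fix g y assume g: "g \<in> carrier G" and y: "y \<in> topspace (subtopology (config_topology G A) Y)"
    have "\<rho> y \<in> configs \<R>" using y \<rho>(2) by blast
    then show "(\<pi> \<circ> \<rho>) (shift G g y) = a g ((\<pi> \<circ> \<rho>) y)"
      using \<rho>(3) g y equiv by simp
  qed
  then show ?thesis unfolding factor_of_SFT_def using Y by blast
qed

end

section \<open>The Haar mean\<close>

lemma sum_list_le_member:
  fixes f :: "'a \<Rightarrow> real"
  assumes "a \<in> set l" "\<And>b. b \<in> set l \<Longrightarrow> f b \<le> K"
  shows "sum_list (map f l) \<le> f a + (real (length l) - 1) * K"
  using assms
proof (induction l)
  case (Cons b l)
  have le: "sum_list (map f l) \<le> real (length l) * K"
    using sum_list_mono[of l f "\<lambda>_. K"] Cons.prems by (simp add: sum_list_triv)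
  show ?case
  proof (cases "a = b")
    case False
    then have "sum_list (map f l) \<le> f a + (real (length l) - 1) * K" using Cons by auto
    then show ?thesis using Cons.prems(2)[of b] by (simp add: algebra_simps)
  qed (use le in simp)
qed simp

lemma sum_list_ge_member:
  fixes f :: "'a \<Rightarrow> real"
  assumes "a \<in> set l" "\<And>b. b \<in> set l \<Longrightarrow> K \<le> f b"
  shows "f a + (real (length l) - 1) * K \<le> sum_list (map f l)"
proof -
  have "sum_list (map (\<lambda>b. - f b) l) \<le> - f a + (real (length l) - 1) * (- K)"
    by (rule sum_list_le_member) (use assms in auto)
  moreover have "sum_list (map (\<lambda>b. - f b) l) = - sum_list (map f l)" by (induction l) auto
  ultimately show ?thesis by simp
qed

lemma scaleR_sum_list:
  fixes g :: "'a \<Rightarrow> 'v::real_vector"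
  shows "(\<Sum>a\<leftarrow>k. c *\<^sub>R g a) = c *\<^sub>R (\<Sum>a\<leftarrow>k. g a)"
  by (induction k) (auto simp: scaleR_add_right)

lemma continuous_map_mult_complex:
  fixes f g :: "'a \<Rightarrow> complex"
  shows "continuous_map T euclidean f \<Longrightarrow> continuous_map T euclidean g \<Longrightarrow> continuous_map T euclidean (\<lambda>x. f x * g x)"
  by (simp add: continuous_map_atin tendsto_mult)

lemma continuous_map_cnj:
  "continuous_map T euclidean f \<Longrightarrow> continuous_map T euclidean (\<lambda>x. cnj (f x))"
  by (simp add: continuous_map_atin tendsto_cnj)

lemma continuous_map_of_real:
  "continuous_map T euclidean f \<Longrightarrow> continuous_map T euclidean (\<lambda>x. complex_of_real (f x))"
  by (simp add: continuous_map_atin tendsto_of_real)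

lemma continuous_map_iff_dist:
  fixes f :: "'a \<Rightarrow> complex"
  shows "continuous_map T euclidean f \<longleftrightarrow>
    (\<forall>x\<in>topspace T. \<forall>\<epsilon>>0. \<exists>U. openin T U \<and> x \<in> U \<and> (\<forall>y\<in>U. cmod (f y - f x) < \<epsilon>))"
  using Met_TC.continuous_map_to_metric[of T f]
  by (simp add: mball_eq_ball dist_norm norm_minus_commute mtopology_is_euclidean)

section \<open>Averages over finitely many translates\<close>

context compact_metrizable_abelian_group
begin

definition vlist :: "'x list \<Rightarrow> bool" where "vlist l \<longleftrightarrow> l \<noteq> [] \<and> set l \<subseteq> carrier X"

text \<open>Lists instead of sets, because the product of two lists must keep multiplicities for
  \<open>avg_list_mult\<close> to hold.\<close>

definition avg :: "'x list \<Rightarrow> ('x \<Rightarrow> 'v::real_normed_vector) \<Rightarrow> 'x \<Rightarrow> 'v" where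
  "avg l f x = (\<Sum>a\<leftarrow>l. f (x \<otimes> a)) /\<^sub>R real (length l)"

definition list_mult :: "'x list \<Rightarrow> 'x list \<Rightarrow> 'x list" where
  "list_mult k l = map (\<lambda>(a, b). a \<otimes> b) (List.product k l)"

text \<open>Equicontinuity expressed through the group: a bound of this kind survives averaging over
  translates, whereas a metric for the topology need not be translation invariant.\<close>

definition modulus :: "'x set \<Rightarrow> real \<Rightarrow> ('x \<Rightarrow> 'v::real_normed_vector) \<Rightarrow> bool" where
  "modulus U \<delta> f \<longleftrightarrow> (\<forall>x\<in>carrier X. \<forall>u\<in>U. norm (f (x \<otimes> u) - f x) \<le> \<delta>)"

lemma vlist_list_mult: "vlist k \<Longrightarrow> vlist l \<Longrightarrow> vlist (list_mult k l)"
  unfolding vlist_def list_mult_def by (cases k; cases l) (auto simp: subset_iff)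

lemma avg_list_mult:
  assumes "vlist k" "vlist l" "x \<in> carrier X"
  shows "avg (list_mult k l) f x = avg k (avg l f) x"
proof -
  have "(\<Sum>a\<leftarrow>list_mult k l. f (x \<otimes> a)) = (\<Sum>a\<leftarrow>k. \<Sum>b\<leftarrow>l. f ((x \<otimes> a) \<otimes> b))"
    if "set k \<subseteq> carrier X"
    using that
  proof (induction k)
    case (Cons a k)
    have "(\<Sum>b\<leftarrow>l. f (x \<otimes> (a \<otimes> b))) = (\<Sum>b\<leftarrow>l. f ((x \<otimes> a) \<otimes> b))"
      using Cons.prems assms by (intro arg_cong[of _ _ sum_list] map_cong) (auto simp: vlist_def m_assoc)
    then show ?case using Cons by (simp add: list_mult_def o_def)
  qed (simp add: list_mult_def)
  moreover have "length (list_mult k l) = length k * length l" by (simp add: list_mult_def)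
  ultimately show ?thesis
    using assms by (simp add: avg_def vlist_def mult.commute scaleR_sum_list)
qed

lemma avg_cong:
  "\<lbrakk>vlist l; x \<in> carrier X; \<And>y. y \<in> carrier X \<Longrightarrow> f y = g y\<rbrakk> \<Longrightarrow> avg l f x = avg l g x"
  unfolding avg_def vlist_def
  by (intro arg_cong[of _ _ "\<lambda>s. s /\<^sub>R real (length l)"] arg_cong[of _ _ sum_list] map_cong) auto

lemma avg_commute:
  assumes "vlist k" "vlist l" "x \<in> carrier X"
  shows "avg k (avg l f) x = avg l (avg k f) x"
proof -
  have "(\<Sum>a\<leftarrow>k. \<Sum>b\<leftarrow>l. f ((x \<otimes> a) \<otimes> b)) = (\<Sum>b\<leftarrow>l. \<Sum>a\<leftarrow>k. f ((x \<otimes> b) \<otimes> a))"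
    if "set k \<subseteq> carrier X"
    using that
  proof (induction k)
    case (Cons a k)
    have "(\<Sum>b\<leftarrow>l. f ((x \<otimes> a) \<otimes> b)) = (\<Sum>b\<leftarrow>l. f ((x \<otimes> b) \<otimes> a))"
      using Cons.prems assms by (intro arg_cong[of _ _ sum_list] map_cong refl) (auto simp: vlist_def m_assoc m_comm m_lcomm subset_iff)
    then show ?case using Cons by (simp add: sum_list_addf)
  qed simp
  then show ?thesis using assms by (simp add: avg_def vlist_def mult.commute scaleR_sum_list)
qed

lemma avg_add: "avg l (\<lambda>x. f x + g x) x = avg l f x + avg l g x"
  by (simp add: avg_def sum_list_addf scaleR_add_right)

lemma avg_mult_left: fixes f :: "'x \<Rightarrow> complex" shows "avg l (\<lambda>x. c * f x) x = c * avg l f x"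
  by (simp add: avg_def sum_list_const_mult)

lemma avg_const: "vlist l \<Longrightarrow> avg l (\<lambda>x. c) x = c"
proof -
  have "(\<Sum>a\<leftarrow>l. c) = real (length l) *\<^sub>R c" by (induction l) (auto simp: scaleR_left_distrib)
  then show "vlist l \<Longrightarrow> avg l (\<lambda>x. c) x = c" by (simp add: avg_def vlist_def)
qed

lemma avg_diff: "avg l (\<lambda>x. f x - g x) x = avg l f x - avg l g x"
  by (simp add: avg_def sum_list_subtractf scaleR_diff_right)

lemma norm_avg_le:
  assumes l: "vlist l" and x: "x \<in> carrier X" and f: "\<And>y. y \<in> carrier X \<Longrightarrow> norm (f y) \<le> B"
  shows "norm (avg l f x) \<le> B"
proof -
  have "norm (\<Sum>a\<leftarrow>k. f (x \<otimes> a)) \<le> real (length k) * B" if "set k \<subseteq> carrier X" for k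
    using that
  proof (induction k)
    case (Cons a k)
    then have "norm (f (x \<otimes> a)) \<le> B" using x f by auto
    then show ?case using Cons norm_triangle_ineq[of "f (x \<otimes> a)" "\<Sum>a\<leftarrow>k. f (x \<otimes> a)"]
      by (simp add: algebra_simps)
  qed simp
  then show ?thesis using l unfolding avg_def vlist_def by (simp add: field_simps)
qed

lemma norm_avg_diff_le:
  assumes l: "vlist l" and x: "x \<in> carrier X" and f: "\<And>y. y \<in> carrier X \<Longrightarrow> norm (f y - c) \<le> B"
  shows "norm (avg l f x - c) \<le> B"
  using norm_avg_le[OF l x, of "\<lambda>y. f y - c" B] f by (simp add: avg_diff avg_const[OF l])

lemma modulus_avg:
  assumes l: "vlist l" and U: "U \<subseteq> carrier X" and f: "modulus U \<delta> f"
  shows "modulus U \<delta> (avg l f)"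
  unfolding modulus_def
proof (intro ballI)
  fix x u assume x: "x \<in> carrier X" and u: "u \<in> U"
  have uc: "u \<in> carrier X" using u U by auto
  have "avg l f (x \<otimes> u) = avg l (\<lambda>y. f (y \<otimes> u)) x"
    unfolding avg_def
    by (intro arg_cong[of _ _ "\<lambda>s. s /\<^sub>R real (length l)"] arg_cong[of _ _ sum_list] map_cong)
      (use l x uc in \<open>auto simp: vlist_def m_assoc m_comm m_lcomm subset_iff\<close>)
  then have "avg l f (x \<otimes> u) - avg l f x = avg l (\<lambda>y. f (y \<otimes> u) - f y) x"
    by (simp add: avg_diff)
  also have "norm \<dots> \<le> \<delta>"
    by (rule norm_avg_le[OF l x]) (use f u in \<open>auto simp: modulus_def\<close>)
  finally show "norm (avg l f (x \<otimes> u) - avg l f x) \<le> \<delta>" .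
qed

lemma openin_translate:
  assumes "openin T U" "a \<in> carrier X"
  shows "openin T {y \<in> carrier X. inv y \<otimes> a \<in> U}" "openin T {y \<in> carrier X. inv a \<otimes> y \<in> U}"
proof -
  have *: "continuous_map T T (\<lambda>y. f y \<otimes> g y)" if "continuous_map T T f" "continuous_map T T g" for f g
    using continuous_map_compose[OF continuous_map_pairedI[OF that] continuous_mult] by (simp add: o_def)
  have const: "continuous_map T T (\<lambda>_. a)" "continuous_map T T (\<lambda>_. inv a)"
    using assms(2) by (simp_all add: topspace_eq)
  show "openin T {y \<in> carrier X. inv y \<otimes> a \<in> U}"
    using openin_continuous_map_preimage[OF *[OF continuous_inv const(1)] assms(1)] by (simp add: topspace_eq)
  show "openin T {y \<in> carrier X. inv a \<otimes> y \<in> U}"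
    using openin_continuous_map_preimage[OF *[OF const(2) continuous_map_id[unfolded id_def]] assms(1)] by (simp add: topspace_eq)
qed

text \<open>\<open>inv y \<otimes> a \<in> U\<close> says that \<open>a\<close> lies in the
  translate of \<open>U\<close> by \<open>y\<close>. For each \<open>a\<close> the suitable
  \<open>y\<close> form an open set, and finitely many of these cover the group.\<close>

lemma ex_cover:
  assumes U: "openin T U" "\<one> \<in> U"
  shows "\<exists>l. vlist l \<and> (\<forall>y\<in>carrier X. \<exists>a\<in>set l. inv y \<otimes> a \<in> U)"
proof -
  let ?V = "\<lambda>a. {y \<in> carrier X. inv y \<otimes> a \<in> U}"
  have 1: "compactin T (carrier X)" using compact_T by (simp add: compact_space_def topspace_eq)
  have 2: "openin T V" if "V \<in> ?V ` carrier X" for V using openin_translate(1)[OF U(1)] that by blast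
  have 3: "carrier X \<subseteq> \<Union> (?V ` carrier X)" using U(2) by auto
  obtain \<F> where \<F>: "finite \<F>" "\<F> \<subseteq> ?V ` carrier X" "carrier X \<subseteq> \<Union> \<F>"
    using compactinD[OF 1 2 3] by auto
  obtain A where A: "A \<subseteq> carrier X" "finite A" "\<F> = ?V ` A"
    using finite_subset_image[OF \<F>(1,2)] by blast
  obtain l where l: "set l = A" using A(2) finite_list by auto
  have cov: "\<exists>a\<in>set l. inv y \<otimes> a \<in> U" if "y \<in> carrier X" for y
    using \<F>(3) that A(3) l by auto
  moreover have "vlist l" using cov[of \<one>] A(1) l by (auto simp: vlist_def)
  ultimately show ?thesis by auto
qed

text \<open>The list meets every translate of \<open>U\<close>, so some term of the sum at
  \<open>x\<close> exceeds a chosen term of the sum at \<open>y\<close> by at most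
  \<open>\<delta>\<close>. The remaining \<open>n - 1\<close> terms on either side lie in an
  interval of length \<open>w\<close> above the least value \<open>v\<close> that occurs.\<close>

lemma avg_contraction:
  fixes h :: "'x \<Rightarrow> real"
  assumes l: "vlist l" and U: "U \<subseteq> carrier X" and cov: "\<forall>y\<in>carrier X. \<exists>a\<in>set l. inv y \<otimes> a \<in> U"
    and h: "modulus U \<delta> h" and w: "\<And>x y. x \<in> carrier X \<Longrightarrow> y \<in> carrier X \<Longrightarrow> h x - h y \<le> w"
    and x: "x \<in> carrier X" and y: "y \<in> carrier X"
  shows "avg l h x - avg l h y \<le> (1 - 1 / real (length l)) * w + \<delta> / real (length l)"
proof -
  define n where "n = real (length l)"
  have n: "n \<ge> 1" using l unfolding n_def vlist_def by (cases l) auto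
  obtain b where b: "b \<in> set l" using l by (cases l) (auto simp: vlist_def)
  have bc: "b \<in> carrier X" using b l by (auto simp: vlist_def)
  have "inv x \<otimes> (y \<otimes> b) \<in> carrier X" using x y bc by auto
  from bspec[OF cov this] obtain a where a: "a \<in> set l" "inv (inv x \<otimes> (y \<otimes> b)) \<otimes> a \<in> U"
    by blast
  have ac: "a \<in> carrier X" using a l by (auto simp: vlist_def)
  have "(y \<otimes> b) \<otimes> (inv (inv x \<otimes> (y \<otimes> b)) \<otimes> a) = x \<otimes> a"
    using x y bc ac by (simp add: inv_mult m_ac)
  then have hxa: "h (x \<otimes> a) \<le> h (y \<otimes> b) + \<delta>"
    using h[unfolded modulus_def, rule_format, OF m_closed[OF y bc] a(2)] by simp
  let ?S = "(\<lambda>c. h (x \<otimes> c)) ` set l \<union> (\<lambda>c. h (y \<otimes> c)) ` set l"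
  define v where "v = Min ?S"
  have "v \<in> ?S" unfolding v_def by (rule Min_in) (use a in auto)
  then obtain q where q: "q \<in> carrier X" "v = h q" using x y l by (auto simp: vlist_def)
  have v: "v \<le> h (x \<otimes> c)" "v \<le> h (y \<otimes> c)" if "c \<in> set l" for c
    unfolding v_def using that by (auto intro: Min_le)
  have vw: "h (x \<otimes> c) \<le> v + w" if "c \<in> set l" for c
    using w[of "x \<otimes> c" q] q x l that by (auto simp: vlist_def)
  have "(\<Sum>c\<leftarrow>l. h (x \<otimes> c)) \<le> h (x \<otimes> a) + (n - 1) * (v + w)"
    unfolding n_def by (rule sum_list_le_member) (use a vw in auto)
  moreover have "h (y \<otimes> b) + (n - 1) * v \<le> (\<Sum>c\<leftarrow>l. h (y \<otimes> c))"
    unfolding n_def by (rule sum_list_ge_member) (use b v in auto)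
  ultimately have "(\<Sum>c\<leftarrow>l. h (x \<otimes> c)) - (\<Sum>c\<leftarrow>l. h (y \<otimes> c)) \<le> (n - 1) * w + \<delta>"
    using hxa by (simp add: algebra_simps)
  then have "((\<Sum>c\<leftarrow>l. h (x \<otimes> c)) - (\<Sum>c\<leftarrow>l. h (y \<otimes> c))) / n \<le> ((n - 1) * w + \<delta>) / n"
    using n by (intro divide_right_mono) auto
  moreover have "((n - 1) * w + \<delta>) / n = (1 - 1 / n) * w + \<delta> / n"
    using n by (simp add: field_simps)
  moreover have "avg l h z = (\<Sum>c\<leftarrow>l. h (z \<otimes> c)) / n" for z
    by (simp add: avg_def n_def divide_inverse mult.commute)
  ultimately show ?thesis
    unfolding n_def[symmetric] by (simp add: diff_divide_distrib)
qed

text \<open>Each averaging replaces an oscillation bound \<open>w\<close> by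
  \<open>(1 - 1 / n) * w + \<delta> / n\<close>, a contraction with fixed point
  \<open>\<delta>\<close>, and the starting bound is \<open>2 * B\<close>. The list depends on
  \<open>U\<close>, \<open>\<delta>\<close> and \<open>B\<close> but not on the function.\<close>

lemma ex_averaging_list:
  assumes U: "openin T U" "\<one> \<in> U" and \<delta>: "\<delta> > 0"
  shows "\<exists>l. vlist l \<and> (\<forall>f::'x \<Rightarrow> real. modulus U \<delta> f \<longrightarrow> (\<forall>x\<in>carrier X. \<bar>f x\<bar> \<le> B) \<longrightarrow>
    (\<forall>x\<in>carrier X. \<forall>y\<in>carrier X. avg l f x - avg l f y \<le> 2 * \<delta>))"
proof -
  obtain l where l: "vlist l" "\<forall>y\<in>carrier X. \<exists>a\<in>set l. inv y \<otimes> a \<in> U"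
    using ex_cover[OF U] by auto
  have Uc: "U \<subseteq> carrier X" using openin_subset[OF U(1)] topspace_eq by simp
  define n where "n = real (length l)"
  have n: "n \<ge> 1" using l unfolding n_def vlist_def by (cases l) auto
  have "\<exists>m. vlist m \<and> (\<forall>f::'x \<Rightarrow> real. modulus U \<delta> f \<longrightarrow> (\<forall>x\<in>carrier X. \<bar>f x\<bar> \<le> B) \<longrightarrow>
    (\<forall>x\<in>carrier X. \<forall>y\<in>carrier X. avg m f x - avg m f y \<le> (1 - 1 / n) ^ k * (2 * B) + \<delta>))" for k
  proof (induction k)
    case 0
    have "avg [\<one>] f x - avg [\<one>] f y \<le> 2 * B + \<delta>"
      if "\<forall>x\<in>carrier X. \<bar>f x\<bar> \<le> B" "x \<in> carrier X" "y \<in> carrier X" for f :: "'x \<Rightarrow> real" and x y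
      using that(1)[rule_format, OF that(2)] that(1)[rule_format, OF that(3)] that(2,3) \<delta> by (simp add: avg_def)
    then show ?case by (intro exI[of _ "[\<one>]"]) (auto simp: vlist_def)
  next
    case (Suc k)
    then obtain m where m: "vlist m" "\<And>f::'x \<Rightarrow> real. \<And>x y. modulus U \<delta> f \<Longrightarrow> \<forall>x\<in>carrier X. \<bar>f x\<bar> \<le> B \<Longrightarrow> x \<in> carrier X \<Longrightarrow> y \<in> carrier X \<Longrightarrow>
       avg m f x - avg m f y \<le> (1 - 1 / n) ^ k * (2 * B) + \<delta>" by blast
    show ?case
    proof (intro exI[of _ "list_mult l m"] conjI allI impI ballI)
      show "vlist (list_mult l m)" by (rule vlist_list_mult[OF l(1) m(1)])
      fix f :: "'x \<Rightarrow> real" and x y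
      assume f: "modulus U \<delta> f" "\<forall>x\<in>carrier X. \<bar>f x\<bar> \<le> B" and x: "x \<in> carrier X" and y: "y \<in> carrier X"
      have "avg l (avg m f) x - avg l (avg m f) y \<le> (1 - 1 / n) * ((1 - 1 / n) ^ k * (2 * B) + \<delta>) + \<delta> / n"
        unfolding n_def
        by (rule avg_contraction[OF l(1) Uc l(2) modulus_avg[OF m(1) Uc f(1)] _ x y])
          (use m(2)[OF f] in \<open>auto simp: n_def\<close>)
      also have "\<dots> = (1 - 1 / n) ^ Suc k * (2 * B) + \<delta>" using n by (simp add: field_simps)
      finally show "avg (list_mult l m) f x - avg (list_mult l m) f y \<le> (1 - 1 / n) ^ Suc k * (2 * B) + \<delta>"
        using x y by (simp only: avg_list_mult[OF l(1) m(1)])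
    qed
  qed
  moreover have "\<exists>k. (1 - 1 / n) ^ k * (2 * B) \<le> \<delta>"
  proof -
    have "(\<lambda>k. (1 - 1 / n) ^ k * (2 * B)) \<longlonglongrightarrow> 0 * (2 * B)"
      by (intro tendsto_mult LIMSEQ_power_zero tendsto_const) (use n in auto)
    then have "\<forall>\<^sub>F k in sequentially. (1 - 1 / n) ^ k * (2 * B) < \<delta>"
      using \<delta> by (intro order_tendstoD(2)[where y = 0]) auto
    then show ?thesis by (auto simp: eventually_sequentially intro: less_imp_le)
  qed
  then obtain k where k: "(1 - 1 / n) ^ k * (2 * B) \<le> \<delta>" by auto
  from calculation[of k] show ?thesis
  proof (elim exE conjE, intro exI conjI allI impI ballI)
    fix m and f :: "'x \<Rightarrow> real" and x y
    assume "\<forall>f::'x \<Rightarrow> real. modulus U \<delta> f \<longrightarrow> (\<forall>x\<in>carrier X. \<bar>f x\<bar> \<le> B) \<longrightarrow>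
       (\<forall>x\<in>carrier X. \<forall>y\<in>carrier X. avg m f x - avg m f y \<le> (1 - 1 / n) ^ k * (2 * B) + \<delta>)"
      "modulus U \<delta> f" "\<forall>x\<in>carrier X. \<bar>f x\<bar> \<le> B" "x \<in> carrier X" "y \<in> carrier X"
    then have "avg m f x - avg m f y \<le> (1 - 1 / n) ^ k * (2 * B) + \<delta>" by blast
    with k show "avg m f x - avg m f y \<le> 2 * \<delta>" by simp
  qed
qed

lemma ex_averaging_list_complex:
  assumes U: "openin T U" "\<one> \<in> U" and \<delta>: "\<delta> > 0"
  shows "\<exists>l. vlist l \<and> (\<forall>f::'x \<Rightarrow> complex. modulus U \<delta> f \<longrightarrow> (\<forall>x\<in>carrier X. cmod (f x) \<le> B) \<longrightarrow>
    (\<forall>x\<in>carrier X. \<forall>y\<in>carrier X. cmod (avg l f x - avg l f y) \<le> 4 * \<delta>))"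
proof -
  obtain l where l: "vlist l" "\<And>f::'x \<Rightarrow> real. \<And>x y. modulus U \<delta> f \<Longrightarrow> \<forall>x\<in>carrier X. \<bar>f x\<bar> \<le> B \<Longrightarrow>
     x \<in> carrier X \<Longrightarrow> y \<in> carrier X \<Longrightarrow> avg l f x - avg l f y \<le> 2 * \<delta>"
    using ex_averaging_list[OF assms, of B] by blast
  show ?thesis
  proof (intro exI[of _ l] conjI l(1) allI impI ballI)
    fix f :: "'x \<Rightarrow> complex" and x y
    assume f: "modulus U \<delta> f" "\<forall>x\<in>carrier X. cmod (f x) \<le> B" and x: "x \<in> carrier X" and y: "y \<in> carrier X"
    have avg_Re: "Re (avg l f z) = avg l (\<lambda>x. Re (f x)) z" and avg_Im: "Im (avg l f z) = avg l (\<lambda>x. Im (f x)) z" for z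
    proof -
      have "Re (\<Sum>a\<leftarrow>k. f (z \<otimes> a)) = (\<Sum>a\<leftarrow>k. Re (f (z \<otimes> a)))" "Im (\<Sum>a\<leftarrow>k. f (z \<otimes> a)) = (\<Sum>a\<leftarrow>k. Im (f (z \<otimes> a)))" for k
        by (induction k) auto
      then show "Re (avg l f z) = avg l (\<lambda>x. Re (f x)) z" "Im (avg l f z) = avg l (\<lambda>x. Im (f x)) z"
        by (simp_all add: avg_def)
    qed
    have "modulus U \<delta> (\<lambda>x. Re (f x))" "modulus U \<delta> (\<lambda>x. Im (f x))"
      using f(1) order_trans[OF abs_Re_le_cmod] order_trans[OF abs_Im_le_cmod]
      unfolding modulus_def minus_complex.simps[symmetric] real_norm_def by blast+
    moreover have "\<forall>x\<in>carrier X. \<bar>Re (f x)\<bar> \<le> B" "\<forall>x\<in>carrier X. \<bar>Im (f x)\<bar> \<le> B"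
      using f(2) order_trans[OF abs_Re_le_cmod] order_trans[OF abs_Im_le_cmod] by blast+
    ultimately have "\<bar>Re (avg l f x - avg l f y)\<bar> \<le> 2 * \<delta>" "\<bar>Im (avg l f x - avg l f y)\<bar> \<le> 2 * \<delta>"
      using l(2) x y by (auto simp: avg_Re avg_Im abs_le_iff)
    then show "cmod (avg l f x - avg l f y) \<le> 4 * \<delta>"
      using cmod_le[of "avg l f x - avg l f y"] by linarith
  qed
qed

text \<open>The deviations caused by multiplying a coordinate by \<open>u\<close> are continuous in
  \<open>u\<close> and the two coordinates and vanish at \<open>u = \<one>\<close>. The tube lemma
  over the compact square makes them small for all points at once.\<close>

lemma uniform_modulus:
  fixes F :: "'x \<times> 'x \<Rightarrow> complex"
  assumes F: "continuous_map (prod_topology T T) euclidean F" and \<epsilon>: "\<epsilon> > 0"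
  shows "\<exists>U. openin T U \<and> \<one> \<in> U \<and> (\<forall>x\<in>carrier X. modulus U \<epsilon> (\<lambda>y. F (x, y))) \<and> (\<forall>y\<in>carrier X. modulus U \<epsilon> (\<lambda>x. F (x, y)))"
proof -
  let ?P = "prod_topology T (prod_topology T T)"
  have c: "continuous_map ?P T (\<lambda>p. f p \<otimes> g p)" if "continuous_map ?P T f" "continuous_map ?P T g" for f g
    using continuous_map_compose[OF continuous_map_pairedI[OF that] continuous_mult] by (simp add: o_def)
  have p: "continuous_map ?P T fst" "continuous_map ?P T (\<lambda>p. fst (snd p))" "continuous_map ?P T (\<lambda>p. snd (snd p))"
    by (auto intro: continuous_map_fst continuous_map_snd continuous_map_compose[OF continuous_map_snd continuous_map_fst, unfolded o_def]
        continuous_map_compose[OF continuous_map_snd continuous_map_snd, unfolded o_def])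
  have FF: "continuous_map ?P euclidean (\<lambda>p. F (f p, g p))" if "continuous_map ?P T f" "continuous_map ?P T g" for f g
    using continuous_map_compose[OF continuous_map_pairedI[OF that] F] by (simp add: o_def)
  let ?d = "\<lambda>p. cmod (F (fst (snd p), snd (snd p) \<otimes> fst p) - F (fst (snd p), snd (snd p))) +
                cmod (F (fst (snd p) \<otimes> fst p, snd (snd p)) - F (fst (snd p), snd (snd p)))"
  have "continuous_map ?P euclideanreal ?d"
    by (intro continuous_map_add continuous_map_norm continuous_map_diff FF c p)
  then have "openin ?P {p \<in> topspace ?P. ?d p \<in> {..<\<epsilon>}}"
    by (rule openin_continuous_map_preimage) auto
  then have "\<exists>U V. openin T U \<and> openin (prod_topology T T) V \<and> \<one> \<in> U \<and> topspace (prod_topology T T) \<subseteq> V \<and> U \<times> V \<subseteq> {p \<in> topspace ?P. ?d p \<in> {..<\<epsilon>}}"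
  proof (rule tube_lemma_right)
    show "compactin (prod_topology T T) (topspace (prod_topology T T))"
    proof -
      have "compact_space (prod_topology T T)" using compact_T by (simp add: compact_space_prod_topology)
      then show ?thesis by (simp only: compact_space_def)
    qed
    show "{\<one>} \<times> topspace (prod_topology T T) \<subseteq> {p \<in> topspace ?P. ?d p \<in> {..<\<epsilon>}}"
      using \<epsilon> by (auto simp: topspace_eq)
  qed (simp add: topspace_eq)
  then obtain U V where U: "openin T U" "\<one> \<in> U" "carrier X \<times> carrier X \<subseteq> V" "U \<times> V \<subseteq> {p \<in> topspace ?P. ?d p \<in> {..<\<epsilon>}}"
    by (auto simp: topspace_eq)
  have *: "cmod (F (x, y \<otimes> u) - F (x, y)) + cmod (F (x \<otimes> u, y) - F (x, y)) < \<epsilon>" if "u \<in> U" "x \<in> carrier X" "y \<in> carrier X" for u x y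
  proof -
    have "(u, x, y) \<in> U \<times> V" using that U(3) by auto
    then have "(u, x, y) \<in> {p \<in> topspace ?P. ?d p \<in> {..<\<epsilon>}}" using U(4) by blast
    then show ?thesis by simp
  qed
  have "cmod (F (x, y \<otimes> u) - F (x, y)) \<le> \<epsilon>" "cmod (F (x \<otimes> u, y) - F (x, y)) \<le> \<epsilon>" if "u \<in> U" "x \<in> carrier X" "y \<in> carrier X" for u x y
    using *[OF that] norm_ge_zero[of "F (x, y \<otimes> u) - F (x, y)"] norm_ge_zero[of "F (x \<otimes> u, y) - F (x, y)"] by linarith+
  then show ?thesis using U(1,2) by (intro exI[of _ U]) (auto simp: modulus_def)
qed

lemma bounded_continuous:
  fixes f :: "'a \<Rightarrow> complex"
  assumes "continuous_map S euclidean f" "compact_space S"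
  shows "\<exists>B\<ge>0. \<forall>x\<in>topspace S. cmod (f x) \<le> B"
proof -
  have "compactin euclidean (f ` topspace S)"
    by (rule image_compactin[OF _ assms(1)]) (use assms(2) in \<open>simp add: compact_space_def\<close>)
  then have "bounded (f ` topspace S)" by (simp add: compact_imp_bounded)
  then obtain B where "\<forall>y\<in>f ` topspace S. norm y \<le> B" unfolding bounded_iff by auto
  then show ?thesis by (intro exI[of _ "max B 0"]) (auto simp: le_max_iff_disj)
qed

abbreviation cont :: "('x \<Rightarrow> complex) \<Rightarrow> bool" where "cont f \<equiv> continuous_map T euclidean f"

lemma cont_fst_snd:
  assumes "cont f"
  shows "continuous_map (prod_topology T T) euclidean (\<lambda>p. f (fst p))" "continuous_map (prod_topology T T) euclidean (\<lambda>p. f (snd p))"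
  using continuous_map_compose[OF continuous_map_fst assms] continuous_map_compose[OF continuous_map_snd assms]
  by (simp_all add: o_def)

lemma cont_modulus:
  assumes "cont f" "\<epsilon> > 0"
  shows "\<exists>U. openin T U \<and> \<one> \<in> U \<and> modulus U \<epsilon> f"
  using uniform_modulus[OF cont_fst_snd(2)[OF assms(1)] assms(2)] one_closed by auto

lemma modulus_cont:
  assumes "\<And>\<epsilon>. \<epsilon> > 0 \<Longrightarrow> \<exists>U. openin T U \<and> \<one> \<in> U \<and> modulus U \<epsilon> f"
  shows "cont f"
  unfolding continuous_map_iff_dist
proof (intro ballI allI impI)
  fix x and \<epsilon> :: real assume x: "x \<in> topspace T" and "\<epsilon> > 0"
  then obtain U where U: "openin T U" "\<one> \<in> U" "modulus U (\<epsilon> / 2) f" using assms[of "\<epsilon> / 2"] by auto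
  have xc: "x \<in> carrier X" using x topspace_eq by simp
  have "cmod (f y - f x) < \<epsilon>" if "y \<in> carrier X" "inv x \<otimes> y \<in> U" for y
  proof -
    have "x \<otimes> (inv x \<otimes> y) = y" using that xc by (simp add: m_assoc[symmetric])
    then have "cmod (f y - f x) \<le> \<epsilon> / 2" 
      using U(3)[unfolded modulus_def, rule_format, OF xc that(2)] by simp
    then show ?thesis using \<open>\<epsilon> > 0\<close> by linarith
  qed
  then show "\<exists>U. openin T U \<and> x \<in> U \<and> (\<forall>y\<in>U. cmod (f y - f x) < \<epsilon>)"
    using openin_translate(2)[OF U(1) xc] U(2) xc
    by (intro exI[of _ "{y \<in> carrier X. inv x \<otimes> y \<in> U}"]) auto
qed

end

section \<open>The mean of a continuous function\<close>

context compact_metrizable_abelian_group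
begin

text \<open>The value that a Haar integral is forced to have: averaging translates does not change
  the integral, so averages that become uniformly constant reveal it.\<close>

definition has_mean :: "('x \<Rightarrow> complex) \<Rightarrow> complex \<Rightarrow> bool" where
  "has_mean f c \<longleftrightarrow> (\<forall>\<epsilon>>0. \<exists>l. vlist l \<and> (\<forall>x\<in>carrier X. cmod (avg l f x - c) \<le> \<epsilon>))"

definition haar :: "('x \<Rightarrow> complex) \<Rightarrow> complex" where
  "haar f = (THE c. has_mean f c)"

text \<open>Further averaging never increases the distance to a constant. Since averages commute,
  the product list can be read with either factor applied last.\<close>

lemma has_mean_common:
  assumes "has_mean f c" "has_mean g d" "\<epsilon> > 0"
  shows "\<exists>l. vlist l \<and> (\<forall>x\<in>carrier X. cmod (avg l f x - c) \<le> \<epsilon> \<and> cmod (avg l g x - d) \<le> \<epsilon>)"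
proof -
  obtain k where k: "vlist k" "\<forall>x\<in>carrier X. cmod (avg k f x - c) \<le> \<epsilon>"
    using assms(1,3) unfolding has_mean_def by blast
  obtain l where l: "vlist l" "\<forall>x\<in>carrier X. cmod (avg l g x - d) \<le> \<epsilon>"
    using assms(2,3) unfolding has_mean_def by blast
  have "cmod (avg (list_mult l k) f x - c) \<le> \<epsilon>" if x: "x \<in> carrier X" for x
    unfolding avg_list_mult[OF l(1) k(1) x] by (rule norm_avg_diff_le[OF l(1) x]) (use k(2) in auto)
  moreover have "cmod (avg (list_mult l k) g x - d) \<le> \<epsilon>" if x: "x \<in> carrier X" for x
    unfolding avg_list_mult[OF l(1) k(1) x] avg_commute[OF l(1) k(1) x]
    by (rule norm_avg_diff_le[OF k(1) x]) (use l(2) in auto)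
  ultimately show ?thesis using vlist_list_mult[OF l(1) k(1)] by blast
qed

lemma has_mean_unique: "has_mean f c \<Longrightarrow> has_mean f d \<Longrightarrow> c = d"
proof (rule ccontr)
  assume cd: "has_mean f c" "has_mean f d" "c \<noteq> d"
  define \<epsilon> where "\<epsilon> = cmod (c - d) / 4"
  have pos: "cmod (c - d) > 0" using cd(3) by simp
  then have \<epsilon>: "\<epsilon> > 0" by (simp add: \<epsilon>_def)
  obtain l where l: "vlist l" "\<forall>x\<in>carrier X. cmod (avg l f x - c) \<le> \<epsilon> \<and> cmod (avg l f x - d) \<le> \<epsilon>"
    using has_mean_common[OF cd(1,2) \<epsilon>] by auto
  have "cmod (c - d) \<le> cmod (avg l f \<one> - c) + cmod (avg l f \<one> - d)"
    using norm_triangle_ineq4[of "avg l f \<one> - d" "avg l f \<one> - c"] by simp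
  then show False using l(2)[rule_format, OF one_closed] pos unfolding \<epsilon>_def by linarith
qed

lemma haar_eqI: "has_mean f c \<Longrightarrow> haar f = c"
  unfolding haar_def by (rule the_equality) (auto intro: has_mean_unique)

text \<open>Choose lists whose averages oscillate less and less. Any two of the averages are close
  to their common double average, so their values at the identity form a Cauchy sequence, whose
  limit is the mean.\<close>

lemma has_mean_haar:
  assumes f: "cont f"
  shows "has_mean f (haar f)"
proof -
  obtain B where B: "\<forall>x\<in>topspace T. cmod (f x) \<le> B"
    using bounded_continuous[OF f compact_T] by auto
  have ex: "\<exists>l. vlist l \<and> (\<forall>x\<in>carrier X. \<forall>y\<in>carrier X. cmod (avg l f x - avg l f y) \<le> \<epsilon>)" if \<epsilon>: "\<epsilon> > 0" for \<epsilon>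
  proof -
    obtain U where U: "openin T U" "\<one> \<in> U" "modulus U (\<epsilon> / 4) f" using cont_modulus[OF f, of "\<epsilon> / 4"] \<epsilon> by auto
    have "\<epsilon> / 4 > 0" using \<epsilon> by simp
    from ex_averaging_list_complex[OF U(1,2) this, of B] U(3) B show ?thesis by (auto simp: topspace_eq)
  qed
  have "\<exists>l. vlist l \<and> (\<forall>x\<in>carrier X. \<forall>y\<in>carrier X. cmod (avg l f x - avg l f y) \<le> inverse (real (Suc n)))" for n
    by (rule ex) simp
  then obtain l where l: "\<And>n. vlist (l n)"
    "\<And>n x y. x \<in> carrier X \<Longrightarrow> y \<in> carrier X \<Longrightarrow> cmod (avg (l n) f x - avg (l n) f y) \<le> inverse (real (Suc n))"
    by metis
  define c where "c n = avg (l n) f \<one>" for n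
  have d: "cmod (c m - c n) \<le> inverse (real (Suc m)) + inverse (real (Suc n))" for m n
  proof -
    have "cmod (avg (l m) (avg (l n) f) \<one> - c n) \<le> inverse (real (Suc n))"
      by (rule norm_avg_diff_le[OF l(1) one_closed]) (use l(2) in \<open>auto simp: c_def\<close>)
    moreover have "cmod (avg (l m) (avg (l n) f) \<one> - c m) \<le> inverse (real (Suc m))"
      unfolding avg_commute[OF l(1)[of m] l(1)[of n] one_closed]
      by (rule norm_avg_diff_le[OF l(1) one_closed]) (use l(2) in \<open>auto simp: c_def\<close>)
    ultimately show ?thesis
      using norm_triangle_ineq4[of "avg (l m) (avg (l n) f) \<one> - c n" "avg (l m) (avg (l n) f) \<one> - c m"] by simp
  qed
  have "Cauchy c"
  proof (rule metric_CauchyI)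
    fix \<epsilon> :: real assume "\<epsilon> > 0"
    then obtain N where N: "inverse (real (Suc N)) < \<epsilon> / 2"
      using reals_Archimedean[of "\<epsilon> / 2"] by auto
    have "dist (c m) (c n) < \<epsilon>" if "m \<ge> N" "n \<ge> N" for m n
    proof -
      have "inverse (real (Suc m)) \<le> inverse (real (Suc N))" "inverse (real (Suc n)) \<le> inverse (real (Suc N))"
        using that by (intro le_imp_inverse_le; simp)+
      then show ?thesis using d[of m n] N unfolding dist_norm by linarith
    qed
    then show "\<exists>M. \<forall>m\<ge>M. \<forall>n\<ge>M. dist (c m) (c n) < \<epsilon>" by blast
  qed
  then obtain c0 where c0: "c \<longlonglongrightarrow> c0" using convergent_eq_Cauchy by blast
  have "cmod (c n - c0) \<le> inverse (real (Suc n))" for n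
  proof (rule tendsto_le[OF sequentially_bot])
    show "(\<lambda>m. cmod (c n - c m)) \<longlonglongrightarrow> cmod (c n - c0)" by (intro tendsto_intros c0)
    show "(\<lambda>m. inverse (real (Suc n)) + inverse (real (Suc m))) \<longlonglongrightarrow> inverse (real (Suc n))"
      using tendsto_add[OF tendsto_const LIMSEQ_inverse_real_of_nat, of "inverse (real (Suc n))"] by simp
  qed (intro always_eventually allI d)
  then have *: "cmod (avg (l n) f x - c0) \<le> 2 * inverse (real (Suc n))" if "x \<in> carrier X" for n x
  proof -
    have "cmod (avg (l n) f x - c n) \<le> inverse (real (Suc n))"
      unfolding c_def by (rule l(2)[OF that one_closed])
    moreover have "cmod (avg (l n) f x - c0) \<le> cmod (avg (l n) f x - c n) + cmod (c n - c0)"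
      using norm_triangle_ineq[of "avg (l n) f x - c n" "c n - c0"] by simp
    ultimately show ?thesis using \<open>\<And>n. cmod (c n - c0) \<le> inverse (real (Suc n))\<close>[of n] by linarith
  qed
  have "has_mean f c0"
    unfolding has_mean_def
  proof (intro allI impI)
    fix \<epsilon> :: real assume "\<epsilon> > 0"
    then obtain N where N: "inverse (real (Suc N)) < \<epsilon> / 2"
      using reals_Archimedean[of "\<epsilon> / 2"] by auto
    have "cmod (avg (l N) f x - c0) \<le> \<epsilon>" if "x \<in> carrier X" for x
      using *[OF that, of N] N by linarith
    then show "\<exists>l. vlist l \<and> (\<forall>x\<in>carrier X. cmod (avg l f x - c0) \<le> \<epsilon>)" using l(1) by blast
  qed
  then show ?thesis by (simp add: haar_eqI)
qed

lemma has_mean_add: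
  assumes "has_mean f c" "has_mean g d" shows "has_mean (\<lambda>x. f x + g x) (c + d)"
  unfolding has_mean_def
proof (intro allI impI)
  fix \<epsilon> :: real assume "\<epsilon> > 0"
  then have "\<epsilon> / 2 > 0" by simp
  from has_mean_common[OF assms this] obtain l where l: "vlist l"
    "\<forall>x\<in>carrier X. cmod (avg l f x - c) \<le> \<epsilon> / 2 \<and> cmod (avg l g x - d) \<le> \<epsilon> / 2" by auto
  have "cmod (avg l (\<lambda>x. f x + g x) x - (c + d)) \<le> \<epsilon>" if "x \<in> carrier X" for x
    using l(2)[rule_format, OF that] norm_triangle_ineq[of "avg l f x - c" "avg l g x - d"]
    by (simp add: avg_add algebra_simps)
  then show "\<exists>l. vlist l \<and> (\<forall>x\<in>carrier X. cmod (avg l (\<lambda>x. f x + g x) x - (c + d)) \<le> \<epsilon>)" using l(1) by blast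
qed

lemma has_mean_mult:
  assumes "has_mean f c" shows "has_mean (\<lambda>x. a * f x) (a * c)"
  unfolding has_mean_def
proof (intro allI impI)
  fix \<epsilon> :: real assume \<epsilon>: "\<epsilon> > 0"
  then have "\<epsilon> / (cmod a + 1) > 0" by (simp add: add_nonneg_pos)
  then obtain l where l: "vlist l" "\<forall>x\<in>carrier X. cmod (avg l f x - c) \<le> \<epsilon> / (cmod a + 1)"
    using assms unfolding has_mean_def by blast
  have "cmod (avg l (\<lambda>x. a * f x) x - a * c) \<le> \<epsilon>" if "x \<in> carrier X" for x
  proof -
    have "cmod (avg l (\<lambda>x. a * f x) x - a * c) = cmod a * cmod (avg l f x - c)"
      by (simp add: avg_mult_left norm_mult[symmetric] algebra_simps)
    also have "\<dots> \<le> (cmod a + 1) * (\<epsilon> / (cmod a + 1))"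
      using l(2) that by (intro mult_mono) auto
    also have "\<dots> = \<epsilon>" using norm_ge_zero[of a] by (simp add: add_nonneg_eq_0_iff)
    finally show ?thesis .
  qed
  then show "\<exists>l. vlist l \<and> (\<forall>x\<in>carrier X. cmod (avg l (\<lambda>x. a * f x) x - a * c) \<le> \<epsilon>)" using l(1) by blast
qed

lemma has_mean_const: "has_mean (\<lambda>x. c) c"
  unfolding has_mean_def
  by (intro allI impI exI[of _ "[\<one>]"]) (simp add: vlist_def avg_def)

lemma has_mean_cong:
  assumes "has_mean f c" "\<And>x. x \<in> carrier X \<Longrightarrow> g x = f x" shows "has_mean g c"
  unfolding has_mean_def
proof (intro allI impI)
  fix \<epsilon> :: real assume "\<epsilon> > 0"
  then obtain l where l: "vlist l" "\<forall>x\<in>carrier X. cmod (avg l f x - c) \<le> \<epsilon>"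
    using assms(1) unfolding has_mean_def by blast
  then show "\<exists>l. vlist l \<and> (\<forall>x\<in>carrier X. cmod (avg l g x - c) \<le> \<epsilon>)"
    using avg_cong[OF l(1) _ assms(2)] by auto
qed

lemma has_mean_translate:
  assumes "has_mean f c" "a \<in> carrier X" shows "has_mean (\<lambda>x. f (a \<otimes> x)) c"
  unfolding has_mean_def
proof (intro allI impI)
  fix \<epsilon> :: real assume "\<epsilon> > 0"
  then obtain l where l: "vlist l" "\<forall>x\<in>carrier X. cmod (avg l f x - c) \<le> \<epsilon>"
    using assms(1) unfolding has_mean_def by blast
  have "avg l (\<lambda>x. f (a \<otimes> x)) x = avg l f (a \<otimes> x)" if "x \<in> carrier X" for x
    unfolding avg_def using l(1) assms(2) that
    by (intro arg_cong[of _ _ "\<lambda>s. s /\<^sub>R real (length l)"] arg_cong[of _ _ sum_list] map_cong) (auto simp: vlist_def m_assoc)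
  then show "\<exists>l. vlist l \<and> (\<forall>x\<in>carrier X. cmod (avg l (\<lambda>x. f (a \<otimes> x)) x - c) \<le> \<epsilon>)"
    using l assms(2) by auto
qed

lemma has_mean_inv:
  assumes "has_mean f c" shows "has_mean (\<lambda>x. f (inv x)) c"
  unfolding has_mean_def
proof (intro allI impI)
  fix \<epsilon> :: real assume "\<epsilon> > 0"
  then obtain l where l: "vlist l" "\<forall>x\<in>carrier X. cmod (avg l f x - c) \<le> \<epsilon>"
    using assms(1) unfolding has_mean_def by blast
  let ?k = "map (\<lambda>a. inv a) l"
  have "avg ?k (\<lambda>x. f (inv x)) x = avg l f (inv x)" if "x \<in> carrier X" for x
  proof -
    have "(\<Sum>a\<leftarrow>l. f (inv (x \<otimes> inv a))) = (\<Sum>a\<leftarrow>l. f (inv x \<otimes> a))"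
      using l(1) that by (intro arg_cong[of _ _ sum_list] map_cong) (auto simp: vlist_def inv_mult subset_iff)
    then show ?thesis by (simp add: avg_def o_def)
  qed
  moreover have "vlist ?k" using l(1) by (auto simp: vlist_def subset_iff)
  ultimately show "\<exists>l. vlist l \<and> (\<forall>x\<in>carrier X. cmod (avg l (\<lambda>x. f (inv x)) x - c) \<le> \<epsilon>)"
    using l(2) by (intro exI[of _ ?k]) auto
qed

lemma has_mean_cnj:
  assumes "has_mean f c" shows "has_mean (\<lambda>x. cnj (f x)) (cnj c)"
proof -
  have "avg l (\<lambda>x. cnj (f x)) x - cnj c = cnj (avg l f x - c)" for l x
  proof -
    have "(\<Sum>a\<leftarrow>l. cnj (f (x \<otimes> a))) = cnj (\<Sum>a\<leftarrow>l. f (x \<otimes> a))" by (induction l) auto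
    then show ?thesis by (simp add: avg_def)
  qed
  then show ?thesis using assms unfolding has_mean_def by (simp del: complex_cnj_diff)
qed

lemma has_mean_norm_le:
  assumes "has_mean f c" "\<And>x. x \<in> carrier X \<Longrightarrow> cmod (f x - d) \<le> B"
  shows "cmod (c - d) \<le> B"
proof (rule field_le_epsilon)
  fix \<epsilon> :: real assume "\<epsilon> > 0"
  then obtain l where l: "vlist l" "\<forall>x\<in>carrier X. cmod (avg l f x - c) \<le> \<epsilon>"
    using assms(1) unfolding has_mean_def by blast
  have "cmod (avg l f \<one> - d) \<le> B" by (rule norm_avg_diff_le[OF l(1) one_closed assms(2)])
  then show "cmod (c - d) \<le> B + \<epsilon>"
    using l(2)[rule_format, OF one_closed] norm_triangle_ineq4[of "avg l f \<one> - d" "avg l f \<one> - c"] by simp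
qed

lemma haar_add: "cont f \<Longrightarrow> cont g \<Longrightarrow> haar (\<lambda>x. f x + g x) = haar f + haar g"
  by (intro haar_eqI has_mean_add has_mean_haar)

lemma haar_mult: "cont f \<Longrightarrow> haar (\<lambda>x. a * f x) = a * haar f"
  by (intro haar_eqI has_mean_mult has_mean_haar)

lemma haar_mult_right: "cont f \<Longrightarrow> haar (\<lambda>x. f x * a) = haar f * a"
  using haar_mult[of f a] by (simp add: mult.commute)

lemma haar_const: "haar (\<lambda>x. c) = c"
  by (intro haar_eqI has_mean_const)

lemma haar_cong: "cont f \<Longrightarrow> (\<And>x. x \<in> carrier X \<Longrightarrow> g x = f x) \<Longrightarrow> haar g = haar f"
  by (intro haar_eqI has_mean_cong[OF has_mean_haar])

lemma haar_translate: "cont f \<Longrightarrow> a \<in> carrier X \<Longrightarrow> haar (\<lambda>x. f (a \<otimes> x)) = haar f"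
  by (intro haar_eqI has_mean_translate has_mean_haar)

lemma haar_inv: "cont f \<Longrightarrow> haar (\<lambda>x. f (inv x)) = haar f"
  by (intro haar_eqI has_mean_inv has_mean_haar)

lemma haar_cnj: "cont f \<Longrightarrow> haar (\<lambda>x. cnj (f x)) = cnj (haar f)"
  by (intro haar_eqI has_mean_cnj has_mean_haar)

lemma haar_diff: "cont f \<Longrightarrow> cont g \<Longrightarrow> haar (\<lambda>x. f x - g x) = haar f - haar g"
  using haar_add[of f "\<lambda>x. (-1) * g x"] haar_mult[of g "-1"] by (simp add: continuous_map_minus)

lemma norm_haar_diff_le:
  assumes "cont f" "cont g" "\<And>x. x \<in> carrier X \<Longrightarrow> cmod (f x - g x) \<le> B"
  shows "cmod (haar f - haar g) \<le> B"
  using has_mean_norm_le[OF has_mean_haar[OF continuous_map_diff[OF assms(1,2)]], of 0 B] assms by (simp add: haar_diff)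

lemma norm_haar_le:
  assumes "cont f" "\<And>x. x \<in> carrier X \<Longrightarrow> cmod (f x) \<le> B"
  shows "cmod (haar f) \<le> B"
  using has_mean_norm_le[OF has_mean_haar[OF assms(1)], of 0 B] assms(2) by simp

lemma haar_nonneg:
  assumes f: "cont (\<lambda>x. complex_of_real (f x))" and pos: "\<And>x. x \<in> carrier X \<Longrightarrow> 0 \<le> f x"
  shows "\<exists>r\<ge>0. haar (\<lambda>x. complex_of_real (f x)) = complex_of_real r"
proof -
  let ?f = "\<lambda>x. complex_of_real (f x)"
  obtain B where B: "B \<ge> 0" "\<forall>x\<in>topspace T. cmod (?f x) \<le> B" using bounded_continuous[OF f compact_T] by auto
  have "cnj (haar ?f) = haar ?f" using haar_cnj[OF f] by simp
  then obtain r where r: "haar ?f = complex_of_real r" by (metis Reals_cases Reals_cnj_iff)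
  \<comment> \<open>Nonnegativity is expressed by a disc: the values of \<open>f\<close> lie within
    distance \<open>B\<close> of \<open>B\<close>, hence so does the mean.\<close>
  have "cmod (haar ?f - of_real B) \<le> B"
  proof (rule has_mean_norm_le[OF has_mean_haar[OF f]])
    fix x assume x: "x \<in> carrier X"
    then have "cmod (?f x) \<le> B" using B(2) by (simp add: topspace_eq)
    then have "0 \<le> f x" "f x \<le> B" using pos[OF x] by simp_all
    then show "cmod (?f x - of_real B) \<le> B" by (simp flip: of_real_diff)
  qed
  then have "\<bar>r - B\<bar> \<le> B" unfolding r by (simp flip: of_real_diff)
  then show ?thesis using r by (intro exI[of _ r]) auto
qed

text \<open>\<open>K\<close> translates of a set where \<open>f \<ge> c\<close> cover the group, so
  the mean is at least \<open>c / K\<close>, and \<open>K\<close> depends only on the set.\<close>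

lemma haar_lower_bound:
  assumes U: "openin T U" "\<one> \<in> U"
  shows "\<exists>K>0. \<forall>(f :: 'x \<Rightarrow> real) p c. cont (\<lambda>x. complex_of_real (f x)) \<longrightarrow> (\<forall>x\<in>carrier X. 0 \<le> f x) \<longrightarrow> p \<in> carrier X \<longrightarrow>
    (\<forall>u\<in>U. c \<le> f (p \<otimes> u)) \<longrightarrow> c / K \<le> Re (haar (\<lambda>x. complex_of_real (f x)))"
proof -
  obtain l where l: "vlist l" "\<forall>y\<in>carrier X. \<exists>a\<in>set l. inv y \<otimes> a \<in> U" using ex_cover[OF U] by auto
  define K where "K = real (length l)"
  have K: "K > 0" using l(1) by (auto simp: K_def vlist_def)
  show ?thesis
  proof (intro exI[of _ K] conjI allI impI K)
    fix f :: "'x \<Rightarrow> real" and p c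
    let ?f = "\<lambda>x. complex_of_real (f x)"
    assume f: "cont ?f" and pos: "\<forall>x\<in>carrier X. 0 \<le> f x" and p: "p \<in> carrier X" and c: "\<forall>u\<in>U. c \<le> f (p \<otimes> u)"
    have Uc: "U \<subseteq> carrier X" using openin_subset[OF U(1)] topspace_eq by simp
    have avgf: "c / K \<le> avg l f x" if x: "x \<in> carrier X" for x
    proof -
      have "inv x \<otimes> p \<in> carrier X" using x p by auto
      from bspec[OF l(2) this] obtain a where a: "a \<in> set l" "inv (inv x \<otimes> p) \<otimes> a \<in> U" by blast
      have ac: "a \<in> carrier X" using a l by (auto simp: vlist_def)
      have "p \<otimes> (inv (inv x \<otimes> p) \<otimes> a) = x \<otimes> a" using x p ac m_lcomm[of p x "inv p"] by (simp add: inv_mult m_ac)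
      then have "c \<le> f (x \<otimes> a)" using c a(2) by fastforce
      also have "f (x \<otimes> a) + (real (length l) - 1) * 0 \<le> (\<Sum>a\<leftarrow>l. f (x \<otimes> a))"
        by (rule sum_list_ge_member[OF a(1)]) (use pos x l in \<open>auto simp: vlist_def\<close>)
      finally have "c \<le> (\<Sum>a\<leftarrow>l. f (x \<otimes> a))" by simp
      then show ?thesis using K by (simp add: avg_def K_def[symmetric] divide_inverse mult.commute)
    qed
    obtain r where r: "haar ?f = of_real r" using haar_nonneg[OF f] pos by auto
    show "c / K \<le> Re (haar ?f)"
    proof (rule ccontr)
      assume "\<not> c / K \<le> Re (haar ?f)"
      then have \<epsilon>: "(c / K - r) / 2 > 0" by (simp add: r)
      obtain k where k: "vlist k" "\<forall>x\<in>carrier X. cmod (avg k ?f x - of_real r) \<le> (c / K - r) / 2"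
        using has_mean_haar[OF f] \<epsilon> unfolding has_mean_def r by blast
      have avgR: "avg m (\<lambda>x. complex_of_real (g x)) x = of_real (avg m g x)" for m x and g :: "'x \<Rightarrow> real"
      proof -
        have "(\<Sum>a\<leftarrow>m. complex_of_real (g (x \<otimes> a))) = of_real (\<Sum>a\<leftarrow>m. g (x \<otimes> a))" by (induction m) auto
        then show ?thesis by (simp add: avg_def scaleR_conv_of_real)
      qed
      have avg_l: "avg l ?f = (\<lambda>x. of_real (avg l f x))" by (rule HOL.ext) (rule avgR)
      \<comment> \<open>The double average is near \<open>r\<close> when \<open>k\<close> is applied
        first and at least \<open>c / K\<close> when \<open>l\<close> is applied first.\<close>
      have "cmod (avg l (avg k ?f) \<one> - of_real r) \<le> (c / K - r) / 2"
        by (rule norm_avg_diff_le[OF l(1) one_closed]) (use k(2) in auto)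
      moreover have "avg l (avg k ?f) \<one> = of_real (avg k (avg l f) \<one>)"
        unfolding avg_commute[OF l(1) k(1) one_closed]
        by (simp only: avg_l avgR)
      ultimately have "\<bar>avg k (avg l f) \<one> - r\<bar> \<le> (c / K - r) / 2" by (simp flip: of_real_diff)
      then have "avg k (avg l f) \<one> - r \<le> (c / K - r) / 2" by (rule abs_le_D1)
      moreover have "c / K \<le> avg k (avg l f) \<one>"
      proof -
        have "(\<Sum>a\<leftarrow>m. c / K) \<le> (\<Sum>a\<leftarrow>m. avg l f (\<one> \<otimes> a))" if "set m \<subseteq> carrier X" for m
          using that avgf by (induction m) (auto simp: add_mono)
        from this[of k] have "real (length k) * (c / K) \<le> (\<Sum>a\<leftarrow>k. avg l f (\<one> \<otimes> a))"
          using k(1) by (simp add: vlist_def sum_list_triv)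
        then show ?thesis using k(1) unfolding avg_def[of k] by (simp add: vlist_def field_simps)
      qed
      ultimately have "c / K - r \<le> (c / K - r) / 2" by linarith
      moreover have "u \<le> u / 2 \<Longrightarrow> 0 < u / 2 \<Longrightarrow> False" for u :: real by linarith
      ultimately show False using \<epsilon> by blast
    qed
  qed
qed

section \<open>Means depending on a parameter\<close>

lemma cont_const: "cont (\<lambda>x. c)"
  by simp

lemma cont_section:
  assumes F: "continuous_map (prod_topology T T) euclidean F" and a: "a \<in> carrier X"
  shows "cont (\<lambda>y. F (a, y))" "cont (\<lambda>x. F (x, a))"
proof -
  have "continuous_map T (prod_topology T T) (\<lambda>y. (a, y))" "continuous_map T (prod_topology T T) (\<lambda>x. (x, a))"
    using a by (auto intro!: continuous_map_pairedI simp: topspace_eq)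
  then show "cont (\<lambda>y. F (a, y))" "cont (\<lambda>x. F (x, a))"
    using continuous_map_compose[OF _ F] by (auto simp: o_def)
qed

lemma cont_haar_section:
  fixes F :: "'x \<times> 'x \<Rightarrow> complex"
  assumes F: "continuous_map (prod_topology T T) euclidean F"
  shows "cont (\<lambda>x. haar (\<lambda>y. F (x, y)))" "cont (\<lambda>y. haar (\<lambda>x. F (x, y)))"
proof -
  show "cont (\<lambda>x. haar (\<lambda>y. F (x, y)))"
  proof (rule modulus_cont)
    fix \<epsilon> :: real assume "\<epsilon> > 0"
    from uniform_modulus[OF F this] obtain U where U: "openin T U" "\<one> \<in> U" "\<forall>y\<in>carrier X. modulus U \<epsilon> (\<lambda>x. F (x, y))" by auto
    have "U \<subseteq> carrier X" using openin_subset[OF U(1)] topspace_eq by simp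
    then have "modulus U \<epsilon> (\<lambda>x. haar (\<lambda>y. F (x, y)))"
      unfolding modulus_def using U(3)
      by (intro ballI norm_haar_diff_le cont_section[OF F]) (auto simp: modulus_def)
    then show "\<exists>U. openin T U \<and> \<one> \<in> U \<and> modulus U \<epsilon> (\<lambda>x. haar (\<lambda>y. F (x, y)))" using U by blast
  qed
  show "cont (\<lambda>y. haar (\<lambda>x. F (x, y)))"
  proof (rule modulus_cont)
    fix \<epsilon> :: real assume "\<epsilon> > 0"
    from uniform_modulus[OF F this] obtain U where U: "openin T U" "\<one> \<in> U" "\<forall>y\<in>carrier X. modulus U \<epsilon> (\<lambda>x. F (y, x))" by auto
    have "U \<subseteq> carrier X" using openin_subset[OF U(1)] topspace_eq by simp
    then have "modulus U \<epsilon> (\<lambda>y. haar (\<lambda>x. F (x, y)))"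
      unfolding modulus_def using U(3)
      by (intro ballI norm_haar_diff_le cont_section[OF F]) (auto simp: modulus_def)
    then show "\<exists>U. openin T U \<and> \<one> \<in> U \<and> modulus U \<epsilon> (\<lambda>y. haar (\<lambda>x. F (x, y)))" using U by blast
  qed
qed

lemma haar_sum_list:
  assumes "\<And>a. a \<in> set l \<Longrightarrow> cont (g a)"
  shows "haar (\<lambda>x. \<Sum>a\<leftarrow>l. g a x) = (\<Sum>a\<leftarrow>l. haar (g a))" "cont (\<lambda>x. \<Sum>a\<leftarrow>l. g a x)"
  using assms
proof (induction l)
  case (Cons a l)
  { case 1 then show ?case using Cons haar_add[of "g a" "\<lambda>x. \<Sum>a\<leftarrow>l. g a x"] by simp }
  { case 2 then show ?case using Cons by (simp add: continuous_map_add) }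
qed (auto simp: haar_const)

text \<open>Fubini holds because one averaging list works for all functions with a common bound and modulus.\<close>

lemma haar_swap:
  fixes F :: "'x \<times> 'x \<Rightarrow> complex"
  assumes F: "continuous_map (prod_topology T T) euclidean F"
  shows "haar (\<lambda>x. haar (\<lambda>y. F (x, y))) = haar (\<lambda>y. haar (\<lambda>x. F (x, y)))"
proof -
  have ct: "compact_space (prod_topology T T)" using compact_T by (simp add: compact_space_prod_topology)
  obtain B where B: "\<forall>p\<in>topspace (prod_topology T T). cmod (F p) \<le> B" using bounded_continuous[OF F ct] by auto
  have close: "cmod (haar (\<lambda>x. haar (\<lambda>y. F (x, y))) - haar (\<lambda>y. haar (\<lambda>x. F (x, y)))) \<le> \<epsilon>" if "\<epsilon> > 0" for \<epsilon>
  proof -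
    have \<delta>: "\<epsilon> / 8 > 0" using that by simp
    from uniform_modulus[OF F this] obtain U where U: "openin T U" "\<one> \<in> U" "\<forall>x\<in>carrier X. modulus U (\<epsilon> / 8) (\<lambda>y. F (x, y))" by auto
    have Uc: "U \<subseteq> carrier X" using openin_subset[OF U(1)] topspace_eq by simp
    obtain l where l: "vlist l" "\<And>(f::'x \<Rightarrow> complex) x y. modulus U (\<epsilon> / 8) f \<Longrightarrow> \<forall>x\<in>carrier X. cmod (f x) \<le> B \<Longrightarrow>
       x \<in> carrier X \<Longrightarrow> y \<in> carrier X \<Longrightarrow> cmod (avg l f x - avg l f y) \<le> 4 * (\<epsilon> / 8)"
      using ex_averaging_list_complex[OF U(1,2) \<delta>, of B] by blast
    have near: "cmod (haar f - avg l f \<one>) \<le> \<epsilon> / 2" if f: "cont f" "modulus U (\<epsilon> / 8) f" "\<forall>x\<in>carrier X. cmod (f x) \<le> B" for f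
    proof -
      \<comment> \<open>Averaging over \<open>l\<close> keeps the mean and leaves an oscillation of
        at most \<open>\<epsilon> / 2\<close>, so the value at the identity is already that close to
        the mean.\<close>
      have "has_mean (avg l f) (haar f)"
        unfolding has_mean_def
      proof (intro allI impI)
        fix \<eta> :: real assume "\<eta> > 0"
        then obtain k where k: "vlist k" "\<forall>x\<in>carrier X. cmod (avg k f x - haar f) \<le> \<eta>"
          using has_mean_haar[OF f(1)] unfolding has_mean_def by blast
        have "cmod (avg k (avg l f) x - haar f) \<le> \<eta>" if x: "x \<in> carrier X" for x
          unfolding avg_commute[OF k(1) l(1) x] by (rule norm_avg_diff_le[OF l(1) x]) (use k(2) in auto)
        then show "\<exists>k. vlist k \<and> (\<forall>x\<in>carrier X. cmod (avg k (avg l f) x - haar f) \<le> \<eta>)" using k(1) by blast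
      qed
      then show ?thesis by (rule has_mean_norm_le) (use l(2)[OF f(2,3)] in auto)
    qed
    \<comment> \<open>The intermediate value: one mean is replaced by the finite average over
      \<open>l\<close>, which commutes with the other by linearity.\<close>
    let ?m = "haar (\<lambda>x. avg l (\<lambda>y. F (x, y)) \<one>)"
    have lc: "\<one> \<otimes> a \<in> carrier X" if "a \<in> set l" for a using l(1) that by (auto simp: vlist_def)
    have cm: "cont (\<lambda>x. \<Sum>a\<leftarrow>l. F (x, \<one> \<otimes> a))" "haar (\<lambda>x. \<Sum>a\<leftarrow>l. F (x, \<one> \<otimes> a)) = (\<Sum>a\<leftarrow>l. haar (\<lambda>x. F (x, \<one> \<otimes> a)))"
      using haar_sum_list[of l "\<lambda>a x. F (x, \<one> \<otimes> a)"] cont_section(2)[OF F lc] by auto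
    have m_eq: "?m = avg l (\<lambda>y. haar (\<lambda>x. F (x, y))) \<one>"
      using haar_mult[OF cm(1), of "of_real (inverse (real (length l)))"] cm(2)
      by (simp add: avg_def scaleR_conv_of_real)
    have cont_m: "cont (\<lambda>x. avg l (\<lambda>y. F (x, y)) \<one>)"
      using continuous_map_mult_complex[OF cont_const[of "of_real (inverse (real (length l)))"] cm(1)]
      by (simp add: avg_def scaleR_conv_of_real)
    have "cmod (haar (\<lambda>x. haar (\<lambda>y. F (x, y))) - ?m) \<le> \<epsilon> / 2"
      by (rule norm_haar_diff_le[OF cont_haar_section(1)[OF F] cont_m near])
        (use U(3) B in \<open>auto simp: topspace_eq intro: cont_section[OF F]\<close>)
    moreover have "cmod (haar (\<lambda>y. haar (\<lambda>x. F (x, y))) - ?m) \<le> \<epsilon> / 2"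
      unfolding m_eq
    proof (rule near[OF cont_haar_section(2)[OF F]])
      show "modulus U (\<epsilon> / 8) (\<lambda>y. haar (\<lambda>x. F (x, y)))"
        unfolding modulus_def using U(3) Uc
        by (intro ballI norm_haar_diff_le cont_section[OF F]) (auto simp: modulus_def)
      show "\<forall>y\<in>carrier X. cmod (haar (\<lambda>x. F (x, y))) \<le> B"
        using B by (intro ballI norm_haar_le cont_section[OF F]) (auto simp: topspace_eq)
    qed
    ultimately show ?thesis
      using norm_triangle_ineq4[of "haar (\<lambda>x. haar (\<lambda>y. F (x, y))) - ?m" "haar (\<lambda>y. haar (\<lambda>x. F (x, y))) - ?m"] by simp
  qed
  then have "cmod (haar (\<lambda>x. haar (\<lambda>y. F (x, y))) - haar (\<lambda>y. haar (\<lambda>x. F (x, y)))) \<le> 0"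
    by (rule field_le_epsilon[of _ 0, simplified])
  then show ?thesis by simp
qed

end

section \<open>The convolution algebra\<close>

context compact_metrizable_abelian_group
begin

text \<open>Fixing the value 0 outside the carrier lets identities of the convolution algebra be
  stated as equalities of functions.\<close>

definition CF :: "('x \<Rightarrow> complex) set" where
  "CF = {f. cont f \<and> (\<forall>x. x \<notin> carrier X \<longrightarrow> f x = 0)}"

definition conv :: "('x \<Rightarrow> complex) \<Rightarrow> ('x \<Rightarrow> complex) \<Rightarrow> 'x \<Rightarrow> complex" where
  "conv f g x = (if x \<in> carrier X then haar (\<lambda>y. f y * g (inv y \<otimes> x)) else 0)"

definition star :: "('x \<Rightarrow> complex) \<Rightarrow> 'x \<Rightarrow> complex" where
  "star f x = (if x \<in> carrier X then cnj (f (inv x)) else 0)"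

definition tau :: "'x \<Rightarrow> ('x \<Rightarrow> complex) \<Rightarrow> 'x \<Rightarrow> complex" where
  "tau a f x = (if x \<in> carrier X then f (inv a \<otimes> x) else 0)"

definition ip :: "('x \<Rightarrow> complex) \<Rightarrow> ('x \<Rightarrow> complex) \<Rightarrow> complex" where
  "ip f g = haar (\<lambda>y. f y * cnj (g y))"

definition nsq :: "('x \<Rightarrow> complex) \<Rightarrow> real" where
  "nsq f = Re (ip f f)"

lemma CF_cont: "f \<in> CF \<Longrightarrow> cont f" by (simp add: CF_def)

lemma CF_outside: "f \<in> CF \<Longrightarrow> x \<notin> carrier X \<Longrightarrow> f x = 0" by (simp add: CF_def)

lemma CF_eqI: "f \<in> CF \<Longrightarrow> g \<in> CF \<Longrightarrow> (\<And>x. x \<in> carrier X \<Longrightarrow> f x = g x) \<Longrightarrow> f = g"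
  by (rule HOL.ext) (metis CF_outside)

lemma cont_cong: "cont f \<Longrightarrow> (\<And>x. x \<in> carrier X \<Longrightarrow> g x = f x) \<Longrightarrow> cont g"
  by (rule continuous_map_eq) (auto simp: topspace_eq)

lemma continuous_map_group_mult:
  "continuous_map S T f \<Longrightarrow> continuous_map S T g \<Longrightarrow> continuous_map S T (\<lambda>p. f p \<otimes> g p)"
  using continuous_map_compose[OF continuous_map_pairedI continuous_mult, of S f g] by (simp add: o_def)

lemma continuous_map_group_inv: "continuous_map S T f \<Longrightarrow> continuous_map S T (\<lambda>p. inv (f p))"
  using continuous_map_compose[OF _ continuous_inv, of S f] by (simp add: o_def)

lemma continuous_map_comp_cont:
  "continuous_map S T u \<Longrightarrow> cont f \<Longrightarrow> continuous_map S euclidean (\<lambda>p. f (u p))"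
  using continuous_map_compose[of S T u euclidean f] by (simp add: o_def)

lemma continuous_map_pair_fst_snd:
  "continuous_map (prod_topology T T) T fst" "continuous_map (prod_topology T T) T snd"
  by (auto intro: continuous_map_fst continuous_map_snd)

lemma continuous_map_ident: "continuous_map T T (\<lambda>x. x)"
  using continuous_map_id by (simp add: id_def)

lemma continuous_map_const_carrier: "a \<in> carrier X \<Longrightarrow> continuous_map S T (\<lambda>x. a)"
  by (simp add: topspace_eq)

lemma CF_comp: "f \<in> CF \<Longrightarrow> continuous_map S T u \<Longrightarrow> continuous_map S euclidean (\<lambda>p. f (u p))"
  by (rule continuous_map_comp_cont[OF _ CF_cont])

lemmas cont_intros = continuous_map_mult_complex continuous_map_cnj continuous_map_group_mult
  continuous_map_group_inv continuous_map_pair_fst_snd continuous_map_const_carrier continuous_map_ident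

lemma cont_conv_section:
  assumes "cont f" "cont g" "x \<in> carrier X" shows "cont (\<lambda>y. f y * g (inv y \<otimes> x))"
  by (intro cont_intros continuous_map_comp_cont[OF _ assms(1)] continuous_map_comp_cont[OF _ assms(2)] assms(3))

lemma CF_add: "f \<in> CF \<Longrightarrow> g \<in> CF \<Longrightarrow> (\<lambda>x. f x + g x) \<in> CF"
  by (simp add: CF_def continuous_map_add)

lemma CF_diff: "f \<in> CF \<Longrightarrow> g \<in> CF \<Longrightarrow> (\<lambda>x. f x - g x) \<in> CF"
  by (simp add: CF_def continuous_map_diff)

lemma CF_scale: "f \<in> CF \<Longrightarrow> (\<lambda>x. c * f x) \<in> CF"
  by (simp add: CF_def continuous_map_mult_complex)

lemma CF_zero: "(\<lambda>x. 0) \<in> CF"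
  by (simp add: CF_def)

lemma CF_restrict: "cont f \<Longrightarrow> (\<lambda>x. if x \<in> carrier X then f x else 0) \<in> CF"
  unfolding CF_def by (auto intro: cont_cong)

lemma CF_star: "f \<in> CF \<Longrightarrow> star f \<in> CF"
  unfolding star_def[abs_def] by (intro CF_restrict cont_intros CF_comp[of f])

lemma CF_tau: "f \<in> CF \<Longrightarrow> a \<in> carrier X \<Longrightarrow> tau a f \<in> CF"
  unfolding tau_def[abs_def] by (intro CF_restrict CF_comp[of f] cont_intros) auto

lemma CF_conv:
  assumes "f \<in> CF" "g \<in> CF" shows "conv f g \<in> CF"
proof -
  have "continuous_map (prod_topology T T) euclidean (\<lambda>p. f (snd p) * g (inv (snd p) \<otimes> fst p))"
    by (intro cont_intros CF_comp[OF assms(1)] CF_comp[OF assms(2)])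
  from cont_haar_section(1)[OF this] show ?thesis
    unfolding conv_def[abs_def] by (intro CF_restrict) simp
qed

lemma haar_reflect:
  assumes h: "cont h" and x: "x \<in> carrier X"
  shows "haar (\<lambda>y. h (x \<otimes> inv y)) = haar h"
proof -
  have "cont (\<lambda>y. h (x \<otimes> y))" by (intro cont_intros continuous_map_comp_cont[OF _ h] x)
  from haar_inv[OF this] haar_translate[OF h x] show ?thesis by simp
qed

lemma conv_commute:
  assumes f: "f \<in> CF" and g: "g \<in> CF" shows "conv f g = conv g f"
proof (rule CF_eqI[OF CF_conv[OF f g] CF_conv[OF g f]])
  fix x assume x: "x \<in> carrier X"
  have c: "cont (\<lambda>y. f y * g (inv y \<otimes> x))" by (intro cont_conv_section CF_cont f g x)
  have "haar (\<lambda>y. f y * g (inv y \<otimes> x)) = haar (\<lambda>y. f (x \<otimes> inv y) * g (inv (x \<otimes> inv y) \<otimes> x))"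
    using haar_reflect[OF c x] by simp
  also have "\<dots> = haar (\<lambda>y. g y * f (inv y \<otimes> x))"
  proof (rule haar_cong[OF cont_conv_section[OF CF_cont[OF g] CF_cont[OF f] x]])
    fix y assume y: "y \<in> carrier X"
    have "inv (x \<otimes> inv y) \<otimes> x = y" using x y m_lcomm[of "inv x" y x] by (simp add: inv_mult m_assoc)
    then show "f (x \<otimes> inv y) * g (inv (x \<otimes> inv y) \<otimes> x) = g y * f (inv y \<otimes> x)"
      using x y by (simp add: m_comm)
  qed
  finally show "conv f g x = conv g f x" using x by (simp add: conv_def)
qed

text \<open>Exchange the two means, then translate the inner variable by \<open>z\<close>.\<close>

lemma conv_assoc:
  assumes f: "f \<in> CF" and g: "g \<in> CF" and h: "h \<in> CF"
  shows "conv (conv f g) h = conv f (conv g h)"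
proof (rule CF_eqI[OF CF_conv[OF CF_conv[OF f g] h] CF_conv[OF f CF_conv[OF g h]]])
  fix x assume x: "x \<in> carrier X"
  let ?F = "\<lambda>p. f (snd p) * (g (inv (snd p) \<otimes> fst p) * h (inv (fst p) \<otimes> x))"
  have F: "continuous_map (prod_topology T T) euclidean ?F"
    by (intro cont_intros CF_comp[OF f] CF_comp[OF g] CF_comp[OF h] x)
  have "haar (\<lambda>y. conv f g y * h (inv y \<otimes> x)) = haar (\<lambda>y. haar (\<lambda>z. ?F (y, z)))"
  proof (rule haar_cong[OF cont_haar_section(1)[OF F]])
    fix y assume y: "y \<in> carrier X"
    show "conv f g y * h (inv y \<otimes> x) = haar (\<lambda>z. ?F (y, z))"
      using haar_mult_right[OF cont_conv_section[OF CF_cont[OF f] CF_cont[OF g] y], of "h (inv y \<otimes> x)"] y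
      by (simp add: conv_def mult.assoc)
  qed
  also have "\<dots> = haar (\<lambda>z. haar (\<lambda>y. ?F (y, z)))" by (rule haar_swap[OF F])
  also have "\<dots> = haar (\<lambda>z. f z * conv g h (inv z \<otimes> x))"
  proof (rule haar_cong)
    show "cont (\<lambda>z. f z * conv g h (inv z \<otimes> x))"
      by (intro cont_conv_section CF_cont CF_conv f g h x)
    fix z assume z: "z \<in> carrier X"
    let ?h = "\<lambda>y. g (inv z \<otimes> y) * h (inv y \<otimes> x)"
    have iz: "inv z \<in> carrier X" using z by simp
    have ch: "cont ?h" by (intro cont_intros CF_comp[OF g] CF_comp[OF h] x iz)
    have ch': "cont (\<lambda>y. g y * h (inv y \<otimes> (inv z \<otimes> x)))" by (intro cont_intros CF_comp[OF g] CF_comp[OF h] x iz)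
    have "haar (\<lambda>y. ?F (y, z)) = f z * haar ?h" using haar_mult[OF ch, of "f z"] by simp
    also have "haar ?h = haar (\<lambda>y. ?h (z \<otimes> y))" using haar_translate[OF ch z] by simp
    also have "\<dots> = haar (\<lambda>y. g y * h (inv y \<otimes> (inv z \<otimes> x)))"
    proof (rule haar_cong[OF ch'])
      fix y assume y: "y \<in> carrier X"
      have "inv z \<otimes> (z \<otimes> y) = y" using y z by (simp add: m_assoc[symmetric])
      moreover have "inv (z \<otimes> y) \<otimes> x = inv y \<otimes> (inv z \<otimes> x)" using x y z by (simp add: inv_mult m_ac)
      ultimately show "?h (z \<otimes> y) = g y * h (inv y \<otimes> (inv z \<otimes> x))" by simp
    qed
    finally show "haar (\<lambda>y. ?F (y, z)) = f z * conv g h (inv z \<otimes> x)" using x z by (simp add: conv_def)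
  qed
  finally show "conv (conv f g) h x = conv f (conv g h) x" using x by (simp add: conv_def)
qed

lemma star_conv:
  assumes f: "f \<in> CF" and g: "g \<in> CF" shows "star (conv f g) = conv (star f) (star g)"
proof (rule CF_eqI[OF CF_star[OF CF_conv[OF f g]] CF_conv[OF CF_star[OF f] CF_star[OF g]]])
  fix x assume x: "x \<in> carrier X"
  have ix: "inv x \<in> carrier X" using x by simp
  have c: "cont (\<lambda>y. f y * g (inv y \<otimes> inv x))" by (intro cont_intros CF_comp[OF f] CF_comp[OF g] ix)
  have c': "cont (\<lambda>y. cnj (f y * g (inv y \<otimes> inv x)))" by (intro cont_intros CF_comp[OF f] CF_comp[OF g] ix)
  have "star (conv f g) x = haar (\<lambda>y. cnj (f y * g (inv y \<otimes> inv x)))"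
    using haar_cnj[OF c] x by (simp add: star_def conv_def)
  also have "\<dots> = haar (\<lambda>y. cnj (f (inv y) * g (inv (inv y) \<otimes> inv x)))"
    using haar_inv[OF c'] by simp
  also have "\<dots> = haar (\<lambda>y. star f y * star g (inv y \<otimes> x))"
  proof (rule haar_cong[symmetric])
    show "cont (\<lambda>y. cnj (f (inv y) * g (inv (inv y) \<otimes> inv x)))" by (intro cont_intros CF_comp[OF f] CF_comp[OF g] ix)
  qed (use x in \<open>auto simp: star_def inv_mult\<close>)
  finally show "star (conv f g) x = conv (star f) (star g) x" using x by (simp add: conv_def)
qed

lemma star_star: "f \<in> CF \<Longrightarrow> star (star f) = f"
  by (rule CF_eqI) (auto intro: CF_star simp: star_def)

lemma conv_tau:
  assumes f: "f \<in> CF" and g: "g \<in> CF" and a: "a \<in> carrier X"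
  shows "conv f (tau a g) = tau a (conv f g)"
proof (rule CF_eqI[OF CF_conv[OF f CF_tau[OF g a]] CF_tau[OF CF_conv[OF f g] a]])
  fix x assume x: "x \<in> carrier X"
  have ax: "inv a \<otimes> x \<in> carrier X" using a x by simp
  have "haar (\<lambda>y. f y * tau a g (inv y \<otimes> x)) = haar (\<lambda>y. f y * g (inv y \<otimes> (inv a \<otimes> x)))"
    by (rule haar_cong[OF cont_conv_section[OF CF_cont[OF f] CF_cont[OF g] ax]])
      (use a x in \<open>auto simp: tau_def m_lcomm\<close>)
  then show "conv f (tau a g) x = tau a (conv f g) x" using x ax by (simp add: conv_def tau_def)
qed

lemma conv_add:
  assumes f: "f \<in> CF" and g: "g \<in> CF" and h: "h \<in> CF"
  shows "conv f (\<lambda>x. g x + h x) = (\<lambda>x. conv f g x + conv f h x)"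
proof (rule CF_eqI[OF CF_conv[OF f CF_add[OF g h]] CF_add[OF CF_conv[OF f g] CF_conv[OF f h]]])
  fix x assume x: "x \<in> carrier X"
  show "conv f (\<lambda>x. g x + h x) x = conv f g x + conv f h x"
    using haar_add[OF cont_conv_section[OF CF_cont[OF f] CF_cont[OF g] x] cont_conv_section[OF CF_cont[OF f] CF_cont[OF h] x]] x
    by (simp add: conv_def distrib_left)
qed

lemma conv_scale:
  assumes f: "f \<in> CF" and g: "g \<in> CF"
  shows "conv f (\<lambda>x. c * g x) = (\<lambda>x. c * conv f g x)"
proof (rule CF_eqI[OF CF_conv[OF f CF_scale[OF g]] CF_scale[OF CF_conv[OF f g]]])
  fix x assume x: "x \<in> carrier X"
  show "conv f (\<lambda>x. c * g x) x = c * conv f g x"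
    using haar_mult[OF cont_conv_section[OF CF_cont[OF f] CF_cont[OF g] x], of c] x
    by (simp add: conv_def mult.left_commute)
qed

lemma conv_diff:
  assumes f: "f \<in> CF" and g: "g \<in> CF" and h: "h \<in> CF"
  shows "conv f (\<lambda>x. g x - h x) = (\<lambda>x. conv f g x - conv f h x)"
  using conv_add[OF f g CF_scale[OF h, of "-1"]] conv_scale[OF f h, of "-1"] by simp

lemma conv_scale_left:
  assumes f: "f \<in> CF" and g: "g \<in> CF"
  shows "conv (\<lambda>x. c * f x) g = (\<lambda>x. c * conv f g x)"
  using conv_scale[OF g f, of c] conv_commute[OF CF_scale[OF f] g] conv_commute[OF f g] by simp

lemma conv_diff_left:
  assumes f: "f \<in> CF" and g: "g \<in> CF" and h: "h \<in> CF"
  shows "conv (\<lambda>x. g x - h x) f = (\<lambda>x. conv g f x - conv h f x)"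
  using conv_diff[OF f g h] conv_commute[OF CF_diff[OF g h] f] conv_commute[OF g f] conv_commute[OF h f] by simp

lemma conv_zero: "f \<in> CF \<Longrightarrow> conv f (\<lambda>x. 0) = (\<lambda>x. 0)"
  using conv_scale[of f "\<lambda>x. 0" 0] CF_zero by simp

section \<open>The inner product given by the mean\<close>

lemma ip_self:
  assumes "cont f" shows "ip f f = of_real (nsq f)" "0 \<le> nsq f"
proof -
  have eq: "f x * cnj (f x) = complex_of_real ((cmod (f x))\<^sup>2)" for x
    by (simp add: complex_norm_square del: of_real_power)
  have "cont (\<lambda>x. complex_of_real ((cmod (f x))\<^sup>2))"
    unfolding eq[symmetric] by (intro cont_intros continuous_map_comp_cont[OF _ assms])
  from haar_nonneg[OF this] obtain r where "r \<ge> 0" "ip f f = of_real r"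
    unfolding ip_def eq by auto
  then show "ip f f = of_real (nsq f)" "0 \<le> nsq f" by (simp_all add: nsq_def)
qed

text \<open>By continuity \<open>f\<close> keeps at least half of a nonzero value on a translate of
  a neighbourhood of the identity, and \<open>haar_lower_bound\<close> gives such a set a positive
  share of the mean.\<close>

lemma nsq_pos:
  assumes f: "f \<in> CF" and nz: "f \<noteq> (\<lambda>x. 0)"
  shows "0 < nsq f"
proof -
  obtain p where p0: "f p \<noteq> 0" using nz by auto
  then have p: "p \<in> carrier X" using CF_outside[OF f] by auto
  define c where "c = cmod (f p) / 2"
  have c: "c > 0" using p0 by (simp add: c_def)
  obtain U where U: "openin T U" "\<one> \<in> U" "modulus U c f" using cont_modulus[OF CF_cont[OF f] c] by auto
  have eq: "f x * cnj (f x) = complex_of_real ((cmod (f x))\<^sup>2)" for x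
    by (simp add: complex_norm_square del: of_real_power)
  have cf: "cont (\<lambda>x. complex_of_real ((cmod (f x))\<^sup>2))"
    unfolding eq[symmetric] by (intro cont_intros CF_comp[OF f])
  have low: "\<forall>u\<in>U. c\<^sup>2 \<le> (cmod (f (p \<otimes> u)))\<^sup>2"
  proof
    fix u assume "u \<in> U"
    then have "cmod (f (p \<otimes> u) - f p) \<le> c" using U(3) p by (auto simp: modulus_def)
    then have "c \<le> cmod (f (p \<otimes> u))"
      using norm_triangle_ineq2[of "f p" "f (p \<otimes> u)"] by (simp add: c_def norm_minus_commute)
    then show "c\<^sup>2 \<le> (cmod (f (p \<otimes> u)))\<^sup>2" using c by (intro power_mono) auto
  qed
  obtain K where K: "K > 0" "\<forall>(f :: 'x \<Rightarrow> real) p c. cont (\<lambda>x. complex_of_real (f x)) \<longrightarrow> (\<forall>x\<in>carrier X. 0 \<le> f x) \<longrightarrow> p \<in> carrier X \<longrightarrow>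
    (\<forall>u\<in>U. c \<le> f (p \<otimes> u)) \<longrightarrow> c / K \<le> Re (haar (\<lambda>x. complex_of_real (f x)))"
    using haar_lower_bound[OF U(1,2)] by auto
  have "c\<^sup>2 / K \<le> nsq f"
    unfolding nsq_def ip_def eq using K(2)[rule_format, of "\<lambda>x. (cmod (f x))\<^sup>2" p "c\<^sup>2"] cf p low by simp
  moreover have "c\<^sup>2 / K > 0" using c K(1) by simp
  ultimately show ?thesis by linarith
qed

lemma ip_Cauchy_Schwarz:
  assumes f: "f \<in> CF" and g: "g \<in> CF"
  shows "(cmod (ip f g))\<^sup>2 \<le> nsq f * nsq g"
proof (cases "g = (\<lambda>x. 0)")
  case True
  then show ?thesis by (simp add: ip_def nsq_def haar_const)
next
  case False
  then have ng: "nsq g > 0" by (rule nsq_pos[OF g])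
  \<comment> \<open>The coefficient of the orthogonal projection of \<open>f\<close> onto
    \<open>g\<close>.\<close>
  define c where "c = ip f g / of_real (nsq g)"
  have cs: "cont (\<lambda>y. f y * cnj (f y))" "cont (\<lambda>y. f y * cnj (g y))" "cont (\<lambda>y. g y * cnj (f y))" "cont (\<lambda>y. g y * cnj (g y))"
    by (intro cont_intros CF_comp[OF f] CF_comp[OF g])+
  have cc: "cont (\<lambda>y. - cnj c * (f y * cnj (g y)))" "cont (\<lambda>y. - c * (g y * cnj (f y)))" "cont (\<lambda>y. c * cnj c * (g y * cnj (g y)))"
    by (intro continuous_map_mult_complex cs cont_const)+
  have gf: "haar (\<lambda>y. g y * cnj (f y)) = cnj (ip f g)"
    using haar_cnj[OF cs(2)] by (simp add: ip_def mult.commute)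
  have "ip (\<lambda>x. f x - c * g x) (\<lambda>x. f x - c * g x) =
    haar (\<lambda>y. ((f y * cnj (f y) + - cnj c * (f y * cnj (g y))) + - c * (g y * cnj (f y))) + c * cnj c * (g y * cnj (g y)))"
    unfolding ip_def by (rule arg_cong[of _ _ haar]) (simp add: fun_eq_iff algebra_simps)
  also have "\<dots> = of_real (nsq f) - cnj c * ip f g - c * cnj (ip f g) + c * cnj c * of_real (nsq g)"
    using ip_self(1)[OF CF_cont[OF f]] ip_self(1)[OF CF_cont[OF g]] gf
    by (simp only: haar_add haar_mult cs cc continuous_map_add) (simp add: ip_def)
  also have "\<dots> = of_real (nsq f) - ip f g * cnj (ip f g) / of_real (nsq g)"
    using ng unfolding c_def by (simp add: field_simps)
  also have "\<dots> = of_real (nsq f - (cmod (ip f g))\<^sup>2 / nsq g)"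
    by (simp add: complex_norm_square del: of_real_power)
  finally have "nsq (\<lambda>x. f x - c * g x) = nsq f - (cmod (ip f g))\<^sup>2 / nsq g"
    by (simp add: nsq_def)
  then have "(cmod (ip f g))\<^sup>2 / nsq g \<le> nsq f"
    using ip_self(2)[OF CF_cont[OF CF_diff[OF f CF_scale[OF g, of c]]]] by simp
  then show ?thesis using ng by (simp add: field_simps)
qed

lemma conv_ip:
  assumes f: "f \<in> CF" and g: "g \<in> CF" and x: "x \<in> carrier X"
  shows "conv f g x = ip f (tau x (star g))"
proof -
  have "haar (\<lambda>y. f y * g (inv y \<otimes> x)) = haar (\<lambda>y. f y * cnj (tau x (star g) y))"
    by (rule haar_cong[symmetric, OF cont_conv_section[OF CF_cont[OF f] CF_cont[OF g] x]])
      (use x in \<open>auto simp: tau_def star_def inv_mult m_comm\<close>)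
  then show ?thesis using x by (simp add: conv_def ip_def)
qed

lemma nsq_tau: "f \<in> CF \<Longrightarrow> a \<in> carrier X \<Longrightarrow> nsq (tau a f) = nsq f"
proof -
  assume f: "f \<in> CF" and a: "a \<in> carrier X"
  have ia: "inv a \<in> carrier X" using a by simp
  have c: "cont (\<lambda>y. f y * cnj (f y))" by (intro cont_intros CF_comp[OF f])
  have "haar (\<lambda>y. tau a f y * cnj (tau a f y)) = haar (\<lambda>y. f (inv a \<otimes> y) * cnj (f (inv a \<otimes> y)))"
  proof (rule haar_cong)
    show "cont (\<lambda>y. f (inv a \<otimes> y) * cnj (f (inv a \<otimes> y)))" by (intro cont_intros CF_comp[OF f] ia)
  qed (simp add: tau_def)
  then show ?thesis using haar_translate[OF c ia] by (simp add: nsq_def ip_def)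
qed

lemma nsq_star: "f \<in> CF \<Longrightarrow> nsq (star f) = nsq f"
proof -
  assume f: "f \<in> CF"
  have c: "cont (\<lambda>y. f y * cnj (f y))" by (intro cont_intros CF_comp[OF f])
  have "haar (\<lambda>y. star f y * cnj (star f y)) = haar (\<lambda>y. f (inv y) * cnj (f (inv y)))"
  proof (rule haar_cong)
    show "cont (\<lambda>y. f (inv y) * cnj (f (inv y)))" by (intro cont_intros CF_comp[OF f])
  qed (simp add: star_def mult.commute)
  then show ?thesis using haar_inv[OF c] by (simp add: nsq_def ip_def)
qed

text \<open>A value of the convolution is an inner product of \<open>f\<close> with a translate of
  \<open>star g\<close>. Convolution thus bounds the sup norm by L2 norms, which later takes the
  place of compactness of the operator.\<close>

lemma conv_bound:
  assumes f: "f \<in> CF" and g: "g \<in> CF"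
  shows "(cmod (conv f g x))\<^sup>2 \<le> nsq f * nsq g"
proof (cases "x \<in> carrier X")
  case True
  then show ?thesis
    using ip_Cauchy_Schwarz[OF f CF_tau[OF CF_star[OF g] True]]
    by (simp add: conv_ip[OF f g] nsq_tau[OF CF_star[OF g]] nsq_star[OF g])
next
  case False
  then show ?thesis using ip_self(2)[OF CF_cont[OF f]] ip_self(2)[OF CF_cont[OF g]] by (simp add: conv_def)
qed

lemma conv_star_one: "f \<in> CF \<Longrightarrow> g \<in> CF \<Longrightarrow> conv f (star g) \<one> = ip f g"
proof -
  assume f: "f \<in> CF" and g: "g \<in> CF"
  have "tau \<one> g = g" by (rule CF_eqI[OF CF_tau[OF g one_closed] g]) (simp add: tau_def)
  then show ?thesis using conv_ip[OF f CF_star[OF g] one_closed] by (simp add: star_star[OF g])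
qed

end

text \<open>Log-convexity makes the ratios \<open>r n\<close> increase, and submultiplicativity
  bounds their powers by \<open>r n ^ Suc m \<le> s m\<close>. With \<open>\<rho>\<close> the limit
  of the ratios, \<open>s n / \<rho> ^ Suc n\<close> therefore decreases and stays at least 1. The
  exponent is \<open>Suc n\<close> because \<open>s n\<close> plays the role of the term of index
  \<open>n + 1\<close>.\<close>

lemma log_convex_submultiplicative_limit:
  fixes s :: "nat \<Rightarrow> real"
  assumes pos: "\<And>n. s n > 0" and lc: "\<And>n. (s (Suc n))\<^sup>2 \<le> s n * s (Suc (Suc n))"
    and sub: "\<And>n m. s (n + m + 1) \<le> s n * s m"
  shows "\<exists>\<rho>>0. \<exists>L\<ge>1. (\<lambda>n. s n / \<rho> ^ Suc n) \<longlonglongrightarrow> L"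
proof -
  define r where "r n = s (Suc n) / s n" for n
  have r_pos: "r n > 0" for n using pos by (simp add: r_def)
  have s_Suc: "s (Suc n) = s n * r n" for n using pos[of n] by (simp add: r_def)
  have "r n \<le> r (Suc n)" for n
  proof -
    have "s (Suc n) * s (Suc n) \<le> s (Suc (Suc n)) * s n" using lc[of n] by (simp add: power2_eq_square mult.commute)
    then show ?thesis using pos[of n] pos[of "Suc n"] by (simp add: r_def divide_simps mult.commute)
  qed
  then have inc: "incseq r" by (rule incseq_SucI)
  have low: "s n * r n ^ k \<le> s (n + k)" for n k
  proof (induction k)
    case (Suc k)
    have "s n * r n ^ Suc k = (s n * r n ^ k) * r n" by simp
    also have "\<dots> \<le> s (n + k) * r (n + k)"
      using Suc incseqD[OF inc, of n "n + k"] r_pos[of n] pos[of n] pos[of "n + k"] by (intro mult_mono) auto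
    also have "\<dots> = s (n + Suc k)" by (simp add: s_Suc)
    finally show ?case .
  qed simp
  have r_le: "r n ^ Suc m \<le> s m" for n m
  proof -
    have "s n * r n ^ Suc m \<le> s n * s m" using low[of n "Suc m"] sub[of n m] by simp
    then show ?thesis using pos[of n] by simp
  qed
  have "\<And>n. r n \<le> s 0" using r_le[of _ 0] by simp
  then obtain \<rho> where \<rho>: "r \<longlonglongrightarrow> \<rho>" "\<And>n. r n \<le> \<rho>"
    using incseq_convergent[OF inc] by blast
  have \<rho>_pos: "\<rho> > 0" using \<rho>(2)[of 0] r_pos[of 0] by linarith
  have "\<rho> ^ Suc m \<le> s m" for m
    by (rule LIMSEQ_le_const2[OF tendsto_power[OF \<rho>(1)]]) (use r_le in auto)
  then have t_ge: "1 \<le> s m / \<rho> ^ Suc m" for m using \<rho>_pos by (simp add: divide_simps del: power_Suc)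
  have "decseq (\<lambda>n. s n / \<rho> ^ Suc n)"
  proof (rule decseq_SucI)
    fix n
    have "s (Suc n) / \<rho> ^ Suc (Suc n) = (s n / \<rho> ^ Suc n) * (r n / \<rho>)" by (simp add: s_Suc)
    also have "\<dots> \<le> (s n / \<rho> ^ Suc n) * 1"
      using \<rho>_pos \<rho>(2)[of n] pos[of n] by (intro mult_left_mono) auto
    finally show "s (Suc n) / \<rho> ^ Suc (Suc n) \<le> s n / \<rho> ^ Suc n" by simp
  qed
  then obtain L where "(\<lambda>n. s n / \<rho> ^ Suc n) \<longlonglongrightarrow> L"
    using decseq_convergent[of "\<lambda>n. s n / \<rho> ^ Suc n" 1] t_ge by blast
  moreover have "L \<ge> 1" by (rule LIMSEQ_le_const[OF calculation]) (use t_ge in auto)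
  ultimately show ?thesis using \<rho>_pos by blast
qed

section \<open>Power iteration and idempotents\<close>

context compact_metrizable_abelian_group
begin

text \<open>Index \<open>n\<close> stands for \<open>n + 1\<close> factors, since convolution has no
  unit among continuous functions in general; hence the \<open>+ 1\<close> in
  \<open>conv_mult_power\<close>.\<close>

primrec conv_power :: "('x \<Rightarrow> complex) \<Rightarrow> nat \<Rightarrow> 'x \<Rightarrow> complex" where
  "conv_power f 0 = f"
| "conv_power f (Suc n) = conv f (conv_power f n)"

lemma conv_power_CF: "f \<in> CF \<Longrightarrow> conv_power f n \<in> CF"
  by (induction n) (auto intro: CF_conv)

lemma conv_mult_power: "f \<in> CF \<Longrightarrow> conv (conv_power f m) (conv_power f n) = conv_power f (m + n + 1)"
  by (induction m) (auto simp: conv_assoc conv_power_CF)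

lemma star_conv_power:
  assumes f: "f \<in> CF" "star f = f" shows "star (conv_power f n) = conv_power f n"
proof (induction n)
  case (Suc n)
  have "star (conv_power f (Suc n)) = conv f (conv_power f n)" using Suc f by (simp add: star_conv conv_power_CF)
  then show ?case by simp
qed (simp add: f)

lemma ip_selfadjoint: "f \<in> CF \<Longrightarrow> g \<in> CF \<Longrightarrow> star g = g \<Longrightarrow> ip f g = conv f g \<one>"
  using conv_star_one by metis

lemma nsq_selfadjoint: "f \<in> CF \<Longrightarrow> star f = f \<Longrightarrow> conv f f \<one> = of_real (nsq f)"
  using ip_selfadjoint[of f f] ip_self(1)[OF CF_cont] by simp

text \<open>The squared norm of power \<open>n\<close> is the value at the identity of power
  \<open>2 * n + 1\<close>. If power \<open>n + 1\<close> vanished, so would this one, which has it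
  as a factor.\<close>

lemma conv_power_nonzero:
  assumes f: "f \<in> CF" "star f = f" "f \<noteq> (\<lambda>x. 0)" shows "conv_power f n \<noteq> (\<lambda>x. 0)"
proof (induction n)
  case (Suc n)
  show ?case
  proof
    assume z: "conv_power f (Suc n) = (\<lambda>x. 0)"
    have "conv (conv_power f n) (conv_power f n) \<one> = of_real (nsq (conv_power f n))"
      by (intro nsq_selfadjoint conv_power_CF star_conv_power f)
    then have nz: "conv_power f (n + n + 1) \<one> \<noteq> 0"
      using nsq_pos[OF conv_power_CF[OF f(1)] Suc] by (simp add: conv_mult_power f)
    show False
    proof (cases n)
      case 0 then show False using nz z by simp
    next
      case (Suc k)
      have "conv_power f (n + n + 1) = conv (conv_power f k) (conv_power f (Suc n))"
        using conv_mult_power[OF f(1), of k "Suc n"] Suc by simp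
      then show False using nz z conv_zero[OF conv_power_CF[OF f(1)]] by simp
    qed
  qed
qed (simp add: f)

lemma nsq_diff_selfadjoint:
  assumes f: "f \<in> CF" "star f = f" and g: "g \<in> CF" "star g = g"
  shows "of_real (nsq (\<lambda>x. f x - g x)) = conv f f \<one> + conv g g \<one> - 2 * conv f g \<one>"
proof -
  have "star (\<lambda>x. f x - g x) = (\<lambda>x. star f x - star g x)" by (auto simp: star_def)
  then have s: "star (\<lambda>x. f x - g x) = (\<lambda>x. f x - g x)" by (simp add: f g)
  have "conv (\<lambda>x. f x - g x) (\<lambda>x. f x - g x) \<one> = conv f f \<one> + conv g g \<one> - 2 * conv f g \<one>"
    using conv_commute[OF f(1) g(1)]
    by (simp add: conv_diff[OF CF_diff] conv_diff_left f g)
  then show ?thesis using nsq_selfadjoint[OF CF_diff[OF f(1) g(1)] s] by simp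
qed

lemma uniform_limit_CF:
  fixes g :: "nat \<Rightarrow> 'x \<Rightarrow> complex"
  assumes g: "\<And>n. g n \<in> CF"
    and C: "\<And>\<epsilon>. \<epsilon> > 0 \<Longrightarrow> \<exists>N. \<forall>m\<ge>N. \<forall>n\<ge>N. \<forall>x. cmod (g m x - g n x) \<le> \<epsilon>"
  shows "\<exists>\<psi>\<in>CF. \<forall>\<epsilon>>0. \<exists>N. \<forall>n\<ge>N. \<forall>x. cmod (g n x - \<psi> x) \<le> \<epsilon>"
proof -
  have "Cauchy (\<lambda>n. g n x)" for x
  proof (rule metric_CauchyI)
    fix \<epsilon> :: real assume "\<epsilon> > 0"
    then obtain N where "\<forall>m\<ge>N. \<forall>n\<ge>N. cmod (g m x - g n x) \<le> \<epsilon> / 2" using C[of "\<epsilon> / 2"] by auto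
    then show "\<exists>N. \<forall>m\<ge>N. \<forall>n\<ge>N. dist (g m x) (g n x) < \<epsilon>"
      using \<open>\<epsilon> > 0\<close> by (intro exI[of _ N]) (force simp: dist_norm)
  qed
  then have "\<forall>x. \<exists>l. (\<lambda>n. g n x) \<longlonglongrightarrow> l" using convergent_eq_Cauchy by blast
  then obtain \<psi> where \<psi>: "\<And>x. (\<lambda>n. g n x) \<longlonglongrightarrow> \<psi> x" by metis
  have unif: "\<exists>N. \<forall>n\<ge>N. \<forall>x. cmod (g n x - \<psi> x) \<le> \<epsilon>" if "\<epsilon> > 0" for \<epsilon>
  proof -
    obtain N where N: "\<forall>m\<ge>N. \<forall>n\<ge>N. \<forall>x. cmod (g m x - g n x) \<le> \<epsilon>" using C[OF \<open>\<epsilon> > 0\<close>] by auto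
    have "cmod (g n x - \<psi> x) \<le> \<epsilon>" if "n \<ge> N" for n x
      by (rule LIMSEQ_le_const2[OF tendsto_norm[OF tendsto_diff[OF tendsto_const \<psi>]]])
        (use N that in blast)
    then show ?thesis by blast
  qed
  have "cont \<psi>"
  proof (rule modulus_cont)
    fix \<epsilon> :: real assume "\<epsilon> > 0"
    then have \<epsilon>: "\<epsilon> / 3 > 0" by simp
    then obtain N where N: "\<And>x. cmod (g N x - \<psi> x) \<le> \<epsilon> / 3" using unif by blast
    obtain U where U: "openin T U" "\<one> \<in> U" "modulus U (\<epsilon> / 3) (g N)" using cont_modulus[OF CF_cont[OF g] \<epsilon>] by auto
    have "modulus U \<epsilon> \<psi>"
      unfolding modulus_def
    proof (intro ballI)
      fix x u assume "x \<in> carrier X" "u \<in> U"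
      then have 1: "cmod (g N (x \<otimes> u) - g N x) \<le> \<epsilon> / 3" using U(3) by (auto simp: modulus_def)
      have "\<psi> (x \<otimes> u) - \<psi> x = (g N (x \<otimes> u) - g N x) - (g N (x \<otimes> u) - \<psi> (x \<otimes> u)) + (g N x - \<psi> x)" by simp
      also have "cmod \<dots> \<le> cmod (g N (x \<otimes> u) - g N x) + cmod (g N (x \<otimes> u) - \<psi> (x \<otimes> u)) + cmod (g N x - \<psi> x)"
        by (intro order_trans[OF norm_triangle_ineq] add_mono order_refl norm_triangle_ineq4)
      finally show "cmod (\<psi> (x \<otimes> u) - \<psi> x) \<le> \<epsilon>" using 1 N[of "x \<otimes> u"] N[of x] by linarith
    qed
    then show "\<exists>U. openin T U \<and> \<one> \<in> U \<and> modulus U \<epsilon> \<psi>" using U by blast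
  qed
  moreover have "\<psi> x = 0" if "x \<notin> carrier X" for x
    using \<psi>[of x] CF_outside[OF g that] by (simp add: LIMSEQ_const_iff)
  ultimately have "\<psi> \<in> CF" by (simp add: CF_def)
  then show ?thesis using unif by blast
qed

lemma nsq_le_sup:
  assumes f: "f \<in> CF" and B: "\<And>x. cmod (f x) \<le> B"
  shows "nsq f \<le> B\<^sup>2"
proof -
  have c: "cont (\<lambda>y. f y * cnj (f y))" by (intro cont_intros CF_comp[OF f])
  have "B \<ge> 0" using B norm_ge_zero order_trans by blast
  then have "cmod (f y * cnj (f y)) \<le> B\<^sup>2" for y
    using B[of y] by (simp add: norm_mult power2_eq_square mult_mono)
  then have "cmod (ip f f) \<le> B\<^sup>2" unfolding ip_def by (intro norm_haar_le c)
  then show ?thesis using complex_Re_le_cmod[of "ip f f"] by (simp add: nsq_def)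
qed

lemma conv_uniform_tendsto:
  fixes g :: "nat \<Rightarrow> 'x \<Rightarrow> complex"
  assumes h: "h \<in> CF" and g: "\<And>n. g n \<in> CF" and \<psi>: "\<psi> \<in> CF"
    and U: "\<forall>\<epsilon>>0. \<exists>N. \<forall>n\<ge>N. \<forall>x. cmod (g n x - \<psi> x) \<le> \<epsilon>"
  shows "(\<lambda>n. conv h (g n) x) \<longlonglongrightarrow> conv h \<psi> x"
proof (rule LIMSEQ_I)
  fix \<epsilon> :: real assume \<epsilon>: "\<epsilon> > 0"
  define \<delta> where "\<delta> = \<epsilon> / (sqrt (nsq h) + 1)"
  have sq: "sqrt (nsq h) \<ge> 0" using ip_self(2)[OF CF_cont[OF h]] by simp
  have \<delta>: "\<delta> > 0" using \<epsilon> sq by (simp add: \<delta>_def add_nonneg_pos)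
  then obtain N where N: "\<And>n x. n \<ge> N \<Longrightarrow> cmod (g n x - \<psi> x) \<le> \<delta>" using U by blast
  have "cmod (conv h (g n) x - conv h \<psi> x) < \<epsilon>" if "n \<ge> N" for n
  proof -
    have "(cmod (conv h (g n) x - conv h \<psi> x))\<^sup>2 \<le> nsq h * nsq (\<lambda>x. g n x - \<psi> x)"
      using conv_bound[OF h CF_diff[OF g[of n] \<psi>], where x = x] by (simp add: conv_diff h g \<psi>)
    also have "\<dots> \<le> nsq h * \<delta>\<^sup>2"
      by (intro mult_left_mono nsq_le_sup CF_diff g \<psi> N that ip_self(2) CF_cont h)
    also have "\<dots> = (sqrt (nsq h) * \<delta>)\<^sup>2"
      using ip_self(2)[OF CF_cont[OF h]] by (simp only: power_mult_distrib real_sqrt_pow2)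
    finally have "cmod (conv h (g n) x - conv h \<psi> x) \<le> sqrt (nsq h) * \<delta>"
      by (rule power2_le_imp_le) (intro mult_nonneg_nonneg sq less_imp_le[OF \<delta>])
    also have "\<dots> < (sqrt (nsq h) + 1) * \<delta>" using \<delta> by simp
    also have "\<dots> = \<epsilon>"
    proof -
      have "sqrt (nsq h) + 1 \<noteq> 0" using sq by linarith
      then show ?thesis by (simp add: \<delta>_def)
    qed
    finally show ?thesis .
  qed
  then show "\<exists>N. \<forall>n\<ge>N. norm (conv h (g n) x - conv h \<psi> x) < \<epsilon>" by blast
qed

text \<open>Power iteration: the normalised even powers of \<open>f\<close> converge to the projection onto the top
  eigenspace of convolution with \<open>f * f\<close>.\<close>

lemma ex_idempotent:
  assumes f: "f \<in> CF" "star f = f" "f \<noteq> (\<lambda>x. 0)"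
  shows "\<exists>\<psi> \<rho>. \<psi> \<in> CF \<and> star \<psi> = \<psi> \<and> \<psi> \<noteq> (\<lambda>x. 0) \<and> conv \<psi> \<psi> = \<psi> \<and> \<rho> > 0 \<and>
    conv (conv f f) \<psi> = (\<lambda>x. complex_of_real \<rho> * \<psi> x)"
proof -
  \<comment> \<open>Log-convexity of \<open>S\<close> will be Cauchy-Schwarz for the powers
    \<open>n\<close> and \<open>n + 2\<close>. Submultiplicativity comes from bounding an inner
    product by the product of two sup norms.\<close>
  define S where "S n = nsq (conv_power f n)" for n
  have S: "conv_power f (2 * n + 1) \<one> = of_real (S n)" for n
    using nsq_selfadjoint[OF conv_power_CF[OF f(1)] star_conv_power[OF f(1,2)], of n] conv_mult_power[OF f(1), of n n]
    by (simp add: S_def mult_2)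
  have ip_conv_power: "ip (conv_power f m) (conv_power f n) = conv_power f (m + n + 1) \<one>" for m n
    using ip_selfadjoint[OF conv_power_CF[OF f(1)] conv_power_CF[OF f(1)] star_conv_power[OF f(1,2)]] conv_mult_power[OF f(1)] by simp
  have S_pos: "S n > 0" for n unfolding S_def by (intro nsq_pos conv_power_CF conv_power_nonzero f)
  have lc: "(S (Suc n))\<^sup>2 \<le> S n * S (Suc (Suc n))" for n
  proof -
    have "n + Suc (Suc n) + 1 = 2 * Suc n + 1" by simp
    then have "ip (conv_power f n) (conv_power f (Suc (Suc n))) = of_real (S (Suc n))" by (simp only: ip_conv_power S)
    then show ?thesis
      using ip_Cauchy_Schwarz[OF conv_power_CF[OF f(1)] conv_power_CF[OF f(1)], of n "Suc (Suc n)"] by (simp add: S_def)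
  qed
  have sup: "cmod (conv_power f (2 * n + 1) x) \<le> S n" for n x
  proof -
    have "conv_power f (2 * n + 1) = conv (conv_power f n) (conv_power f n)" using conv_mult_power[OF f(1), of n n] by (simp add: mult_2)
    then have "(cmod (conv_power f (2 * n + 1) x))\<^sup>2 \<le> (S n)\<^sup>2"
      using conv_bound[OF conv_power_CF[OF f(1), of n] conv_power_CF[OF f(1), of n], where x = x] by (simp add: S_def power2_eq_square)
    then show ?thesis using S_pos[of n] by - (rule power2_le_imp_le, auto)
  qed
  have sub: "S (n + m + 1) \<le> S n * S m" for n m
  proof -
    have "(2 * n + 1) + (2 * m + 1) + 1 = 2 * (n + m + 1) + 1" by simp
    then have "ip (conv_power f (2 * n + 1)) (conv_power f (2 * m + 1)) = of_real (S (n + m + 1))" by (simp only: ip_conv_power S)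
    moreover have "cmod (ip (conv_power f (2 * n + 1)) (conv_power f (2 * m + 1))) \<le> S n * S m"
      unfolding ip_def
    proof (rule norm_haar_le)
      show "cont (\<lambda>y. conv_power f (2 * n + 1) y * cnj (conv_power f (2 * m + 1) y))" by (intro cont_intros CF_comp[OF conv_power_CF[OF f(1)]])
      show "cmod (conv_power f (2 * n + 1) x * cnj (conv_power f (2 * m + 1) x)) \<le> S n * S m" for x
        unfolding norm_mult complex_mod_cnj using S_pos[of n] by (intro mult_mono sup) auto
    qed
    ultimately show ?thesis by simp
  qed
  obtain \<rho> L where \<rho>: "\<rho> > 0" "L \<ge> 1" "(\<lambda>n. S n / \<rho> ^ Suc n) \<longlonglongrightarrow> L"
    using log_convex_submultiplicative_limit[OF S_pos lc sub] by blast
  define t where "t n = S n / \<rho> ^ Suc n" for n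
  \<comment> \<open>\<open>conv_power f (2 * n + 1)\<close> has \<open>2 * n + 2\<close> factors, so
    \<open>g n\<close> is the power of \<open>conv f f\<close> with \<open>n + 1\<close> factors,
    divided by \<open>\<rho> ^ Suc n\<close>.\<close>
  define g where "g n = (\<lambda>x. complex_of_real (1 / \<rho> ^ Suc n) * conv_power f (2 * n + 1) x)" for n
  have g_CF: "g n \<in> CF" for n unfolding g_def by (intro CF_scale conv_power_CF f)
  have star_scale: "star (\<lambda>x. complex_of_real c * h x) = (\<lambda>x. complex_of_real c * star h x)" for c h
    by (auto simp: star_def)
  have g_star: "star (g n) = g n" for n unfolding g_def star_scale by (simp only: star_conv_power f)
  have conv_g: "conv (g m) (g n) = g (m + n + 1)" for m n
  proof -
    have "(2 * m + 1) + (2 * n + 1) + 1 = 2 * (m + n + 1) + 1" by simp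
    then have "conv (conv_power f (2 * m + 1)) (conv_power f (2 * n + 1)) = conv_power f (2 * (m + n + 1) + 1)"
      using conv_mult_power[OF f(1)] by metis
    moreover have "1 / \<rho> ^ Suc n * (1 / \<rho> ^ Suc m) = 1 / \<rho> ^ Suc (m + n + 1)"
      by (simp add: power_add)
    ultimately show ?thesis
      unfolding g_def
      by (simp only: conv_scale conv_scale_left CF_scale conv_power_CF f mult.assoc[symmetric] of_real_mult[symmetric])
  qed
  have g_one: "g n \<one> = of_real (t n)" for n by (simp only: g_def S t_def of_real_mult[symmetric]) simp
  have t_lim: "t \<longlonglongrightarrow> L" using \<rho>(3) by (simp add: t_def[abs_def])
  define a where "a = conv f f"
  have a_CF: "a \<in> CF" unfolding a_def by (intro CF_conv f)
  have conv_a: "conv a (g n) = (\<lambda>x. complex_of_real \<rho> * g (Suc n) x)" for n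
  proof -
    have "a = conv_power f 1" by (simp add: a_def)
    moreover have "1 + (2 * n + 1) + 1 = 2 * Suc n + 1" by simp
    ultimately have conv_power: "conv a (conv_power f (2 * n + 1)) = conv_power f (2 * Suc n + 1)"
      using conv_mult_power[OF f(1), of 1 "2 * n + 1"] by simp
    have "complex_of_real (1 / \<rho> ^ Suc n) * z = complex_of_real \<rho> * (complex_of_real (1 / \<rho> ^ Suc (Suc n)) * z)" for z
      using \<rho>(1) by simp
    then show ?thesis
      unfolding g_def conv_scale[OF a_CF conv_power_CF[OF f(1)]] conv_power by (rule HOL.ext)
  qed
  \<comment> \<open>All three values of \<open>t\<close> tend to \<open>L\<close>, so the
    \<open>g n\<close> form a Cauchy sequence in L2.\<close>
  have nsq_g: "nsq (\<lambda>x. g m x - g n x) = t (2 * m + 1) + t (2 * n + 1) - 2 * t (m + n + 1)" for m n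
  proof -
    have "complex_of_real (nsq (\<lambda>x. g m x - g n x)) = conv (g m) (g m) \<one> + conv (g n) (g n) \<one> - 2 * conv (g m) (g n) \<one>"
      by (rule nsq_diff_selfadjoint[OF g_CF g_star g_CF g_star])
    also have "\<dots> = complex_of_real (t (m + m + 1) + t (n + n + 1) - 2 * t (m + n + 1))"
      unfolding conv_g g_one by simp
    finally have "nsq (\<lambda>x. g m x - g n x) = t (m + m + 1) + t (n + n + 1) - 2 * t (m + n + 1)"
      by (simp only: of_real_eq_iff)
    then show ?thesis by (simp only: mult_2)
  qed
  \<comment> \<open>Convolution with \<open>a\<close> makes an L2 Cauchy sequence uniformly Cauchy
    by \<open>conv_bound\<close>, and on the \<open>g n\<close> it merely shifts the index and
    multiplies by \<open>\<rho>\<close>.\<close>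
  have cauchy: "\<exists>N. \<forall>m\<ge>N. \<forall>n\<ge>N. \<forall>x. cmod (g m x - g n x) \<le> \<epsilon>" if \<epsilon>: "\<epsilon> > 0" for \<epsilon>
  proof -
    have na: "nsq a \<ge> 0" by (intro ip_self(2) CF_cont a_CF)
    \<comment> \<open>Chosen so that the bound \<open>nsq a * (4 * \<delta>)\<close> for the squared
      value stays within \<open>(\<rho> * \<epsilon>)\<close> squared; the \<open>+ 1\<close>
      prevents division by 0.\<close>
    define \<delta> where "\<delta> = (\<rho> * \<epsilon>)\<^sup>2 / (4 * (nsq a + 1))"
    have \<delta>: "\<delta> > 0" using \<epsilon> \<rho>(1) na by (simp add: \<delta>_def)
    obtain N where N: "\<And>n. n \<ge> N \<Longrightarrow> \<bar>t n - L\<bar> < \<delta>" using LIMSEQ_D[OF t_lim \<delta>] by auto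
    have step: "cmod (g (Suc m) x - g (Suc n) x) \<le> \<epsilon>" if "m \<ge> N" "n \<ge> N" for m n x
    proof -
      have "nsq (\<lambda>x. g m x - g n x) \<le> 4 * \<delta>"
        using N[of "2 * m + 1"] N[of "2 * n + 1"] N[of "m + n + 1"] that unfolding nsq_g by (simp add: abs_less_iff)
      then have "nsq a * nsq (\<lambda>x. g m x - g n x) \<le> (nsq a + 1) * (4 * \<delta>)"
        using na ip_self(2)[OF CF_cont[OF CF_diff[OF g_CF g_CF]]] by (intro mult_mono) auto
      also have "\<dots> = (\<rho> * \<epsilon>)\<^sup>2" using na by (simp add: \<delta>_def field_simps add_nonneg_eq_0_iff)
      finally have "(cmod (conv a (\<lambda>x. g m x - g n x) x))\<^sup>2 \<le> (\<rho> * \<epsilon>)\<^sup>2"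
        using conv_bound[OF a_CF CF_diff[OF g_CF[of m] g_CF[of n]], where x = x] by linarith
      then have "cmod (conv a (\<lambda>x. g m x - g n x) x) \<le> \<rho> * \<epsilon>"
        using \<rho>(1) \<epsilon> by - (rule power2_le_imp_le, auto)
      moreover have "conv a (\<lambda>x. g m x - g n x) x = complex_of_real \<rho> * (g (Suc m) x - g (Suc n) x)"
        by (simp add: conv_diff[OF a_CF g_CF g_CF] conv_a right_diff_distrib)
      ultimately show ?thesis using \<rho>(1) by (simp add: norm_mult)
    qed
    have "cmod (g m x - g n x) \<le> \<epsilon>" if "m \<ge> Suc N" "n \<ge> Suc N" for m n x
      using that step[of "m - 1" "n - 1" x] by (cases m; cases n) auto
    then show ?thesis by blast
  qed
  obtain \<psi> where \<psi>: "\<psi> \<in> CF" "\<forall>\<epsilon>>0. \<exists>N. \<forall>n\<ge>N. \<forall>x. cmod (g n x - \<psi> x) \<le> \<epsilon>"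
    using uniform_limit_CF[OF g_CF cauchy] by blast
  have lim: "(\<lambda>n. g n x) \<longlonglongrightarrow> \<psi> x" for x
  proof (rule LIMSEQ_I)
    fix \<epsilon> :: real assume "\<epsilon> > 0"
    then obtain N where N: "\<forall>n\<ge>N. \<forall>x. cmod (g n x - \<psi> x) \<le> \<epsilon> / 2" using \<psi>(2)[rule_format, of "\<epsilon> / 2"] by auto
    have "cmod (g n x - \<psi> x) < \<epsilon>" if "n \<ge> N" for n
    proof -
      have "cmod (g n x - \<psi> x) \<le> \<epsilon> / 2" using N that by blast
      then show ?thesis using \<open>\<epsilon> > 0\<close> by linarith
    qed
    then show "\<exists>N. \<forall>n\<ge>N. norm (g n x - \<psi> x) < \<epsilon>" by blast
  qed
  \<comment> \<open>The bound \<open>L \<ge> 1\<close> is what keeps the limit from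
    vanishing.\<close>
  have "(\<lambda>n. g n \<one>) \<longlonglongrightarrow> of_real L" unfolding g_one by (intro tendsto_of_real t_lim)
  then have "\<psi> \<one> = of_real L" using LIMSEQ_unique[OF lim] by blast
  then have nz: "\<psi> \<noteq> (\<lambda>x. 0)" using \<rho>(2) by auto
  have star_psi: "star \<psi> = \<psi>"
  proof (rule CF_eqI[OF CF_star[OF \<psi>(1)] \<psi>(1)])
    fix x assume x: "x \<in> carrier X"
    have "(\<lambda>n. cnj (g n (inv x))) \<longlonglongrightarrow> cnj (\<psi> (inv x))" by (intro tendsto_cnj lim)
    moreover have "cnj (g n (inv x)) = g n x" for n
      using g_star[of n] x unfolding star_def fun_eq_iff by metis
    ultimately have "(\<lambda>n. g n x) \<longlonglongrightarrow> cnj (\<psi> (inv x))" by simp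
    then show "star \<psi> x = \<psi> x" using LIMSEQ_unique[OF lim] x by (simp add: star_def)
  qed
  have g_psi: "conv (g m) \<psi> = \<psi>" for m
  proof
    fix x
    have "(\<lambda>n. conv (g m) (g n) x) \<longlonglongrightarrow> conv (g m) \<psi> x"
      by (rule conv_uniform_tendsto[OF g_CF g_CF \<psi>])
    moreover have "(\<lambda>n. conv (g m) (g n) x) \<longlonglongrightarrow> \<psi> x"
      using LIMSEQ_ignore_initial_segment[OF lim[of x], of "m + 1"] by (simp add: conv_g add.commute add.left_commute)
    ultimately show "conv (g m) \<psi> x = \<psi> x" by (rule LIMSEQ_unique)
  qed
  have psi_psi: "conv \<psi> \<psi> = \<psi>"
  proof
    fix x
    have "(\<lambda>n. conv \<psi> (g n) x) \<longlonglongrightarrow> conv \<psi> \<psi> x"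
      by (rule conv_uniform_tendsto[OF \<psi>(1) g_CF \<psi>])
    moreover have "conv \<psi> (g n) = \<psi>" for n using g_psi conv_commute[OF \<psi>(1) g_CF] by simp
    ultimately show "conv \<psi> \<psi> x = \<psi> x" by (simp add: LIMSEQ_const_iff)
  qed
  have a_psi: "conv a \<psi> = (\<lambda>x. complex_of_real \<rho> * \<psi> x)"
  proof
    fix x
    have "(\<lambda>n. conv a (g n) x) \<longlonglongrightarrow> conv a \<psi> x"
      by (rule conv_uniform_tendsto[OF a_CF g_CF \<psi>])
    moreover have "(\<lambda>n. conv a (g n) x) \<longlonglongrightarrow> complex_of_real \<rho> * \<psi> x"
      unfolding conv_a by (intro tendsto_mult tendsto_const LIMSEQ_Suc lim)
    ultimately show "conv a \<psi> x = complex_of_real \<rho> * \<psi> x" by (rule LIMSEQ_unique)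
  qed
  show ?thesis using \<psi>(1) star_psi nz psi_psi \<rho>(1) a_psi unfolding a_def by blast
qed

text \<open>Since \<open>\<psi> = conv \<psi> \<psi>\<close>, its sup norm is at most
  \<open>nsq \<psi>\<close>, whence \<open>nsq \<psi>\<close> is at most its own square.\<close>

lemma idempotent_nsq_ge_1:
  assumes \<psi>: "\<psi> \<in> CF" "star \<psi> = \<psi>" "conv \<psi> \<psi> = \<psi>" "\<psi> \<noteq> (\<lambda>x. 0)"
  shows "1 \<le> nsq \<psi>" "\<psi> \<one> = of_real (nsq \<psi>)"
proof -
  show "\<psi> \<one> = of_real (nsq \<psi>)" using nsq_selfadjoint[OF \<psi>(1,2)] \<psi>(3) by simp
  have pos: "nsq \<psi> > 0" by (rule nsq_pos[OF \<psi>(1,4)])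
  have "cmod (\<psi> x) \<le> nsq \<psi>" for x
    using conv_bound[OF \<psi>(1,1), where x = x] \<psi>(3) pos by - (rule power2_le_imp_le, auto simp: power2_eq_square)
  from nsq_le_sup[OF \<psi>(1) this] have "nsq \<psi> * 1 \<le> nsq \<psi> * nsq \<psi>" by (simp add: power2_eq_square)
  then show "1 \<le> nsq \<psi>" using pos by simp
qed

end

section \<open>Characters\<close>

context compact_metrizable_abelian_group
begin

text \<open>In hindsight these are the nonempty finite sums of distinct characters, and
  \<open>nsq\<close> counts the summands.\<close>

definition idem :: "('x \<Rightarrow> complex) \<Rightarrow> bool" where
  "idem \<psi> \<longleftrightarrow> \<psi> \<in> CF \<and> star \<psi> = \<psi> \<and> \<psi> \<noteq> (\<lambda>x. 0) \<and> conv \<psi> \<psi> = \<psi>"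

lemma star_diff: "star (\<lambda>x. f x - g x) = (\<lambda>x. star f x - star g x)"
  by (auto simp: star_def)

lemma star_scale: "star (\<lambda>x. c * f x) = (\<lambda>x. cnj c * star f x)"
  by (auto simp: star_def)

lemma star_add: "star (\<lambda>x. f x + g x) = (\<lambda>x. star f x + star g x)"
  by (auto simp: star_def)

text \<open>The difference is again an idempotent, so its squared norm is at least 1. For
  idempotents the squared norm is the value at the identity, hence additive.\<close>

lemma idem_diff:
  assumes \<psi>: "idem \<psi>" and \<phi>: "idem \<phi>" and le: "conv \<psi> \<phi> = \<phi>" and ne: "\<psi> \<noteq> \<phi>"
  shows "nsq \<phi> + 1 \<le> nsq \<psi>"
proof -
  let ?d = "\<lambda>x. \<psi> x - \<phi> x"
  have CF: "\<psi> \<in> CF" "\<phi> \<in> CF" using \<psi> \<phi> by (auto simp: idem_def)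
  have s: "star ?d = ?d" using \<psi> \<phi> by (simp add: star_diff idem_def)
  have "conv ?d ?d = (\<lambda>x. conv \<psi> \<psi> x - conv \<psi> \<phi> x - (conv \<phi> \<psi> x - conv \<phi> \<phi> x))"
    by (simp add: conv_diff_left[OF CF_diff] conv_diff CF)
  also have "\<dots> = ?d" using \<psi> \<phi> le conv_commute[OF CF] by (simp add: idem_def)
  finally have c: "conv ?d ?d = ?d" .
  have nz: "?d \<noteq> (\<lambda>x. 0)" using ne by (auto simp: fun_eq_iff)
  have "1 \<le> nsq ?d" "?d \<one> = of_real (nsq ?d)"
    using idempotent_nsq_ge_1[OF CF_diff[OF CF] s c nz] by auto
  moreover have "\<psi> \<one> = of_real (nsq \<psi>)" "\<phi> \<one> = of_real (nsq \<phi>)"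
    using idempotent_nsq_ge_1[of \<psi>] idempotent_nsq_ge_1[of \<phi>] \<psi> \<phi> by (auto simp: idem_def)
  ultimately have "complex_of_real (nsq \<psi> - nsq \<phi>) = of_real (nsq ?d)" by simp
  then have "nsq \<psi> - nsq \<phi> = nsq ?d" by (simp only: of_real_eq_iff)
  with \<open>1 \<le> nsq ?d\<close> show ?thesis by simp
qed

text \<open>The idempotent that power iteration extracts from \<open>f\<close> lies below
  \<open>\<psi>\<close>, because \<open>\<psi>\<close> fixes \<open>f\<close>, and so equals
  \<open>\<psi>\<close> by minimality. Then \<open>conv f f\<close>, being fixed by
  \<open>\<psi>\<close>, is the eigenvalue times \<open>\<psi>\<close>.\<close>

lemma minimal_idem_square:
  assumes \<psi>: "idem \<psi>" and min: "\<And>\<phi>. idem \<phi> \<Longrightarrow> conv \<psi> \<phi> = \<phi> \<Longrightarrow> \<phi> = \<psi>"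
    and f: "f \<in> CF" "star f = f" "conv \<psi> f = f" "f \<noteq> (\<lambda>x. 0)"
  shows "\<exists>r>0. conv f f = (\<lambda>x. complex_of_real r * \<psi> x)"
proof -
  obtain \<phi> r where \<phi>: "\<phi> \<in> CF" "star \<phi> = \<phi>" "\<phi> \<noteq> (\<lambda>x. 0)" "conv \<phi> \<phi> = \<phi>" and r: "r > 0"
    and ev: "conv (conv f f) \<phi> = (\<lambda>x. complex_of_real r * \<phi> x)"
    using ex_idempotent[OF f(1,2,4)] by blast
  have CF: "\<psi> \<in> CF" using \<psi> by (simp add: idem_def)
  have "(\<lambda>x. complex_of_real r * conv \<psi> \<phi> x) = conv \<psi> (conv (conv f f) \<phi>)"
    by (simp add: ev conv_scale CF \<phi>)
  also have "\<dots> = conv (conv (conv \<psi> f) f) \<phi>"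
    by (simp add: conv_assoc CF \<phi> f(1) CF_conv)
  also have "\<dots> = (\<lambda>x. complex_of_real r * \<phi> x)" by (simp add: f(3) ev)
  finally have "complex_of_real r * conv \<psi> \<phi> x = complex_of_real r * \<phi> x" for x by (rule fun_cong)
  then have "conv \<psi> \<phi> = \<phi>" using r by (intro HOL.ext) simp
  then have eq: "\<phi> = \<psi>" using min \<phi> by (simp add: idem_def)
  have "conv f f = conv f (conv \<psi> f)" by (simp add: f(3))
  also have "\<dots> = conv f (conv f \<psi>)" using conv_commute[OF CF f(1)] by simp
  also have "\<dots> = conv (conv f f) \<psi>" by (simp add: conv_assoc f CF)
  finally show ?thesis using ev r eq by auto
qed

text \<open>With \<open>q\<close> the square root of \<open>r\<close>, the equation
  \<open>conv f f = r * \<psi>\<close> factors as a vanishing product of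
  \<open>f - q * \<psi>\<close> and \<open>f + q * \<psi>\<close>. If the first factor is nonzero,
  its square is a positive multiple of \<open>\<psi>\<close>, which forces the second factor to be
  0.\<close>

lemma minimal_idem_multiple:
  assumes \<psi>: "idem \<psi>" and min: "\<And>\<phi>. idem \<phi> \<Longrightarrow> conv \<psi> \<phi> = \<phi> \<Longrightarrow> \<phi> = \<psi>"
    and f: "f \<in> CF" "star f = f" "conv \<psi> f = f"
  shows "\<exists>c. f = (\<lambda>x. c * \<psi> x)"
proof (cases "f = (\<lambda>x. 0)")
  case True then show ?thesis by (intro exI[of _ 0]) simp
next
  case False
  have CF: "\<psi> \<in> CF" and \<psi>2: "conv \<psi> \<psi> = \<psi>" "star \<psi> = \<psi>" using \<psi> by (auto simp: idem_def)
  obtain r where r: "r > 0" "conv f f = (\<lambda>x. complex_of_real r * \<psi> x)"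
    using minimal_idem_square[OF \<psi> min f False] by blast
  define q where "q = complex_of_real (sqrt r)"
  have q2: "q * q = complex_of_real r" using r(1) by (simp add: q_def flip: of_real_mult)
  have cq: "cnj q = q" by (simp add: q_def)
  let ?p = "\<lambda>x. f x + q * \<psi> x" and ?m = "\<lambda>x. f x - q * \<psi> x"
  have pm_CF: "?p \<in> CF" "?m \<in> CF" by (intro CF_add CF_diff CF_scale f CF)+
  have fpsi: "conv f \<psi> = f" using conv_commute[OF f(1) CF] f(3) by simp
  have "conv ?m ?p = (\<lambda>x. conv f f x + q * conv f \<psi> x - (q * conv \<psi> f x + q * q * conv \<psi> \<psi> x))"
    by (simp add: conv_diff_left[OF pm_CF(1)] conv_scale_left conv_add conv_scale CF_scale CF f(1) pm_CF distrib_left mult.assoc)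
  also have "\<dots> = (\<lambda>x. 0)" by (simp add: r(2) fpsi f(3) \<psi>2 q2)
  finally have mp: "conv ?m ?p = (\<lambda>x. 0)" .
  show ?thesis
  proof (cases "?m = (\<lambda>x. 0)")
    case True
    then have "f = (\<lambda>x. q * \<psi> x)" by (simp add: fun_eq_iff)
    then show ?thesis by blast
  next
    case False
    have m_star: "star ?m = ?m" by (simp add: star_diff star_scale f(2) \<psi>2 cq)
    have m_psi: "conv \<psi> ?m = ?m" by (simp add: conv_diff conv_scale CF_scale CF f \<psi>2)
    obtain s where s: "s > 0" "conv ?m ?m = (\<lambda>x. complex_of_real s * \<psi> x)"
      using minimal_idem_square[OF \<psi> min pm_CF(2) m_star m_psi False] by blast
    have "(\<lambda>x. complex_of_real s * conv \<psi> ?p x) = conv (conv ?m ?m) ?p"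
      by (simp add: s(2) conv_scale_left CF pm_CF)
    also have "\<dots> = (\<lambda>x. 0)"
      by (simp add: conv_assoc[OF pm_CF(2,2,1)] mp conv_zero pm_CF)
    finally have "complex_of_real s * conv \<psi> ?p x = 0" for x by (rule fun_cong)
    then have "conv \<psi> ?p x = 0" for x using s(1) by simp
    moreover have "conv \<psi> ?p = ?p" by (simp add: conv_add conv_scale CF_scale CF f \<psi>2)
    ultimately have "f x + q * \<psi> x = 0" for x by metis
    then have "f = (\<lambda>x. (- q) * \<psi> x)" by (auto simp: fun_eq_iff eq_neg_iff_add_eq_0)
    then show ?thesis by blast
  qed
qed

text \<open>A translate of \<open>\<psi>\<close> is fixed by \<open>\<psi>\<close> but need not be
  self-adjoint, so it is split as \<open>h1 + \<i> * h2\<close> with self-adjoint \<open>h1\<close>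
  and \<open>h2\<close>.\<close>

lemma minimal_idem_tau:
  assumes \<psi>: "idem \<psi>" and min: "\<And>\<phi>. idem \<phi> \<Longrightarrow> conv \<psi> \<phi> = \<phi> \<Longrightarrow> \<phi> = \<psi>"
    and y: "y \<in> carrier X"
  shows "\<exists>c. tau y \<psi> = (\<lambda>x. c * \<psi> x)"
proof -
  have CF: "\<psi> \<in> CF" and \<psi>2: "conv \<psi> \<psi> = \<psi>" "star \<psi> = \<psi>" using \<psi> by (auto simp: idem_def)
  define h where "h = tau y \<psi>"
  have h: "h \<in> CF" unfolding h_def by (intro CF_tau CF y)
  have hs: "star h \<in> CF" by (rule CF_star[OF h])
  have ph: "conv \<psi> h = h" using conv_tau[OF CF CF y] by (simp add: h_def \<psi>2)
  have phs: "conv \<psi> (star h) = star h" using star_conv[OF CF h] by (simp add: \<psi>2 ph)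
  define h1 where "h1 = (\<lambda>x. (1/2) * (h x + star h x))"
  define h2 where "h2 = (\<lambda>x. (- \<i>/2) * (h x - star h x))"
  have h1: "h1 \<in> CF" unfolding h1_def by (intro CF_scale CF_add h hs)
  have "star h1 = h1" unfolding h1_def by (simp only: star_scale star_add star_star[OF h]) (simp add: add.commute)
  moreover have "conv \<psi> h1 = h1" unfolding h1_def by (simp only: conv_scale conv_add CF_add CF h hs ph phs)
  ultimately obtain c1 where c1: "h1 = (\<lambda>x. c1 * \<psi> x)" using minimal_idem_multiple[OF \<psi> min h1] by blast
  have h2: "h2 \<in> CF" unfolding h2_def by (intro CF_scale CF_diff h hs)
  have "star h2 = h2" unfolding h2_def by (simp only: star_scale star_diff star_star[OF h]) (simp add: fun_eq_iff field_simps)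
  moreover have "conv \<psi> h2 = h2" unfolding h2_def by (simp only: conv_scale conv_diff CF_diff CF h hs ph phs)
  ultimately obtain c2 where c2: "h2 = (\<lambda>x. c2 * \<psi> x)" using minimal_idem_multiple[OF \<psi> min h2] by blast
  have "h x = h1 x + \<i> * h2 x" for x by (simp add: h1_def h2_def field_simps)
  then have "h = (\<lambda>x. (c1 + \<i> * c2) * \<psi> x)" unfolding c1 c2 by (simp add: fun_eq_iff distrib_right mult.assoc)
  then show ?thesis unfolding h_def by blast
qed

text \<open>The complex-valued counterpart of \<open>characters\<close>, with no condition outside
  the carrier; \<open>characters_iff\<close> links the two.\<close>

definition character :: "('x \<Rightarrow> complex) \<Rightarrow> bool" where
  "character \<eta> \<longleftrightarrow> cont \<eta> \<and> (\<forall>x\<in>carrier X. \<forall>y\<in>carrier X. \<eta> (x \<otimes> y) = \<eta> x * \<eta> y) \<and> (\<forall>x\<in>carrier X. cmod (\<eta> x) = 1)"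

text \<open>\<open>\<psi>\<close> is an eigenvector of every translation, and evaluating the
  eigenvector equation at \<open>y\<close> gives the eigenvalue
  \<open>\<psi> \<one> / \<psi> y\<close>; this is multiplicativity of the normalised function.
  Self-adjointness turns inversion into conjugation, which makes the modulus 1.\<close>

lemma minimal_idem_character:
  assumes \<psi>: "idem \<psi>" and min: "\<And>\<phi>. idem \<phi> \<Longrightarrow> conv \<psi> \<phi> = \<phi> \<Longrightarrow> \<phi> = \<psi>"
  shows "\<psi> \<one> \<noteq> 0" "character (\<lambda>x. \<psi> x / \<psi> \<one>)"
proof -
  have CF: "\<psi> \<in> CF" and \<psi>2: "conv \<psi> \<psi> = \<psi>" "star \<psi> = \<psi>" "\<psi> \<noteq> (\<lambda>x. 0)" using \<psi> by (auto simp: idem_def)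
  have one: "1 \<le> nsq \<psi>" "\<psi> \<one> = of_real (nsq \<psi>)" using idempotent_nsq_ge_1[OF CF \<psi>2(2,1,3)] by auto
  then show nz: "\<psi> \<one> \<noteq> 0" by auto
  let ?\<eta> = "\<lambda>x. \<psi> x / \<psi> \<one>"
  have mult: "?\<eta> (y \<otimes> x) = ?\<eta> y * ?\<eta> x" if x: "x \<in> carrier X" and y: "y \<in> carrier X" for x y
  proof -
    obtain c where c: "tau y \<psi> = (\<lambda>x. c * \<psi> x)" using minimal_idem_tau[OF \<psi> min y] by blast
    have "\<psi> \<one> = c * \<psi> y" using fun_cong[OF c, of y] y by (simp add: tau_def)
    moreover have "\<psi> x = c * \<psi> (y \<otimes> x)"
      using fun_cong[OF c, of "y \<otimes> x"] x y by (simp add: tau_def m_assoc[symmetric])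
    ultimately have "\<psi> (y \<otimes> x) * \<psi> \<one> = \<psi> y * \<psi> x" by simp
    then show ?thesis using nz by (simp add: field_simps)
  qed
  have "cmod (?\<eta> x) = 1" if x: "x \<in> carrier X" for x
  proof -
    have "\<psi> (inv x) = cnj (\<psi> x)" using fun_cong[OF \<psi>2(2), of "inv x"] x by (simp add: star_def)
    then have "?\<eta> (inv x) = cnj (?\<eta> x)" by (simp add: one(2))
    then have "?\<eta> x * cnj (?\<eta> x) = ?\<eta> \<one>" using mult[of "inv x" x] x by simp
    also have "?\<eta> \<one> = 1" using nz by simp
    finally have "complex_of_real ((cmod (?\<eta> x))\<^sup>2) = 1" by (simp only: complex_norm_square)
    then have "(cmod (?\<eta> x))\<^sup>2 = 1" by (simp only: of_real_eq_1_iff)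
    then show ?thesis using power2_eq_1_iff[of "cmod (?\<eta> x)"] norm_ge_zero[of "?\<eta> x"] by linarith
  qed
  moreover have "cont ?\<eta>"
    using continuous_map_mult_complex[OF CF_cont[OF CF] cont_const[of "1 / \<psi> \<one>"]] by simp
  ultimately show "character ?\<eta>" unfolding character_def using mult by blast
qed

text \<open>The distance from \<open>p\<close> for a metric that induces the topology.\<close>

lemma ex_separating_function:
  assumes p: "p \<in> carrier X" and "p \<noteq> \<one>"
  shows "\<exists>k\<in>CF. k p = 0 \<and> k \<one> \<noteq> 0"
proof -
  obtain M d where d: "Metric_space M d" "T = Metric_space.mtopology M d"
    using metrizable_T unfolding metrizable_space_def by blast
  interpret M: Metric_space M d by (rule d(1))
  have M: "M = carrier X" using topspace_eq d(2) by simp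
  have T: "T = mtopology_of (metric (M, d))" using d(2) by simp
  have "continuous_map T euclidean (\<lambda>x. mdist (metric (M, d)) x p)"
    unfolding T by (rule continuous_map_mdist) (use p in \<open>simp_all add: M[symmetric] continuous_map_id[unfolded id_def]\<close>)
  then have "cont (\<lambda>x. complex_of_real (d x p))" by (intro continuous_map_of_real) simp
  from CF_restrict[OF this] show ?thesis
    by (rule bexI[rotated]) (use assms M M.zero[of p p] M.zero[of \<one> p] in auto)
qed

theorem characters_separate:
  assumes x0: "x0 \<in> carrier X" "x0 \<noteq> \<one>"
  shows "\<exists>\<eta>. character \<eta> \<and> \<eta> x0 \<noteq> 1"
proof -
  have "inv x0 \<noteq> \<one>" using x0 inv_eq_1_iff by blast
  then obtain k where k: "k \<in> CF" "k (inv x0) = 0" "k \<one> \<noteq> 0"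
    using ex_separating_function[of "inv x0"] x0(1) by auto
  \<comment> \<open>At the identity \<open>b\<close> has the value
    \<open>k \<one> - k (inv x0)\<close>, which is nonzero because \<open>k\<close> vanishes at
    \<open>inv x0\<close>.\<close>
  define b where "b = (\<lambda>x. k x - tau x0 k x)"
  have tk: "tau x0 k \<in> CF" by (intro CF_tau k x0)
  have b: "b \<in> CF" unfolding b_def by (intro CF_diff k tk)
  have "b \<one> \<noteq> 0" using k x0(1) by (simp add: b_def tau_def)
  then have bnz: "b \<noteq> (\<lambda>x. 0)" by auto
  define f where "f = conv b (star b)"
  have bs: "star b \<in> CF" by (rule CF_star[OF b])
  have f: "f \<in> CF" unfolding f_def by (intro CF_conv b bs)
  have fs: "star f = f" using star_conv[OF b bs] conv_commute[OF bs b] by (simp add: f_def star_star[OF b])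
  have "f \<one> = of_real (nsq b)" using conv_star_one[OF b b] ip_self(1)[OF CF_cont[OF b]] by (simp add: f_def)
  then have fnz: "f \<noteq> (\<lambda>x. 0)" using nsq_pos[OF b bnz] by auto
  obtain \<psi>0 r where \<psi>0: "\<psi>0 \<in> CF" "star \<psi>0 = \<psi>0" "\<psi>0 \<noteq> (\<lambda>x. 0)" "conv \<psi>0 \<psi>0 = \<psi>0" and r: "r > 0"
    and ev: "conv (conv f f) \<psi>0 = (\<lambda>x. complex_of_real r * \<psi>0 x)"
    using ex_idempotent[OF f fs fnz] by blast
  have "idem \<psi>0 \<and> conv \<psi>0 \<psi>0 = \<psi>0" using \<psi>0 by (simp add: idem_def)
  \<comment> \<open>Squared norms of nested idempotents differ by at least 1, so minimising the
    integer part of \<open>nsq\<close> among the idempotents below \<open>\<psi>0\<close> already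
    yields a minimal one.\<close>
  then have "\<exists>\<psi>. (idem \<psi> \<and> conv \<psi>0 \<psi> = \<psi>) \<and> (\<forall>\<phi>. idem \<phi> \<and> conv \<psi>0 \<phi> = \<phi> \<longrightarrow> nat \<lfloor>nsq \<psi>\<rfloor> \<le> nat \<lfloor>nsq \<phi>\<rfloor>)"
    by (rule ex_has_least_nat[where P = "\<lambda>\<psi>. idem \<psi> \<and> conv \<psi>0 \<psi> = \<psi>" and m = "\<lambda>\<psi>. nat \<lfloor>nsq \<psi>\<rfloor>"])
  then obtain \<psi> where \<psi>: "idem \<psi>" "conv \<psi>0 \<psi> = \<psi>"
    and least: "\<And>\<phi>. idem \<phi> \<Longrightarrow> conv \<psi>0 \<phi> = \<phi> \<Longrightarrow> nat \<lfloor>nsq \<psi>\<rfloor> \<le> nat \<lfloor>nsq \<phi>\<rfloor>"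
    by blast
  have CF: "\<psi> \<in> CF" using \<psi> by (simp add: idem_def)
  have min: "\<phi> = \<psi>" if \<phi>: "idem \<phi>" "conv \<psi> \<phi> = \<phi>" for \<phi>
  proof (rule ccontr)
    assume "\<phi> \<noteq> \<psi>"
    then have le: "nsq \<phi> + 1 \<le> nsq \<psi>" using idem_diff[OF \<psi>(1) \<phi>] by simp
    have \<phi>CF: "\<phi> \<in> CF" using \<phi> by (simp add: idem_def)
    have "conv \<psi>0 \<phi> = conv \<psi>0 (conv \<psi> \<phi>)" by (simp add: \<phi>(2))
    also have "\<dots> = conv (conv \<psi>0 \<psi>) \<phi>" by (rule conv_assoc[symmetric, OF \<psi>0(1) CF \<phi>CF])
    also have "\<dots> = \<phi>" by (simp only: \<psi>(2) \<phi>(2))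
    finally have "nat \<lfloor>nsq \<psi>\<rfloor> \<le> nat \<lfloor>nsq \<phi>\<rfloor>" by (rule least[OF \<phi>(1)])
    moreover have "0 \<le> nsq \<phi>" by (intro ip_self(2) CF_cont \<phi>CF)
    moreover have "\<lfloor>nsq \<phi> + 1\<rfloor> \<le> \<lfloor>nsq \<psi>\<rfloor>" using le by (rule floor_mono)
    ultimately show False by (simp add: nat_le_eq_zle)
  qed
  let ?\<eta> = "\<lambda>x. \<psi> x / \<psi> \<one>"
  have \<eta>: "\<psi> \<one> \<noteq> 0" "character ?\<eta>" using minimal_idem_character[OF \<psi>(1) min] by auto
  have "?\<eta> x0 \<noteq> 1"
  proof
    assume one: "?\<eta> x0 = 1"
    have "tau x0 \<psi> = \<psi>"
    proof (rule CF_eqI[OF CF_tau[OF CF x0(1)] CF])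
      fix z assume z: "z \<in> carrier X"
      have "?\<eta> (x0 \<otimes> (inv x0 \<otimes> z)) = ?\<eta> x0 * ?\<eta> (inv x0 \<otimes> z)"
        using \<eta>(2) x0(1) z unfolding character_def by blast
      moreover have "x0 \<otimes> (inv x0 \<otimes> z) = z" using x0(1) z by (simp add: m_assoc[symmetric])
      ultimately show "tau x0 \<psi> z = \<psi> z" using one z \<eta>(1) by (simp add: tau_def)
    qed
    \<comment> \<open>Being invariant under translation by \<open>x0\<close>, \<open>\<psi>\<close>
      does not distinguish \<open>k\<close> from its translate; so it annihilates \<open>b\<close>,
      hence \<open>f\<close>. But \<open>\<psi>\<close> lies below \<open>\<psi>0\<close>, where
      \<open>conv f f\<close> acts as the positive scalar \<open>r\<close>.\<close>
    moreover have "conv \<psi> (tau x0 k) = tau x0 (conv \<psi> k)" "conv k (tau x0 \<psi>) = tau x0 (conv k \<psi>)"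
      by (intro conv_tau CF k x0)+
    ultimately have "conv \<psi> (tau x0 k) = conv \<psi> k" using conv_commute[OF CF k(1)] by simp
    then have "conv \<psi> b = (\<lambda>x. 0)" by (simp add: b_def conv_diff CF k tk)
    then have "conv f \<psi> = (\<lambda>x. 0)"
      using conv_assoc[OF bs b CF] conv_commute[OF b bs] conv_commute[OF b CF] conv_zero[OF bs] by (simp add: f_def)
    then have z: "conv (conv f f) \<psi> = (\<lambda>x. 0)" by (simp add: conv_assoc f CF conv_zero)
    have "conv (conv f f) \<psi> = conv (conv f f) (conv \<psi>0 \<psi>)" by (simp add: \<psi>(2))
    also have "\<dots> = conv (conv (conv f f) \<psi>0) \<psi>" by (rule conv_assoc[symmetric, OF CF_conv[OF f f] \<psi>0(1) CF])
    also have "\<dots> = (\<lambda>x. complex_of_real r * \<psi> x)" by (simp add: ev conv_scale_left \<psi>0 CF \<psi>(2))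
    finally show False using fun_cong[of _ _ \<one>] z r \<eta>(1) by (metis mult_eq_0_iff of_real_eq_0_iff less_irrefl)
  qed
  then show ?thesis using \<eta>(2) by blast
qed

end

section \<open>Interpolation of homomorphisms on the dual by points\<close>

lemma sum_list_product_mult:
  fixes f :: "'a \<Rightarrow> 'c::comm_ring_1"
  shows "(\<Sum>p\<leftarrow>List.product k l. f (fst p) * g (snd p)) = (\<Sum>a\<leftarrow>k. f a) * (\<Sum>b\<leftarrow>l. g b)"
  by (induction k) (auto simp: o_def sum_list_const_mult distrib_right)

context compact_metrizable_abelian_group
begin

lemma character_one: "character \<eta> \<Longrightarrow> \<eta> \<one> = 1"
proof -
  assume \<eta>: "character \<eta>"
  then have "\<eta> (\<one> \<otimes> \<one>) = \<eta> \<one> * \<eta> \<one>" "cmod (\<eta> \<one>) = 1" unfolding character_def using one_closed by blast+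
  then show ?thesis by auto
qed

lemma character_cont: "character \<eta> \<Longrightarrow> cont \<eta>" by (simp add: character_def)

text \<open>Translation by \<open>a\<close> multiplies the mean by \<open>\<eta> a\<close> and also
  leaves it unchanged.\<close>

lemma haar_character:
  assumes \<eta>: "character \<eta>" and a: "a \<in> carrier X" "\<eta> a \<noteq> 1"
  shows "haar \<eta> = 0"
proof -
  have "haar (\<lambda>x. \<eta> (a \<otimes> x)) = haar (\<lambda>x. \<eta> a * \<eta> x)"
    by (rule haar_cong[OF continuous_map_mult_complex[OF cont_const character_cont[OF \<eta>]]])
      (use \<eta> a in \<open>simp add: character_def\<close>)
  then have "haar \<eta> = \<eta> a * haar \<eta>"
    using haar_translate[OF character_cont[OF \<eta>] a(1)] haar_mult[OF character_cont[OF \<eta>]] by simp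
  then show ?thesis using a(2) by simp
qed

text \<open>A formal trigonometric polynomial: coefficients and indices are kept apart from the
  family \<open>\<phi>\<close>, so that the same polynomial can be evaluated in the characters and
  in their twists.\<close>

definition lincomb :: "('m \<Rightarrow> 'x \<Rightarrow> complex) \<Rightarrow> (complex \<times> 'm) list \<Rightarrow> 'x \<Rightarrow> complex" where
  "lincomb \<phi> l x = (\<Sum>p\<leftarrow>l. fst p * \<phi> (snd p) x)"

lemma cont_lincomb: "(\<And>p. p \<in> set l \<Longrightarrow> cont (\<phi> (snd p))) \<Longrightarrow> cont (lincomb \<phi> l)"
  and haar_lincomb: "(\<And>p. p \<in> set l \<Longrightarrow> cont (\<phi> (snd p))) \<Longrightarrow> haar (lincomb \<phi> l) = (\<Sum>p\<leftarrow>l. fst p * haar (\<phi> (snd p)))"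
proof -
  assume c: "\<And>p. p \<in> set l \<Longrightarrow> cont (\<phi> (snd p))"
  have c': "cont (\<lambda>x. fst p * \<phi> (snd p) x)" if "p \<in> set l" for p
    by (rule continuous_map_mult_complex[OF cont_const c[OF that]])
  note s = haar_sum_list[of l "\<lambda>p x. fst p * \<phi> (snd p) x", OF c']
  show "cont (lincomb \<phi> l)" using s(2) unfolding lincomb_def[abs_def] by simp
  have "haar (lincomb \<phi> l) = (\<Sum>p\<leftarrow>l. haar (\<lambda>x. fst p * \<phi> (snd p) x))" using s(1) unfolding lincomb_def[abs_def] by simp
  also have "\<dots> = (\<Sum>p\<leftarrow>l. fst p * haar (\<phi> (snd p)))"
    by (intro arg_cong[of _ _ sum_list] map_cong refl haar_mult c)
  finally show "haar (lincomb \<phi> l) = (\<Sum>p\<leftarrow>l. fst p * haar (\<phi> (snd p)))" .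
qed

text \<open>The twists \<open>tw m\<close> have the same means as the characters, since a nontrivial
  index has mean 0 and the trivial one is not changed; so formal polynomials have equal means in
  both families. If no point interpolates, the twisted \<open>1 + \<Sum>\<close> stays below some
  \<open>q < 1 + card F\<close> in modulus, and the mean of the power \<open>2 * n\<close> of this
  modulus is at most \<open>q ^ (2 * n)\<close>. Untwisted, it is near \<open>1 + card F\<close>
  around the identity, and the mean grows at least like \<open>q' ^ (2 * n) / K\<close> with
  \<open>q < q'\<close>.\<close>

lemma character_interpolation_finite:
  fixes N :: "('m, 'e) monoid_scheme" and ch :: "'m \<Rightarrow> 'x \<Rightarrow> complex" and \<theta> :: "'m \<Rightarrow> complex"
  assumes N: "comm_group N"
    and ch: "\<And>m. m \<in> carrier N \<Longrightarrow> character (ch m)"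
    and ch_mult: "\<And>m n x. m \<in> carrier N \<Longrightarrow> n \<in> carrier N \<Longrightarrow> x \<in> carrier X \<Longrightarrow> ch (m \<otimes>\<^bsub>N\<^esub> n) x = ch m x * ch n x"
    and faithful: "\<And>m. m \<in> carrier N \<Longrightarrow> (\<forall>x\<in>carrier X. ch m x = 1) \<Longrightarrow> m = \<one>\<^bsub>N\<^esub>"
    and \<theta>_mult: "\<And>m n. m \<in> carrier N \<Longrightarrow> n \<in> carrier N \<Longrightarrow> \<theta> (m \<otimes>\<^bsub>N\<^esub> n) = \<theta> m * \<theta> n"
    and \<theta>_norm: "\<And>m. m \<in> carrier N \<Longrightarrow> cmod (\<theta> m) = 1"
    and F: "finite F" "F \<subseteq> carrier N"
  shows "\<exists>p\<in>carrier X. \<forall>m\<in>F. ch m p = \<theta> m"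
proof (rule ccontr)
  assume contra: "\<not> (\<exists>p\<in>carrier X. \<forall>m\<in>F. ch m p = \<theta> m)"
  interpret N: comm_group N by fact
  define tw where "tw m x = cnj (\<theta> m) * ch m x" for m x
  define good where "good \<phi> \<longleftrightarrow> (\<forall>m\<in>carrier N. cont (\<phi> m)) \<and>
     (\<forall>m\<in>carrier N. \<forall>n\<in>carrier N. \<forall>x\<in>carrier X. \<phi> (m \<otimes>\<^bsub>N\<^esub> n) x = \<phi> m x * \<phi> n x) \<and>
     (\<forall>m\<in>carrier N. \<forall>x\<in>carrier X. cmod (\<phi> m x) = 1)" for \<phi> :: "'m \<Rightarrow> 'x \<Rightarrow> complex"
  have good_ch: "good ch" unfolding good_def using ch ch_mult by (auto simp: character_def)
  have good_tw: "good tw"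
    unfolding good_def tw_def
  proof (intro conjI ballI)
    show "cont (\<lambda>x. cnj (\<theta> m) * ch m x)" if "m \<in> carrier N" for m
      by (rule continuous_map_mult_complex[OF cont_const character_cont[OF ch[OF that]]])
  qed (use ch \<theta>_norm in \<open>auto simp: ch_mult \<theta>_mult character_def norm_mult\<close>)
  have inv_cnj: "\<phi> (inv\<^bsub>N\<^esub> m) x = cnj (\<phi> m x)" and one1: "\<phi> \<one>\<^bsub>N\<^esub> x = 1"
    if g: "good \<phi>" and m: "m \<in> carrier N" and x: "x \<in> carrier X" for \<phi> m x
  proof -
    have n1: "cmod (\<phi> k x) = 1" if "k \<in> carrier N" for k using g x that by (simp add: good_def)
    have "\<phi> (\<one>\<^bsub>N\<^esub> \<otimes>\<^bsub>N\<^esub> \<one>\<^bsub>N\<^esub>) x = \<phi> \<one>\<^bsub>N\<^esub> x * \<phi> \<one>\<^bsub>N\<^esub> x"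
      using g x N.one_closed unfolding good_def by blast
    then show o: "\<phi> \<one>\<^bsub>N\<^esub> x = 1" using n1[of "\<one>\<^bsub>N\<^esub>"] by auto
    have "\<phi> (m \<otimes>\<^bsub>N\<^esub> inv\<^bsub>N\<^esub> m) x = \<phi> m x * \<phi> (inv\<^bsub>N\<^esub> m) x"
      using g x m N.inv_closed unfolding good_def by blast
    then have "\<phi> m x * \<phi> (inv\<^bsub>N\<^esub> m) x = 1" using m o by simp
    moreover have "\<phi> m x * cnj (\<phi> m x) = 1" using n1[OF m] by (simp flip: complex_norm_square)
    ultimately have "\<phi> m x * \<phi> (inv\<^bsub>N\<^esub> m) x = \<phi> m x * cnj (\<phi> m x)" by simp
    moreover have "\<phi> m x \<noteq> 0" using n1[OF m] by auto
    ultimately show "\<phi> (inv\<^bsub>N\<^esub> m) x = cnj (\<phi> m x)" by simp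
  qed
  define ok where "ok l \<longleftrightarrow> snd ` set l \<subseteq> carrier N" for l :: "(complex \<times> 'm) list"
  define lm where "lm k l = map (\<lambda>p. (fst (fst p) * fst (snd p), snd (fst p) \<otimes>\<^bsub>N\<^esub> snd (snd p))) (List.product k l)"
    for k l :: "(complex \<times> 'm) list"
  define lc where "lc l = map (\<lambda>p. (cnj (fst p), inv\<^bsub>N\<^esub> (snd p))) l" for l :: "(complex \<times> 'm) list"
  have ok_lm: "ok (lm k l)" if "ok k" "ok l" for k l using that unfolding ok_def lm_def by fastforce
  have ok_lc: "ok (lc l)" if "ok l" for l using that unfolding ok_def lc_def by fastforce
  have lincomb_lm: "lincomb \<phi> (lm k l) x = lincomb \<phi> k x * lincomb \<phi> l x" if g: "good \<phi>" and k: "ok k" and l: "ok l" and x: "x \<in> carrier X" for \<phi> k l x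
  proof -
    have "lincomb \<phi> (lm k l) x = (\<Sum>p\<leftarrow>List.product k l. (fst (fst p) * \<phi> (snd (fst p)) x) * (fst (snd p) * \<phi> (snd (snd p)) x))"
      unfolding lincomb_def lm_def map_map
    proof (intro arg_cong[of _ _ sum_list] map_cong refl)
      fix p assume "p \<in> set (List.product k l)"
      then have "snd (fst p) \<in> carrier N" "snd (snd p) \<in> carrier N" using k l by (auto simp: ok_def)
      then have "\<phi> (snd (fst p) \<otimes>\<^bsub>N\<^esub> snd (snd p)) x = \<phi> (snd (fst p)) x * \<phi> (snd (snd p)) x"
        using g x unfolding good_def by blast
      then show "((\<lambda>p. fst p * \<phi> (snd p) x) \<circ> (\<lambda>p. (fst (fst p) * fst (snd p), snd (fst p) \<otimes>\<^bsub>N\<^esub> snd (snd p)))) p =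
        (fst (fst p) * \<phi> (snd (fst p)) x) * (fst (snd p) * \<phi> (snd (snd p)) x)" by simp
    qed
    then show ?thesis unfolding lincomb_def using sum_list_product_mult[of "\<lambda>p. fst p * \<phi> (snd p) x" "\<lambda>p. fst p * \<phi> (snd p) x" k l] by simp
  qed
  have lincomb_lc: "lincomb \<phi> (lc l) x = cnj (lincomb \<phi> l x)" if g: "good \<phi>" and l: "ok l" and x: "x \<in> carrier X" for \<phi> l x
    using l
  proof (induction l)
    case (Cons p l)
    then have "ok l" "snd p \<in> carrier N" by (auto simp: ok_def)
    then show ?case using Cons.IH inv_cnj[OF g _ x] by (simp add: lincomb_def lc_def)
  qed (simp add: lincomb_def lc_def)
  have haar_eq: "haar (lincomb tw l) = haar (lincomb ch l)" if l: "ok l" for l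
  proof -
    have "haar (tw m) = haar (ch m)" if m: "m \<in> carrier N" for m
    proof (cases "\<forall>x\<in>carrier X. ch m x = 1")
      case True
      then have "m = \<one>\<^bsub>N\<^esub>" by (rule faithful[OF m])
      then have "\<forall>x\<in>carrier X. tw m x = ch m x" using one1[OF good_tw m] one1[OF good_ch m] by auto
      then show ?thesis by (intro haar_cong character_cont[OF ch[OF m]]) auto
    next
      case False
      then obtain a where "a \<in> carrier X" "ch m a \<noteq> 1" by blast
      then have "haar (ch m) = 0" by (rule haar_character[OF ch[OF m]])
      then show ?thesis using haar_mult[OF character_cont[OF ch[OF m]]] by (simp add: tw_def[abs_def])
    qed
    then have "(\<Sum>p\<leftarrow>l. fst p * haar (tw (snd p))) = (\<Sum>p\<leftarrow>l. fst p * haar (ch (snd p)))"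
      using l by (intro arg_cong[of _ _ sum_list] map_cong refl) (auto simp: ok_def)
    moreover have "haar (lincomb tw l) = (\<Sum>p\<leftarrow>l. fst p * haar (tw (snd p)))"
      by (rule haar_lincomb) (use l good_tw in \<open>auto simp: ok_def good_def\<close>)
    moreover have "haar (lincomb ch l) = (\<Sum>p\<leftarrow>l. fst p * haar (ch (snd p)))"
      by (rule haar_lincomb) (use l good_ch in \<open>auto simp: ok_def good_def\<close>)
    ultimately show ?thesis by simp
  qed
  obtain fl where fl: "set fl = F" "distinct fl" using finite_distinct_list[OF F(1)] by auto
  define P where "P = (1, \<one>\<^bsub>N\<^esub>) # map (\<lambda>m. (1 :: complex, m)) fl"
  define D where "D = 1 + real (card F)"
  have okP: "ok P" using fl F(2) by (auto simp: ok_def P_def)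
  have lincomb_P: "lincomb \<phi> P x = 1 + (\<Sum>m\<in>F. \<phi> m x)" if "good \<phi>" "x \<in> carrier X" for \<phi> x
    using one1[OF that(1) N.one_closed that(2)] fl
    by (simp add: lincomb_def P_def o_def sum_list_distinct_conv_sum_set)
  \<comment> \<open>The squared modulus of \<open>P\<close>, raised to the power \<open>n\<close>,
    as a formal polynomial; even powers of the modulus are what conjugation makes
    expressible.\<close>
  define L where "L n = ((\<lambda>l. lm P (lm (lc P) l)) ^^ n) [(1, \<one>\<^bsub>N\<^esub>)]" for n
  have okL: "ok (L n)" for n
  proof (induction n)
    case (Suc n)
    then show ?case unfolding L_def by (simp add: ok_lm ok_lc okP)
  qed (simp add: L_def ok_def)
  have E_L: "lincomb \<phi> (L n) x = complex_of_real ((cmod (lincomb \<phi> P x)) ^ (2 * n))" if g: "good \<phi>" and x: "x \<in> carrier X" for \<phi> n x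
  proof (induction n)
    case 0
    then show ?case using one1[OF g N.one_closed x] by (simp add: L_def lincomb_def)
  next
    case (Suc n)
    have "lincomb \<phi> (L (Suc n)) x = lincomb \<phi> (lm P (lm (lc P) (L n))) x" by (simp add: L_def)
    also have "\<dots> = (lincomb \<phi> P x * cnj (lincomb \<phi> P x)) * lincomb \<phi> (L n) x"
      by (simp add: lincomb_lm[OF g] lincomb_lc[OF g] ok_lm ok_lc okP okL x mult.assoc)
    also have "\<dots> = complex_of_real ((cmod (lincomb \<phi> P x))\<^sup>2 * cmod (lincomb \<phi> P x) ^ (2 * n))"
      unfolding Suc complex_norm_square[symmetric] by (simp only: of_real_mult)
    also have "(cmod (lincomb \<phi> P x))\<^sup>2 * cmod (lincomb \<phi> P x) ^ (2 * n) = cmod (lincomb \<phi> P x) ^ (2 * Suc n)"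
      by (simp flip: power_add)
    finally show ?case .
  qed
  have cE: "cont (lincomb \<phi> l)" if "good \<phi>" "ok l" for \<phi> l
    by (rule cont_lincomb) (use that in \<open>auto simp: ok_def good_def\<close>)
  have less: "cmod (lincomb tw P x) < D" if x: "x \<in> carrier X" for x
  proof -
    obtain j where j: "j \<in> F" "ch j x \<noteq> \<theta> j" using contra x by blast
    have jN: "j \<in> carrier N" using j F by auto
    have tw1: "cmod (tw m x) = 1" if "m \<in> F" for m using good_tw that F x unfolding good_def by blast
    have "\<theta> j * cnj (\<theta> j) = 1" using \<theta>_norm[OF jN] by (simp flip: complex_norm_square)
    then have "\<theta> j * tw j x = ch j x" by (simp add: tw_def mult.assoc[symmetric])
    then have tj: "tw j x \<noteq> 1" using j(2) by auto
    \<comment> \<open>The constant term of \<open>P\<close> provides a summand of known direction: a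
      unit number other than 1 added to it has modulus below 2, and the other summands contribute at
      most their number.\<close>
    have "cmod (1 + tw j x) < 2"
    proof -
      have sq: "(cmod (1 + tw j x))\<^sup>2 = 2 + 2 * Re (tw j x)"
      proof -
        have "(Re (tw j x))\<^sup>2 + (Im (tw j x))\<^sup>2 = 1" using tw1[OF j(1)] cmod_power2[of "tw j x"] by simp
        moreover have "(cmod (1 + tw j x))\<^sup>2 = 1 + 2 * Re (tw j x) + ((Re (tw j x))\<^sup>2 + (Im (tw j x))\<^sup>2)"
          unfolding cmod_power2 by (simp add: power2_eq_square algebra_simps)
        ultimately show ?thesis by simp
      qed
      have "Re (tw j x) \<noteq> 1"
      proof
        assume re: "Re (tw j x) = 1"
        then have "Im (tw j x) = 0" using tw1[OF j(1)] by (simp add: cmod_def)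
        then show False using re tj by (simp add: complex_eq_iff)
      qed
      then have "Re (tw j x) < 1" using complex_Re_le_cmod[of "tw j x"] tw1[OF j(1)] by linarith
      then have "(cmod (1 + tw j x))\<^sup>2 < 2\<^sup>2" unfolding sq by simp
      then show ?thesis by (rule power2_less_imp_less) simp
    qed
    moreover have "cmod (\<Sum>m\<in>F - {j}. tw m x) \<le> real (card (F - {j}))"
      using sum_norm_le[of "F - {j}" "\<lambda>m. tw m x" "\<lambda>_. 1"] tw1 by simp
    moreover have split: "lincomb tw P x = (1 + tw j x) + (\<Sum>m\<in>F - {j}. tw m x)"
      using lincomb_P[OF good_tw x] sum.remove[OF F(1) j(1), of "\<lambda>m. tw m x"] by simp
    moreover have "real (card (F - {j})) = real (card F) - 1"
      using card_Diff_singleton[of j F] card_gt_0_iff[of F] F(1) j(1) by (auto simp: of_nat_diff Suc_leI)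
    ultimately show ?thesis
      using norm_triangle_ineq[of "1 + tw j x" "\<Sum>m\<in>F - {j}. tw m x"] unfolding D_def split by linarith
  qed
  have "\<exists>x1\<in>carrier X. \<forall>x\<in>carrier X. cmod (lincomb tw P x) \<le> cmod (lincomb tw P x1)"
  proof -
    have "continuous_map T euclideanreal (\<lambda>x. cmod (lincomb tw P x))" by (intro continuous_map_norm cE good_tw okP)
    then have "compactin euclideanreal ((\<lambda>x. cmod (lincomb tw P x)) ` topspace T)"
      by (rule image_compactin[rotated]) (use compact_T in \<open>simp add: compact_space_def\<close>)
    then have "compact ((\<lambda>x. cmod (lincomb tw P x)) ` carrier X)" by (simp add: topspace_eq)
    from compact_attains_sup[OF this] show ?thesis using one_closed by fastforce
  qed
  then obtain x1 where x1: "x1 \<in> carrier X" "\<And>x. x \<in> carrier X \<Longrightarrow> cmod (lincomb tw P x) \<le> cmod (lincomb tw P x1)" by blast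
  define q where "q = cmod (lincomb tw P x1)"
  \<comment> \<open>Any number strictly between the maximum \<open>q\<close> of the twisted modulus
    and the value \<open>D\<close> of the untwisted one at the identity. Powers of
    \<open>q / q'\<close> then beat \<open>K\<close>, which does not depend on the power.\<close>
  define q' where "q' = (q + D) / 2"
  have q: "0 \<le> q" "q < q'" "q' < D" using less[OF x1(1)] by (auto simp: q_def q'_def)
  have E_one: "lincomb ch P \<one> = of_real D"
    using lincomb_P[OF good_ch one_closed] character_one[OF ch] F(2) by (simp add: D_def subset_iff)
  obtain U where U: "openin T U" "\<one> \<in> U" "modulus U (D - q') (lincomb ch P)"
    using cont_modulus[OF cE[OF good_ch okP], of "D - q'"] q by auto
  have Uc: "U \<subseteq> carrier X" using openin_subset[OF U(1)] topspace_eq by simp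
  have low: "q' \<le> cmod (lincomb ch P u)" if u: "u \<in> U" for u
  proof -
    have "cmod (lincomb ch P u - of_real D) \<le> D - q'"
      using U(3) u Uc E_one unfolding modulus_def by (metis l_one one_closed subsetD)
    moreover have "cmod (of_real D :: complex) = D" unfolding norm_of_real by (simp add: D_def)
    ultimately show ?thesis using norm_triangle_ineq2[of "of_real D" "lincomb ch P u"] by (simp add: norm_minus_commute)
  qed
  obtain K where K: "K > 0" "\<forall>(f :: 'x \<Rightarrow> real) p c. cont (\<lambda>x. complex_of_real (f x)) \<longrightarrow> (\<forall>x\<in>carrier X. 0 \<le> f x) \<longrightarrow> p \<in> carrier X \<longrightarrow>
    (\<forall>u\<in>U. c \<le> f (p \<otimes> u)) \<longrightarrow> c / K \<le> Re (haar (\<lambda>x. complex_of_real (f x)))"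
    using haar_lower_bound[OF U(1,2)] by auto
  have bound: "1 / K \<le> ((q / q')\<^sup>2) ^ n" for n
  proof -
    let ?f = "\<lambda>x. cmod (lincomb ch P x) ^ (2 * n)"
    have cf: "cont (\<lambda>x. complex_of_real (?f x))"
      by (rule cont_cong[OF cE[OF good_ch okL]]) (simp only: E_L[OF good_ch])
    have "q' ^ (2 * n) / K \<le> Re (haar (\<lambda>x. complex_of_real (?f x)))"
    proof (rule K(2)[rule_format])
      show "q' ^ (2 * n) \<le> cmod (lincomb ch P (\<one> \<otimes> u)) ^ (2 * n)" if "u \<in> U" for u
        using low[OF that] q Uc that by (auto intro!: power_mono)
    qed (use cf in auto)
    also have "haar (\<lambda>x. complex_of_real (?f x)) = haar (lincomb ch (L n))"
      by (rule haar_cong[OF cE[OF good_ch okL]]) (simp only: E_L[OF good_ch])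
    also have "\<dots> = haar (lincomb tw (L n))" by (rule haar_eq[OF okL, symmetric])
    also have "Re \<dots> \<le> cmod (haar (lincomb tw (L n)))" by (rule complex_Re_le_cmod)
    also have "\<dots> \<le> q ^ (2 * n)"
    proof (rule norm_haar_le[OF cE[OF good_tw okL]])
      fix x assume x: "x \<in> carrier X"
      show "cmod (lincomb tw (L n) x) \<le> q ^ (2 * n)"
        unfolding E_L[OF good_tw x] norm_of_real
        using power_mono[OF x1(2)[OF x] norm_ge_zero, of "2 * n"] by (simp add: q_def)
    qed
    finally have "q' ^ (2 * n) / K \<le> q ^ (2 * n)" .
    then have "1 / K \<le> q ^ (2 * n) / q' ^ (2 * n)" using q by (simp add: divide_simps mult.commute)
    then show ?thesis by (simp add: power_mult power_divide)
  qed
  have "(\<lambda>n. ((q / q')\<^sup>2) ^ n) \<longlonglongrightarrow> 0"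
  proof (rule LIMSEQ_power_zero)
    have "0 \<le> q / q'" "q / q' < 1" using q by (auto simp: divide_simps)
    then show "norm ((q / q')\<^sup>2) < 1" by (simp add: abs_square_less_1)
  qed
  then have "1 / K \<le> 0" by (rule LIMSEQ_le_const) (use bound in auto)
  then show False using K(1) by (simp add: divide_le_0_iff)
qed

theorem character_interpolation:
  fixes N :: "('m, 'e) monoid_scheme" and ch :: "'m \<Rightarrow> 'x \<Rightarrow> complex" and \<theta> :: "'m \<Rightarrow> complex"
  assumes N: "comm_group N"
    and ch: "\<And>m. m \<in> carrier N \<Longrightarrow> character (ch m)"
    and ch_mult: "\<And>m n x. m \<in> carrier N \<Longrightarrow> n \<in> carrier N \<Longrightarrow> x \<in> carrier X \<Longrightarrow> ch (m \<otimes>\<^bsub>N\<^esub> n) x = ch m x * ch n x"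
    and faithful: "\<And>m. m \<in> carrier N \<Longrightarrow> (\<forall>x\<in>carrier X. ch m x = 1) \<Longrightarrow> m = \<one>\<^bsub>N\<^esub>"
    and \<theta>_mult: "\<And>m n. m \<in> carrier N \<Longrightarrow> n \<in> carrier N \<Longrightarrow> \<theta> (m \<otimes>\<^bsub>N\<^esub> n) = \<theta> m * \<theta> n"
    and \<theta>_norm: "\<And>m. m \<in> carrier N \<Longrightarrow> cmod (\<theta> m) = 1"
  shows "\<exists>p\<in>carrier X. \<forall>m\<in>carrier N. ch m p = \<theta> m"
proof -
  interpret N: comm_group N by fact
  let ?C = "\<lambda>m. {x \<in> carrier X. ch m x = \<theta> m}"
  have cl: "closedin T (?C m)" if "m \<in> carrier N" for m
    using closedin_continuous_map_preimage[OF character_cont[OF ch[OF that]], of "{\<theta> m}"] by (simp add: topspace_eq)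
  have "\<Inter> (?C ` carrier N) \<noteq> {}"
  proof (rule compact_space_fip[THEN iffD1, OF compact_T, rule_format], intro conjI ballI allI impI)
    show "closedin T C" if "C \<in> ?C ` carrier N" for C using that cl by auto
    fix \<F> assume "finite \<F> \<and> \<F> \<subseteq> ?C ` carrier N"
    then obtain F where F: "finite F" "F \<subseteq> carrier N" "\<F> = ?C ` F"
      using finite_subset_image[of \<F> ?C "carrier N"] by blast
    obtain p where "p \<in> carrier X" "\<forall>m\<in>F. ch m p = \<theta> m"
      using character_interpolation_finite[OF assms F(1,2)] by blast
    then have "p \<in> \<Inter> \<F>" using F(3) by auto
    then show "\<Inter> \<F> \<noteq> {}" by blast
  qed
  then obtain p where "p \<in> \<Inter> (?C ` carrier N)" by blast
  then show ?thesis using N.one_closed by blast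
qed

end

section \<open>The circle group\<close>

definition coset :: "real \<Rightarrow> real set" where "coset x = {t. t - x \<in> \<int>}"

text \<open>Cosets of \<int> become unit complex numbers, in which all later computations take
  place; by \<open>circle_exp_coset\<close> the chosen representative is immaterial.\<close>

definition circle_exp :: "real set \<Rightarrow> complex" where
  "circle_exp C = cis (2 * pi * (SOME t. t \<in> C))"

lemma coset_eq_r_coset: "coset x = \<int> #>\<^bsub>real_group\<^esub> x"
proof -
  have "t - x \<in> \<int> \<longleftrightarrow> (\<exists>h\<in>\<int>. t = h + x)" for t
    by (metis add_diff_cancel_right' diff_add_cancel)
  then show ?thesis by (auto simp: coset_def r_coset_def real_group_def)
qed

lemma carrier_circle_group: "carrier circle_group = range coset"
  by (auto simp: circle_group_def FactGroup_def RCOSETS_def coset_eq_r_coset[symmetric]) (auto simp: real_group_def)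

lemma coset_mult: "coset x \<otimes>\<^bsub>circle_group\<^esub> coset y = coset (x + y)"
proof -
  have "(\<exists>a b. a - x \<in> \<int> \<and> b - y \<in> \<int> \<and> t = a + b) \<longleftrightarrow> t - (x + y) \<in> \<int>" for t
  proof
    assume "t - (x + y) \<in> \<int>"
    then show "\<exists>a b. a - x \<in> \<int> \<and> b - y \<in> \<int> \<and> t = a + b"
      by (intro exI[of _ "t - y"] exI[of _ y]) (simp add: algebra_simps)
  next
    assume "\<exists>a b. a - x \<in> \<int> \<and> b - y \<in> \<int> \<and> t = a + b"
    then obtain a b where ab: "a - x \<in> \<int>" "b - y \<in> \<int>" "t = a + b" by blast
    then have "(a - x) + (b - y) \<in> \<int>" by (intro Ints_add)
    then show "t - (x + y) \<in> \<int>" using ab by (simp add: algebra_simps)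
  qed
  then show ?thesis
    by (auto simp: circle_group_def FactGroup_def set_mult_def coset_def real_group_def)
qed

lemma coset_0: "\<one>\<^bsub>circle_group\<^esub> = coset 0"
  by (auto simp: circle_group_def FactGroup_def coset_def)

lemma cis_2pi_eq_iff: "cis (2 * pi * x) = cis (2 * pi * y) \<longleftrightarrow> x - y \<in> \<int>"
proof -
  have "cis (2 * pi * x) = cis (2 * pi * y) \<longleftrightarrow> cis (2 * pi * (x - y)) = 1"
    by (simp add: right_diff_distrib cis_divide[symmetric] divide_eq_1_iff)
  also have "\<dots> \<longleftrightarrow> x - y \<in> \<int>"
  proof
    assume "cis (2 * pi * (x - y)) = 1"
    then have "cos (2 * pi * (x - y)) = 1" by (simp add: complex_eq_iff)
    then obtain n :: int where "2 * pi * (x - y) = of_int n * 2 * pi" using cos_one_2pi_int by blast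
    then have "x - y = of_int n" by simp
    then show "x - y \<in> \<int>" by simp
  qed (auto simp: cis_multiple_2pi)
  finally show ?thesis .
qed

lemma circle_exp_coset: "circle_exp (coset x) = cis (2 * pi * x)"
proof -
  have "x \<in> coset x" by (simp add: coset_def)
  then have "(SOME t. t \<in> coset x) \<in> coset x" by (rule someI)
  then show ?thesis unfolding circle_exp_def cis_2pi_eq_iff by (simp add: coset_def)
qed

lemma coset_eq_iff: "coset x = coset y \<longleftrightarrow> x - y \<in> \<int>"
proof
  assume "coset x = coset y"
  moreover have "x \<in> coset x" by (simp add: coset_def)
  ultimately show "x - y \<in> \<int>" by (auto simp: coset_def)
next
  assume xy: "x - y \<in> \<int>"
  have "t - x \<in> \<int> \<longleftrightarrow> t - y \<in> \<int>" for t
    using Ints_add[OF _ xy, of "t - x"] Ints_diff[OF _ xy, of "t - y"] by auto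
  then show "coset x = coset y" by (simp add: coset_def)
qed

lemma inj_circle_exp: "inj_on circle_exp (carrier circle_group)"
  by (auto simp: inj_on_def carrier_circle_group circle_exp_coset cis_2pi_eq_iff coset_eq_iff)

lemma norm_circle_exp: "C \<in> carrier circle_group \<Longrightarrow> cmod (circle_exp C) = 1"
  by (auto simp: carrier_circle_group circle_exp_coset)

lemma circle_exp_mult:
  "C \<in> carrier circle_group \<Longrightarrow> D \<in> carrier circle_group \<Longrightarrow> circle_exp (C \<otimes>\<^bsub>circle_group\<^esub> D) = circle_exp C * circle_exp D"
  by (auto simp: carrier_circle_group circle_exp_coset coset_mult cis_mult distrib_left)

lemma circle_exp_one: "circle_exp \<one>\<^bsub>circle_group\<^esub> = 1"
  by (simp add: coset_0 circle_exp_coset)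

lemma comm_group_circle: "comm_group circle_group"
proof (rule comm_groupI)
  fix C assume "C \<in> carrier circle_group"
  then obtain x where C: "C = coset x" by (auto simp: carrier_circle_group)
  show "\<exists>D\<in>carrier circle_group. D \<otimes>\<^bsub>circle_group\<^esub> C = \<one>\<^bsub>circle_group\<^esub>"
    by (rule bexI[of _ "coset (- x)"]) (auto simp: C coset_mult coset_0 carrier_circle_group)
qed (auto simp: carrier_circle_group coset_mult coset_0 ac_simps)

interpretation circle: comm_group circle_group by (rule comm_group_circle)

lemma circle_exp_nat_pow: "C \<in> carrier circle_group \<Longrightarrow> circle_exp (C [^]\<^bsub>circle_group\<^esub> (n::nat)) = circle_exp C ^ n"
  by (induction n) (auto simp: circle_exp_one circle_exp_mult)

lemma circle_exp_inv: "C \<in> carrier circle_group \<Longrightarrow> circle_exp (inv\<^bsub>circle_group\<^esub> C) = inverse (circle_exp C)"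
proof -
  assume C: "C \<in> carrier circle_group"
  have "circle_exp C * circle_exp (inv\<^bsub>circle_group\<^esub> C) = 1"
    using circle_exp_mult[of C "inv\<^bsub>circle_group\<^esub> C"] C by (simp add: circle_exp_one)
  from inverse_unique[OF this] show ?thesis by simp
qed

lemma circle_exp_int_pow: "C \<in> carrier circle_group \<Longrightarrow> circle_exp (C [^]\<^bsub>circle_group\<^esub> (n::int)) = circle_exp C powi n"
proof -
  assume C: "C \<in> carrier circle_group"
  then have neg: "circle_exp (inv\<^bsub>circle_group\<^esub> (C [^]\<^bsub>circle_group\<^esub> m)) = inverse (circle_exp C) ^ m" for m :: nat
    using circle_exp_inv[of "C [^]\<^bsub>circle_group\<^esub> m"] by (simp add: circle_exp_nat_pow power_inverse)
  show ?thesis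
  proof (cases "n < 0")
    case True
    have "C [^]\<^bsub>circle_group\<^esub> n = inv\<^bsub>circle_group\<^esub> (C [^]\<^bsub>circle_group\<^esub> nat (- n))"
      using True by (simp only: int_pow_def2 if_True)
    moreover have "circle_exp C powi n = inverse (circle_exp C) ^ nat (- n)"
      using True by (simp add: power_int_def)
    ultimately show ?thesis by (simp only: neg)
  next
    case False
    have "C [^]\<^bsub>circle_group\<^esub> n = C [^]\<^bsub>circle_group\<^esub> nat n"
      using False by (simp only: int_pow_def2 if_False)
    moreover have "circle_exp C powi n = circle_exp C ^ nat n"
      using False by (simp add: power_int_def)
    ultimately show ?thesis by (simp only: circle_exp_nat_pow[OF C])
  qed
qed

lemma circle_exp_finprod:
  assumes "finite A" "\<And>i. i \<in> A \<Longrightarrow> f i \<in> carrier circle_group"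
  shows "circle_exp (finprod circle_group f A) = (\<Prod>i\<in>A. circle_exp (f i))"
  using assms
proof (induction A)
  case (insert i A)
  then have "finprod circle_group f (insert i A) = f i \<otimes>\<^bsub>circle_group\<^esub> finprod circle_group f A"
    by (intro circle.finprod_insert) auto
  moreover have "finprod circle_group f A \<in> carrier circle_group"
    using insert by (intro circle.finprod_closed) auto
  ultimately show ?case using insert by (simp add: circle_exp_mult)
qed (simp add: circle_exp_one)

lemma topspace_circle_topology: "topspace circle_topology = carrier circle_group"
proof -
  have "\<Union> (carrier circle_group) = UNIV"
    by (auto simp: carrier_circle_group coset_def intro!: exI[of _ "_::real"])
  then have "openin circle_topology (carrier circle_group)" by (simp add: openin_circle_topology)
  then show ?thesis
    by (meson openin_circle_topology openin_subset openin_topspace subset_antisym)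
qed

lemma continuous_circle_exp: "continuous_map circle_topology euclidean circle_exp"
  unfolding continuous_map_def topspace_circle_topology
proof (intro conjI allI impI)
  fix V :: "complex set" assume "openin euclidean V"
  then have V: "open V" by simp
  have "\<Union> {C \<in> carrier circle_group. circle_exp C \<in> V} = (\<lambda>t. cis (2 * pi * t)) -` V"
  proof (intro equalityI subsetI)
    fix t assume "t \<in> \<Union> {C \<in> carrier circle_group. circle_exp C \<in> V}"
    then obtain x where "t \<in> coset x" "cis (2 * pi * x) \<in> V" by (auto simp: carrier_circle_group circle_exp_coset)
    moreover from this have "cis (2 * pi * t) = cis (2 * pi * x)" unfolding cis_2pi_eq_iff by (simp add: coset_def)
    ultimately show "t \<in> (\<lambda>t. cis (2 * pi * t)) -` V" by simp
  next
    fix t assume "t \<in> (\<lambda>t. cis (2 * pi * t)) -` V"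
    then have "coset t \<in> {C \<in> carrier circle_group. circle_exp C \<in> V}" by (auto simp: carrier_circle_group circle_exp_coset)
    moreover have "t \<in> coset t" by (simp add: coset_def)
    ultimately show "t \<in> \<Union> {C \<in> carrier circle_group. circle_exp C \<in> V}" by blast
  qed
  moreover have "open ((\<lambda>t. cis (2 * pi * t)) -` V)"
    by (intro open_vimage[OF V] continuous_intros)
  ultimately show "openin circle_topology {C \<in> carrier circle_group. circle_exp C \<in> V}"
    by (simp add: openin_circle_topology)
qed auto

text \<open>This is continuity of the inverse of \<open>circle_exp\<close>. The part of the interval
  from 0 to 1 outside the open set \<open>\<Union>U\<close> is compact, so its image
  \<open>?K\<close> on the unit circle is closed, and \<open>U\<close> corresponds to the complement
  of \<open>?K\<close>. Every coset has a representative in the interval, namely a fractional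
  part.\<close>

lemma continuous_map_circleI:
  assumes f: "f ` topspace S \<subseteq> carrier circle_group" and c: "continuous_map S euclidean (\<lambda>x. circle_exp (f x))"
  shows "continuous_map S circle_topology f"
  unfolding continuous_map_def topspace_circle_topology
proof (intro conjI allI impI)
  fix U assume "openin circle_topology U"
  then have U: "U \<subseteq> carrier circle_group" "open (\<Union>U)" by (auto simp: openin_circle_topology)
  let ?K = "(\<lambda>t. cis (2 * pi * t)) ` ({0..1} - \<Union>U)"
  have "compact ({0..1} - \<Union>U)" using U(2) by (intro compact_diff) auto
  then have "compact ?K" by (intro compact_continuous_image continuous_intros)
  then have K: "open (- ?K)" by (simp add: compact_imp_closed open_Compl)
  have "f x \<in> U \<longleftrightarrow> circle_exp (f x) \<in> - ?K" if x: "x \<in> topspace S" for x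
  proof -
    obtain y where y: "f x = coset y" using f x by (auto simp: carrier_circle_group)
    have fy: "coset (frac y) = coset y" unfolding coset_eq_iff frac_def by (simp add: algebra_simps)
    have memU: "t \<in> \<Union>U \<longleftrightarrow> coset t \<in> U" for t
    proof
      assume "t \<in> \<Union>U"
      then obtain z where z: "t \<in> coset z" "coset z \<in> U" using U(1) by (auto simp: carrier_circle_group)
      then have "coset t = coset z" unfolding coset_eq_iff by (simp add: coset_def)
      then show "coset t \<in> U" using z by simp
    qed (auto simp: coset_def intro!: bexI[of _ "coset t"])
    show ?thesis
    proof
      assume "f x \<in> U"
      then have yU: "coset y \<in> U" by (simp add: y)
      show "circle_exp (f x) \<in> - ?K"
      proof
        assume "circle_exp (f x) \<in> ?K"
        then obtain t where t: "cis (2 * pi * y) = cis (2 * pi * t)" "t \<notin> \<Union>U" by (auto simp: y circle_exp_coset)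
        then have "coset y = coset t" by (simp only: cis_2pi_eq_iff coset_eq_iff)
        then show False using t(2) yU unfolding memU by simp
      qed
    next
      assume "circle_exp (f x) \<in> - ?K"
      moreover have "circle_exp (f x) = cis (2 * pi * frac y)" by (simp add: y fy[symmetric] circle_exp_coset)
      moreover have "frac y \<in> {0..1}" using frac_ge_0[of y] frac_lt_1[of y] by simp
      ultimately have "frac y \<in> \<Union>U" by blast
      then show "f x \<in> U" unfolding memU by (simp add: y fy)
    qed
  qed
  then have "{x \<in> topspace S. f x \<in> U} = {x \<in> topspace S. circle_exp (f x) \<in> - ?K}" by blast
  also have "openin S \<dots>" using openin_continuous_map_preimage[OF c, of "- ?K"] K by simp
  finally show "openin S {x \<in> topspace S. f x \<in> U}" .
qed (use f in auto)

section \<open>Characters through their complex values\<close>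

context compact_metrizable_abelian_group
begin

lemma characters_iff:
  "\<xi> \<in> characters X T \<longleftrightarrow> \<xi> \<in> carrier X \<rightarrow>\<^sub>E carrier circle_group \<and> character (\<lambda>x. circle_exp (\<xi> x))"
proof
  assume \<xi>: "\<xi> \<in> characters X T"
  then have hom: "\<xi> \<in> hom X circle_group" and cont: "continuous_map T circle_topology \<xi>" by (auto simp: characters_def)
  have "cont (\<lambda>x. circle_exp (\<xi> x))"
    using continuous_map_compose[OF cont continuous_circle_exp] by (simp add: o_def)
  moreover have cl: "\<xi> x \<in> carrier circle_group" if "x \<in> carrier X" for x using hom that by (auto simp: hom_def)
  moreover have "\<xi> (x \<otimes> y) = \<xi> x \<otimes>\<^bsub>circle_group\<^esub> \<xi> y" if "x \<in> carrier X" "y \<in> carrier X" for x y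
    using hom that by (simp add: hom_def)
  ultimately have "character (\<lambda>x. circle_exp (\<xi> x))"
    unfolding character_def by (auto simp: circle_exp_mult norm_circle_exp)
  then show "\<xi> \<in> carrier X \<rightarrow>\<^sub>E carrier circle_group \<and> character (\<lambda>x. circle_exp (\<xi> x))"
    using \<xi> cl by (auto simp: characters_def PiE_def)
next
  assume a: "\<xi> \<in> carrier X \<rightarrow>\<^sub>E carrier circle_group \<and> character (\<lambda>x. circle_exp (\<xi> x))"
  then have cl: "\<xi> x \<in> carrier circle_group" if "x \<in> carrier X" for x using that by auto
  have "\<xi> \<in> hom X circle_group"
  proof (rule homI)
    fix x y assume xy: "x \<in> carrier X" "y \<in> carrier X"
    have "circle_exp (\<xi> (x \<otimes> y)) = circle_exp (\<xi> x \<otimes>\<^bsub>circle_group\<^esub> \<xi> y)"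
      using a xy cl by (simp add: circle_exp_mult character_def)
    then show "\<xi> (x \<otimes> y) = \<xi> x \<otimes>\<^bsub>circle_group\<^esub> \<xi> y"
      using inj_onD[OF inj_circle_exp] xy cl by (meson circle.m_closed m_closed)
  qed (use cl in auto)
  moreover have "continuous_map T circle_topology \<xi>"
    by (rule continuous_map_circleI) (use a cl in \<open>auto simp: character_def topspace_eq\<close>)
  ultimately show "\<xi> \<in> characters X T" using a by (auto simp: characters_def PiE_def)
qed

lemma characters_closed: "\<xi> \<in> characters X T \<Longrightarrow> x \<in> carrier X \<Longrightarrow> \<xi> x \<in> carrier circle_group"
  by (auto simp: characters_iff)

lemma characters_character: "\<xi> \<in> characters X T \<Longrightarrow> character (\<lambda>x. circle_exp (\<xi> x))"
  by (simp add: characters_iff)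

lemma characters_eqI:
  assumes "\<xi> \<in> characters X T" "\<psi> \<in> characters X T" "\<And>x. x \<in> carrier X \<Longrightarrow> circle_exp (\<xi> x) = circle_exp (\<psi> x)"
  shows "\<xi> = \<psi>"
proof
  fix x show "\<xi> x = \<psi> x"
  proof (cases "x \<in> carrier X")
    case True
    then show ?thesis using inj_onD[OF inj_circle_exp assms(3)[OF True]] assms characters_closed by blast
  next
    case False
    then show ?thesis using assms(1,2) by (auto simp: characters_iff PiE_def extensional_def)
  qed
qed

lemma character_lift:
  assumes "character \<eta>"
  shows "\<exists>\<xi>\<in>characters X T. \<forall>x\<in>carrier X. circle_exp (\<xi> x) = \<eta> x"
proof -
  define \<xi> where "\<xi> = (\<lambda>x\<in>carrier X. coset (Arg (\<eta> x) / (2 * pi)))"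
  have e: "circle_exp (\<xi> x) = \<eta> x" if "x \<in> carrier X" for x
  proof -
    have "cmod (\<eta> x) = 1" using assms that by (simp add: character_def)
    then have "cis (Arg (\<eta> x)) = \<eta> x" using rcis_cmod_Arg[of "\<eta> x"] by (simp add: rcis_def)
    then show ?thesis using that by (simp add: \<xi>_def circle_exp_coset)
  qed
  have "character (\<lambda>x. circle_exp (\<xi> x))"
    using assms cont_cong[of \<eta> "\<lambda>x. circle_exp (\<xi> x)"] e unfolding character_def by auto
  then have "\<xi> \<in> characters X T"
    unfolding characters_iff by (auto simp: \<xi>_def carrier_circle_group)
  then show ?thesis using e by blast
qed

lemma character_mult: "character \<eta> \<Longrightarrow> character \<zeta> \<Longrightarrow> character (\<lambda>x. \<eta> x * \<zeta> x)"
  unfolding character_def by (auto simp: norm_mult intro: continuous_map_mult_complex)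

lemma character_const_one: "character (\<lambda>x. 1)"
  unfolding character_def by simp

lemma character_cnj: "character \<eta> \<Longrightarrow> character (\<lambda>x. cnj (\<eta> x))"
  unfolding character_def by (auto intro: continuous_map_cnj)

lemma character_powi:
  assumes "character \<eta>" shows "character (\<lambda>x. \<eta> x powi k)"
proof -
  have p: "character (\<lambda>x. \<eta> x ^ n)" if "character \<eta>" for n and \<eta> :: "'x \<Rightarrow> complex"
    by (induction n) (auto intro: character_const_one character_mult that)
  have "inverse z = cnj z" if "cmod z = 1" for z
    by (rule inverse_unique) (simp add: that flip: complex_norm_square)
  then have "\<eta> x powi k = (if k \<ge> 0 then \<eta> x ^ nat k else cnj (\<eta> x) ^ nat (- k))" if "x \<in> carrier X" for x
    using assms that by (auto simp: power_int_def character_def)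
  moreover have "character (\<lambda>x. if k \<ge> 0 then \<eta> x ^ nat k else cnj (\<eta> x) ^ nat (- k))"
    using p[OF assms, of "nat k"] p[OF character_cnj[OF assms], of "nat (- k)"] by (cases "k \<ge> 0") auto
  ultimately show ?thesis
    unfolding character_def by (auto intro: cont_cong)
qed

lemma character_prod: "finite A \<Longrightarrow> (\<And>i. i \<in> A \<Longrightarrow> character (\<eta> i)) \<Longrightarrow> character (\<lambda>x. \<Prod>i\<in>A. \<eta> i x)"
  by (induction rule: finite_induct) (auto intro: character_const_one character_mult)

lemma character_cong: "character \<eta> \<Longrightarrow> (\<And>x. x \<in> carrier X \<Longrightarrow> \<zeta> x = \<eta> x) \<Longrightarrow> character \<zeta>"
  unfolding character_def by (auto intro: cont_cong)

lemma points_eqI: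
  assumes p: "p \<in> carrier X" and q: "q \<in> carrier X"
    and eq: "\<And>\<xi>. \<xi> \<in> characters X T \<Longrightarrow> circle_exp (\<xi> p) = circle_exp (\<xi> q)"
  shows "p = q"
proof (rule ccontr)
  assume "p \<noteq> q"
  then have "p \<otimes> inv q \<noteq> \<one>" using p q inv_solve_right'[of "\<one>" p q] by auto
  moreover have pq: "p \<otimes> inv q \<in> carrier X" using p q by simp
  ultimately obtain \<eta> where \<eta>: "character \<eta>" "\<eta> (p \<otimes> inv q) \<noteq> 1" using characters_separate by blast
  obtain \<xi> where \<xi>: "\<xi> \<in> characters X T" "\<forall>x\<in>carrier X. circle_exp (\<xi> x) = \<eta> x" using character_lift[OF \<eta>(1)] by blast
  have "\<eta> p = \<eta> q" using eq[OF \<xi>(1)] \<xi>(2) p q by simp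
  moreover have "\<eta> (p \<otimes> inv q) = \<eta> p * \<eta> (inv q)" "\<eta> (q \<otimes> inv q) = \<eta> q * \<eta> (inv q)"
    using \<eta>(1) p q unfolding character_def by blast+
  ultimately have "\<eta> (p \<otimes> inv q) = \<eta> \<one>" using q by simp
  then show False using \<eta> character_one by simp
qed

end

section \<open>Duals of finitely presented actions\<close>

text \<open>The \<int>-linear pairing of the group ring with functions on the group, written
  multiplicatively: \<open>c\<close> extended to a homomorphism into the nonzero complex numbers
  when all its values are nonzero.\<close>

definition pair :: "('g \<Rightarrow> complex) \<Rightarrow> ('g \<Rightarrow>\<^sub>0 int) \<Rightarrow> complex" where
  "pair c v = (\<Prod>g\<in>Poly_Mapping.keys v. c g powi Poly_Mapping.lookup v g)"

lemma pair_superset: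
  assumes "finite A" "Poly_Mapping.keys v \<subseteq> A"
  shows "pair c v = (\<Prod>g\<in>A. c g powi Poly_Mapping.lookup v g)"
  unfolding pair_def
  by (rule prod.mono_neutral_left[OF assms]) (auto simp: in_keys_iff)

lemma pair_0: "pair c 0 = 1"
  by (simp add: pair_def)

lemma pair_of: "pair c (frag_of g) = c g"
  by (simp add: pair_def keys_frag_of)

lemma pair_diff:
  assumes "\<And>g. c g \<noteq> 0"
  shows "pair c (v - w) = pair c v / pair c w"
proof -
  let ?A = "Poly_Mapping.keys v \<union> Poly_Mapping.keys w"
  have "pair c (v - w) = (\<Prod>g\<in>?A. c g powi Poly_Mapping.lookup (v - w) g)"
    by (rule pair_superset) (use keys_diff[of v w] in auto)
  also have "\<dots> = (\<Prod>g\<in>?A. c g powi Poly_Mapping.lookup v g / c g powi Poly_Mapping.lookup w g)"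
    using assms by (intro prod.cong refl) (simp add: lookup_minus power_int_diff)
  also have "\<dots> = pair c v / pair c w"
    by (simp add: prod_dividef pair_superset[of ?A])
  finally show ?thesis .
qed

lemma pair_nonzero: "(\<And>g. c g \<noteq> 0) \<Longrightarrow> pair c v \<noteq> 0"
  by (simp add: pair_def)

lemma pair_add:
  assumes "\<And>g. c g \<noteq> 0"
  shows "pair c (v + w) = pair c v * pair c w"
  using pair_diff[where c = c and v = "v + w" and w = w] pair_nonzero[where c = c and v = w] assms
  by (simp add: field_simps)

lemma pair_sum:
  assumes "\<And>g. c g \<noteq> 0"
  shows "pair c (sum f I) = (\<Prod>i\<in>I. pair c (f i))"
proof (cases "finite I")
  case True
  then show ?thesis by (induction I) (auto simp: pair_0 pair_add[OF assms])
qed (simp add: pair_0)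

lemma pair_frag_extend:
  assumes "\<And>g. c g \<noteq> 0"
  shows "pair c (frag_extend f v) = pair (\<lambda>g. pair c (f g)) v"
  using subset_UNIV[of "Poly_Mapping.keys v"]
proof (induction v rule: frag_induction)
  case (diff a b)
  then show ?case
    using pair_diff[of "\<lambda>g. pair c (f g)" a b] pair_nonzero[where c = c] assms
    by (simp add: frag_extend_diff pair_diff)
qed (auto simp: pair_0 pair_of)

lemma pair_prod:
  assumes "finite J"
  shows "pair (\<lambda>g. \<Prod>j\<in>J. c j g) v = (\<Prod>j\<in>J. pair (c j) v)"
proof -
  have "(\<Prod>j\<in>J. c j g) powi k = (\<Prod>j\<in>J. c j g powi k)" for g k
    using assms by (induction J) (auto simp: power_int_mult_distrib)
  then show ?thesis unfolding pair_def by (simp add: prod.swap[of _ J])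
qed

lemma norm_pair: "(\<And>g. cmod (c g) = 1) \<Longrightarrow> cmod (pair c v) = 1"
  by (simp add: pair_def norm_power_int prod_norm[symmetric])

lemma pair_cong: "(\<And>g. g \<in> Poly_Mapping.keys v \<Longrightarrow> c g = d g) \<Longrightarrow> pair c v = pair d v"
  by (simp add: pair_def)

lemma pair_one: "pair (\<lambda>g. 1) v = 1"
  by (simp add: pair_def)

lemma pair_mult_group_ring:
  assumes "\<And>g. c g \<noteq> 0"
  shows "pair c (r \<otimes>\<^bsub>group_ring G\<^esub> s) = pair (\<lambda>g. pair (\<lambda>h. c (g \<otimes>\<^bsub>G\<^esub> h)) s) r"
  by (simp add: group_ring_def pair_frag_extend[OF assms] pair_of)

section \<open>The group ring, free modules and the row space\<close>

lemma group_ring_carrier: "carrier (group_ring G) = {a. Poly_Mapping.keys a \<subseteq> carrier G}"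
  and group_ring_add: "r \<oplus>\<^bsub>group_ring G\<^esub> s = r + s"
  and group_ring_zero: "\<zero>\<^bsub>group_ring G\<^esub> = 0"
  by (simp_all add: group_ring_def)

lemma abelian_group_group_ring: "abelian_group (group_ring G)"
proof (rule abelian_groupI)
  fix x y assume "x \<in> carrier (group_ring G)" "y \<in> carrier (group_ring G)"
  then show "x \<oplus>\<^bsub>group_ring G\<^esub> y \<in> carrier (group_ring G)"
    using keys_add[of x y] by (auto simp: group_ring_carrier group_ring_add)
next
  fix x assume "x \<in> carrier (group_ring G)"
  then show "\<exists>y\<in>carrier (group_ring G). y \<oplus>\<^bsub>group_ring G\<^esub> x = \<zero>\<^bsub>group_ring G\<^esub>"
    by (intro bexI[of _ "- x"]) (auto simp: group_ring_carrier group_ring_add group_ring_zero)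
qed (auto simp: group_ring_carrier group_ring_add group_ring_zero ac_simps)

lemma finsum_group_ring:
  assumes "finite I" "\<And>i. i \<in> I \<Longrightarrow> f i \<in> carrier (group_ring G)"
  shows "finsum (group_ring G) f I = sum f I"
proof -
  interpret abelian_group "group_ring G" by (rule abelian_group_group_ring)
  show ?thesis using assms
    by (induction I) (auto simp: group_ring_zero group_ring_add Pi_iff)
qed

lemma group_ring_mult_closed:
  assumes "group G" "r \<in> carrier (group_ring G)" "s \<in> carrier (group_ring G)"
  shows "r \<otimes>\<^bsub>group_ring G\<^esub> s \<in> carrier (group_ring G)"
proof -
  interpret group G by fact
  have "Poly_Mapping.keys (frag_extend (\<lambda>h. frag_of (g \<otimes>\<^bsub>G\<^esub> h)) s) \<subseteq> carrier G" if "g \<in> carrier G" for g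
  proof (rule order_trans[OF keys_frag_extend])
    show "(\<Union>x\<in>Poly_Mapping.keys s. Poly_Mapping.keys (frag_of (g \<otimes>\<^bsub>G\<^esub> x))) \<subseteq> carrier G"
      using that assms(3) by (auto simp: keys_frag_of group_ring_carrier)
  qed
  then have "(\<Union>x\<in>Poly_Mapping.keys r. Poly_Mapping.keys (frag_extend (\<lambda>h. frag_of (x \<otimes>\<^bsub>G\<^esub> h)) s)) \<subseteq> carrier G"
    using assms(2) by (auto simp: group_ring_carrier)
  then have "Poly_Mapping.keys (frag_extend (\<lambda>g. frag_extend (\<lambda>h. frag_of (g \<otimes>\<^bsub>G\<^esub> h)) s) r) \<subseteq> carrier G"
    by (rule order_trans[OF keys_frag_extend])
  then show ?thesis by (simp add: group_ring_def)
qed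

lemma group_ring_mult_add_left:
  "(r + r') \<otimes>\<^bsub>group_ring G\<^esub> s = r \<otimes>\<^bsub>group_ring G\<^esub> s + r' \<otimes>\<^bsub>group_ring G\<^esub> s"
  by (simp add: group_ring_def frag_extend_add)

lemma group_ring_mult_0: "0 \<otimes>\<^bsub>group_ring G\<^esub> s = 0" "r \<otimes>\<^bsub>group_ring G\<^esub> 0 = 0"
  by (simp_all add: group_ring_def) (simp add: frag_extend_def)

lemma group_ring_mult_one:
  assumes "group G"
  shows "s \<in> carrier (group_ring G) \<Longrightarrow> frag_of \<one>\<^bsub>G\<^esub> \<otimes>\<^bsub>group_ring G\<^esub> s = s"
    and "s \<in> carrier (group_ring G) \<Longrightarrow> s \<otimes>\<^bsub>group_ring G\<^esub> frag_of \<one>\<^bsub>G\<^esub> = s"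
proof -
  interpret group G by fact
  assume s: "s \<in> carrier (group_ring G)"
  have "frag_extend (\<lambda>h. frag_of (\<one>\<^bsub>G\<^esub> \<otimes>\<^bsub>G\<^esub> h)) s = frag_extend frag_of s"
       "frag_extend (\<lambda>h. frag_of (h \<otimes>\<^bsub>G\<^esub> \<one>\<^bsub>G\<^esub>)) s = frag_extend frag_of s"
    using s by (intro frag_extend_eq; auto simp: group_ring_carrier)+
  then show "frag_of \<one>\<^bsub>G\<^esub> \<otimes>\<^bsub>group_ring G\<^esub> s = s" "s \<otimes>\<^bsub>group_ring G\<^esub> frag_of \<one>\<^bsub>G\<^esub> = s"
    using frag_expansion[of s] by (simp_all add: group_ring_def)
qed

lemma free_carrier: "carrier (free_left_module R n) = {..<n} \<rightarrow>\<^sub>E carrier R"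
  and free_add: "v \<oplus>\<^bsub>free_left_module R n\<^esub> w = (\<lambda>i\<in>{..<n}. v i \<oplus>\<^bsub>R\<^esub> w i)"
  and free_zero: "\<zero>\<^bsub>free_left_module R n\<^esub> = (\<lambda>i\<in>{..<n}. \<zero>\<^bsub>R\<^esub>)"
  and free_smult: "r \<odot>\<^bsub>free_left_module R n\<^esub> v = (\<lambda>i\<in>{..<n}. r \<otimes>\<^bsub>R\<^esub> v i)"
  by (simp_all add: free_left_module_def)

lemma abelian_group_free:
  assumes "abelian_group R" shows "abelian_group (free_left_module R n)"
proof -
  interpret R: abelian_group R by fact
  show ?thesis
  proof (rule abelian_groupI)
    fix x assume x: "x \<in> carrier (free_left_module R n)"
    then have "(\<lambda>i\<in>{..<n}. \<ominus>\<^bsub>R\<^esub> x i) \<oplus>\<^bsub>free_left_module R n\<^esub> x = \<zero>\<^bsub>free_left_module R n\<^esub>"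
      unfolding free_add free_zero by (intro restrict_ext) (auto simp: free_carrier PiE_iff R.l_neg)
    moreover have "(\<lambda>i\<in>{..<n}. \<ominus>\<^bsub>R\<^esub> x i) \<in> carrier (free_left_module R n)"
      using x by (auto simp: free_carrier PiE_iff)
    ultimately show "\<exists>y\<in>carrier (free_left_module R n). y \<oplus>\<^bsub>free_left_module R n\<^esub> x = \<zero>\<^bsub>free_left_module R n\<^esub>"
      by blast
  next
    fix x assume x: "x \<in> carrier (free_left_module R n)"
    show "\<zero>\<^bsub>free_left_module R n\<^esub> \<oplus>\<^bsub>free_left_module R n\<^esub> x = x"
    proof
      fix i show "(\<zero>\<^bsub>free_left_module R n\<^esub> \<oplus>\<^bsub>free_left_module R n\<^esub> x) i = x i"
        using x by (cases "i < n") (auto simp: free_add free_zero free_carrier PiE_iff extensional_def)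
    qed
  next
    fix x y assume "x \<in> carrier (free_left_module R n)" "y \<in> carrier (free_left_module R n)"
    then show "x \<oplus>\<^bsub>free_left_module R n\<^esub> y \<in> carrier (free_left_module R n)"
      "x \<oplus>\<^bsub>free_left_module R n\<^esub> y = y \<oplus>\<^bsub>free_left_module R n\<^esub> x"
      unfolding free_carrier free_add by (auto simp: PiE_iff R.a_comm intro!: restrict_ext)
  next
    fix x y z assume "x \<in> carrier (free_left_module R n)" "y \<in> carrier (free_left_module R n)" "z \<in> carrier (free_left_module R n)"
    then show "x \<oplus>\<^bsub>free_left_module R n\<^esub> y \<oplus>\<^bsub>free_left_module R n\<^esub> z = x \<oplus>\<^bsub>free_left_module R n\<^esub> (y \<oplus>\<^bsub>free_left_module R n\<^esub> z)"
      unfolding free_carrier free_add by (intro restrict_ext) (auto simp: PiE_iff R.a_assoc)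
  qed (auto simp: free_carrier free_zero)
qed

definition row_space :: "('g, 'b) monoid_scheme \<Rightarrow> nat \<Rightarrow> nat \<Rightarrow> (nat \<Rightarrow> nat \<Rightarrow> 'g \<Rightarrow>\<^sub>0 int) \<Rightarrow> (nat \<Rightarrow> 'g \<Rightarrow>\<^sub>0 int) set" where
  "row_space G k n P = (\<lambda>v. row_times_matrix (group_ring G) k n v P) ` carrier (free_left_module (group_ring G) k)"

lemma row_times_matrix_eq:
  assumes "group G" "\<forall>i<k. \<forall>j<n. P i j \<in> carrier (group_ring G)" "v \<in> carrier (free_left_module (group_ring G) k)"
  shows "row_times_matrix (group_ring G) k n v P = (\<lambda>j\<in>{..<n}. \<Sum>i<k. v i \<otimes>\<^bsub>group_ring G\<^esub> P i j)"
  unfolding row_times_matrix_def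
  by (intro restrict_ext finsum_group_ring)
    (use assms in \<open>auto simp: free_carrier PiE_iff intro!: group_ring_mult_closed\<close>)

lemma abelian_subgroup_row_space:
  assumes G: "group G" and P: "\<forall>i<k. \<forall>j<n. P i j \<in> carrier (group_ring G)"
  shows "abelian_subgroup (row_space G k n P) (free_left_module (group_ring G) n)"
proof (rule abelian_subgroupI3)
  let ?R = "group_ring G" let ?F = "free_left_module (group_ring G) n" let ?K = "free_left_module (group_ring G) k"
  interpret R: abelian_group ?R by (rule abelian_group_group_ring)
  interpret F: abelian_group ?F by (rule abelian_group_free[OF R.abelian_group_axioms])
  interpret K: abelian_group ?K by (rule abelian_group_free[OF R.abelian_group_axioms])
  show "abelian_group ?F" by (rule F.abelian_group_axioms)
  note row = row_times_matrix_eq[OF G P]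
  have closed: "row_times_matrix ?R k n v P \<in> carrier ?F" if v: "v \<in> carrier ?K" for v
  proof -
    have "(\<Sum>i<k. v i \<otimes>\<^bsub>?R\<^esub> P i j) \<in> carrier ?R" if "j < n" for j
    proof -
      have m: "v i \<otimes>\<^bsub>?R\<^esub> P i j \<in> carrier ?R" if "i \<in> {..<k}" for i
        using v P that \<open>j < n\<close> by (intro group_ring_mult_closed[OF G]) (auto simp: free_carrier PiE_iff)
      have eq: "finsum ?R (\<lambda>i. v i \<otimes>\<^bsub>?R\<^esub> P i j) {..<k} = (\<Sum>i<k. v i \<otimes>\<^bsub>?R\<^esub> P i j)"
        by (rule finsum_group_ring) (use m in auto)
      show ?thesis unfolding eq[symmetric] by (rule R.finsum_closed) (use m in auto)
    qed
    then show ?thesis unfolding row[OF v] by (auto simp: free_carrier)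
  qed
  have add: "row_times_matrix ?R k n (v \<oplus>\<^bsub>?K\<^esub> w) P = row_times_matrix ?R k n v P \<oplus>\<^bsub>?F\<^esub> row_times_matrix ?R k n w P"
    if v: "v \<in> carrier ?K" and w: "w \<in> carrier ?K" for v w
    by (subst row[OF K.a_closed[OF v w]], subst row[OF v], subst row[OF w], unfold free_add, intro restrict_ext) (auto simp: group_ring_add group_ring_mult_add_left sum.distrib)
  have "group_hom (add_monoid ?K) (add_monoid ?F) (\<lambda>v. row_times_matrix ?R k n v P)"
    unfolding group_hom_def group_hom_axioms_def
    using K.a_group F.a_group closed add by (auto simp: hom_def)
  from group_hom.img_is_subgroup[OF this]
  show "additive_subgroup (row_space G k n P) ?F"
    unfolding row_space_def by (intro additive_subgroupI) simp
qed

section \<open>The dual module of the action\<close>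

context algebraic_action
begin

abbreviation "M \<equiv> dual_module G X T a"

lemma group_G: "group G"
  using group_hom by (simp add: group_hom_def)

lemma act_closed: "g \<in> carrier G \<Longrightarrow> x \<in> carrier X \<Longrightarrow> a g x \<in> carrier X"
  using acts_by_homomorphisms by (auto simp: hom_def)

lemma inv_closed_G: "g \<in> carrier G \<Longrightarrow> inv\<^bsub>G\<^esub> g \<in> carrier G"
  by (rule group.inv_closed[OF group_G])

lemma act_mult: "g \<in> carrier G \<Longrightarrow> h \<in> carrier G \<Longrightarrow> x \<in> carrier X \<Longrightarrow> a g (a h x) = a (g \<otimes>\<^bsub>G\<^esub> h) x"
  using composition_rule by auto

lemma dual_carrier: "carrier M = characters X T"
  by (simp add: dual_module_def)

lemma dual_add: "x \<in> carrier X \<Longrightarrow> \<xi> \<in> characters X T \<Longrightarrow> \<psi> \<in> characters X T \<Longrightarrow>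
    circle_exp ((\<xi> \<oplus>\<^bsub>M\<^esub> \<psi>) x) = circle_exp (\<xi> x) * circle_exp (\<psi> x)"
  by (simp add: dual_module_def circle_exp_mult characters_closed)

lemma dual_add_closed:
  assumes "\<xi> \<in> characters X T" "\<psi> \<in> characters X T" shows "\<xi> \<oplus>\<^bsub>M\<^esub> \<psi> \<in> characters X T"
  unfolding characters_iff
proof
  show "\<xi> \<oplus>\<^bsub>M\<^esub> \<psi> \<in> carrier X \<rightarrow>\<^sub>E carrier circle_group"
    using assms characters_closed by (auto simp: dual_module_def)
  show "character (\<lambda>x. circle_exp ((\<xi> \<oplus>\<^bsub>M\<^esub> \<psi>) x))"
    by (rule character_cong[OF character_mult[OF assms[THEN characters_character]]]) (simp add: dual_add assms)
qed

lemma dual_zero: "\<zero>\<^bsub>M\<^esub> \<in> characters X T" "x \<in> carrier X \<Longrightarrow> circle_exp (\<zero>\<^bsub>M\<^esub> x) = 1"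
proof -
  show e: "circle_exp (\<zero>\<^bsub>M\<^esub> x) = 1" if "x \<in> carrier X" for x
    using that by (simp add: dual_module_def circle_exp_one)
  have "character (\<lambda>x. circle_exp (\<zero>\<^bsub>M\<^esub> x))"
    by (rule character_cong[OF character_const_one]) (simp add: e)
  then show "\<zero>\<^bsub>M\<^esub> \<in> characters X T"
    unfolding characters_iff by (auto simp: dual_module_def)
qed

lemma dual_smult:
  assumes r: "r \<in> carrier (group_ring G)" and \<xi>: "\<xi> \<in> characters X T"
  shows "r \<odot>\<^bsub>M\<^esub> \<xi> \<in> characters X T"
    and "x \<in> carrier X \<Longrightarrow> circle_exp ((r \<odot>\<^bsub>M\<^esub> \<xi>) x) = pair (\<lambda>g. circle_exp (\<xi> (a (inv\<^bsub>G\<^esub> g) x))) r"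
proof -
  have keys: "g \<in> carrier G" if "g \<in> Poly_Mapping.keys r" for g using r that by (auto simp: group_ring_carrier)
  have cl: "\<xi> (a (inv\<^bsub>G\<^esub> g) x) [^]\<^bsub>circle_group\<^esub> Poly_Mapping.lookup r g \<in> carrier circle_group"
    if "x \<in> carrier X" "g \<in> Poly_Mapping.keys r" for x g
    using that keys by (intro circle.int_pow_closed characters_closed[OF \<xi>] act_closed inv_closed_G) auto
  show e: "circle_exp ((r \<odot>\<^bsub>M\<^esub> \<xi>) x) = pair (\<lambda>g. circle_exp (\<xi> (a (inv\<^bsub>G\<^esub> g) x))) r" if x: "x \<in> carrier X" for x
  proof -
    have "circle_exp ((r \<odot>\<^bsub>M\<^esub> \<xi>) x) = (\<Prod>g\<in>Poly_Mapping.keys r. circle_exp (\<xi> (a (inv\<^bsub>G\<^esub> g) x) [^]\<^bsub>circle_group\<^esub> Poly_Mapping.lookup r g))"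
      using x cl by (simp add: dual_module_def circle_exp_finprod)
    also have "\<dots> = pair (\<lambda>g. circle_exp (\<xi> (a (inv\<^bsub>G\<^esub> g) x))) r"
      unfolding pair_def
      by (intro prod.cong refl circle_exp_int_pow characters_closed[OF \<xi>] act_closed inv_closed_G keys x)
    finally show ?thesis .
  qed
  have ch: "character (\<lambda>x. circle_exp (\<xi> (a g x)))" if g: "g \<in> carrier G" for g
  proof -
    have c: "character (\<lambda>x. circle_exp (\<xi> x))" by (rule characters_character[OF \<xi>])
    then have "cont (\<lambda>x. circle_exp (\<xi> (a g x)))"
      using continuous_map_comp_cont[OF acts_continuously[OF g], of "\<lambda>x. circle_exp (\<xi> x)"] by (simp add: character_def)
    then show ?thesis
      using c acts_by_homomorphisms[OF g] act_closed[OF g] unfolding character_def by (auto simp: hom_def)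
  qed
  have "character (\<lambda>x. pair (\<lambda>g. circle_exp (\<xi> (a (inv\<^bsub>G\<^esub> g) x))) r)"
    unfolding pair_def by (intro character_prod character_powi ch inv_closed_G keys) auto
  then have "character (\<lambda>x. circle_exp ((r \<odot>\<^bsub>M\<^esub> \<xi>) x))" by (rule character_cong) (rule e)
  moreover have "r \<odot>\<^bsub>M\<^esub> \<xi> \<in> carrier X \<rightarrow>\<^sub>E carrier circle_group"
    using cl by (auto simp: dual_module_def intro!: circle.finprod_closed)
  ultimately show "r \<odot>\<^bsub>M\<^esub> \<xi> \<in> characters X T" by (simp add: characters_iff)
qed

lemma comm_group_dual: "comm_group (add_monoid M)"
proof (rule comm_groupI)
  fix \<xi> assume "\<xi> \<in> carrier (add_monoid M)"
  then have \<xi>: "\<xi> \<in> characters X T" by (simp add: dual_carrier)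
  obtain \<psi> where \<psi>: "\<psi> \<in> characters X T" "\<forall>x\<in>carrier X. circle_exp (\<psi> x) = cnj (circle_exp (\<xi> x))"
    using character_lift[OF character_cnj[OF characters_character[OF \<xi>]]] by blast
  have "\<psi> \<oplus>\<^bsub>M\<^esub> \<xi> = \<zero>\<^bsub>M\<^esub>"
  proof (rule characters_eqI[OF dual_add_closed[OF \<psi>(1) \<xi>] dual_zero(1)])
    fix x assume x: "x \<in> carrier X"
    have "circle_exp (\<xi> x) * cnj (circle_exp (\<xi> x)) = 1"
      using norm_circle_exp[OF characters_closed[OF \<xi> x]] by (simp flip: complex_norm_square)
    then show "circle_exp ((\<psi> \<oplus>\<^bsub>M\<^esub> \<xi>) x) = circle_exp (\<zero>\<^bsub>M\<^esub> x)"
      using x \<psi> \<xi> by (simp add: dual_add dual_zero mult.commute)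
  qed
  then show "\<exists>\<psi>\<in>carrier (add_monoid M). \<psi> \<otimes>\<^bsub>add_monoid M\<^esub> \<xi> = \<one>\<^bsub>add_monoid M\<^esub>"
    using \<psi>(1) by (auto simp: dual_carrier)
qed (auto simp: dual_carrier dual_add_closed dual_zero dual_add intro!: characters_eqI)

text \<open>The module isomorphism turns the dual into a presentation of \<open>X\<close> as the solution set of the
  equations given by the rows of the matrix, with coordinates \<open>\<xi> j (a (inv g) p)\<close>.\<close>

lemma finitely_presented_coordinates:
  assumes "finitely_presented_action G X T a"
  shows "\<exists>(n :: nat) (k :: nat) P \<xi>. (\<forall>i<k. \<forall>j<n. P i j \<in> carrier (group_ring G)) \<and>
    (\<forall>j<n. \<xi> j \<in> characters X T) \<and>
    (\<forall>i<k. \<forall>p\<in>carrier X. (\<Prod>j<n. pair (\<lambda>g. circle_exp (\<xi> j (a (inv\<^bsub>G\<^esub> g) p))) (P i j)) = 1) \<and>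
    (\<forall>x. (\<forall>j g. cmod (x j g) = 1) \<longrightarrow>
      (\<forall>i<k. \<forall>h\<in>carrier G. (\<Prod>j<n. pair (\<lambda>g. x j (h \<otimes>\<^bsub>G\<^esub> g)) (P i j)) = 1) \<longrightarrow>
      (\<exists>!p. p \<in> carrier X \<and> (\<forall>j<n. \<forall>g\<in>carrier G. circle_exp (\<xi> j (a (inv\<^bsub>G\<^esub> g) p)) = x j g)))"
proof -
  let ?R = "group_ring G"
  obtain n k P where P: "\<forall>i<k. \<forall>j<n. P i j \<in> carrier ?R"
    and iso: "isomorphic_left_modules ?R M (quotient_left_module (free_left_module ?R n) (row_space G k n P))"
    using assms unfolding finitely_presented_action_def finitely_presented_left_module_def row_space_def by blast
  let ?F = "free_left_module ?R n"
  define N where "N = row_space G k n P"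
  let ?Q = "quotient_left_module ?F N"
  interpret N: abelian_subgroup N ?F unfolding N_def by (rule abelian_subgroup_row_space[OF group_G P])
  interpret R: abelian_group ?R by (rule abelian_group_group_ring)
  interpret D: comm_group "add_monoid M" by (rule comm_group_dual)
  define cl where "cl v = N +>\<^bsub>?F\<^esub> v" for v
  have Q: "carrier ?Q = cl ` carrier ?F" "\<And>C D. C \<oplus>\<^bsub>?Q\<^esub> D = C <+>\<^bsub>?F\<^esub> D"
    "\<And>r C. r \<odot>\<^bsub>?Q\<^esub> C = (\<Union>m\<in>C. cl (r \<odot>\<^bsub>?F\<^esub> m))"
    unfolding quotient_left_module_def cl_def by (auto simp: A_RCOSETS_def' )
  obtain \<phi> where \<phi>: "\<phi> \<in> iso (add_monoid M) (add_monoid ?Q)"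
    and \<phi>_smult: "\<And>r m. r \<in> carrier ?R \<Longrightarrow> m \<in> carrier M \<Longrightarrow> \<phi> (r \<odot>\<^bsub>M\<^esub> m) = r \<odot>\<^bsub>?Q\<^esub> \<phi> m"
    using iso unfolding isomorphic_left_modules_def N_def by blast
  have bij: "bij_betw \<phi> (characters X T) (cl ` carrier ?F)"
    using \<phi> by (simp add: iso_def dual_carrier Q)
  have \<phi>_add: "\<phi> (\<xi> \<oplus>\<^bsub>M\<^esub> \<psi>) = \<phi> \<xi> <+>\<^bsub>?F\<^esub> \<phi> \<psi>" if "\<xi> \<in> characters X T" "\<psi> \<in> characters X T" for \<xi> \<psi>
    using \<phi> that by (simp add: iso_def hom_def dual_carrier Q)
  have cl_add: "cl v <+>\<^bsub>?F\<^esub> cl w = cl (v \<oplus>\<^bsub>?F\<^esub> w)" if "v \<in> carrier ?F" "w \<in> carrier ?F" for v w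
    unfolding cl_def by (rule N.a_rcos_sum[OF that])
  have cl_self: "v \<in> cl v" if "v \<in> carrier ?F" for v unfolding cl_def by (rule N.a_rcos_self[OF that])
  have cl_mem: "w \<in> cl v \<longleftrightarrow> (\<exists>u\<in>N. w = u \<oplus>\<^bsub>?F\<^esub> v)" for v w
    unfolding cl_def by (auto simp: a_r_coset_def')
  have N_sub: "u \<in> carrier ?F" if "u \<in> N" for u using N.a_subset that by blast
  have cl_eq: "cl v = cl w" if "w \<in> cl v" "v \<in> carrier ?F" for v w
    unfolding cl_def by (rule N.a_repr_independence[OF _ that(2) N.a_subgroup]) (use that(1) in \<open>simp add: cl_def\<close>)
  have surj: "\<exists>S\<in>characters X T. \<phi> S = cl v" if "v \<in> carrier ?F" for v
  proof -
    have "cl v \<in> \<phi> ` characters X T" using bij_betw_imp_surj_on[OF bij] that by blast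
    then show ?thesis by (auto simp: image_iff)
  qed
  have inj: "S = S'" if "S \<in> characters X T" "S' \<in> characters X T" "\<phi> S = \<phi> S'" for S S'
    using bij that unfolding bij_betw_def inj_on_def by blast
  define one where "one = frag_of \<one>\<^bsub>G\<^esub>"
  have one: "one \<in> carrier ?R"
    using group.is_monoid[OF group_G, THEN monoid.one_closed] by (simp add: one_def group_ring_carrier keys_frag_of)
  define e where "e j = (\<lambda>i\<in>{..<n}. if i = j then one else 0)" for j :: nat
  have e: "e j \<in> carrier ?F" for j using one by (auto simp: e_def free_carrier group_ring_carrier)
  define \<xi> where "\<xi> j = (SOME S. S \<in> characters X T \<and> \<phi> S = cl (e j))" for j
  have \<xi>: "\<xi> j \<in> characters X T" "\<phi> (\<xi> j) = cl (e j)" for j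
    using someI_ex[of "\<lambda>S. S \<in> characters X T \<and> \<phi> S = cl (e j)"] surj[OF e, of j] unfolding \<xi>_def by blast+
  have smult_e: "\<phi> (r \<odot>\<^bsub>M\<^esub> \<xi> j) = cl (\<lambda>i\<in>{..<n}. if i = j then r else 0)" if r: "r \<in> carrier ?R" for r j
  proof -
    let ?re = "\<lambda>i\<in>{..<n}. if i = j then r else 0"
    have re: "r \<odot>\<^bsub>?F\<^esub> e j = ?re"
      unfolding free_smult
      by (intro restrict_ext) (auto simp: e_def one_def group_ring_mult_0 group_ring_mult_one(2)[OF group_G r])
    have reF: "?re \<in> carrier ?F" using r by (auto simp: free_carrier group_ring_carrier)
    have eq: "\<phi> (r \<odot>\<^bsub>M\<^esub> \<xi> j) = (\<Union>m\<in>cl (e j). cl (r \<odot>\<^bsub>?F\<^esub> m))"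
      using \<phi>_smult[OF r, of "\<xi> j"] \<xi> by (simp add: dual_carrier Q(3))
    \<comment> \<open>Scalar multiples in the quotient are written as unions of cosets. That this
      one is a single coset is taken from the range of \<open>\<phi>\<close>, and then the one
      element \<open>?re\<close> identifies it.\<close>
    have "\<phi> (r \<odot>\<^bsub>M\<^esub> \<xi> j) \<in> cl ` carrier ?F"
      using bij dual_smult(1)[OF r \<xi>(1)] unfolding bij_betw_def by blast
    then obtain w where w: "w \<in> carrier ?F" "\<phi> (r \<odot>\<^bsub>M\<^esub> \<xi> j) = cl w" by blast
    have "?re \<in> \<phi> (r \<odot>\<^bsub>M\<^esub> \<xi> j)"
      unfolding eq using cl_self[OF e, of j] cl_self[OF reF] re by (intro UN_I[of "e j"]) simp_all
    then have "cl w = cl ?re" using w by (intro cl_eq) auto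
    then show ?thesis using w by simp
  qed
  \<comment> \<open>The character belonging to the class of \<open>v\<close> is built up one
    coordinate at a time, which yields its values as a product of pairings.\<close>
  have comb: "\<exists>S\<in>characters X T. \<phi> S = cl v \<and>
     (\<forall>p\<in>carrier X. circle_exp (S p) = (\<Prod>j<n. pair (\<lambda>g. circle_exp (\<xi> j (a (inv\<^bsub>G\<^esub> g) p))) (v j)))"
    if v: "v \<in> carrier ?F" for v
  proof -
    have vR: "v i \<in> carrier ?R" if "i < n" for i using v that by (auto simp: free_carrier)
    have tr: "(\<lambda>i\<in>{..<n}. if i < m then v i else 0) \<in> carrier ?F" for m
      using vR by (auto simp: free_carrier group_ring_carrier)
    have "\<exists>S\<in>characters X T. \<phi> S = cl (\<lambda>i\<in>{..<n}. if i < m then v i else 0) \<and>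
      (\<forall>p\<in>carrier X. circle_exp (S p) = (\<Prod>j<m. pair (\<lambda>g. circle_exp (\<xi> j (a (inv\<^bsub>G\<^esub> g) p))) (v j)))" if "m \<le> n" for m
      using that
    proof (induction m)
      case 0
      let ?z = "\<lambda>i\<in>{..<n}. 0 :: 'g \<Rightarrow>\<^sub>0 int"
      have z: "?z \<in> carrier ?F" using tr[of 0] by simp
      obtain S where S: "S \<in> characters X T" "\<phi> S = cl ?z" using surj[OF z] by blast
      \<comment> \<open>The character of the zero class satisfies \<open>S + S = S\<close>, so its
        values are unit numbers equal to their squares, that is 1.\<close>
      have "?z \<oplus>\<^bsub>?F\<^esub> ?z = ?z" by (auto simp: free_add group_ring_add)
      then have "\<phi> (S \<oplus>\<^bsub>M\<^esub> S) = \<phi> S" using \<phi>_add[OF S(1,1)] cl_add[OF z z] S(2) by simp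
      then have SS: "S \<oplus>\<^bsub>M\<^esub> S = S" by (rule inj[OF dual_add_closed[OF S(1,1)] S(1)])
      have S1: "circle_exp (S p) = 1" if p: "p \<in> carrier X" for p
        using dual_add[OF p S(1,1)] norm_circle_exp[OF characters_closed[OF S(1) p]] unfolding SS by auto
      have "\<phi> S = cl (\<lambda>i\<in>{..<n}. if i < 0 then v i else 0)" by (simp only: S(2) not_less0 if_False)
      then show ?case by (intro bexI[OF conjI S(1)]) (auto simp only: S1 lessThan_0 prod.empty)
    next
      case (Suc m)
      then have "m \<le> n" by simp
      from Suc.IH[OF this] obtain S where S: "S \<in> characters X T" "\<phi> S = cl (\<lambda>i\<in>{..<n}. if i < m then v i else 0)"
        "\<forall>p\<in>carrier X. circle_exp (S p) = (\<Prod>j<m. pair (\<lambda>g. circle_exp (\<xi> j (a (inv\<^bsub>G\<^esub> g) p))) (v j))" by blast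
      have m: "m < n" using Suc by simp
      let ?S = "v m \<odot>\<^bsub>M\<^esub> \<xi> m"
      have S': "?S \<in> characters X T" by (rule dual_smult(1)[OF vR[OF m] \<xi>(1)])
      have reF: "(\<lambda>i\<in>{..<n}. if i = m then v m else 0) \<in> carrier ?F" using vR[OF m] by (auto simp: free_carrier group_ring_carrier)
      have "\<phi> (S \<oplus>\<^bsub>M\<^esub> ?S) = cl ((\<lambda>i\<in>{..<n}. if i < m then v i else 0) \<oplus>\<^bsub>?F\<^esub> (\<lambda>i\<in>{..<n}. if i = m then v m else 0))"
        using \<phi>_add[OF S(1) S'] cl_add[OF tr reF] smult_e[OF vR[OF m], of m] S(2) by simp
      also have "(\<lambda>i\<in>{..<n}. if i < m then v i else 0) \<oplus>\<^bsub>?F\<^esub> (\<lambda>i\<in>{..<n}. if i = m then v m else 0) =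
        (\<lambda>i\<in>{..<n}. if i < Suc m then v i else 0)"
        unfolding free_add by (intro restrict_ext) (auto simp: group_ring_add less_Suc_eq)
      finally have "\<phi> (S \<oplus>\<^bsub>M\<^esub> ?S) = cl (\<lambda>i\<in>{..<n}. if i < Suc m then v i else 0)" .
      moreover have "circle_exp ((S \<oplus>\<^bsub>M\<^esub> ?S) p) = (\<Prod>j<Suc m. pair (\<lambda>g. circle_exp (\<xi> j (a (inv\<^bsub>G\<^esub> g) p))) (v j))"
        if p: "p \<in> carrier X" for p
        using S(3) p by (simp add: dual_add[OF p S(1) S'] dual_smult(2)[OF vR[OF m] \<xi>(1) p])
      ultimately show ?case using dual_add_closed[OF S(1) S'] by blast
    qed
    from this[of n] have "\<exists>S\<in>characters X T. \<phi> S = cl (\<lambda>i\<in>{..<n}. if i < n then v i else 0) \<and>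
      (\<forall>p\<in>carrier X. circle_exp (S p) = (\<Prod>j<n. pair (\<lambda>g. circle_exp (\<xi> j (a (inv\<^bsub>G\<^esub> g) p))) (v j)))" by simp
    moreover have "(\<lambda>i\<in>{..<n}. if i < n then v i else 0) = v"
      using v by (auto simp: free_carrier fun_eq_iff PiE_iff extensional_def)
    ultimately show ?thesis by simp
  qed
  \<comment> \<open>Row \<open>i\<close> is the image of unit vector \<open>i\<close> and hence lies
    in \<open>N\<close>. Its class is zero, so by injectivity of \<open>\<phi>\<close> its character
    is the trivial one.\<close>
  have rel: "(\<Prod>j<n. pair (\<lambda>g. circle_exp (\<xi> j (a (inv\<^bsub>G\<^esub> g) p))) (P i j)) = 1"
    if i: "i < k" and p: "p \<in> carrier X" for i p
  proof -
    let ?u = "\<lambda>i'\<in>{..<k}. if i' = i then one else 0"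
    let ?v = "\<lambda>j\<in>{..<n}. P i j" and ?z = "\<lambda>i\<in>{..<n}. 0 :: 'g \<Rightarrow>\<^sub>0 int"
    have u: "?u \<in> carrier (free_left_module ?R k)" using one by (auto simp: free_carrier group_ring_carrier)
    have v: "?v \<in> carrier ?F" using P i by (auto simp: free_carrier)
    have z: "?z \<in> carrier ?F" by (auto simp: free_carrier group_ring_carrier)
    have "row_times_matrix ?R k n ?u P = ?v"
      unfolding row_times_matrix_eq[OF group_G P u]
    proof (intro restrict_ext)
      fix j assume "j \<in> {..<n}"
      then have "P i j \<in> carrier ?R" using P i by auto
      then have "(\<Sum>i'<k. ?u i' \<otimes>\<^bsub>?R\<^esub> P i' j) = (\<Sum>i'<k. if i' = i then P i j else 0)"
        by (intro sum.cong refl) (auto simp: one_def group_ring_mult_0 group_ring_mult_one(1)[OF group_G])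
      then show "(\<Sum>i'<k. ?u i' \<otimes>\<^bsub>?R\<^esub> P i' j) = P i j" using i by simp
    qed
    then have vN: "?v \<in> N" unfolding N_def row_space_def using u by (intro image_eqI[of _ _ ?u]) simp_all
    have "?v = ?v \<oplus>\<^bsub>?F\<^esub> ?z" by (auto simp: free_add group_ring_add)
    then have "?v \<in> cl ?z" unfolding cl_mem using vN by blast
    then have eq: "cl ?z = cl ?v" by (rule cl_eq[OF _ z])
    obtain S where S: "S \<in> characters X T" "\<phi> S = cl ?v"
      "\<forall>p\<in>carrier X. circle_exp (S p) = (\<Prod>j<n. pair (\<lambda>g. circle_exp (\<xi> j (a (inv\<^bsub>G\<^esub> g) p))) (?v j))"
      using comb[OF v] by blast
    obtain S' where S': "S' \<in> characters X T" "\<phi> S' = cl ?z"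
      "\<forall>p\<in>carrier X. circle_exp (S' p) = (\<Prod>j<n. pair (\<lambda>g. circle_exp (\<xi> j (a (inv\<^bsub>G\<^esub> g) p))) (?z j))"
      using comb[OF z] by blast
    have "S = S'" using inj[OF S(1) S'(1)] S(2) S'(2) eq by simp
    then have "(\<Prod>j<n. pair (\<lambda>g. circle_exp (\<xi> j (a (inv\<^bsub>G\<^esub> g) p))) (?v j)) = (\<Prod>j<n. pair (\<lambda>g. circle_exp (\<xi> j (a (inv\<^bsub>G\<^esub> g) p))) (?z j))"
      using trans[OF bspec[OF S(3) p, symmetric], of "circle_exp (S p)"] bspec[OF S'(3) p] by (simp only:)
    then show ?thesis by (simp add: pair_0)
  qed
  have interp: "\<exists>!p. p \<in> carrier X \<and> (\<forall>j<n. \<forall>g\<in>carrier G. circle_exp (\<xi> j (a (inv\<^bsub>G\<^esub> g) p)) = x j g)"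
    if norm: "\<forall>j g. cmod (x j g) = 1"
      and xrel: "\<forall>i<k. \<forall>h\<in>carrier G. (\<Prod>j<n. pair (\<lambda>g. x j (h \<otimes>\<^bsub>G\<^esub> g)) (P i j)) = 1" for x
  proof (rule ex_ex1I)
    have nz: "x j g \<noteq> 0" for j g using norm by (metis norm_zero zero_neq_one)
    \<comment> \<open>The prescribed values extended to a homomorphism from the free module to the
      circle. The relations make it trivial on \<open>N\<close>, so its value at a representative
      depends only on the class, and it induces a homomorphism on the dual.\<close>
    define W where "W v = (\<Prod>j<n. pair (x j) (v j))" for v
    have W_add: "W (v \<oplus>\<^bsub>?F\<^esub> w) = W v * W w" for v w
      unfolding W_def by (simp add: free_add group_ring_add pair_add nz prod.distrib)
    have W_N: "W u = 1" if uN: "u \<in> N" for u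
    proof -
      obtain v where v: "v \<in> carrier (free_left_module ?R k)" "u = row_times_matrix ?R k n v P"
        using uN unfolding N_def row_space_def by blast
      have "W u = (\<Prod>j<n. \<Prod>i<k. pair (\<lambda>h. pair (\<lambda>g. x j (h \<otimes>\<^bsub>G\<^esub> g)) (P i j)) (v i))"
        unfolding W_def v(2) row_times_matrix_eq[OF group_G P v(1)]
        by (intro prod.cong refl) (simp add: pair_sum nz pair_mult_group_ring)
      also have "\<dots> = (\<Prod>i<k. pair (\<lambda>h. \<Prod>j<n. pair (\<lambda>g. x j (h \<otimes>\<^bsub>G\<^esub> g)) (P i j)) (v i))"
        by (subst prod.swap) (simp add: pair_prod)
      also have "\<dots> = (\<Prod>i<k. 1)"
      proof (intro prod.cong refl)
        fix i assume i: "i \<in> {..<k}"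
        then have "Poly_Mapping.keys (v i) \<subseteq> carrier G" using v(1) by (auto simp: free_carrier group_ring_carrier)
        then have "pair (\<lambda>h. \<Prod>j<n. pair (\<lambda>g. x j (h \<otimes>\<^bsub>G\<^esub> g)) (P i j)) (v i) = pair (\<lambda>h. 1) (v i)"
          using xrel i by (intro pair_cong) auto
        then show "pair (\<lambda>h. \<Prod>j<n. pair (\<lambda>g. x j (h \<otimes>\<^bsub>G\<^esub> g)) (P i j)) (v i) = 1" by (simp add: pair_one)
      qed
      finally show ?thesis by simp
    qed
    have W_cl: "W v = W w" if vw: "cl v = cl w" "v \<in> carrier ?F" for v w
    proof -
      obtain u where "u \<in> N" "v = u \<oplus>\<^bsub>?F\<^esub> w" using cl_self[OF vw(2)] unfolding vw(1) cl_mem by blast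
      then show ?thesis using W_add W_N by simp
    qed
    define rep where "rep S = (SOME v. v \<in> carrier ?F \<and> \<phi> S = cl v)" for S
    have rep: "rep S \<in> carrier ?F" "\<phi> S = cl (rep S)" if "S \<in> characters X T" for S
    proof -
      have "\<phi> S \<in> cl ` carrier ?F" using bij that unfolding bij_betw_def by blast
      then have "\<exists>v. v \<in> carrier ?F \<and> \<phi> S = cl v" by blast
      from someI_ex[OF this] show "rep S \<in> carrier ?F" "\<phi> S = cl (rep S)" unfolding rep_def by blast+
    qed
    have "\<exists>p\<in>carrier X. \<forall>S\<in>carrier (add_monoid M). (\<lambda>S x. circle_exp (S x)) S p = W (rep S)"
    proof (rule character_interpolation[OF comm_group_dual])
      fix S assume "S \<in> carrier (add_monoid M)"
      then have S: "S \<in> characters X T" by (simp add: dual_carrier)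
      show "character (\<lambda>x. circle_exp (S x))" by (rule characters_character[OF S])
      show "cmod (W (rep S)) = 1" unfolding W_def by (simp add: prod_norm[symmetric] norm_pair norm)
      show "S = \<one>\<^bsub>add_monoid M\<^esub>" if "\<forall>x\<in>carrier X. circle_exp (S x) = 1"
        using characters_eqI[OF S dual_zero(1)] that dual_zero(2) by simp
    next
      fix S S' assume "S \<in> carrier (add_monoid M)" "S' \<in> carrier (add_monoid M)"
      then have S: "S \<in> characters X T" "S' \<in> characters X T" by (simp_all add: dual_carrier)
      have "cl (rep (S \<oplus>\<^bsub>M\<^esub> S')) = cl (rep S \<oplus>\<^bsub>?F\<^esub> rep S')"
        using rep(2)[OF dual_add_closed[OF S]] \<phi>_add[OF S] rep[OF S(1)] rep[OF S(2)] cl_add by simp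
      from W_cl[OF this rep(1)[OF dual_add_closed[OF S]]]
      show "W (rep (S \<otimes>\<^bsub>add_monoid M\<^esub> S')) = W (rep S) * W (rep S')" by (simp add: W_add)
      show "circle_exp ((S \<otimes>\<^bsub>add_monoid M\<^esub> S') x) = circle_exp (S x) * circle_exp (S' x)" if "x \<in> carrier X" for x
        using dual_add[OF that S] by simp
    qed
    then obtain p where p: "p \<in> carrier X" "\<And>S. S \<in> characters X T \<Longrightarrow> circle_exp (S p) = W (rep S)"
      by (auto simp: dual_carrier)
    have "circle_exp (\<xi> j (a (inv\<^bsub>G\<^esub> g) p)) = x j g" if j: "j < n" and g: "g \<in> carrier G" for j g
    proof -
      have r: "frag_of g \<in> carrier ?R" using g by (simp add: group_ring_carrier keys_frag_of)
      let ?v = "\<lambda>i\<in>{..<n}. if i = j then frag_of g else 0"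
      have v: "?v \<in> carrier ?F" using r by (auto simp: free_carrier group_ring_carrier)
      have S: "frag_of g \<odot>\<^bsub>M\<^esub> \<xi> j \<in> characters X T" by (rule dual_smult(1)[OF r \<xi>(1)])
      have "circle_exp (\<xi> j (a (inv\<^bsub>G\<^esub> g) p)) = circle_exp ((frag_of g \<odot>\<^bsub>M\<^esub> \<xi> j) p)"
        using dual_smult(2)[OF r \<xi>(1) p(1)] by (simp add: pair_of)
      also have "\<dots> = W (rep (frag_of g \<odot>\<^bsub>M\<^esub> \<xi> j))" by (rule p(2)[OF S])
      also have "\<dots> = W ?v"
        by (rule W_cl) (use rep[OF S] smult_e[OF r, of j] in auto)
      also have "\<dots> = (\<Prod>i<n. if i = j then x j g else 1)"
        unfolding W_def by (intro prod.cong refl) (auto simp: pair_of pair_0)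
      also have "\<dots> = x j g" using j by simp
      finally show ?thesis .
    qed
    then show "\<exists>p. p \<in> carrier X \<and> (\<forall>j<n. \<forall>g\<in>carrier G. circle_exp (\<xi> j (a (inv\<^bsub>G\<^esub> g) p)) = x j g)" using p(1) by blast
  next
    fix p q
    assume pq: "p \<in> carrier X \<and> (\<forall>j<n. \<forall>g\<in>carrier G. circle_exp (\<xi> j (a (inv\<^bsub>G\<^esub> g) p)) = x j g)"
      "q \<in> carrier X \<and> (\<forall>j<n. \<forall>g\<in>carrier G. circle_exp (\<xi> j (a (inv\<^bsub>G\<^esub> g) q)) = x j g)"
    \<comment> \<open>Every character is one of the combinations in \<open>comb\<close>, so equal
      coordinates give equal values of all characters, and these separate points.\<close>
    show "p = q"
    proof (rule points_eqI)
      fix S assume S: "S \<in> characters X T"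
      have "\<phi> S \<in> cl ` carrier ?F" using bij S unfolding bij_betw_def by blast
      then obtain v where v: "v \<in> carrier ?F" "\<phi> S = cl v" by blast
      obtain S' where S': "S' \<in> characters X T" "\<phi> S' = cl v"
        "\<forall>p\<in>carrier X. circle_exp (S' p) = (\<Prod>j<n. pair (\<lambda>g. circle_exp (\<xi> j (a (inv\<^bsub>G\<^esub> g) p))) (v j))"
        using comb[OF v(1)] by blast
      have SS: "S = S'" using inj[OF S S'(1)] v(2) S'(2) by simp
      have vk: "Poly_Mapping.keys (v j) \<subseteq> carrier G" if "j < n" for j
        using v(1) that by (auto simp: free_carrier group_ring_carrier)
      have "(\<Prod>j<n. pair (\<lambda>g. circle_exp (\<xi> j (a (inv\<^bsub>G\<^esub> g) p))) (v j)) = (\<Prod>j<n. pair (\<lambda>g. circle_exp (\<xi> j (a (inv\<^bsub>G\<^esub> g) q))) (v j))"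
        using pq vk by (intro prod.cong refl pair_cong) (auto simp: subset_iff)
      then show "circle_exp (S p) = circle_exp (S q)" using S'(3) pq SS by simp
    qed (use pq in auto)
  qed
  show ?thesis
    by (rule exI[of _ n], rule exI[of _ k], rule exI[of _ P], rule exI[of _ \<xi>], intro conjI allI impI ballI)
      (use P in blast, rule \<xi>(1), rule rel, assumption+, rule interp, assumption+)
qed

end

section \<open>Binary digits and carries\<close>

text \<open>After division by \<open>2 ^ Suc m\<close> the recursion telescopes, and boundedness
  removes the remainder. It serves both for integer carries and for the fractional parts that
  produce binary digits.\<close>

lemma carry_sums:
  fixes K s :: "nat \<Rightarrow> real"
  assumes rec: "\<And>m. 2 * K m = s m + K (Suc m)" and bound: "\<And>m. \<bar>K m\<bar> \<le> C"
  shows "(\<lambda>m. s m / 2 ^ Suc m) sums K 0"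
proof -
  have part: "(\<Sum>m<n. s m / 2 ^ Suc m) = K 0 - K n / 2 ^ n" for n
  proof (induction n)
    case (Suc n)
    have "K n / 2 ^ n = (s n + K (Suc n)) / 2 ^ Suc n" using rec[of n] by (simp add: field_simps)
    then show ?case using Suc by (simp add: add_divide_distrib)
  qed simp
  have "(\<lambda>n. K n / 2 ^ n) \<longlonglongrightarrow> 0"
  proof (rule Lim_null_comparison)
    show "\<forall>\<^sub>F n in sequentially. norm (K n / 2 ^ n) \<le> C * (1 / 2) ^ n"
      using bound by (intro always_eventually allI) (simp add: power_divide divide_right_mono)
    have "(\<lambda>n. C * (1 / 2 :: real) ^ n) \<longlonglongrightarrow> C * 0"
      by (intro tendsto_mult tendsto_const LIMSEQ_power_zero) simp
    then show "(\<lambda>n. C * (1 / 2 :: real) ^ n) \<longlonglongrightarrow> 0" by simp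
  qed
  then have "(\<lambda>n. K 0 - K n / 2 ^ n) \<longlonglongrightarrow> K 0 - 0" by (intro tendsto_diff tendsto_const)
  then show ?thesis unfolding sums_def part by simp
qed

definition binary_value :: "(nat \<Rightarrow> bool) \<Rightarrow> real" where
  "binary_value b = suminf (\<lambda>m. of_bool (b m) / 2 ^ Suc m)"

lemma summable_binary: "summable (\<lambda>m. of_bool (b m) / 2 ^ Suc m :: real)"
proof (rule summable_comparison_test')
  show "summable (\<lambda>m. (1 / 2 :: real) ^ Suc m)" by (rule summable_Suc_iff[THEN iffD2]) (rule summable_geometric, simp)
  show "norm (of_bool (b m) / 2 ^ Suc m :: real) \<le> (1 / 2) ^ Suc m" if "m \<ge> 0" for m
    by (simp add: power_divide divide_right_mono)
qed

lemma binary_value_diff: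
  assumes "\<And>m. m < N \<Longrightarrow> b m = b' m"
  shows "\<bar>binary_value b - binary_value b'\<bar> \<le> (1 / 2) ^ N"
proof -
  let ?d = "\<lambda>m. (of_bool (b m) / 2 ^ Suc m :: real) - of_bool (b' m) / 2 ^ Suc m"
  have sd: "summable ?d" by (intro summable_diff summable_binary)
  have "binary_value b - binary_value b' = suminf ?d"
    unfolding binary_value_def by (rule suminf_diff[OF summable_binary summable_binary])
  also have "\<dots> = suminf (\<lambda>m. ?d (m + N)) + (\<Sum>m<N. ?d m)" by (rule suminf_split_initial_segment[OF sd])
  also have "(\<Sum>m<N. ?d m) = 0" using assms by (intro sum.neutral) auto
  finally have eq: "binary_value b - binary_value b' = suminf (\<lambda>m. ?d (m + N))" by simp
  have g: "(\<lambda>m. (1 / 2 :: real) ^ N * (1 / 2) ^ Suc m) sums ((1 / 2) ^ N * 1)"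
    by (rule sums_mult[OF power_half_series])
  have le: "norm (?d (m + N)) \<le> (1 / 2) ^ N * (1 / 2) ^ Suc m" for m
    by (cases "b (m + N)"; cases "b' (m + N)") (simp_all add: power_add power_divide mult_ac)
  have "norm (suminf (\<lambda>m. ?d (m + N))) \<le> suminf (\<lambda>m. (1 / 2 :: real) ^ N * (1 / 2) ^ Suc m)"
    by (rule norm_suminf_le[OF le sums_summable[OF g]])
  also have "\<dots> = (1 / 2) ^ N" using sums_unique[OF g] by simp
  finally show ?thesis using eq by simp
qed

lemma cis_sum: "finite A \<Longrightarrow> cis (2 * pi * (\<Sum>i\<in>A. f i)) = (\<Prod>i\<in>A. cis (2 * pi * f i))"
  by (induction A rule: finite_induct) (auto simp: distrib_left cis_mult[symmetric])

lemma cis_powi: "cis (2 * pi * t) powi k = cis (2 * pi * (of_int k * t))"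
proof (cases "k \<ge> 0")
  case True
  then obtain n where "k = int n" by (rule nonneg_int_cases)
  then show ?thesis by (simp add: Complex.DeMoivre mult_ac)
next
  case False
  then have "k = - int (nat (- k))" by simp
  then obtain n where "k = - int n" by blast
  then show ?thesis by (simp add: power_int_minus Complex.DeMoivre mult_ac)
qed

lemma pair_cis: "pair (\<lambda>g. cis (2 * pi * \<beta> g)) v = cis (2 * pi * (\<Sum>g\<in>Poly_Mapping.keys v. of_int (Poly_Mapping.lookup v g) * \<beta> g))"
  unfolding pair_def cis_powi by (rule cis_sum[symmetric]) simp

lemma cis_eq_one_iff: "cis (2 * pi * t) = 1 \<longleftrightarrow> t \<in> \<int>"
  using cis_2pi_eq_iff[of t 0] by simp

text \<open>The bit \<open>prod_encode (m, prod_encode (0, j))\<close> at \<open>h\<close> is the \<open>m\<close>-th binary digit of the coordinate \<open>j\<close>;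
  the bits \<open>prod_encode (m, prod_encode (Suc i, r))\<close>, \<open>r < 2 * C\<close>, write in unary the carry of the equation \<open>i\<close>,
  shifted by \<open>C\<close> to be nonnegative.\<close>

definition digit :: "nat \<Rightarrow> nat \<Rightarrow> nat" where "digit j m = prod_encode (m, prod_encode (0, j))"
definition carry :: "nat \<Rightarrow> nat \<Rightarrow> nat \<Rightarrow> nat" where "carry i r m = prod_encode (m, prod_encode (Suc i, r))"

text \<open>With \<open>A\<close> and \<open>B\<close> the numbers of carry bits set at digits
  \<open>m\<close> and \<open>m + 1\<close>, and \<open>S\<close> the linear form in the coordinate
  bits at digit \<open>m\<close>, the terms add up to \<open>2 * A - B - S\<close>. Setting this
  equal to \<open>C\<close> means \<open>2 * (A - C) = S + (B - C)\<close>, the recursion for the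
  carries after undoing their shift.\<close>

definition equation_terms ::
    "('g, 'b) monoid_scheme \<Rightarrow> nat \<Rightarrow> nat \<Rightarrow> nat \<Rightarrow> (nat \<Rightarrow> 'g \<Rightarrow>\<^sub>0 int) \<Rightarrow> ('g \<times> (nat \<Rightarrow> nat) \<times> int) list" where
  "equation_terms G C n i p =
     map (\<lambda>r. (\<one>\<^bsub>G\<^esub>, carry i r, 2)) [0..<2 * C] @
     map (\<lambda>r. (\<one>\<^bsub>G\<^esub>, (\<lambda>m. carry i r (Suc m)), - 1)) [0..<2 * C] @
     concat (map (\<lambda>j. map (\<lambda>g. (g, digit j, - Poly_Mapping.lookup (p j) g))
       (SOME l. set l = Poly_Mapping.keys (p j) \<and> distinct l)) [0..<n])"

lemma sum_list_upt: "(\<Sum>i\<leftarrow>[0..<n]. f i) = (\<Sum>i<n. f i)"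
  by (simp add: sum_list_distinct_conv_sum_set atLeast0LessThan)

lemma some_list: "finite A \<Longrightarrow> set (SOME l. set l = A \<and> distinct l) = A \<and> distinct (SOME l. set l = A \<and> distinct l)"
  using someI_ex[of "\<lambda>l. set l = A \<and> distinct l"] finite_distinct_list[of A] by blast

lemma sum_equation_terms:
  "(\<Sum>(g, \<phi>, \<alpha>)\<leftarrow>equation_terms G C n i p. \<alpha> * of_bool (x (h \<otimes>\<^bsub>G\<^esub> g) (\<phi> m))) =
    2 * (\<Sum>r<2 * C. of_bool (x (h \<otimes>\<^bsub>G\<^esub> \<one>\<^bsub>G\<^esub>) (carry i r m))) - (\<Sum>r<2 * C. of_bool (x (h \<otimes>\<^bsub>G\<^esub> \<one>\<^bsub>G\<^esub>) (carry i r (Suc m)))) -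
    (\<Sum>j<n. \<Sum>g\<in>Poly_Mapping.keys (p j). Poly_Mapping.lookup (p j) g * of_bool (x (h \<otimes>\<^bsub>G\<^esub> g) (digit j m)))"
proof -
  have conc: "(\<Sum>t\<leftarrow>concat (map F js). f t) = (\<Sum>j\<leftarrow>js. \<Sum>t\<leftarrow>F j. f t)" for F js and f :: "'c \<Rightarrow> int"
    by (induction js) auto
  have keys: "(\<Sum>g\<leftarrow>(SOME l. set l = Poly_Mapping.keys (p j) \<and> distinct l). f g) = (\<Sum>g\<in>Poly_Mapping.keys (p j). f g)"
    for j and f :: "'a \<Rightarrow> int"
    using some_list[of "Poly_Mapping.keys (p j)"] by (simp add: sum_list_distinct_conv_sum_set)
  show ?thesis
    unfolding equation_terms_def map_append sum_list_append conc
    by (simp add: o_def sum_list_upt keys sum_distrib_left sum_negf)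
qed

lemma equation_terms_set:
  assumes "(g, \<phi>, \<alpha>) \<in> set (equation_terms G C n i p)"
  shows "g = \<one>\<^bsub>G\<^esub> \<or> (\<exists>j<n. g \<in> Poly_Mapping.keys (p j))" "recursive 1 (\<lambda>xs. \<phi> (xs ! 0))"
proof -
  have set_keys: "set (SOME l. set l = Poly_Mapping.keys (p j) \<and> distinct l) = Poly_Mapping.keys (p j)" for j
    using some_list[of "Poly_Mapping.keys (p j)"] by simp
  show "g = \<one>\<^bsub>G\<^esub> \<or> (\<exists>j<n. g \<in> Poly_Mapping.keys (p j))"
    using assms by (auto simp: equation_terms_def set_keys)
  have "recursive 1 (\<lambda>xs. digit j (xs ! 0))" "recursive 1 (\<lambda>xs. carry i r (xs ! 0))" "recursive 1 (\<lambda>xs. carry i r (Suc (xs ! 0)))" for i j r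
    unfolding digit_def carry_def by (intro recursive_prod_encode recursive_intros; simp)+
  then show "recursive 1 (\<lambda>xs. \<phi> (xs ! 0))"
    using assms by (auto simp: equation_terms_def set_keys)
qed

section \<open>Equations with carries as rules\<close>

context numbered_group
begin

lemma obeys_decode:
  assumes R: "recursive_rules \<R>" and z: "z \<in> configs \<R>"
  shows "obeys \<R> (decode_config z)"
  unfolding obeys_def
proof (intro ballI allI, clarify)
  fix ts \<beta> h m assume r: "(ts, \<beta>) \<in> \<R>" and h: "h \<in> carrier G"
  obtain x where x: "z = encode_config x" "obeys \<R> x" using z by (auto simp: configs_def)
  have "(\<Sum>(g, \<phi>, \<alpha>)\<leftarrow>ts. \<alpha> * of_bool (decode_config z (h \<otimes> g) (\<phi> m))) = (\<Sum>(g, \<phi>, \<alpha>)\<leftarrow>ts. \<alpha> * of_bool (x (h \<otimes> g) (\<phi> m)))"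
    by (rule arg_cong[of _ _ sum_list], rule map_cong) (auto simp: x(1) decode_encode recursive_rulesD(1)[OF R r] h)
  then show "(\<Sum>(g, \<phi>, \<alpha>)\<leftarrow>ts. \<alpha> * of_bool (decode_config z (h \<otimes> g) (\<phi> m))) = \<beta>"
    using x(2) r h unfolding obeys_def by auto
qed

definition equations :: "nat \<Rightarrow> nat \<Rightarrow> nat \<Rightarrow> (nat \<Rightarrow> nat \<Rightarrow> 'g \<Rightarrow>\<^sub>0 int) \<Rightarrow> (('g \<times> (nat \<Rightarrow> nat) \<times> int) list \<times> int) set" where
  "equations C n k P = (\<lambda>i. (equation_terms G C n i (P i), int C)) ` {..<k}"

lemma recursive_rules_equations:
  assumes "\<forall>i<k. \<forall>j<n. Poly_Mapping.keys (P i j) \<subseteq> carrier G"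
  shows "recursive_rules (equations C n k P)"
  unfolding recursive_rules_def
proof (intro conjI)
  show "finite (equations C n k P)" by (simp add: equations_def)
  have "g \<in> carrier G \<and> recursive 1 (\<lambda>xs. \<phi> (xs ! 0))"
    if "i < k" "(g, \<phi>, \<alpha>) \<in> set (equation_terms G C n i (P i))" for i g \<phi> \<alpha>
    using equation_terms_set[OF that(2)] assms that(1) by auto
  then show "\<forall>(ts, \<beta>)\<in>equations C n k P. \<forall>(g, \<phi>, \<alpha>)\<in>set ts. g \<in> carrier G \<and> recursive 1 (\<lambda>xs. \<phi> (xs ! 0))"
    by (auto simp: equations_def)
qed

lemma obeys_equations:
  "obeys (equations C n k P) x \<longleftrightarrow> (\<forall>i<k. \<forall>h\<in>carrier G. \<forall>m.
    2 * ((\<Sum>r<2 * C. of_bool (x h (carry i r m))) - int C) =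
    (\<Sum>j<n. \<Sum>g\<in>Poly_Mapping.keys (P i j). Poly_Mapping.lookup (P i j) g * of_bool (x (h \<otimes> g) (digit j m))) +
    ((\<Sum>r<2 * C. of_bool (x h (carry i r (Suc m)))) - int C))"
proof -
  have balance: "(2 * A - B - S = c) = (2 * (A - c) = S + (B - c))" for A B S c :: int by auto
  have "obeys (equations C n k P) x \<longleftrightarrow> (\<forall>i<k. \<forall>h\<in>carrier G. \<forall>m.
    (\<Sum>(g, \<phi>, \<alpha>)\<leftarrow>equation_terms G C n i (P i). \<alpha> * of_bool (x (h \<otimes> g) (\<phi> m))) = int C)"
    unfolding obeys_def equations_def by auto
  also have "\<dots> \<longleftrightarrow> (\<forall>i<k. \<forall>h\<in>carrier G. \<forall>m.
    2 * ((\<Sum>r<2 * C. of_bool (x h (carry i r m))) - int C) =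
    (\<Sum>j<n. \<Sum>g\<in>Poly_Mapping.keys (P i j). Poly_Mapping.lookup (P i j) g * of_bool (x (h \<otimes> g) (digit j m))) +
    ((\<Sum>r<2 * C. of_bool (x h (carry i r (Suc m)))) - int C))"
  proof (intro all_cong1 imp_cong ball_cong refl)
    fix i h m assume h: "h \<in> carrier G"
    show "((\<Sum>(g, \<phi>, \<alpha>)\<leftarrow>equation_terms G C n i (P i). \<alpha> * of_bool (x (h \<otimes> g) (\<phi> m))) = int C) =
      (2 * ((\<Sum>r<2 * C. of_bool (x h (carry i r m))) - int C) =
      (\<Sum>j<n. \<Sum>g\<in>Poly_Mapping.keys (P i j). Poly_Mapping.lookup (P i j) g * of_bool (x (h \<otimes> g) (digit j m))) +
      ((\<Sum>r<2 * C. of_bool (x h (carry i r (Suc m)))) - int C))"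
      unfolding sum_equation_terms r_one[OF h] by (rule balance)
  qed
  finally show ?thesis .
qed

definition coordinate :: "('g \<Rightarrow> nat \<Rightarrow> bool) \<Rightarrow> nat \<Rightarrow> 'g \<Rightarrow> real" where
  "coordinate x j h = binary_value (\<lambda>m. x h (digit j m))"

text \<open>The shifted carries lie between \<open>- C\<close> and \<open>C\<close>, because
  \<open>2 * C\<close> bits are counted. By \<open>carry_sums\<close> the value of the linear form
  is therefore the integer carry at digit 0.\<close>

lemma obeys_integral:
  assumes x: "obeys (equations C n k P) x" and i: "i < k" and h: "h \<in> carrier G"
  shows "(\<Sum>j<n. \<Sum>g\<in>Poly_Mapping.keys (P i j). of_int (Poly_Mapping.lookup (P i j) g) * coordinate x j (h \<otimes> g)) \<in> \<int>"
proof -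
  define K where "K m = (\<Sum>r<2 * C. of_bool (x h (carry i r m))) - int C" for m
  define s where "s m = (\<Sum>j<n. \<Sum>g\<in>Poly_Mapping.keys (P i j). Poly_Mapping.lookup (P i j) g * of_bool (x (h \<otimes> g) (digit j m)))" for m
  have "2 * K m = s m + K (Suc m)" for m using x i h unfolding obeys_equations K_def s_def by blast
  then have rec: "2 * real_of_int (K m) = of_int (s m) + of_int (K (Suc m))" for m
    by (metis of_int_add of_int_mult of_int_numeral)
  have "0 \<le> K m + int C \<and> K m + int C \<le> int (2 * C)" for m
    using sum_nonneg[of "{..<2 * C}" "\<lambda>r. of_bool (x h (carry i r m)) :: int"]
      sum_bounded_above[of "{..<2 * C}" "\<lambda>r. of_bool (x h (carry i r m)) :: int" 1] by (simp add: K_def)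
  then have "\<bar>real_of_int (K m)\<bar> \<le> real C" for m by (simp add: abs_le_iff) (smt (verit) of_int_le_iff of_int_of_nat_eq of_int_minus)
  from carry_sums[of "\<lambda>m. real_of_int (K m)" "\<lambda>m. real_of_int (s m)", OF rec this]
  have sums1: "(\<lambda>m. real_of_int (s m) / 2 ^ Suc m) sums real_of_int (K 0)" .
  have "(\<lambda>m. \<Sum>j<n. \<Sum>g\<in>Poly_Mapping.keys (P i j). of_int (Poly_Mapping.lookup (P i j) g) * (of_bool (x (h \<otimes> g) (digit j m)) / 2 ^ Suc m)) sums
    (\<Sum>j<n. \<Sum>g\<in>Poly_Mapping.keys (P i j). of_int (Poly_Mapping.lookup (P i j) g) * coordinate x j (h \<otimes> g))"
    unfolding coordinate_def binary_value_def by (intro sums_sum sums_mult summable_sums summable_binary)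
  moreover have "(\<lambda>m. real_of_int (s m) / 2 ^ Suc m) = (\<lambda>m. \<Sum>j<n. \<Sum>g\<in>Poly_Mapping.keys (P i j). of_int (Poly_Mapping.lookup (P i j) g) * (of_bool (x (h \<otimes> g) (digit j m)) / 2 ^ Suc m))"
    by (simp only: s_def of_int_sum of_int_mult of_int_of_bool sum_divide_distrib times_divide_eq_right)
  ultimately have "(\<Sum>j<n. \<Sum>g\<in>Poly_Mapping.keys (P i j). of_int (Poly_Mapping.lookup (P i j) g) * coordinate x j (h \<otimes> g)) = real_of_int (K 0)"
    using sums_unique2[OF sums1] by simp
  then show ?thesis by simp
qed

text \<open>The carry at digit \<open>m\<close> is the linear form evaluated at the fractional parts
  of \<open>2 ^ m * \<beta>\<close>. Passing to the next digit doubles it and subtracts an integer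
  combination of bits, so it stays an integer; fractional parts below 1 keep it within the sum of
  the absolute coefficients, hence within \<open>C\<close>.\<close>

lemma ex_obeying_configuration:
  assumes C: "\<And>i. i < k \<Longrightarrow> (\<Sum>j<n. \<Sum>g\<in>Poly_Mapping.keys (P i j). \<bar>Poly_Mapping.lookup (P i j) g\<bar>) \<le> int C"
    and int: "\<And>i h. i < k \<Longrightarrow> h \<in> carrier G \<Longrightarrow>
      (\<Sum>j<n. \<Sum>g\<in>Poly_Mapping.keys (P i j). of_int (Poly_Mapping.lookup (P i j) g) * \<beta> j (h \<otimes> g)) \<in> \<int>"
    and \<beta>: "\<And>j h. 0 \<le> \<beta> j h \<and> \<beta> j h < 1"
  shows "\<exists>x. obeys (equations C n k P) x \<and> (\<forall>j h. coordinate x j h = \<beta> j h)"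
proof -
  \<comment> \<open>The fraction left over after the first \<open>m\<close> binary digits; the next
    digit tells whether it reaches 1/2.\<close>
  define t where "t j h m = frac (2 ^ m * \<beta> j h)" for j h m
  define b where "b j h m \<longleftrightarrow> t j h m \<ge> 1 / 2" for j h m
  have t_rec: "2 * t j h m = of_bool (b j h m) + t j h (Suc m)" for j h m
  proof -
    let ?y = "2 ^ m * \<beta> j h"
    have "frac (2 * ?y) = 2 * frac ?y - of_bool (frac ?y \<ge> 1 / 2)"
    proof (rule frac_unique_iff[THEN iffD2], intro conjI)
      have "2 * ?y - (2 * frac ?y - of_bool (frac ?y \<ge> 1 / 2)) = of_int (2 * \<lfloor>?y\<rfloor> + of_bool (frac ?y \<ge> 1 / 2))"
        by (simp add: frac_def)
      then show "2 * ?y - (2 * frac ?y - of_bool (frac ?y \<ge> 1 / 2)) \<in> \<int>" by (metis Ints_of_int)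
    qed (use frac_ge_0[of ?y] frac_lt_1[of ?y] in \<open>auto simp: of_bool_def\<close>)
    then show ?thesis by (simp add: t_def b_def mult.assoc)
  qed
  have t01: "0 \<le> t j h m" "t j h m < 1" for j h m unfolding t_def by (simp_all add: frac_lt_1)
  define L where "L i h m = (\<Sum>j<n. \<Sum>g\<in>Poly_Mapping.keys (P i j). of_int (Poly_Mapping.lookup (P i j) g) * t j (h \<otimes> g) m)" for i h m
  define s where "s i h m = (\<Sum>j<n. \<Sum>g\<in>Poly_Mapping.keys (P i j). Poly_Mapping.lookup (P i j) g * of_bool (b j (h \<otimes> g) m))" for i h m
  have L_rec: "2 * L i h m = of_int (s i h m) + L i h (Suc m)" for i h m
  proof -
    have "2 * L i h m = (\<Sum>j<n. \<Sum>g\<in>Poly_Mapping.keys (P i j). of_int (Poly_Mapping.lookup (P i j) g) * (2 * t j (h \<otimes> g) m))"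
      by (simp add: L_def sum_distrib_left mult.left_commute)
    also have "\<dots> = of_int (s i h m) + L i h (Suc m)"
      unfolding t_rec by (simp add: s_def L_def distrib_left sum.distrib)
    finally show ?thesis .
  qed
  have L_int: "L i h m \<in> \<int>" if "i < k" "h \<in> carrier G" for i h m
  proof (induction m)
    case 0
    have "t j h 0 = \<beta> j h" for j h using \<beta>[of j h] by (simp add: t_def frac_eq)
    then show ?case using int[OF that] by (simp add: L_def)
  next
    case (Suc m)
    have "L i h (Suc m) = 2 * L i h m - of_int (s i h m)" using L_rec[of i h m] by simp
    then show ?case using Suc by (simp add: Ints_diff Ints_mult)
  qed
  have L_bound: "\<bar>L i h m\<bar> \<le> real C" if "i < k" for i h m
  proof -
    have "\<bar>L i h m\<bar> \<le> (\<Sum>j<n. \<Sum>g\<in>Poly_Mapping.keys (P i j). \<bar>of_int (Poly_Mapping.lookup (P i j) g)\<bar>)"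
      unfolding L_def
    proof (intro order_trans[OF sum_abs] sum_mono order_trans[OF sum_abs])
      fix j g show "\<bar>real_of_int (Poly_Mapping.lookup (P i j) g) * t j (h \<otimes> g) m\<bar> \<le> \<bar>real_of_int (Poly_Mapping.lookup (P i j) g)\<bar>"
        using t01[of j "h \<otimes> g" m] by (simp add: abs_mult mult_left_le)
    qed
    also have "\<dots> = of_int (\<Sum>j<n. \<Sum>g\<in>Poly_Mapping.keys (P i j). \<bar>Poly_Mapping.lookup (P i j) g\<bar>)" by simp
    also have "\<dots> \<le> of_int (int C)" using C[OF that] by (simp only: of_int_le_iff)
    finally show ?thesis by simp
  qed
  define x where "x h q = (let m = fst (prod_decode q); u = prod_decode (snd (prod_decode q)) in
     case fst u of 0 \<Rightarrow> b (snd u) h m | Suc i \<Rightarrow> int (snd u) < \<lfloor>L i h m\<rfloor> + int C)" for h q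
  have x_digit: "x h (digit j m) = b j h m" for h j m by (simp add: x_def digit_def Let_def)
  have x_carry: "x h (carry i r m) \<longleftrightarrow> int r < \<lfloor>L i h m\<rfloor> + int C" for h i r m by (simp add: x_def carry_def Let_def)
  have unary: "(\<Sum>r<2 * C. of_bool (x h (carry i r m))) - int C = \<lfloor>L i h m\<rfloor>" if "i < k" for h i m
  proof -
    have "\<bar>L i h m\<bar> \<le> real C" by (rule L_bound[OF that])
    then have "- int C \<le> \<lfloor>L i h m\<rfloor>" "\<lfloor>L i h m\<rfloor> \<le> int C" by (auto simp: le_floor_iff floor_le_iff)
    then obtain q where q: "\<lfloor>L i h m\<rfloor> + int C = int q" "q \<le> 2 * C" using nonneg_int_cases[of "\<lfloor>L i h m\<rfloor> + int C"] by auto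
    have "(\<Sum>r<2 * C. of_bool (x h (carry i r m)) :: int) = (\<Sum>r<2 * C. of_bool (r < q))"
      unfolding x_carry q(1) by simp
    also have "\<dots> = int (card ({..<2 * C} \<inter> {r. r < q}))" by (simp add: sum.If_cases of_bool_def)
    also have "{..<2 * C} \<inter> {r. r < q} = {..<q}" using q(2) by auto
    finally show ?thesis using q(1) by simp
  qed
  have "obeys (equations C n k P) x"
    unfolding obeys_equations
  proof (intro allI impI ballI)
    fix i h m assume i: "i < k" and h: "h \<in> carrier G"
    have fl: "real_of_int \<lfloor>L i h m\<rfloor> = L i h m" for m using L_int[OF i h, of m] by (auto elim!: Ints_cases)
    have "real_of_int (2 * \<lfloor>L i h m\<rfloor>) = real_of_int (s i h m + \<lfloor>L i h (Suc m)\<rfloor>)"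
      using L_rec[of i h m] by (simp add: fl)
    then have "2 * \<lfloor>L i h m\<rfloor> = s i h m + \<lfloor>L i h (Suc m)\<rfloor>" by (simp only: of_int_eq_iff)
    then show "2 * ((\<Sum>r<2 * C. of_bool (x h (carry i r m))) - int C) =
      (\<Sum>j<n. \<Sum>g\<in>Poly_Mapping.keys (P i j). Poly_Mapping.lookup (P i j) g * of_bool (x (h \<otimes> g) (digit j m))) +
      ((\<Sum>r<2 * C. of_bool (x h (carry i r (Suc m)))) - int C)"
      unfolding unary[OF i] x_digit s_def .
  qed
  moreover have "coordinate x j h = \<beta> j h" for j h
  proof -
    have "(\<lambda>m. of_bool (b j h m) / 2 ^ Suc m) sums t j h 0"
      by (rule carry_sums[of "t j h" _ 1]) (use t_rec t01[of j h] in \<open>auto simp: abs_le_iff less_imp_le intro: order_trans[of _ 0]\<close>)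
    moreover have "t j h 0 = \<beta> j h" using \<beta>[of j h] by (simp add: t_def frac_eq)
    ultimately show ?thesis unfolding coordinate_def binary_value_def x_digit using sums_unique by metis
  qed
  ultimately show ?thesis by blast
qed

lemma continuous_coordinate:
  "continuous_map cantor_topology euclidean (\<lambda>z. cis (2 * pi * coordinate (decode_config z) j h))"
proof -
  have "continuous_map cantor_topology euclidean (\<lambda>z. complex_of_real (coordinate (decode_config z) j h))"
    unfolding continuous_map_iff_dist
  proof (intro ballI allI impI)
    fix z :: "nat \<Rightarrow> bool" and \<epsilon> :: real assume "\<epsilon> > 0"
    then obtain N where N: "(1 / 2 :: real) ^ N < \<epsilon>" using real_arch_pow_inv[of \<epsilon> "1/2"] by auto
    define pos where "pos m = prod_encode (code h, digit j m)" for m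
    let ?U = "\<Inter>m\<in>{..<N}. {y. y (pos m) = z (pos m)}"
    have op: "openin cantor_topology {y. y (pos m) = z (pos m)}" for m
      using openin_continuous_map_preimage[OF continuous_map_product_projection[of "pos m" UNIV "\<lambda>_. discrete_topology (UNIV :: bool set)"], of "{z (pos m)}"]
      by (simp add: cantor_topology_def)
    have "openin cantor_topology (topspace cantor_topology \<inter> ?U)"
    proof (cases "N = 0")
      case False
      then have "openin cantor_topology ?U" by (intro openin_Inter) (auto simp: op)
      then show ?thesis by (rule openin_Int[OF openin_topspace])
    qed simp
    then have "openin cantor_topology ?U" by (simp add: cantor_topology_def)
    moreover have "z \<in> ?U" by simp
    moreover have "cmod (complex_of_real (coordinate (decode_config y) j h) - complex_of_real (coordinate (decode_config z) j h)) < \<epsilon>"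
      if "y \<in> ?U" for y
    proof -
      have "\<bar>coordinate (decode_config y) j h - coordinate (decode_config z) j h\<bar> \<le> (1 / 2) ^ N"
        unfolding coordinate_def by (rule binary_value_diff) (use that in \<open>auto simp: decode_config_def pos_def\<close>)
      then show ?thesis using N by (simp flip: of_real_diff)
    qed
    ultimately show "\<exists>U. openin cantor_topology U \<and> z \<in> U \<and> (\<forall>y\<in>U. cmod (complex_of_real (coordinate (decode_config y) j h) - complex_of_real (coordinate (decode_config z) j h)) < \<epsilon>)"
      by blast
  qed
  moreover have "continuous_map euclidean euclidean (\<lambda>w :: complex. exp (2 * of_real pi * \<i> * w))"
    by (simp add: continuous_on_exp continuous_on_mult_left continuous_on_id)
  ultimately have "continuous_map cantor_topology euclidean ((\<lambda>w. exp (2 * of_real pi * \<i> * w)) \<circ> (\<lambda>z. complex_of_real (coordinate (decode_config z) j h)))"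
    by (rule continuous_map_compose)
  then show ?thesis by (simp add: o_def cis_conv_exp mult_ac)
qed

end

text \<open>The preimage of \<open>D\<close> is the projection of the part of the graph over
  \<open>D\<close>, and projection along a compact factor is a closed map. The graph is given as an
  intersection because the map will be defined by many closed conditions.\<close>

lemma continuous_map_of_closed_graph:
  assumes "compact_space T" and \<pi>: "\<And>z. z \<in> topspace Z \<Longrightarrow> \<pi> z \<in> topspace T"
    and C: "\<And>e. e \<in> E \<Longrightarrow> closedin (prod_topology Z T) (C e)"
    and graph: "\<And>z p. z \<in> topspace Z \<Longrightarrow> p \<in> topspace T \<Longrightarrow> (\<forall>e\<in>E. (z, p) \<in> C e) \<longleftrightarrow> p = \<pi> z"
  shows "continuous_map Z T \<pi>"
  unfolding continuous_map_closedin
proof (intro conjI ballI allI impI funcsetI)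
  fix D assume D: "closedin T D"
  \<comment> \<open>Inserting \<open>topspace Z \<times> D\<close> both restricts to
    \<open>D\<close> and keeps the intersection nonempty as a family when \<open>E\<close> is
    empty.\<close>
  let ?S = "\<Inter> (insert (topspace Z \<times> D) (C ` E))"
  have "closedin (prod_topology Z T) (topspace Z \<times> D)" using D by (simp add: closedin_prod_Times_iff)
  then have "closedin (prod_topology Z T) ?S" using C by (intro closedin_Inter) auto
  then have "closedin Z (fst ` ?S)" using closed_map_fst[OF assms(1)] unfolding closed_map_def by blast
  also have "fst ` ?S = {z \<in> topspace Z. \<pi> z \<in> D}"
  proof (intro equalityI subsetI)
    fix z assume "z \<in> fst ` ?S"
    then obtain p where p: "z \<in> topspace Z" "p \<in> D" "\<forall>e\<in>E. (z, p) \<in> C e" by auto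
    then have "p = \<pi> z" using graph closedin_subset[OF D] by blast
    then show "z \<in> {z \<in> topspace Z. \<pi> z \<in> D}" using p by blast
  next
    fix z assume z: "z \<in> {z \<in> topspace Z. \<pi> z \<in> D}"
    then have "\<forall>e\<in>E. (z, \<pi> z) \<in> C e" using graph \<pi> by blast
    then have "(z, \<pi> z) \<in> ?S" using z by blast
    then show "z \<in> fst ` ?S" by force
  qed
  finally show "closedin Z {z \<in> topspace Z. \<pi> z \<in> D}" .
qed (use \<pi> in blast)

section \<open>The factor map from configurations onto X\<close>

theorem theorem3:
  fixes G :: "('g, 'b) monoid_scheme"
    and X :: "('x, 'c) monoid_scheme"
    and T :: "'x topology"
    and a :: "'g \<Rightarrow> 'x \<Rightarrow> 'x"
  assumes "group G"
    and "finitely_generated G"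
    and "recursively_presented G"
    and "self_simulable G"
    and "algebraic_action G X T a"
    and "finitely_presented_action G X T a"
  shows "factor_of_SFT G T a"
proof -
  obtain \<nu> where "numbered_group G \<nu>" using recursively_presented_numbering[OF assms(1,3)] by blast
  then interpret numbered_group G \<nu> .
  interpret A: algebraic_action G X T a by fact
  obtain n k :: nat and P \<xi> where P: "\<forall>i<k. \<forall>j<n. P i j \<in> carrier (group_ring G)"
    and \<xi>: "\<forall>j<n. \<xi> j \<in> characters X T"
    and rel: "\<forall>i<k. \<forall>p\<in>carrier X. (\<Prod>j<n. pair (\<lambda>g. circle_exp (\<xi> j (a (inv\<^bsub>G\<^esub> g) p))) (P i j)) = 1"
    and interp: "\<forall>x. (\<forall>j g. cmod (x j g) = 1) \<longrightarrow>
      (\<forall>i<k. \<forall>h\<in>carrier G. (\<Prod>j<n. pair (\<lambda>g. x j (h \<otimes>\<^bsub>G\<^esub> g)) (P i j)) = 1) \<longrightarrow>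
      (\<exists>!p. p \<in> carrier X \<and> (\<forall>j<n. \<forall>g\<in>carrier G. circle_exp (\<xi> j (a (inv\<^bsub>G\<^esub> g) p)) = x j g))"
    using A.finitely_presented_coordinates[OF assms(6)] by (elim exE conjE) (rule that, assumption+)
  have keys: "\<forall>i<k. \<forall>j<n. Poly_Mapping.keys (P i j) \<subseteq> carrier G" using P by (simp add: group_ring_carrier)
  \<comment> \<open>One bound for all equations: the sum over \<open>i\<close> dominates the
    absolute coefficients of each single row.\<close>
  define C where "C = nat (\<Sum>i<k. \<Sum>j<n. \<Sum>g\<in>Poly_Mapping.keys (P i j). \<bar>Poly_Mapping.lookup (P i j) g\<bar>)"
  have C: "(\<Sum>j<n. \<Sum>g\<in>Poly_Mapping.keys (P i j). \<bar>Poly_Mapping.lookup (P i j) g\<bar>) \<le> int C" if "i < k" for i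
    using member_le_sum[of i "{..<k}" "\<lambda>i. \<Sum>j<n. \<Sum>g\<in>Poly_Mapping.keys (P i j). \<bar>Poly_Mapping.lookup (P i j) g\<bar>"] that
    by (simp add: C_def sum_nonneg)
  let ?R = "equations C n k P"
  have R: "recursive_rules ?R" by (rule recursive_rules_equations[OF keys])
  define c where "c z j h = cis (2 * pi * coordinate (decode_config z) j h)" for z j h
  \<comment> \<open>The point is described implicitly by its coordinates. Existence and uniqueness
    come from \<open>interp\<close>, and continuity of the resulting map from the closedness of
    these conditions.\<close>
  define pt where "pt z p \<longleftrightarrow> p \<in> carrier X \<and> (\<forall>j<n. \<forall>g\<in>carrier G. circle_exp (\<xi> j (a (inv\<^bsub>G\<^esub> g) p)) = c z j g)" for z p
  have ex1: "\<exists>!p. pt z p" if z: "z \<in> configs ?R" for z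
    unfolding pt_def
  proof (rule interp[rule_format])
    show "cmod (c z j g) = 1" for j g by (simp add: c_def)
    fix i h assume i: "i < k" and h: "h \<in> carrier G"
    have "(\<Prod>j<n. pair (\<lambda>g. c z j (h \<otimes>\<^bsub>G\<^esub> g)) (P i j)) =
      cis (2 * pi * (\<Sum>j<n. \<Sum>g\<in>Poly_Mapping.keys (P i j). of_int (Poly_Mapping.lookup (P i j) g) * coordinate (decode_config z) j (h \<otimes>\<^bsub>G\<^esub> g)))"
      unfolding c_def pair_cis by (rule cis_sum[symmetric]) simp
    then show "(\<Prod>j<n. pair (\<lambda>g. c z j (h \<otimes>\<^bsub>G\<^esub> g)) (P i j)) = 1"
      using obeys_integral[OF obeys_decode[OF R z] i h] by (simp add: cis_eq_one_iff)
  qed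
  define \<pi> where "\<pi> z = (THE p. pt z p)" for z
  have \<pi>: "pt z (\<pi> z)" if "z \<in> configs ?R" for z unfolding \<pi>_def by (rule theI'[OF ex1[OF that]])
  have \<pi>_eq: "\<pi> z = p" if "z \<in> configs ?R" "pt z p" for z p using ex1[OF that(1)] \<pi>[OF that(1)] that(2) by blast
  let ?Z = "subtopology cantor_topology (configs ?R)"
  have topZ: "topspace ?Z = configs ?R" by (simp add: cantor_topology_def)
  show ?thesis
  proof (rule factor_of_SFT_configs[OF R assms(2,4)])
    fix g z assume g: "g \<in> carrier G" and z: "z \<in> configs ?R"
    show "\<pi> (translate g z) = a g (\<pi> z)"
    proof (rule \<pi>_eq[OF translate_closed[OF R g z]])
      show "pt (translate g z) (a g (\<pi> z))"
        unfolding pt_def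
      proof (intro conjI allI impI ballI)
        have p: "\<pi> z \<in> carrier X" using \<pi>[OF z] by (simp add: pt_def)
        then show "a g (\<pi> z) \<in> carrier X" by (rule A.act_closed[OF g])
        fix j h assume j: "j < n" and h: "h \<in> carrier G"
        have gh: "inv\<^bsub>G\<^esub> g \<otimes>\<^bsub>G\<^esub> h \<in> carrier G" using g h by simp
        \<comment> \<open>The coordinate of \<open>a g p\<close> at \<open>h\<close> is that of
          \<open>p\<close> at \<open>inv g \<otimes> h\<close>, in agreement with
          \<open>translate\<close>.\<close>
        have "c (translate g z) j h = c z j (inv\<^bsub>G\<^esub> g \<otimes>\<^bsub>G\<^esub> h)"
          using g h by (simp add: c_def coordinate_def decode_translate)
        also have "\<dots> = circle_exp (\<xi> j (a (inv\<^bsub>G\<^esub> (inv\<^bsub>G\<^esub> g \<otimes>\<^bsub>G\<^esub> h)) (\<pi> z)))"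
          using \<pi>[OF z] j gh unfolding pt_def by metis
        also have "inv\<^bsub>G\<^esub> (inv\<^bsub>G\<^esub> g \<otimes>\<^bsub>G\<^esub> h) = inv\<^bsub>G\<^esub> h \<otimes>\<^bsub>G\<^esub> g" using g h by (simp add: inv_mult_group)
        also have "a (inv\<^bsub>G\<^esub> h \<otimes>\<^bsub>G\<^esub> g) (\<pi> z) = a (inv\<^bsub>G\<^esub> h) (a g (\<pi> z))"
          using A.act_mult[of "inv\<^bsub>G\<^esub> h" g "\<pi> z"] g h p by simp
        finally show "circle_exp (\<xi> j (a (inv\<^bsub>G\<^esub> h) (a g (\<pi> z)))) = c (translate g z) j h" by simp
      qed
    qed
  next
    show "\<pi> ` configs ?R = topspace T"
      unfolding A.topspace_eq
    proof (intro equalityI subsetI)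
      fix p assume p: "p \<in> carrier X"
      define v where "v j h = circle_exp (\<xi> j (a (inv\<^bsub>G\<^esub> h) p))" for j h
      have "\<exists>\<beta>. 0 \<le> \<beta> \<and> \<beta> < 1 \<and> v j h = cis (2 * pi * \<beta>)" for j h
      proof -
        obtain t where t: "v j h = cis (2 * pi * t)" by (auto simp: v_def circle_exp_def)
        have "cis (2 * pi * frac t) = cis (2 * pi * t)" unfolding cis_2pi_eq_iff by (simp add: frac_def)
        then show ?thesis using t frac_ge_0[of t] frac_lt_1[of t] by (intro exI[of _ "frac t"]) simp
      qed
      then obtain \<beta> where \<beta>: "\<And>j h. 0 \<le> \<beta> j h \<and> \<beta> j h < 1 \<and> v j h = cis (2 * pi * \<beta> j h)" by metis
      have "\<exists>x. obeys ?R x \<and> (\<forall>j h. coordinate x j h = \<beta> j h)"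
      proof (rule ex_obeying_configuration[OF C])
        fix i h assume i: "i < k" and h: "h \<in> carrier G"
        have "cis (2 * pi * (\<Sum>j<n. \<Sum>g\<in>Poly_Mapping.keys (P i j). of_int (Poly_Mapping.lookup (P i j) g) * \<beta> j (h \<otimes>\<^bsub>G\<^esub> g))) =
          (\<Prod>j<n. pair (\<lambda>g. v j (h \<otimes>\<^bsub>G\<^esub> g)) (P i j))"
        proof -
          have "v j (h \<otimes>\<^bsub>G\<^esub> g) = cis (2 * pi * \<beta> j (h \<otimes>\<^bsub>G\<^esub> g))" for j g using \<beta> by blast
          then show ?thesis by (simp add: pair_cis cis_sum)
        qed
        \<comment> \<open>The equations for \<open>p\<close> at \<open>h\<close> are the equations
          for the moved point \<open>a (inv h) p\<close> at the identity, where \<open>rel\<close>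
          applies.\<close>
        also have "\<dots> = (\<Prod>j<n. pair (\<lambda>g. circle_exp (\<xi> j (a (inv\<^bsub>G\<^esub> g) (a (inv\<^bsub>G\<^esub> h) p)))) (P i j))"
        proof (intro prod.cong refl pair_cong)
          fix j g assume "j \<in> {..<n}" "g \<in> Poly_Mapping.keys (P i j)"
          then have g: "g \<in> carrier G" using keys i by auto
          then show "v j (h \<otimes>\<^bsub>G\<^esub> g) = circle_exp (\<xi> j (a (inv\<^bsub>G\<^esub> g) (a (inv\<^bsub>G\<^esub> h) p)))"
            using h p by (simp add: v_def A.act_mult inv_mult_group)
        qed
        also have "\<dots> = 1" using rel i A.act_closed[OF inv_closed[OF h] p] by blast
        finally show "(\<Sum>j<n. \<Sum>g\<in>Poly_Mapping.keys (P i j). of_int (Poly_Mapping.lookup (P i j) g) * \<beta> j (h \<otimes>\<^bsub>G\<^esub> g)) \<in> \<int>"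
          by (simp only: cis_eq_one_iff)
      qed (use \<beta> in auto)
      then obtain x where x: "obeys ?R x" "\<And>j h. coordinate x j h = \<beta> j h" by blast
      have z: "encode_config x \<in> configs ?R" using x(1) by (simp add: configs_def)
      have "coordinate (decode_config (encode_config x)) j h = \<beta> j h" if "h \<in> carrier G" for j h
        using x(2)[of j h] that by (simp add: coordinate_def decode_encode)
      then have "pt (encode_config x) p"
        unfolding pt_def c_def using p \<beta> by (auto simp: v_def)
      then have "\<pi> (encode_config x) = p" by (rule \<pi>_eq[OF z])
      then show "p \<in> \<pi> ` configs ?R" using z by blast
    qed (use \<pi> in \<open>auto simp: pt_def\<close>)
  next
    let ?PT = "prod_topology ?Z T"
    \<comment> \<open>One closed condition for each coordinate and group element; their common
      solution set is the graph of \<open>\<pi>\<close>.\<close>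
    define C' where "C' e = {w \<in> topspace ?PT. circle_exp (\<xi> (fst e) (a (inv\<^bsub>G\<^esub> (snd e)) (snd w))) - c (fst w) (fst e) (snd e) \<in> {0}}" for e
    have cl: "closedin ?PT (C' e)" if e: "e \<in> {..<n} \<times> carrier G" for e
      unfolding C'_def
    proof (intro closedin_continuous_map_preimage[where Y = euclidean] continuous_map_diff)
      from e have j: "fst e < n" and g: "snd e \<in> carrier G" by auto
      have "A.cont (\<lambda>x. circle_exp (\<xi> (fst e) x))" using \<xi> j A.characters_character A.character_cont by blast
      from A.continuous_map_comp_cont[OF continuous_map_compose[OF continuous_map_snd A.acts_continuously[OF inv_closed[OF g]]] this]
      show "continuous_map ?PT euclidean (\<lambda>w. circle_exp (\<xi> (fst e) (a (inv\<^bsub>G\<^esub> (snd e)) (snd w))))" by (simp add: o_def)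
    next
      have "continuous_map ?Z euclidean (\<lambda>z. c z (fst e) (snd e))"
        unfolding c_def by (rule continuous_map_from_subtopology[OF continuous_coordinate])
      from continuous_map_compose[OF continuous_map_fst this]
      show "continuous_map ?PT euclidean (\<lambda>w. c (fst w) (fst e) (snd e))" by (simp add: o_def)
    qed simp
    show "continuous_map ?Z T \<pi>"
    proof (rule continuous_map_of_closed_graph[OF A.compact_T _ cl])
      show "\<pi> z \<in> topspace T" if "z \<in> topspace ?Z" for z
        using that \<pi> by (simp add: topZ A.topspace_eq pt_def)
      fix z p assume z: "z \<in> topspace ?Z" and p: "p \<in> topspace T"
      have "(z, p) \<in> C' (j, g) \<longleftrightarrow> circle_exp (\<xi> j (a (inv\<^bsub>G\<^esub> g) p)) = c z j g" for j g
        unfolding C'_def mem_Collect_eq topspace_prod_topology mem_Times_iff fst_conv snd_conv singleton_iff right_minus_eq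
        using z p by (simp only: simp_thms)
      then have "(\<forall>e\<in>{..<n} \<times> carrier G. (z, p) \<in> C' e) \<longleftrightarrow> pt z p"
        unfolding pt_def using p A.topspace_eq by (simp only: ball_simps Ball_def split_paired_All mem_Sigma_iff lessThan_iff simp_thms imp_conjL) blast
      also have "\<dots> \<longleftrightarrow> p = \<pi> z" using \<pi> \<pi>_eq z topZ by blast
      finally show "(\<forall>e\<in>{..<n} \<times> carrier G. (z, p) \<in> C' e) \<longleftrightarrow> p = \<pi> z" .
    qed
  qed
qed

end
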